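(* Let $M,N\in\mathbb{N}$, let $Z_1,\dots,Z_M>0$ and let $R_1,\dots,R_M\in\mathbb{R}^3$ be distinct points. Let $V(x)=-\sum_{i=1}^MZ_i/|x-R_i|$. Assume that the Hartree–Fock equations $(-\Delta+V(x))\varphi_i(x)+\int_{\mathbb{R}^3}\frac{\rho(y)}{|x-y|}dy\,\varphi_i(x)-\int_{\mathbb{R}^3}\frac{\tau(x,y)}{|x-y|}\varphi_i(y)\,dy=\lambda_i\varphi_i(x)$, $i=1,\dots,N$, $x\in\mathbb{R}^3$, where $\tau(x,y)=\sum_{i=1}^N\varphi_i(x)\varphi_i(y)$ and $\rho(x)=\tau(x,x)$, have $N$ real eigenvalues $\lambda_1,\dots,\lambda_N$ with associated eigenfunctions $\varphi_1,\dots,\varphi_N\in H^1(\mathbb{R}^3)$ such that $\int_{\mathbb{R}^3}\varphi_i\varphi_j=\delta_{ij}$. Fix $k\in\{1,\dots,M\}$, let $a>0$ be such that $|R_j-R_k|>2a$ for all $j\neq k$, and let $\Omega_k=\{x\in\mathbb{R}^3:\|x-R_k\|_\infty\le a\}$. Then for every $0<\epsilon<1$ there exists a ReLU neural network $\Phi_{\epsilon,\varphi}$ with $\mathrm{R}(\Phi_{\epsilon,\varphi}):\mathbb{R}^3\to\mathbb{R}^N$ such that $\|\varphi_i-\mathrm{R}(\Phi_{\epsilon,\varphi})_i\|_{H^1(\Omega_k)}\le\epsilon$ for all $i=1,\dots,N$. In addition, as $\epsilon\to0$, $\|\mathrm{R}(\Phi_{\epsilon,\varphi})_i\|_{L^\infty(\Omega_k)}=\mathcal{O}(|\log\epsilon|^6)$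 for every $i$, $\mathrm{size}(\Phi_{\epsilon,\varphi})=\mathcal{O}(|\log\epsilon|^7+N|\log\epsilon|^6)$ and $\mathrm{depth}(\Phi_{\epsilon,\varphi})=\mathcal{O}(|\log\epsilon|\log(|\log\epsilon|))$.
   Context: Neural networks: $\Phi=((A_1,b_1),\dots,(A_L,b_L))$, $A_\ell\in\mathbb{R}^{N_\ell\times N_{\ell-1}}$, $b_\ell\in\mathbb{R}^{N_\ell}$; realization $x_0=x$, $x_\ell=\varrho(A_\ell x_{\ell-1}+b_\ell)$ ($\ell<L$), $\mathrm{R}(\Phi)(x)=A_Lx_{L-1}+b_L$, $\varrho(t)=\max\{0,t\}$ componentwise; $\mathrm{R}(\Phi)_i$ is the $i$-th output component; $\mathrm{depth}(\Phi)=L$, $\mathrm{size}(\Phi)$ = number of nonzero entries of all $A_\ell,b_\ell$. *)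

theory Defs
  imports "HOL-Analysis.Analysis" "HOL-Library.Landau_Symbols"
begin

text \<open>A network is a list of layers (A, b); A is given as the list of its rows.\<close>
type_synonym nnet = "(real list list \<times> real list) list"

definition relu :: "real \<Rightarrow> real" where
  "relu t = max 0 t"

definition affine :: "real list list \<Rightarrow> real list \<Rightarrow> real list \<Rightarrow> real list" where
  "affine A b x = map2 (\<lambda>row bi. sum_list (map2 (*) row x) + bi) A b"

fun realize :: "nnet \<Rightarrow> real list \<Rightarrow> real list" where
  "realize [] x = x"
| "realize [(A, b)] x = affine A b x"
| "realize ((A, b) # L) x = realize L (map relu (affine A b x))"

fun nn_wf :: "nat \<Rightarrow> nnet \<Rightarrow> nat \<Rightarrow> bool" where
  "nn_wf d [] e = False"
| "nn_wf d ((A, b) # L) e =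
     (length A = length b \<and> (\<forall>row\<in>set A. length row = d) \<and>
      (if L = [] then length b = e else nn_wf (length b) L e))"

definition nn_size :: "nnet \<Rightarrow> nat" where
  "nn_size \<Phi> = sum_list (map (\<lambda>(A, b). length (filter (\<lambda>t. t \<noteq> 0) (concat A))
                                   + length (filter (\<lambda>t. t \<noteq> 0) b)) \<Phi>)"

definition nn_depth :: "nnet \<Rightarrow> nat" where
  "nn_depth \<Phi> = length \<Phi>"

definition nn_real3 :: "nnet \<Rightarrow> real^3 \<Rightarrow> nat \<Rightarrow> real" where
  "nn_real3 \<Phi> x i = realize \<Phi> [x $ 1, x $ 2, x $ 3] ! i"

definition pd :: "3 \<Rightarrow> (real^3 \<Rightarrow> real) \<Rightarrow> real^3 \<Rightarrow> real" where
  "pd j f x = deriv (\<lambda>t. f (x + t *\<^sub>R axis j 1)) 0"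

fun pds :: "3 list \<Rightarrow> (real^3 \<Rightarrow> real) \<Rightarrow> real^3 \<Rightarrow> real" where
  "pds [] f = f"
| "pds (j # js) f = pd j (pds js f)"

definition smooth3 :: "(real^3 \<Rightarrow> real) \<Rightarrow> bool" where
  "smooth3 f \<longleftrightarrow> (\<forall>js. continuous_on UNIV (pds js f) \<and>
      (\<forall>j x. (\<lambda>t. pds js f (x + t *\<^sub>R axis j 1)) differentiable (at 0)))"

definition test_fun :: "(real^3) set \<Rightarrow> (real^3 \<Rightarrow> real) \<Rightarrow> bool" where
  "test_fun U \<psi> \<longleftrightarrow> smooth3 \<psi> \<and> compact (closure {x. \<psi> x \<noteq> 0})
      \<and> closure {x. \<psi> x \<noteq> 0} \<subseteq> U"

definition laplacian :: "(real^3 \<Rightarrow> real) \<Rightarrow> real^3 \<Rightarrow> real" where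
  "laplacian f x = (\<Sum>j\<in>UNIV. pd j (pd j f) x)"

definition loc_integrable :: "(real^3) set \<Rightarrow> (real^3 \<Rightarrow> real) \<Rightarrow> bool" where
  "loc_integrable U u \<longleftrightarrow> (\<forall>K. compact K \<and> K \<subseteq> U \<longrightarrow> set_integrable lborel K u)"

definition weak_grad_on :: "(real^3) set \<Rightarrow> (real^3 \<Rightarrow> real) \<Rightarrow> (real^3 \<Rightarrow> real^3) \<Rightarrow> bool" where
  "weak_grad_on U u g \<longleftrightarrow> loc_integrable U u \<and> (\<forall>j. loc_integrable U (\<lambda>x. g x $ j)) \<and>
     (\<forall>j \<psi>. test_fun U \<psi> \<longrightarrow>
        set_lebesgue_integral lborel U (\<lambda>x. u x * pd j \<psi> x)
          = - set_lebesgue_integral lborel U (\<lambda>x. g x $ j * \<psi> x))"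

definition H1_on :: "(real^3) set \<Rightarrow> (real^3 \<Rightarrow> real) \<Rightarrow> bool" where
  "H1_on U u \<longleftrightarrow> u \<in> borel_measurable lborel \<and> set_integrable lborel U (\<lambda>x. (u x)\<^sup>2) \<and>
     (\<exists>g. g \<in> borel_measurable lborel \<and> weak_grad_on U u g \<and>
          set_integrable lborel U (\<lambda>x. (norm (g x))\<^sup>2))"

definition H1_norm :: "(real^3) set \<Rightarrow> (real^3 \<Rightarrow> real) \<Rightarrow> real" where
  "H1_norm U u = (let g = (SOME g. g \<in> borel_measurable lborel \<and> weak_grad_on U u g \<and>
                              set_integrable lborel U (\<lambda>x. (norm (g x))\<^sup>2))
                  in sqrt (set_lebesgue_integral lborel U (\<lambda>x. (u x)\<^sup>2)
                         + set_lebesgue_integral lborel U (\<lambda>x. (norm (g x))\<^sup>2)))"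

definition coulomb_pot :: "nat \<Rightarrow> (nat \<Rightarrow> real) \<Rightarrow> (nat \<Rightarrow> real^3) \<Rightarrow> real^3 \<Rightarrow> real" where
  "coulomb_pot M Z R x = - (\<Sum>i<M. Z i / norm (x - R i))"

definition hf_tau :: "nat \<Rightarrow> (nat \<Rightarrow> real^3 \<Rightarrow> real) \<Rightarrow> real^3 \<Rightarrow> real^3 \<Rightarrow> real" where
  "hf_tau N \<phi> x y = (\<Sum>i<N. \<phi> i x * \<phi> i y)"

definition hf_rho :: "nat \<Rightarrow> (nat \<Rightarrow> real^3 \<Rightarrow> real) \<Rightarrow> real^3 \<Rightarrow> real" where
  "hf_rho N \<phi> x = hf_tau N \<phi> x x"

definition hartree :: "nat \<Rightarrow> (nat \<Rightarrow> real^3 \<Rightarrow> real) \<Rightarrow> real^3 \<Rightarrow> real" where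
  "hartree N \<phi> x = (\<integral>y. hf_rho N \<phi> y / norm (x - y) \<partial>lborel)"

definition exchange :: "nat \<Rightarrow> (nat \<Rightarrow> real^3 \<Rightarrow> real) \<Rightarrow> nat \<Rightarrow> real^3 \<Rightarrow> real" where
  "exchange N \<phi> i x = (\<integral>y. hf_tau N \<phi> x y / norm (x - y) * \<phi> i y \<partial>lborel)"

definition HF_solution :: "nat \<Rightarrow> (nat \<Rightarrow> real) \<Rightarrow> (nat \<Rightarrow> real^3) \<Rightarrow> nat
      \<Rightarrow> (nat \<Rightarrow> real^3 \<Rightarrow> real) \<Rightarrow> (nat \<Rightarrow> real) \<Rightarrow> bool" where
  "HF_solution M Z R N \<phi> lam \<longleftrightarrow>
     (\<forall>i<N. H1_on UNIV (\<phi> i)) \<and>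
     (\<forall>i<N. \<forall>j<N. integrable lborel (\<lambda>x. \<phi> i x * \<phi> j x) \<and>
                  (\<integral>x. \<phi> i x * \<phi> j x \<partial>lborel) = (if i = j then 1 else 0)) \<and>
     (\<forall>x. integrable lborel (\<lambda>y. hf_rho N \<phi> y / norm (x - y))) \<and>
     (\<forall>i<N. \<forall>x. integrable lborel (\<lambda>y. hf_tau N \<phi> x y / norm (x - y) * \<phi> i y)) \<and>
     (\<forall>i<N. \<forall>\<psi>. test_fun UNIV \<psi> \<longrightarrow>
        integrable lborel (\<lambda>x. \<phi> i x * laplacian \<psi> x) \<and>
        integrable lborel (\<lambda>x. coulomb_pot M Z R x * \<phi> i x * \<psi> x) \<and>
        integrable lborel (\<lambda>x. hartree N \<phi> x * \<phi> i x * \<psi> x) \<and>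
        integrable lborel (\<lambda>x. exchange N \<phi> i x * \<psi> x) \<and>
        (\<integral>x. \<phi> i x * (- laplacian \<psi> x) \<partial>lborel)
          + (\<integral>x. coulomb_pot M Z R x * \<phi> i x * \<psi> x \<partial>lborel)
          + (\<integral>x. hartree N \<phi> x * \<phi> i x * \<psi> x \<partial>lborel)
          - (\<integral>x. exchange N \<phi> i x * \<psi> x \<partial>lborel)
          = lam i * (\<integral>x. \<phi> i x * \<psi> x \<partial>lborel))"

definition cube_inf :: "real^3 \<Rightarrow> real \<Rightarrow> (real^3) set" where
  "cube_inf c a = {x. \<forall>j. \<bar>x $ j - c $ j\<bar> \<le> a}"

end

theory Submission
 imports Defs "HOL-Computational_Algebra.Polynomial"
begin

text \<open>
 Truncated Newton potentials represent weak solutions of the Poisson equation and give an interior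
 gradient bound; starting from the H1 bound they make the orbitals bounded. The orbitals, the
 Coulomb potential and the potentials of all products of two orbitals then solve a quadratic system
 of Poisson equations, and the gradient bound on balls of radius proportional to the distance d to
 the nuclei, iterated with shrinking radii, gives derivative bounds B K^p p! d^(-p) of all orders p.

 Around a nucleus these bounds are scale invariant. A geometric decomposition into n dyadic shells,
 each split into boundedly many cubes of side proportional to the radius, admits Taylor polynomials
 of degree O(n) with error 2^(-8n) on every cube. The monomials times the hat-function partition of
 unity are realised by repeated squaring with the sawtooth square of Yarotsky, using O(log n)
 multiplications of depth O(n) each and constant width. The innermost ball of radius O(2^(-n)) is
 ignored, at the price of 2^(-n/2) in H1 because the gradient is bounded there by C/d times a cutoff. Choosing n
 proportional to |log eps| yields the theorem.
\<close>

section \<open>Smooth calculus and test functions\<close>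

text \<open>Only weak equations and H1 bounds are given, so every pointwise statement is extracted
  by testing with truncations of 1/sqrt(|z|^2 + de^2), which are themselves test functions, and by
  letting de tend to 0 after an integration over boxes. Boundedness of the orbitals meets two poles
  at once, one at a nucleus and one of the Newton kernel. The recurring exponent 5/4 is chosen for
  this: H1 controls phi^2 against |q|^(-5/4), so of a Coulomb pole only |q|^(-3/4) is left to face
  the squared Newton kernel, and 3/4 + 2 < 3. An exponent 1 would end in the borderline value 3.
  Networks are only Lipschitz. Their errors are therefore measured in values and in difference
  quotients, and their gradient is the vector of right partial derivatives, which exists at every
  point. Size count: n shells, O(n^3) monomials per cell and O(n log n) layers of constant width
  give O(n^5 log n), estimated by n^6. The orbitals share all these subnetworks, so N enters only
  through the last layer.\<close>

abbreviation ax :: "3 => real^3" where "ax j \<equiv> axis j 1"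

abbreviation sh :: "real^3 => real => 3 => real^3" where "sh x t j \<equiv> x + t *\<^sub>R ax j"

definition has_pd :: "(real^3 => real) => 3 => real^3 => real => bool" where
 "has_pd f j x D \<longleftrightarrow> ((%t. f (sh x t j)) has_real_derivative D) (at 0)"

lemma has_pd_line:
 "has_pd f j (sh x t j) D \<longleftrightarrow> ((%s. f (sh x s j)) has_real_derivative D) (at t)"
proof -
 have "((%s. f (sh x s j)) has_real_derivative D) (at (0 + t))
   \<longleftrightarrow> ((%s. f (x + (s + t) *\<^sub>R ax j)) has_real_derivative D) (at 0)"
  by (rule DERIV_shift)
 then show ?thesis by (simp add: has_pd_def algebra_simps)
qed

lemma has_pd_imp_pd: "has_pd f j x D ==> pd j f x = D"
 unfolding has_pd_def pd_def by (rule DERIV_imp_deriv)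

lemma has_pd_const: "has_pd (%x. c) j x 0"
 by (simp add: has_pd_def)

lemma has_pd_add: "has_pd f j x a ==> has_pd g j x b ==> has_pd (%x. f x + g x) j x (a + b)"
 unfolding has_pd_def by (rule DERIV_add)

lemma has_pd_diff: "has_pd f j x a ==> has_pd g j x b ==> has_pd (%x. f x - g x) j x (a - b)"
 unfolding has_pd_def by (rule DERIV_diff)

lemma has_pd_mult:
 "has_pd f j x a ==> has_pd g j x b ==> has_pd (%x. f x*g x) j x (a*g x + b*f x)"
 unfolding has_pd_def by (drule (1) DERIV_mult) simp

lemma has_pd_cmult: "has_pd f j x a ==> has_pd (%x. c*f x) j x (c*a)"
 unfolding has_pd_def by (rule DERIV_cmult)

lemma has_pd_sum:
 "(!!i. i \<in> I ==> has_pd (f i) j x (a i)) ==> has_pd (%x. \<Sum>i\<in>I. f i x) j x (\<Sum>i\<in>I. a i)"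
 unfolding has_pd_def by (rule DERIV_sum)

lemma has_pd_compose:
 "(h has_real_derivative h') (at (f x)) ==> has_pd f j x D ==> has_pd (%x. h (f x)) j x (h'*D)"
 unfolding has_pd_def using DERIV_chain2[of h h' "%t. f (sh x t j)" 0 D] by simp

lemma has_pd_coord: "has_pd (%x. x $ k) j x (if k = j then 1 else 0)"
 unfolding has_pd_def by (auto intro!: derivative_eq_intros simp: axis_def)

lemma norm_sq3: "(norm (x::real^3))^2 = (x$1)^2 + (x$2)^2 + (x$3)^2"
 unfolding power2_norm_eq_inner by (simp add: inner_vec_def sum_3 power2_eq_square)

lemma has_pd_normsq: "has_pd (%x. (norm (x - c))^2) j x (2*(x $ j - c $ j))"
 unfolding has_pd_def norm_sq3
 using exhaust_3[of j] by (auto intro!: derivative_eq_intros simp: axis_def)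

lemma has_pd_cong_open:
 assumes "open S" "x \<in> S" "!!y. y \<in> S ==> f y = g y" "has_pd f j x D"
 shows "has_pd g j x D"
proof -
 have "open ((%t. sh x t j) -` S)"
  by (intro open_vimage assms continuous_intros)
 then show ?thesis
  using assms unfolding has_pd_def
  by (auto elim!: has_field_derivative_transform_within_open)
qed

text \<open>The partial derivatives are quantified existentially, so that closure under sums,
  products and composition is an induction on n that never mentions \<open>pds\<close>;
  \<open>Cn_pds\<close> then recovers the iterated partial derivatives occurring in
  \<open>smooth3\<close>.\<close>

primrec Cn :: "nat => (real^3 => real) => bool" where
 "Cn 0 f \<longleftrightarrow> continuous_on UNIV f"
| "Cn (Suc n) f \<longleftrightarrow> continuous_on UNIV f & (\<forall>j. \<exists>f'. (\<forall>x. has_pd f j x (f' x)) & Cn n f')"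

lemma Cn_SucD: "Cn (Suc n) f ==> Cn n f"
proof (induction n arbitrary: f)
 case (Suc n)
 show ?case unfolding Cn.simps(2)[of n f]
 proof (intro conjI allI)
  show "continuous_on UNIV f" using Suc.prems by simp
  fix j
  obtain f' where "\<forall>x. has_pd f j x (f' x)" "Cn (Suc n) f'"
   using Suc.prems unfolding Cn.simps(2)[of "Suc n" f] by blast
  then show "\<exists>f'. (\<forall>x. has_pd f j x (f' x)) & Cn n f'" using Suc.IH by blast
 qed
qed simp

lemma Cn_const: "Cn n (%x. c)"
 by (induction n arbitrary: c) (auto intro!: exI[of _ "%x. 0"] has_pd_const)

lemma Cn_add: "Cn n f ==> Cn n g ==> Cn n (%x. f x + g x)"
proof (induction n arbitrary: f g)
 case (Suc n)
 show ?case unfolding Cn.simps(2)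
 proof (intro conjI allI)
  show "continuous_on UNIV (%x. f x + g x)" using Suc.prems by (auto intro: continuous_intros)
  fix j
  obtain f' g' where "\<forall>x. has_pd f j x (f' x)" "Cn n f'" "\<forall>x. has_pd g j x (g' x)" "Cn n g'"
   using Suc.prems by (meson Cn.simps(2))
  then show "\<exists>f'. (\<forall>x. has_pd (%x. f x + g x) j x (f' x)) & Cn n f'"
   using Suc.IH by (intro exI[of _ "%x. f' x + g' x"]) (auto intro: has_pd_add)
 qed
qed (auto intro: continuous_intros)

lemma Cn_mult: "Cn n f ==> Cn n g ==> Cn n (%x. f x*g x)"
proof (induction n arbitrary: f g)
 case (Suc n)
 show ?case unfolding Cn.simps(2)
 proof (intro conjI allI)
  show "continuous_on UNIV (%x. f x*g x)" using Suc.prems by (auto intro: continuous_intros)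
  fix j
  obtain f' g' where "\<forall>x. has_pd f j x (f' x)" "Cn n f'" "\<forall>x. has_pd g j x (g' x)" "Cn n g'"
   using Suc.prems by (meson Cn.simps(2))
  then show "\<exists>f'. (\<forall>x. has_pd (%x. f x*g x) j x (f' x)) & Cn n f'"
   using Suc.IH Suc.prems[THEN Cn_SucD]
   by (intro exI[of _ "%x. f' x*g x + g' x*f x"]) (auto intro: has_pd_mult Cn_add)
 qed
qed (auto intro: continuous_intros)

lemma Cn_coord: "Cn n (%x. x $ k)"
proof (cases n)
 case (Suc m)
 have "\<exists>f'. (\<forall>x. has_pd (%x. x $ k) j x (f' x)) & Cn m f'" for j
  by (rule exI[of _ "%x. if k = j then 1 else 0"]) (simp add: has_pd_coord Cn_const)
 moreover have "continuous_on UNIV (%x::real^3. x $ k)" by (intro continuous_intros)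
 ultimately show ?thesis unfolding Suc Cn.simps(2) by blast
next
 case 0
 have "continuous_on UNIV (%x::real^3. x $ k)" by (intro continuous_intros)
 then show ?thesis using 0 by simp
qed

text \<open>Smoothness is relative to a set S because the powers in the regularised kernels are
  smooth only where their base is positive.\<close>

primrec Dn :: "real set => nat => (real => real) => bool" where
 "Dn S 0 h \<longleftrightarrow> continuous_on S h"
| "Dn S (Suc n) h \<longleftrightarrow> (\<exists>h'. (\<forall>t\<in>S. (h has_real_derivative h' t) (at t)) & Dn S n h')"

lemma Dn_continuous: "Dn S n h ==> continuous_on S h"
 by (cases n) (auto intro!: continuous_at_imp_continuous_on intro: DERIV_isCont)

lemma Cn_continuous: "Cn n f ==> continuous_on UNIV f"
 by (cases n) auto

lemma Cn_compose: "Dn S n h ==> Cn n q ==> range q \<subseteq> S ==> Cn n (%x. h (q x))"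
proof (induction n arbitrary: h)
 case 0
 then show ?case by (auto intro: continuous_on_compose2)
next
 case (Suc n)
 obtain h' where h': "\<forall>t\<in>S. (h has_real_derivative h' t) (at t)" "Dn S n h'"
  using Suc.prems by auto
 show ?case unfolding Cn.simps(2)
 proof (intro conjI allI)
  show "continuous_on UNIV (%x. h (q x))"
   using Dn_continuous[OF Suc.prems(1)] Suc.prems by (auto intro: continuous_on_compose2)
  fix j
  obtain q' where q': "\<forall>x. has_pd q j x (q' x)" "Cn n q'"
   using Suc.prems by (meson Cn.simps(2))
  show "\<exists>f'. (\<forall>x. has_pd (%x. h (q x)) j x (f' x)) & Cn n f'"
   using Suc.IH[OF h'(2) Cn_SucD[OF Suc.prems(2)] Suc.prems(3)] q' h' Suc.prems(3)
   by (intro exI[of _ "%x. h' (q x)*q' x"]) (auto intro!: has_pd_compose[where f = q] Cn_mult simp: image_subset_iff)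
 qed
qed

lemma Cn_pds:
 assumes "!!n. Cn n f"
 shows "Cn n (pds js f)"
proof (induction js arbitrary: n)
 case (Cons j js)
 obtain f' where "\<forall>x. has_pd (pds js f) j x (f' x)" "Cn n f'"
  using Cons.IH[of "Suc n"] by auto
 moreover from this have "pds (j # js) f = f'" by (auto simp: has_pd_imp_pd)
 ultimately show ?case by simp
qed (use assms in auto)

lemma smooth3I:
 assumes "!!n. Cn n f"
 shows "smooth3 f"
 unfolding smooth3_def
proof (intro allI conjI)
 fix js j x
 show "continuous_on UNIV (pds js f)" using Cn_continuous[OF Cn_pds[OF assms]] by blast
 show "(%t. pds js f (sh x t j)) differentiable (at 0)"
  using Cn_pds[OF assms, of "Suc 0" js]
  by (auto simp: has_pd_def) (metis real_differentiable_def)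
qed

lemma smooth3_has_pd:
 assumes "smooth3 f"
 shows "has_pd (pds js f) j x (pds (j # js) f x)"
 using assms unfolding smooth3_def has_pd_def pds.simps pd_def
 by (auto simp: DERIV_deriv_iff_real_differentiable)

lemma smooth3_continuous: "smooth3 f ==> continuous_on S (pds js f)"
 using continuous_on_subset[of UNIV "pds js f" S] by (auto simp: smooth3_def)

lemma pds_append: "pds (js @ ks) f = pds js (pds ks f)"
 by (induction js) auto

lemma smooth3_pd: "smooth3 f ==> smooth3 (pd j f)"
 unfolding smooth3_def using pds_append[of _ "[j]" f] by (metis pds.simps)

lemma smooth3_has_pd1: "smooth3 f ==> has_pd f j x (pd j f x)"
 using smooth3_has_pd[of f "[]" j x] by simp

lemma zero_outside_pd:
 assumes "!!x. x \<notin> K ==> f x = 0" "closed K" "x \<notin> K"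
 shows "has_pd f j x 0"
 by (rule has_pd_cong_open[of "- K" x "%x. 0"]) (use assms in \<open>auto intro: has_pd_const\<close>)

lemma test_fun_pd: 
 assumes "test_fun U f" shows "test_fun U (pd j f)"
proof -
 let ?K = "closure {x. f x ~= 0}"
 have "pd j f x = 0" if "x \<notin> ?K" for x
  by (rule has_pd_imp_pd, rule zero_outside_pd[of ?K]) (use that closure_subset[of "{x. f x ~= 0}"] in auto)
 then have *: "closure {x. pd j f x ~= 0} \<subseteq> ?K"
  by (intro closure_minimal) auto
 have "bounded ?K" using assms by (auto simp: test_fun_def intro: compact_imp_bounded)
 then have "bounded {x. pd j f x ~= 0}"
  using bounded_subset*closure_subset by blast
 then show ?thesis
  using assms * smooth3_pd unfolding test_fun_def by (auto simp: compact_closure)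
qed

section \<open>Flat functions and smooth bumps\<close>

definition bp :: "real poly => real => real" where
 "bp p t = (if t > 0 then poly p (1/t)*exp (- 1/t) else 0)"

lemma poly_exp_tendsto: "((%x. poly p x*exp (- x)) \<longlongrightarrow> (0::real)) at_top"
proof -
 have "((%x. \<Sum>i\<le>degree p. coeff p i*(x^i/exp x)) \<longlongrightarrow> (\<Sum>i\<le>degree p. coeff p i*0)) at_top"
  by (intro tendsto_intros tendsto_power_div_exp_0)
 then show ?thesis
  by (simp add: poly_altdef exp_minus divide_simps flip: sum_divide_distrib)
qed

lemma bp_tendsto0: "(bp p \<longlongrightarrow> 0) (at 0)"
proof -
 have "((%t. poly p (1/t)*exp (- (1/t))) \<longlongrightarrow> 0) (at_right 0)"
  using filterlim_compose[OF poly_exp_tendsto[of p] filterlim_inverse_at_top_right]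
  by (simp add: inverse_eq_divide)
 then have "(bp p \<longlongrightarrow> 0) (at_right 0)"
  by (rule Lim_transform_eventually) (auto simp: bp_def eventually_at_filter)
 moreover have "(bp p \<longlongrightarrow> 0) (at_left 0)"
  by (rule Lim_transform_eventually[OF tendsto_const]) (auto simp: bp_def eventually_at_filter)
 ultimately show ?thesis by (metis filterlim_split_at_real)
qed

text \<open>With s = 1/t one has d/dt = - s^2 d/ds, so p(s) exp(-s) has the derivative s^2 (p -
  p')(s) exp(-s). The family \<open>bp\<close> is thus closed under differentiation, and smoothness
  at 0 follows from a single limit at 0 that holds for every p.\<close>

definition bpd :: "real poly => real poly" where
 "bpd p = [:0,0,1:] * (p - pderiv p)"

lemma bp_deriv: "(bp p has_real_derivative bp (bpd p) t) (at t)"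
proof (cases t "0::real" rule: linorder_cases)
 case less
 have "((%t. 0) has_real_derivative bp (bpd p) t) (at t)"
  using less by (simp add: bp_def)
 then show ?thesis
  by (rule has_field_derivative_transform_within_open[of _ _ _ "{..<0}"]) (use less in \<open>auto simp: bp_def\<close>)
next
 case greater
 have "((%t. poly p (1/t)*exp (- 1/t)) has_real_derivative bp (bpd p) t) (at t)"
  using greater
  by (auto intro!: derivative_eq_intros DERIV_chain2[OF poly_DERIV]
    simp: bp_def bpd_def field_simps power2_eq_square)
 then show ?thesis
  by (rule has_field_derivative_transform_within_open[of _ _ _ "{0<..}"]) (use greater in \<open>auto simp: bp_def\<close>)
next
 case equal
 \<comment> \<open>Division by h multiplies the polynomial by X, so the difference quotient belongs
   to the same family and tends to 0.\<close>
 have "((%h. (bp p (0 + h) - bp p 0)/h) \<longlongrightarrow> 0) (at 0)"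
  by (rule Lim_transform_eventually[OF bp_tendsto0[of "pCons 0 p"]])
    (auto simp: bp_def eventually_at_filter)
 then show ?thesis using equal by (simp add: DERIV_def bp_def)
qed

lemma bp_Dn: "Dn UNIV n (bp p)"
proof (induction n arbitrary: p)
 case 0
 show ?case using bp_deriv by (auto intro!: continuous_at_imp_continuous_on DERIV_isCont)
qed (use bp_deriv in auto)

lemma bp_continuous: "continuous_on S (bp p)"
 using Dn_continuous[OF bp_Dn] continuous_on_subset by blast

lemma bp_measurable [measurable]: "bp p \<in> borel_measurable borel"
 by (intro borel_measurable_continuous_onI bp_continuous)

lemma bp_bounded: "\<exists>B>0. \<forall>t\<le>1. \<bar>bp p t\<bar> <= B"
proof -
 have "compact (bp p ` {0..1})" by (intro compact_continuous_image bp_continuous compact_Icc)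
 then obtain B where B: "\<forall>y\<in>bp p ` {0..1}. norm y <= B" by (meson compact_imp_bounded bounded_iff)
 have "\<bar>bp p t\<bar> <= max B 1" if "t <= 1" for t
 proof (cases "t >= 0")
  case True
  then have "bp p t \<in> bp p ` {0..1}" using that by auto
  then have "norm (bp p t) <= B" using B by blast
  then show ?thesis by simp
 qed (simp add: bp_def)
 then show ?thesis by (intro exI[of _ "max B 1"]) auto
qed

lemma powr_Dn: "Dn {s. s > - c} n (%s. k*(s + c) powr a)"
proof (induction n arbitrary: a k)
 case 0
 show ?case by (auto intro!: continuous_intros)
next
 case (Suc n)
 have "\<forall>t\<in>{s. s > - c}. ((%s. k*(s + c) powr a) has_real_derivative (k*a)*(t + c) powr (a - 1)) (at t)"
  by (auto intro!: derivative_eq_intros)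
 then show ?case using Suc[of "k*a" "a - 1"] by auto
qed

lemma Cn_normsq: "Cn n (%x. (norm (x - c))^2)"
proof -
 have "Cn n (%x. (x$1 + - c$1)*(x$1 + - c$1) + (x$2 + - c$2)*(x$2 + - c$2) + (x$3 + - c$3)*(x$3 + - c$3))"
  by (intro Cn_add Cn_mult Cn_coord Cn_const)
 then show ?thesis unfolding norm_sq3 by (simp add: power2_eq_square)
qed

text \<open>Each factor exp(-1/(n s)) tends to 1 for s > 0 and is 0 for s <= 0. These functions
  converge to the indicator of the open box while staying between 0 and 1, as dominated convergence
  requires.\<close>

definition bump :: "nat => real^3 => real^3 => real^3 => real" where
 "bump n p q x = (bp 1 (real n*(x$1 - p$1))*bp 1 (real n*(q$1 - x$1))) *
   ((bp 1 (real n*(x$2 - p$2))*bp 1 (real n*(q$2 - x$2))) *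
   (bp 1 (real n*(x$3 - p$3))*bp 1 (real n*(q$3 - x$3))))"

lemma bump_smooth: "smooth3 (bump n p q)"
proof (rule smooth3I)
 have 1: "Cn m (%x. bp 1 (real n*(x$k + - a)))" for a k m
  by (rule Cn_compose[OF bp_Dn]) (rule Cn_mult Cn_add Cn_const Cn_coord subset_UNIV)+
 have 2: "Cn m (%x. bp 1 (real n*(a + - 1*x$k)))" for a k m
  by (rule Cn_compose[OF bp_Dn]) (rule Cn_mult Cn_add Cn_const Cn_coord subset_UNIV)+
 have 3: "Cn m (%x. bp 1 (real n*(x$k - a)))" "Cn m (%x. bp 1 (real n*(a - x$k)))" for a k m
  using 1[of m k a] 2[of m a k] by simp_all
 show "Cn m (bump n p q)" for m
  unfolding bump_def by (intro Cn_mult 3)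
qed

lemma bp1_le: "0 <= bp 1 t" "bp 1 t <= 1"
 by (auto simp: bp_def)

lemma bump_bounds: "0 <= bump n p q x" "bump n p q x <= 1"
 unfolding bump_def by (intro mult_nonneg_nonneg mult_le_one bp1_le)+

lemma in_box3: "x \<in> box p q \<longleftrightarrow> (p$1 < x$1 & x$1 < q$1) & (p$2 < x$2 & x$2 < q$2) & (p$3 < x$3 & x$3 < (q::real^3)$3)"
 by (auto simp: mem_box_cart forall_3)

lemma bump_zero: "x \<notin> box p q ==> bump n p q x = 0"
 unfolding in_box3 bump_def by (auto simp: bp_def zero_less_mult_iff not_less)

lemma bp1_tendsto: "a > 0 ==> (%n. bp 1 (real n*a)) \<longlonglongrightarrow> 1"
proof -
 assume a: "a > 0"
 have "(%n. exp (- inverse (real n*a))) \<longlonglongrightarrow> exp (-0)"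
  using a by (intro tendsto_intros tendsto_inverse_0_at_top
   filterlim_at_top_mult_tendsto_pos[OF tendsto_const _ filterlim_real_sequentially])
 then show ?thesis
  by (simp, elim Lim_transform_eventually)
    (use a in \<open>auto intro!: eventually_sequentiallyI[of 1] simp: bp_def inverse_eq_divide\<close>)
qed

lemma bump_tendsto: "(%n. bump n p q x) \<longlonglongrightarrow> indicator (box p q) x"
proof (cases "x \<in> box p q")
 case True
 have "(%n. bump n p q x) \<longlonglongrightarrow> (1*1)*((1*1)*(1*1))"
  unfolding bump_def by (intro tendsto_intros bp1_tendsto) (use True in \<open>auto simp: in_box3\<close>)
 then show ?thesis using True by simp
qed (simp add: bump_zero)

lemma bump_test_fun:
 assumes "cbox p q \<subseteq> U"
 shows "test_fun U (bump n p q)"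
proof -
 have *: "closure {x. bump n p q x ~= 0} \<subseteq> cbox p q"
  by (intro closure_minimal) (auto intro: subsetD[OF box_subset_cbox] bump_zero)
 have "bounded {x. bump n p q x ~= 0}"
  using bounded_subset[OF bounded_cbox[of p q]] * closure_subset by blast
 then show ?thesis unfolding test_fun_def using assms*bump_smooth by (auto simp: compact_closure)
qed

section \<open>Kernel integrals, the fundamental lemma and one-sided derivatives\<close>

lemma nn_integral_affine3:
 fixes f :: "real^3 => ennreal"
 assumes [measurable]: "f \<in> borel_measurable borel" and c: "c ~= 0"
 shows "(\<integral>\<^sup>+x. f x \<partial>lborel) = ennreal (\<bar>c\<bar>^3)*(\<integral>\<^sup>+x. f (t + c *\<^sub>R x) \<partial>lborel)"
 by (subst lborel_affine[OF c, of t])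
   (simp add: nn_integral_density nn_integral_distr nn_integral_cmult)

lemma integrable_affine3:
 fixes f :: "real^3 => real"
 assumes f: "integrable lborel f" and c: "c ~= 0"
 shows "integrable lborel (%x. f (t + c *\<^sub>R x))"
 using f f[THEN borel_measurable_integrable] unfolding integrable_iff_bounded
 by (subst (asm) nn_integral_affine3[where c=c and t=t]) (use c in \<open>auto simp: ennreal_mult_less_top\<close>)

lemma integral_affine3:
 fixes f :: "real^3 => real"
 assumes [measurable]: "f \<in> borel_measurable borel" and c: "c ~= 0"
 shows "(LBINT x. f x) = \<bar>c\<bar>^3*(LBINT x. f (t + c *\<^sub>R x))"
 by (subst lborel_affine[OF c, of t]) (simp add: integral_density integral_distr)

lemma integrable_shift3:
 fixes f :: "real^3 => real"
 assumes "integrable lborel f"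
 shows "integrable lborel (%y. f (y - x))" "integrable lborel (%y. f (x - y))" "integrable lborel (%y. f (y + x))"
 using integrable_affine3[OF assms, of 1 "-x"] integrable_affine3[OF assms, of "-1" "x"]
  integrable_affine3[OF assms, of 1 "x"]
 by (simp_all add: add.commute)

lemma integral_shift3:
 fixes f :: "real^3 => real"
 assumes "f \<in> borel_measurable borel"
 shows "(LBINT y. f (y - x)) = (LBINT y. f y)"
  "(LBINT y. f (x - y)) = (LBINT y. f y)"
  "(LBINT y. f (y + x)) = (LBINT y. f y)"
 using integral_affine3[OF assms, of 1 "-x"] integral_affine3[OF assms, of "-1" "x"]
   integral_affine3[OF assms, of 1 "x"]
 by (simp_all add: add.commute)

lemma nn_integral_shift3:
 fixes f :: "real^3 => ennreal"
 assumes "f \<in> borel_measurable borel"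
 shows "(\<integral>\<^sup>+y. f (y - x) \<partial>lborel) = (\<integral>\<^sup>+y. f y \<partial>lborel)"
  "(\<integral>\<^sup>+y. f (x - y) \<partial>lborel) = (\<integral>\<^sup>+y. f y \<partial>lborel)"
 using nn_integral_affine3[OF assms, of 1 "-x"] nn_integral_affine3[OF assms, of "-1" "x"]
 by (simp_all add: add.commute)

text \<open>Since \<open>0 powr x\<close> is 0, this kernel vanishes at the origin, whereas the
  regularised kernels do not; bounds by \<open>kb\<close> are therefore stated for nonzero z and
  used almost everywhere.\<close>

definition kb :: "real => real => real^3 => real" where
 "kb s r z = (if norm z <= r then norm z powr (- s) else 0)"

lemma kb_measurable [measurable]: "kb s r \<in> borel_measurable borel"
 unfolding kb_def by measurable

lemma kb_nonneg [simp]: "0 <= kb s r z"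
 by (simp add: kb_def)

lemma kb_minus: "kb s r (x - y) = kb s r (y - x)"
 by (simp add: kb_def norm_minus_commute)

text \<open>The value \<open>top\<close> at 0 serves \<open>kb_nn_integral\<close>: a nonzero vector
  may have a vanishing coordinate, and the product bound has to hold on the coordinate planes
  too.\<close>

lemma nn_integral_abs_powr:
 fixes a r :: real
 assumes "0 <= a" "a < 1" "r > 0"
 shows "(\<integral>\<^sup>+t. (if \<bar>t\<bar> <= r then if t = 0 then top else ennreal (\<bar>t\<bar> powr (- a)) else 0) \<partial>lborel) 
  <= ennreal (2*(r powr (1 - a)/(1 - a)))"
proof -
 let ?g = "%t::real. ennreal (t powr (- a)*indicator {0..r} t)"
 have "((%t. t powr (- a)) has_integral (r powr (- a + 1)/(- a + 1))) {0..r}"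
  using assms by (intro has_integral_powr_from_0) auto
 then have "((%t. t powr (- a)*indicator {0..r} t) has_integral (r powr (1 - a)/(1 - a))) UNIV"
  by (subst (asm) has_integral_restrict_UNIV[symmetric]) (auto elim!: has_integral_eq[rotated] simp: indicator_def)
 then have g: "(\<integral>\<^sup>+t. ?g t \<partial>lborel) = ennreal (r powr (1 - a)/(1 - a))"
  by (intro nn_integral_has_integral_lborel) auto
 have "(\<integral>\<^sup>+t. (if \<bar>t\<bar> <= r then if t = 0 then top else ennreal (\<bar>t\<bar> powr (- a)) else 0) \<partial>lborel)
   <= (\<integral>\<^sup>+t. ?g t + ?g (- t) \<partial>lborel)"
  by (intro nn_integral_mono_AE, rule AE_mp[OF AE_lborel_singleton[of 0]])
    (auto simp: indicator_def abs_if)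
 also have "... = (\<integral>\<^sup>+t. ?g t \<partial>lborel) + (\<integral>\<^sup>+t. ?g (- t) \<partial>lborel)"
  by (intro nn_integral_add) auto
 also have "(\<integral>\<^sup>+t. ?g (- t) \<partial>lborel) = (\<integral>\<^sup>+t. ?g t \<partial>lborel)"
  using nn_integral_real_affine[of ?g "-1" 0] by simp
 finally show ?thesis unfolding g using assms by (simp add: ennreal_plus[symmetric] del: ennreal_plus)
qed

text \<open>Every coordinate is at most the norm, so |z|^(-s) is bounded by the product of the
  |z_i|^(-s/3) and the integral factorises; s < 3 makes each factor integrable. For s = 2 the bound
  is 6^3 r, the constant 216 of \<open>kb2_integral\<close>.\<close>

lemma kb_nn_integral:
 assumes "0 <= s" "s < 3" "r > 0"
 shows "(\<integral>\<^sup>+z. ennreal (kb s r z) \<partial>lborel) <= ennreal ((2*(r powr (1 - s/3)/(1 - s/3)))^3)"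
proof -
 let ?f = "%t::real. if \<bar>t\<bar> <= r then if t = 0 then top else ennreal (\<bar>t\<bar> powr (- (s/3))) else 0"
 have "ennreal (kb s r z) <= (\<Prod>b\<in>Basis. ?f (z \<bullet> b))" for z :: "real^3"
 proof (cases "norm z <= r & z ~= 0")
  case True
  have "ennreal (kb s r z) = (\<Prod>b\<in>(Basis :: (real^3) set). ennreal (norm z powr (- (s/3))))"
   using True by (simp add: kb_def ennreal_power powr_power)
  also have "... <= (\<Prod>b\<in>Basis. ?f (z \<bullet> b))"
  proof (intro prod_mono_ennreal)
   fix b :: "real^3" assume b: "b \<in> Basis"
   then have le: "\<bar>z \<bullet> b\<bar> <= norm z" by (rule Basis_le_norm)
   then have "norm z powr (- (s/3)) <= \<bar>z \<bullet> b\<bar> powr (- (s/3))" if "z \<bullet> b ~= 0"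
    using that assms by (intro powr_mono2') auto
   then show "ennreal (norm z powr (- (s/3))) <= ?f (z \<bullet> b)"
    using True le by (auto intro: ennreal_leI)
  qed
  finally show ?thesis .
 qed (auto simp: kb_def)
 then have "(\<integral>\<^sup>+z. ennreal (kb s r z) \<partial>lborel) <= (\<integral>\<^sup>+(z::real^3). (\<Prod>b\<in>Basis. ?f (z \<bullet> b)) \<partial>lborel)"
  by (intro nn_integral_mono)
 also have "... = (\<Prod>b\<in>(Basis :: (real^3) set). (\<integral>\<^sup>+t. ?f t \<partial>lborel))"
  by (intro nn_integral_lborel_prod) auto
 also have "... <= (\<Prod>b\<in>(Basis :: (real^3) set). ennreal (2*(r powr (1 - s/3)/(1 - s/3))))"
  using assms by (intro prod_mono_ennreal nn_integral_abs_powr) auto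
 also have "... = ennreal ((2*(r powr (1 - s/3)/(1 - s/3)))^3)"
  using assms by (simp add: ennreal_power)
 finally show ?thesis .
qed

lemma kb_integrable:
 assumes "0 <= s" "s < 3" "r > 0"
 shows "integrable lborel (kb s r)"
  "(LBINT z. kb s r z) <= (2*(r powr (1 - s/3)/(1 - s/3)))^3"
proof -
 show *: "integrable lborel (kb s r)"
  using kb_nn_integral[OF assms] by (intro integrableI_nonneg) (auto simp: top_unique less_top[symmetric])
 have "ennreal (LBINT z. kb s r z) <= ennreal ((2*(r powr (1 - s/3)/(1 - s/3)))^3)"
  using kb_nn_integral[OF assms] nn_integral_eq_integral[OF *] by simp
 then show "(LBINT z. kb s r z) <= (2*(r powr (1 - s/3)/(1 - s/3)))^3"
  using assms by (subst (asm) ennreal_le_iff) auto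
qed

lemma kb2_integral: "r > 0 ==> (LBINT z. kb 2 r z) <= 216*r"
 using kb_integrable(2)[of 2 r] by (simp add: power_mult_distrib power_divide powr_power)

text \<open>This is minus the Laplacian of (1 + |w|^2)^(-1/2), the profile of the approximate delta
  that arises from regularising 1/|w|. Its integral \<open>cN\<close> is 4 pi and is kept as an
  unevaluated positive constant.\<close>

definition pk :: "real^3 => real" where
 "pk w = 3*(1 + (norm w)^2) powr (-5/2)"

definition cN :: real where "cN = (LBINT w. pk w)"

lemma pk_measurable [measurable]: "pk \<in> borel_measurable borel"
 unfolding pk_def by measurable

lemma pk_pos: "pk w > 0"
proof -
 have "1 + (norm w)^2 > 0" by (metis add_pos_nonneg zero_less_one zero_le_power2)
 then show ?thesis by (simp add: pk_def)
qed

lemma nn_integral_sq_powr: "(\<integral>\<^sup>+(t::real). ennreal ((1 + t^2) powr (-5/6)) \<partial>lborel) < top"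
proof -
 let ?g = "%t::real. ennreal (t powr (-5/3))*indicator {1..} t"
 have g: "(\<integral>\<^sup>+t. ?g t \<partial>lborel) = ennreal (0 - (- 3/2)*1 powr (-2/3))"
 proof (intro nn_integral_FTC_atLeast)
  fix x :: real assume "1 <= x"
  then show "((%t. (- 3/2)*t powr (-2/3)) has_real_derivative x powr (-5/3)) (at x)"
   by (auto intro!: derivative_eq_intros)
 next
  have "((%t::real. (- 3/2)*t powr (-2/3)) \<longlongrightarrow> (- 3/2)*0) at_top"
   by (intro tendsto_intros tendsto_neg_powr filterlim_ident) auto
  then show "((%t::real. (- 3/2)*t powr (-2/3)) \<longlongrightarrow> 0) at_top" by simp
 qed auto
 have "(\<integral>\<^sup>+(t::real). ennreal ((1 + t^2) powr (-5/6)) \<partial>lborel) 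
  <= (\<integral>\<^sup>+t. indicator {-1..1} t + (?g t + ?g (- t)) \<partial>lborel)"
 proof (intro nn_integral_mono)
  fix t :: real
  consider "t \<in> {-1..1}" | "t > 1" | "t < - 1" by force
  then show "ennreal ((1 + t^2) powr (-5/6)) <= indicator {-1..1} t + (?g t + ?g (- t))"
  proof cases
   case 1
   have "(1 + t^2) powr (-5/6) <= 1 powr (-5/6)" by (rule powr_mono2') auto
   then show ?thesis using 1 by (auto simp: add_increasing2 intro: order_trans)
  next
   case 2
   have "(1 + t^2) powr (-5/6) <= (t powr 2) powr (-5/6)"
    using 2 by (intro powr_mono2') (auto simp: powr_numeral)
   also have "... = t powr (-5/3)" by (simp only: powr_powr) simp
   finally show ?thesis using 2 by (auto intro: ennreal_leI)
  next
   case 3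
   have "(1 + t^2) powr (-5/6) <= ((-t) powr 2) powr (-5/6)"
    using 3 by (intro powr_mono2') (auto simp: powr_numeral)
   also have "... = (-t) powr (-5/3)" by (simp only: powr_powr) simp
   finally show ?thesis using 3 by (auto intro: ennreal_leI)
  qed
 qed
 also have "... = (\<integral>\<^sup>+t. indicator {-1..1::real} t \<partial>lborel) + ((\<integral>\<^sup>+t. ?g t \<partial>lborel) + (\<integral>\<^sup>+t. ?g (- t) \<partial>lborel))"
  by (simp add: nn_integral_add)
 also have "(\<integral>\<^sup>+t. ?g (- t) \<partial>lborel) = (\<integral>\<^sup>+t. ?g t \<partial>lborel)"
  using nn_integral_real_affine[of ?g "-1" 0] by simp
 finally show ?thesis unfolding g by (auto simp: less_top[symmetric] top_unique)
qed

text \<open>The same product device as in \<open>kb_nn_integral\<close>: (1 + |w|^2)^(-5/2) is at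
  most the product of the (1 + w_i^2)^(-5/6), which are integrable on the line because 5/3 >
  1.\<close>

lemma pk_integrable: "integrable lborel pk"
proof -
 let ?f = "%t::real. ennreal ((1 + t^2) powr (-5/6))"
 have le: "ennreal ((1 + (norm w)^2) powr (-5/2)) <= (\<Prod>b\<in>Basis. ?f (w \<bullet> b))" for w :: "real^3"
 proof -
  have "ennreal ((1 + (norm w)^2) powr (-5/2)) = (\<Prod>b\<in>(Basis :: (real^3) set). ?f (norm w))"
   by (simp add: ennreal_power powr_power add_nonneg_eq_0_iff)
  also have "... <= (\<Prod>b\<in>Basis. ?f (w \<bullet> b))"
  proof (intro prod_mono_ennreal ennreal_leI)
   fix b :: "real^3" assume "b \<in> Basis"
   then have "(w \<bullet> b)^2 <= (norm w)^2" using Basis_le_norm[of b w] by (metis abs_le_square_iff abs_norm_cancel)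
   then show "(1 + (norm w)^2) powr (-5/6) <= (1 + (w \<bullet> b)^2) powr (-5/6)"
    by (intro powr_mono2') (auto simp: add_pos_nonneg)
  qed
  finally show ?thesis .
 qed
 have "(\<integral>\<^sup>+(w::real^3). ennreal ((1 + (norm w)^2) powr (-5/2)) \<partial>lborel) <= (\<integral>\<^sup>+(w::real^3). (\<Prod>b\<in>Basis. ?f (w \<bullet> b)) \<partial>lborel)"
  by (intro nn_integral_mono le)
 also have "... = (\<Prod>b\<in>(Basis :: (real^3) set). (\<integral>\<^sup>+t. ?f t \<partial>lborel))"
  by (intro nn_integral_lborel_prod) auto
 also have "... < top" using nn_integral_sq_powr by (simp add: power_less_top_ennreal)
 finally have "integrable lborel (%w::real^3. (1 + (norm w)^2) powr (-5/2))"
  by (intro integrableI_nonneg) auto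
 then show ?thesis unfolding pk_def by simp
qed

lemma cN_pos: "cN > 0"
proof -
 have "cN >= 0" unfolding cN_def using pk_pos by (intro integral_nonneg_AE) (auto intro: less_imp_le)
 moreover have "cN ~= 0"
 proof
  assume "cN = 0"
  then have "AE w in lborel. pk w = 0"
   using pk_pos unfolding cN_def
   by (subst (asm) integral_nonneg_eq_0_iff_AE[OF pk_integrable]) (auto intro: less_imp_le)
  then have "AE w in lborel :: (real^3) measure. False"
   by eventually_elim (use pk_pos in \<open>metis less_irrefl\<close>)
  then show False by (simp add: trivial_limit_def[symmetric] ae_filter_eq_bot_iff)
 qed
 ultimately show ?thesis by simp
qed

text \<open>The sets over which h integrates to 0 form a Dynkin system once the whole space is among
  them, which dominated convergence along growing boxes provides; open boxes are stable under
  intersection and generate the Borel sets.\<close>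

lemma zero_on_boxes_all:
 fixes h :: "real^3 => real"
 assumes h: "integrable lborel h" and z: "!!p q. (LBINT x. indicator (box p q) x*h x) = 0"
 shows "AE x in lborel. h x = 0"
proof (rule density_unique_real[where f'="%x. 0", OF h])
 show "integrable lborel (%x::real^3. 0::real)" by simp
next
 fix A :: "(real^3) set" assume "A \<in> sets lborel"
 then have A: "A \<in> sigma_sets UNIV (range (%(a,b). box a b))"
  by (simp add: borel_eq_box)
 have [measurable]: "h \<in> borel_measurable borel" using h by auto
 have ind: "integrable lborel (%x. indicator B x*h x)" if "B \<in> sets borel" for B
  using h that by (intro integrable_mult_indicator[where 'b=real, simplified]) auto
 have tot: "(LBINT x. h x) = 0"
 proof -
  have "(%n. \<integral>x. indicator (box (\<chi> i. - real n) (\<chi> i. real n)) x*h x \<partial>lborel) \<longlonglongrightarrow> (LBINT x. h x)"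
  proof (rule integral_dominated_convergence[where w="%x. \<bar>h x\<bar>"])
   show "AE x in lborel. (%n. indicator (box (\<chi> i. - real n) (\<chi> i. real n)) x*h x) \<longlonglongrightarrow> h x"
   proof (intro AE_I2 tendsto_eventually)
    fix x :: "real^3"
    obtain n :: nat where n: "norm x < real n" using reals_Archimedean2 by blast
    have "x \<in> box (\<chi> i. - real m) (\<chi> i. real m)" if "m >= n" for m
    proof -
     have "\<bar>x $ i\<bar> < real m" for i
      using component_le_norm_cart[of x i] n \<open>m >= n\<close> by linarith
     then show ?thesis unfolding mem_box_cart by (simp add: abs_less_iff minus_less_iff)
    qed
    then show "\<forall>\<^sub>F m in sequentially. indicator (box (\<chi> i. - real m) (\<chi> i. real m)) x*h x = h x"
     by (auto intro!: eventually_sequentiallyI[of n])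
   qed
  qed (use h in \<open>auto simp: indicator_def\<close>)
  then show ?thesis using z by (simp add: LIMSEQ_const_iff)
 qed
 have IS: "Int_stable (range (%(a, b). box a b) :: (real^3) set set)"
  by (auto simp: Int_stable_def box_Int_box)
 have PU: "range (%(a, b). box a b) \<subseteq> Pow (UNIV :: (real^3) set)" by auto
 have "A \<in> sets borel & (LBINT x. indicator A x*h x) = 0"
  using IS PU A
 proof (induction rule: sigma_sets_induct_disjoint)
  case (basic A) then show ?case using z by auto
 next
  case empty then show ?case by simp
 next
  case (compl A)
  have "(LBINT x. indicator (UNIV - A) x*h x) = (LBINT x. h x - indicator A x*h x)"
   by (intro Bochner_Integration.integral_cong) (auto simp: indicator_def)
  also have "... = 0" using compl.IH h ind tot by (subst Bochner_Integration.integral_diff) auto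
  finally show ?case using compl.IH by auto
 next
  case (union A)
  have m: "(\<Union>i. A i) \<in> sets borel" using union by auto
  have "(\<integral>x\<in>(\<Union>i. A i). h x \<partial>lborel) = (\<Sum>i. (\<integral>x\<in>(A i). h x \<partial>lborel))"
   using union ind[OF m] by (intro lebesgue_integral_countable_add) 
    (auto simp: disjoint_family_on_def set_integrable_def)
  also have "... = 0" using union by (simp add: set_lebesgue_integral_def)
  finally show ?case using m by (simp add: set_lebesgue_integral_def)
 qed
 then show "(\<integral>x\<in>A. h x \<partial>lborel) = (\<integral>x\<in>A. 0 \<partial>lborel)" by (simp add: set_lebesgue_integral_def)
qed

text \<open>Localisation: S is a countable union of closed boxes, and on each of them the global
  version applies to h cut off to the box.\<close>

lemma zero_on_boxes:
 fixes h :: "real^3 => real"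
 assumes S: "open S" and h: "!!p q. cbox p q \<subseteq> S ==> integrable lborel (%x. indicator (cbox p q) x*h x)"
  and z: "!!p q. cbox p q \<subseteq> S ==> (LBINT x. indicator (box p q) x*h x) = 0"
 shows "AE x in lborel. x \<in> S --> h x = 0"
proof -
 obtain D where D: "countable D" "D \<subseteq> Pow S" "!!X. X \<in> D ==> \<exists>a b. X = cbox a b" "\<Union>D = S"
  using open_countable_Union_open_cbox[OF S] by metis
 have "AE x in lborel. x \<in> X --> h x = 0" if "X \<in> D" for X
 proof -
  obtain a b where X: "X = cbox a b" using D(3)[OF \<open>X \<in> D\<close>] by blast
  then have sub: "cbox a b \<subseteq> S" using D \<open>X \<in> D\<close> by auto
  have "AE x in lborel. indicator (cbox a b) x*h x = 0"
  proof (rule zero_on_boxes_all[OF h[OF sub]])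
   fix p q :: "real^3"
   obtain p' q' where pq: "box p q \<inter> box a b = box p' q'" using box_Int_box by blast
   obtain p'' q'' where pq'': "box p'' q'' = box p' q'" "cbox p'' q'' \<subseteq> cbox a b"
   proof (cases "box p' q' = {}")
    case True
    \<comment> \<open>An empty open box may still have a degenerate closed box that leaves
      \<open>cbox a b\<close>; the corners 1 and 0 make both empty.\<close>
    have "box 1 (0::real^3) = {}" "cbox 1 (0::real^3) = {}" by (auto simp: mem_box_cart set_eq_iff)
    then show ?thesis using that[of 1 0] True by auto
   next
    case False
    have "cbox p' q' = closure (box p' q')" using False by simp
    also have "... \<subseteq> closure (cbox a b)" using pq box_subset_cbox by (intro closure_mono) blast
    finally show ?thesis using that[of p' q'] by simp
   qed
   have "(LBINT x. indicator (box p q) x*(indicator (cbox a b) x*h x))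
     = (LBINT x. indicator (box p'' q'') x*h x)"
   proof (rule integral_cong_AE)
    have "AE x in lborel. x \<notin> cbox a b - box a b"
     by (rule AE_not_in) (simp add: negligible_frontier_interval null_sets_def emeasure_lborel_cbox_eq emeasure_lborel_box_eq emeasure_Diff box_subset_cbox)
    then show "AE x in lborel. indicator (box p q) x*(indicator (cbox a b) x*h x) = indicator (box p'' q'') x*h x"
     unfolding pq'' pq[symmetric] using box_subset_cbox[of a b] by (auto elim!: eventually_mono simp: indicator_def)
    have 1: "(%x. indicator (cbox a b) x*h x) \<in> borel_measurable lborel" using h[OF sub] by blast
    then show "(%x. indicator (box p q) x*(indicator (cbox a b) x*h x)) \<in> borel_measurable lborel"
     by measurable
    have "(%x. indicator (box p'' q'') x*(indicator (cbox a b) x*h x)) \<in> borel_measurable lborel" using 1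
     by measurable
    moreover have "(%x. indicator (box p'' q'') x*(indicator (cbox a b) x*h x)) = (%x. indicator (box p'' q'') x*h x)"
     using pq''(2) box_subset_cbox[of p'' q''] by (auto simp: indicator_def fun_eq_iff)
    ultimately show "(%x. indicator (box p'' q'') x*h x) \<in> borel_measurable lborel" by simp
   qed
   also have "... = 0" using z pq''(2) sub by blast
   finally show "(LBINT x. indicator (box p q) x*(indicator (cbox a b) x*h x)) = 0" .
  qed
  then show ?thesis unfolding X by eventually_elim (auto simp: indicator_def)
 qed
 then have "AE x in lborel. \<forall>X\<in>D. x \<in> X --> h x = 0" using D(1) by (subst AE_ball_countable) auto
 then show ?thesis by eventually_elim (use D(4) in blast)
qed

text \<open>The bumps converge boundedly to indicators of boxes, so vanishing against all test
  functions forces vanishing integrals over all boxes in S.\<close>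

lemma fundamental_lemma:
 fixes h :: "real^3 => real"
 assumes S: "open S" and h: "loc_integrable S h"
  and z: "!!pt. test_fun S pt ==> (LBINT x. h x*pt x) = 0"
 shows "AE x in lborel. x \<in> S --> h x = 0"
proof (rule zero_on_boxes[OF S])
 fix p q :: "real^3" assume sub: "cbox p q \<subseteq> S"
 show i: "integrable lborel (%x. indicator (cbox p q) x*h x)"
  using h sub by (auto simp: loc_integrable_def set_integrable_def)
 have eq: "(LBINT x. bump n p q x*(indicator (cbox p q) x*h x)) = 0" for n
 proof -
  have "(%x. bump n p q x*(indicator (cbox p q) x*h x)) = (%x. h x*bump n p q x)"
   using bump_zero[of _ p q n] box_subset_cbox[of p q] by (auto simp: indicator_def fun_eq_iff)
  then show ?thesis using z[OF bump_test_fun[OF sub]] by simp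
 qed
 have "(%n. \<integral>x. bump n p q x*(indicator (cbox p q) x*h x) \<partial>lborel) \<longlonglongrightarrow> (LBINT x. indicator (box p q) x*(indicator (cbox p q) x*h x))"
 proof (rule integral_dominated_convergence[where w="%x. \<bar>indicator (cbox p q) x*h x\<bar>"])
  show "AE x in lborel. (%n. bump n p q x*(indicator (cbox p q) x*h x)) \<longlonglongrightarrow> indicator (box p q) x*(indicator (cbox p q) x*h x)"
   by (intro AE_I2 tendsto_intros bump_tendsto)
  show "AE x in lborel. norm (bump n p q x*(indicator (cbox p q) x*h x)) <= \<bar>indicator (cbox p q) x*h x\<bar>" for n
   using bump_bounds by (intro AE_I2) (simp add: abs_mult mult_left_le_one_le del: abs_indicator)
  show "(%x. indicator (box p q) x*(indicator (cbox p q) x*h x)) \<in> borel_measurable lborel"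
   using i by measurable
  have "bump n p q \<in> borel_measurable lborel" for n
   using smooth3_continuous[OF bump_smooth, of UNIV "[]"] by (auto intro: borel_measurable_continuous_onI)
  then show "(%x. bump n p q x*(indicator (cbox p q) x*h x)) \<in> borel_measurable lborel" for n
   using borel_measurable_times[OF _ borel_measurable_integrable[OF i]] by blast
 qed (use i in auto)
 then have "(LBINT x. indicator (box p q) x*(indicator (cbox p q) x*h x)) = 0"
  unfolding eq by (simp add: LIMSEQ_const_iff)
 moreover have "(%x. indicator (box p q) x*(indicator (cbox p q) x*h x)) = (%x. indicator (box p q) x*h x)"
  using box_subset_cbox[of p q] by (auto simp: indicator_def fun_eq_iff)
 ultimately show "(LBINT x. indicator (box p q) x*h x) = 0" by simp
qed

text \<open>A ReLU network has right derivatives along the axes at every point, kinks included, so a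
  gradient can be assigned to it everywhere.\<close>

definition has_rd :: "(real^3 => real) => 3 => real^3 => real => bool" where
 "has_rd f j x D \<longleftrightarrow> ((%t. f (sh x t j)) has_real_derivative D) (at 0 within {0..})"

lemma has_pd_imp_rd: "has_pd f j x D ==> has_rd f j x D"
 unfolding has_pd_def has_rd_def by (rule has_field_derivative_at_within)

lemma has_rd_seq:
 assumes "has_rd f j x D"
 shows "(%n. (f (x + (1/(real n + 1)) *\<^sub>R ax j) - f x)/(1/(real n + 1))) \<longlonglongrightarrow> D"
proof -
 have 1: "((%t. (f (sh x t j) - f x)/t) \<longlongrightarrow> D) (at 0 within {0..})"
  using assms unfolding has_rd_def has_field_derivative_iff by simp
 have "(%n. 1/(real n + 1)) \<longlonglongrightarrow> 0" using LIMSEQ_inverse_real_of_nat by (simp add: inverse_eq_divide add.commute)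
 then have "filterlim (%n. 1/(real n + 1)) (at 0 within {0..}) sequentially"
  by (auto simp: filterlim_at intro!: eventually_sequentiallyI[of 0])
 from filterlim_compose[OF 1 this] show ?thesis by simp
qed

text \<open>The difference quotients of a compactly supported function integrate to 0 by translation
  invariance, are dominated through the Lipschitz bound and converge to g. This is the core of
  integration by parts for functions differentiable only from one side.\<close>

lemma integral_rd_zero:
 assumes f [measurable]: "f \<in> borel_measurable borel"
  and z: "!!x. norm x > rh ==> f x = 0"
  and B: "!!x t. 0 < t ==> t <= 1 ==> \<bar>f (sh x t j) - f x\<bar> <= B*t"
  and bd: "!!x. \<bar>f x\<bar> <= B'"
  and g: "!!x. has_rd f j x (g x)"
 shows "integrable lborel g" "(LBINT x. g x) = 0"
proof -
 let ?s = "%n x. (f (x + (1/(real n + 1)) *\<^sub>R ax j) - f x)/(1/(real n + 1))"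
 let ?w = "%x::real^3. B*indicator (cball 0 (rh + 1)) x"
 have lim: "(%n. ?s n x) \<longlonglongrightarrow> g x" for x by (rule has_rd_seq[OF g])
 have gm: "g \<in> borel_measurable borel"
  by (rule borel_measurable_LIMSEQ_real[where u = ?s]) (use lim in auto)
 have w: "integrable lborel ?w"
  by (intro integrable_mult_right integrable_real_indicator emeasure_lborel_cball_finite) auto
 have bnd: "norm (?s n x) <= ?w x" for n x
 proof (cases "norm x <= rh + 1")
  case True
  have "\<bar>f (x + (1/(real n + 1)) *\<^sub>R ax j) - f x\<bar> <= B*(1/(real n + 1))" by (intro B) auto
  then have "\<bar>f (x + (1/(real n + 1)) *\<^sub>R ax j) - f x\<bar>/(1/(real n + 1)) <= B"
   by (subst pos_divide_le_eq) auto
  then show ?thesis using True by (simp only: real_norm_def abs_divide) (simp add: add.commute)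
 next
  case False
  have "norm (x + (1/(real n + 1)) *\<^sub>R ax j) >= norm x - norm ((1/(real n + 1)) *\<^sub>R ax j)"
   by (rule norm_diff_ineq)
  moreover have "norm ((1/(real n + 1)) *\<^sub>R ax j) <= 1" by (simp add: field_simps)
  ultimately have "f (x + (1/(real n + 1)) *\<^sub>R ax j) = 0" "f x = 0"
   using False by (auto intro!: z simp del: norm_scaleR)
  then show ?thesis using False by simp
 qed
 have fint: "integrable lborel f"
 proof (rule Bochner_Integration.integrable_bound[where f="%x::real^3. B'*indicator (cball 0 rh) x"])
  show "integrable lborel (%x::real^3. B'*indicator (cball 0 rh) x)"
   by (intro integrable_mult_right integrable_real_indicator emeasure_lborel_cball_finite) auto
  have "\<bar>f x\<bar> <= \<bar>B'*indicator (cball 0 rh) x\<bar>" for x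
   using bd[of x] z[of x] by (cases "norm x <= rh") auto
  then show "AE x in lborel. norm (f x) <= norm (B'*indicator (cball 0 rh) x)" by simp
 qed auto
 have s0: "(LBINT x. ?s n x) = 0" for n
  using integrable_shift3(3)[OF fint] integral_shift3(3)[OF f] fint by simp
 have "(%n. \<integral>x. ?s n x \<partial>lborel) \<longlonglongrightarrow> (LBINT x. g x)"
  by (rule integral_dominated_convergence[where w="?w"]) (use lim gm bnd w in \<open>auto\<close>)
 then show "(LBINT x. g x) = 0" unfolding s0 by (simp add: LIMSEQ_const_iff)
 show "integrable lborel g"
 proof (rule Bochner_Integration.integrable_bound[OF w])
  have "\<bar>g x\<bar> <= ?w x" for x
   by (rule LIMSEQ_le_const2[OF tendsto_rabs[OF lim]]) (use bnd in \<open>auto simp: real_norm_def\<close>)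
  then have "\<bar>g x\<bar> <= \<bar>?w x\<bar>" for x by (meson abs_ge_self order_trans)
  then show "AE x in lborel. norm (g x) <= norm (?w x)" by simp
 qed (use gm in auto)
qed

section \<open>Truncated Newton kernels\<close>

text \<open>\<open>chi0\<close> is a smooth cutoff in the variable |z|^2/r^2, and the factor
  \<open>exp 1\<close> normalises its value at 0 to 1. The other polynomials give its derivatives,
  with alternating signs because the argument is 1 - s.\<close>

definition chik :: "real poly => real => real" where
 "chik p s = exp 1*bp p (1 - s)"

abbreviation "chi0 \<equiv> chik 1"
abbreviation "chi1 \<equiv> (%s. - chik (bpd 1) s)"
abbreviation "chi2 \<equiv> chik (bpd (bpd 1))"
abbreviation "chi3 \<equiv> (%s. - chik (bpd (bpd (bpd 1))) s)"

lemma chik_deriv [derivative_intros]: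
 "(chik p has_real_derivative - chik (bpd p) s) (at s)"
 unfolding chik_def
 by (auto intro!: derivative_eq_intros DERIV_chain2[OF bp_deriv])

lemma chik_zero: "s >= 1 ==> chik p s = 0"
 by (simp add: chik_def bp_def)

lemma chi0_0: "chi0 0 = 1"
 by (simp add: chik_def bp_def exp_minus)

lemma chik_bounded: "\<exists>B. \<forall>s\<ge>0. \<bar>chik p s\<bar> <= B"
proof -
 obtain B where "B > 0" "\<forall>t\<le>1. \<bar>bp p t\<bar> <= B" using bp_bounded by blast
 then have "\<forall>s\<ge>0. \<bar>chik p s\<bar> <= exp 1*B" by (auto simp: chik_def abs_mult)
 then show ?thesis by blast
qed

definition BX :: real where
 "BX = (SOME B. B >= 1 & (\<forall>s\<ge>0. \<bar>chi0 s\<bar> <= B & \<bar>chi1 s\<bar> <= B & \<bar>chi2 s\<bar> <= B & \<bar>chi3 s\<bar> <= B))"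

lemma BX: "BX >= 1" "s >= 0 ==> \<bar>chi0 s\<bar> <= BX" "s >= 0 ==> \<bar>chi1 s\<bar> <= BX" "s >= 0 ==> \<bar>chi2 s\<bar> <= BX" "s >= 0 ==> \<bar>chi3 s\<bar> <= BX"
proof -
 obtain B0 B1 B2 B3 where
  B: "\<forall>s\<ge>0. \<bar>chi0 s\<bar> <= B0" "\<forall>s\<ge>0. \<bar>chik (bpd 1) s\<bar> <= B1" "\<forall>s\<ge>0. \<bar>chi2 s\<bar> <= B2" "\<forall>s\<ge>0. \<bar>chik (bpd (bpd (bpd 1))) s\<bar> <= B3"
  using chik_bounded by meson
 have "\<exists>B\<ge>1. (\<forall>s\<ge>0. \<bar>chi0 s\<bar> <= B & \<bar>chi1 s\<bar> <= B & \<bar>chi2 s\<bar> <= B & \<bar>chi3 s\<bar> <= B)"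
  by (rule exI[of _ "max 1 (max (max B0 B1) (max B2 B3))"]) (use B in \<open>auto simp: le_max_iff_disj\<close>)
 from someI_ex[OF this[folded BX_def, simplified]]
 show "BX >= 1" "s >= 0 ==> \<bar>chi0 s\<bar> <= BX" "s >= 0 ==> \<bar>chi1 s\<bar> <= BX" "s >= 0 ==> \<bar>chi2 s\<bar> <= BX" "s >= 0 ==> \<bar>chi3 s\<bar> <= BX"
  unfolding BX_def[symmetric] by (auto simp: BX_def)
qed

lemma chik_measurable [measurable]: "chik p \<in> borel_measurable borel"
 unfolding chik_def by measurable

text \<open>For a = 1/2 and de = 0 this is the Newton kernel 1/|z|, which de > 0 makes smooth; the
  exponents 3/2 and 5/2 arise by differentiation.\<close>

definition mk :: "real => real => real^3 => real" where
 "mk a de z = ((norm z)^2 + de^2) powr (- a)"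

lemma mk_measurable [measurable]: "mk a de \<in> borel_measurable borel"
 unfolding mk_def by measurable

lemma mk_nonneg [simp]: "0 <= mk a de z" by (simp add: mk_def)

lemma mk_le: "z ~= 0 ==> a >= 0 ==> mk a de z <= norm z powr (- (2*a))"
proof -
 assume z: "z ~= 0" "a >= 0"
 have "mk a de z <= ((norm z)^2) powr (- a)"
  unfolding mk_def using z by (intro powr_mono2') auto
 also have "... = (norm z powr 2) powr (-a)" using z by (simp add: powr_numeral)
 finally show ?thesis unfolding powr_powr by (simp add: mult.commute)
qed

lemma mk_tendsto:
 assumes "z ~= 0" "d \<longlonglongrightarrow> 0"
 shows "(%n. mk a (d n) z) \<longlonglongrightarrow> mk a 0 z"
 unfolding mk_def using assms by (intro tendsto_intros) auto

definition Ker :: "(real => real) => real => real^3 => real" where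
 "Ker A de z = A ((norm z)^2)*mk (1/2) de z"

definition dKer :: "(real => real) => (real => real) => real => 3 => real^3 => real" where
 "dKer A A' de j z = 2*z $ j*(A' ((norm z)^2)*mk (1/2) de z - 1/2*A ((norm z)^2)*mk (3/2) de z)"

definition A0 :: "real => real => real" where "A0 r s = chi0 (s/r^2)"
definition A0' :: "real => real => real" where "A0' r s = chi1 (s/r^2)/r^2"
definition A0'' :: "real => real => real" where "A0'' r s = chi2 (s/r^2)/r^2/r^2"
definition A0''' :: "real => real => real" where "A0''' r s = chi3 (s/r^2)/r^2/r^2/r^2"
text \<open>Chosen so that the commutator kernel \<open>kap\<close> at de = 0 is again a cutoff
  divided by |z|, see \<open>kap_0\<close>. Both terms of the representation formula then fall under
  \<open>cv_C1\<close>.\<close>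

definition A1 :: "real => real => real" where "A1 r s = 2*A0' r s + 4 * s*A0'' r s"
definition A1' :: "real => real => real" where "A1' r s = 6*A0'' r s + 4 * s*A0''' r s"

text \<open>The Laplacian of the truncated regularised kernel is \<open>- pkd + kap\<close>. In
  \<open>pkd\<close> the cutoff is not differentiated, and it becomes a multiple of the delta
  function as de tends to 0; \<open>kap\<close> collects all terms with a derivative on the
  cutoff.\<close>

definition kap :: "real => real => real^3 => real" where
 "kap de r z = (6*A0' r ((norm z)^2) + 4*(norm z)^2*A0'' r ((norm z)^2))*mk (1/2) de z
   - 4*(norm z)^2*A0' r ((norm z)^2)*mk (3/2) de z"

definition pkd :: "real => real => real^3 => real" where
 "pkd de r z = 3*de^2*A0 r ((norm z)^2)*mk (5/2) de z"

lemma A0_measurable [measurable]: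
 "A0 r \<in> borel_measurable borel" "A0' r \<in> borel_measurable borel" "A0'' r \<in> borel_measurable borel" "A0''' r \<in> borel_measurable borel"
 "A1 r \<in> borel_measurable borel" "A1' r \<in> borel_measurable borel"
proof -
 show *: "A0 r \<in> borel_measurable borel" "A0' r \<in> borel_measurable borel" "A0'' r \<in> borel_measurable borel" "A0''' r \<in> borel_measurable borel"
  unfolding A0_def A0'_def A0''_def A0'''_def by measurable
 note [measurable] = *
 show "A1 r \<in> borel_measurable borel" "A1' r \<in> borel_measurable borel"
  unfolding A1_def A1'_def by measurable
qed

lemma Ker_measurable [measurable]:
 assumes [measurable]: "A \<in> borel_measurable borel"
 shows "Ker A de \<in> borel_measurable borel"
 unfolding Ker_def by measurable

lemma vec_nth_measurable [measurable]: "(%z::real^3. z $ j) \<in> borel_measurable borel"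
 by (intro borel_measurable_continuous_onI continuous_intros)

lemma dKer_measurable [measurable]:
 assumes [measurable]: "A \<in> borel_measurable borel" "A' \<in> borel_measurable borel"
 shows "dKer A A' de j \<in> borel_measurable borel"
 unfolding dKer_def by measurable

lemma kap_measurable [measurable]: "kap de r \<in> borel_measurable borel"
 unfolding kap_def by measurable

lemma pkd_measurable [measurable]: "pkd de r \<in> borel_measurable borel"
 unfolding pkd_def by measurable

section \<open>Derivatives and size of the kernels\<close>

lemma A0_derivs:
 "(A0 r has_real_derivative A0' r s) (at s)"
 "(A0' r has_real_derivative A0'' r s) (at s)"
 "(A0'' r has_real_derivative A0''' r s) (at s)"
 "(A1 r has_real_derivative A1' r s) (at s)"
proof -
 have c: "((%s. chik p (s/r^2)) has_real_derivative - chik (bpd p) (s/r^2)/r^2) (at s)" for p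
 proof -
  have "((%s. s/r^2) has_real_derivative 1/r^2) (at s)" by (rule DERIV_cdivide[OF DERIV_ident])
  from DERIV_chain2[OF chik_deriv this] show ?thesis by simp
 qed
 show *: "(A0 r has_real_derivative A0' r s) (at s)"
  "(A0' r has_real_derivative A0'' r s) (at s)"
  "(A0'' r has_real_derivative A0''' r s) (at s)"
  unfolding A0_def A0'_def A0''_def A0'''_def
  using c[of 1] DERIV_cdivide[OF DERIV_minus[OF c[of "bpd 1"]], of "r^2"]
    DERIV_cdivide[OF DERIV_cdivide[OF c[of "bpd (bpd 1)"], of "r^2"], of "r^2"] by simp_all
 show "(A1 r has_real_derivative A1' r s) (at s)"
  unfolding A1_def A1'_def by (auto intro!: derivative_eq_intros *)
qed

lemma A0_zero:
 assumes "r > 0" "s >= r^2"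
 shows "A0 r s = 0" "A0' r s = 0" "A0'' r s = 0" "A0''' r s = 0" "A1 r s = 0" "A1' r s = 0"
proof -
 have "s/r^2 >= 1" using assms by (simp add: le_divide_eq)
 then show "A0 r s = 0" "A0' r s = 0" "A0'' r s = 0" "A0''' r s = 0" "A1 r s = 0" "A1' r s = 0"
  by (simp_all add: A0_def A0'_def A0''_def A0'''_def A1_def A1'_def chik_zero)
qed

lemma A0_bounds:
 assumes "r > 0" "s >= 0"
 shows "\<bar>A0 r s\<bar> <= BX" "s * \<bar>A0' r s\<bar> <= BX" "\<bar>A0' r s\<bar> <= BX/r^2" "s * \<bar>A0'' r s\<bar> <= BX/r^2"
  "\<bar>A1 r s\<bar> <= 10*BX/r^2" "s * \<bar>A1' r s\<bar> <= 10*BX/r^2"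
proof -
 have z: "s/r^2 >= 0" using assms by simp
 have B: "BX >= 1" by (rule BX)
 have main: "\<bar>A0 r s\<bar> <= BX & s * \<bar>A0' r s\<bar> <= BX & \<bar>A0' r s\<bar> <= BX/r^2 & s * \<bar>A0'' r s\<bar> <= BX/r^2 & s*(s * \<bar>A0''' r s\<bar>) <= BX/r^2"
 proof (cases "s < r^2")
  case True
  have q: "s/r^2 <= 1" using True assms by (simp add: divide_le_eq)
  have 1: "\<bar>A0' r s\<bar> = \<bar>chi1 (s/r^2)\<bar>/r^2" "\<bar>A0'' r s\<bar> = \<bar>chi2 (s/r^2)\<bar>/r^2/r^2"
    "\<bar>A0''' r s\<bar> = \<bar>chi3 (s/r^2)\<bar>/r^2/r^2/r^2"
   unfolding A0'_def A0''_def A0'''_def by (simp_all add: abs_mult)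
  have "s * \<bar>A0' r s\<bar> = (s/r^2) * \<bar>chi1 (s/r^2)\<bar>" unfolding 1 by simp
  also have "... <= 1*BX" using q z BX(3)[OF z] by (intro mult_mono) auto
  finally have a: "s * \<bar>A0' r s\<bar> <= BX" by simp
  have "s * \<bar>A0'' r s\<bar> = ((s/r^2) * \<bar>chi2 (s/r^2)\<bar>)/r^2" unfolding 1 by simp
  also have "... <= (1*BX)/r^2" using q z BX(4)[OF z] by (intro mult_mono divide_right_mono) auto
  finally have b: "s * \<bar>A0'' r s\<bar> <= BX/r^2" by simp
  have "s*(s * \<bar>A0''' r s\<bar>) = ((s/r^2)*((s/r^2) * \<bar>chi3 (s/r^2)\<bar>))/r^2" unfolding 1 by simp
  also have "... <= (1*(1*BX))/r^2" using q z BX(5)[OF z] B by (intro mult_mono divide_right_mono mult_nonneg_nonneg) auto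
  finally have c: "s*(s * \<bar>A0''' r s\<bar>) <= BX/r^2" by simp
  show ?thesis using a b c BX(2)[OF z] BX(3)[OF z] unfolding 1 by (auto simp: A0_def intro: divide_right_mono)
 qed (use A0_zero[OF assms(1), of s] B in auto)
 then show "\<bar>A0 r s\<bar> <= BX" "s * \<bar>A0' r s\<bar> <= BX" "\<bar>A0' r s\<bar> <= BX/r^2" "s * \<bar>A0'' r s\<bar> <= BX/r^2" by auto
 have P: "BX/r^2 >= 0" using B by simp
 have "\<bar>A1 r s\<bar> <= 2 * \<bar>A0' r s\<bar> + 4*(s * \<bar>A0'' r s\<bar>)" unfolding A1_def using assms
  by (intro order_trans[OF abs_triangle_ineq]) (simp add: abs_mult)
 then have "\<bar>A1 r s\<bar> <= 10*(BX/r^2)" using main P by linarith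
 then show "\<bar>A1 r s\<bar> <= 10*BX/r^2" by simp
 have "\<bar>A1' r s\<bar> <= 6 * \<bar>A0'' r s\<bar> + 4*(s * \<bar>A0''' r s\<bar>)" unfolding A1'_def using assms
  by (intro order_trans[OF abs_triangle_ineq]) (simp add: abs_mult)
 then have "s * \<bar>A1' r s\<bar> <= s*(6 * \<bar>A0'' r s\<bar> + 4*(s * \<bar>A0''' r s\<bar>))" using assms by (intro mult_left_mono)
 also have "... = 6*(s * \<bar>A0'' r s\<bar>) + 4*(s*(s * \<bar>A0''' r s\<bar>))" by (simp add: algebra_simps)
 also have "... <= 10*(BX/r^2)" using main P by linarith
 finally show "s * \<bar>A1' r s\<bar> <= 10*BX/r^2" by simp
qed

lemma normsq_ge: "norm z > r ==> r > 0 ==> (norm z)^2 >= r^2"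
 by (simp add: power_mono)

lemma Ker_bound:
 assumes A: "!!s. s >= 0 ==> \<bar>A s\<bar> <= a" "!!s. s >= r^2 ==> A s = 0" and "r > 0" and z: "z ~= 0"
 shows "\<bar>Ker A de z\<bar> <= a*kb 1 r z"
proof (cases "norm z <= r")
 case True
 have "\<bar>Ker A de z\<bar> <= a*norm z powr (- (2*(1/2)))"
  unfolding Ker_def abs_mult using A(1)[of "(norm z)^2"] mk_le[OF z, of "1/2" de] by (intro mult_mono) auto
 then show ?thesis using True by (simp add: kb_def)
qed (use A(2) normsq_ge[OF _ \<open>r > 0\<close>, of z] in \<open>auto simp: Ker_def kb_def\<close>)

lemma dKer_bound:
 assumes A: "!!s. s >= 0 ==> \<bar>A s\<bar> <= a" "!!s. s >= r^2 ==> A s = 0"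
  "!!s. s >= 0 ==> s * \<bar>A' s\<bar> <= a" "!!s. s >= r^2 ==> A' s = 0" and "r > 0" and z: "z ~= 0"
 shows "\<bar>dKer A A' de j z\<bar> <= 3*a*kb 2 r z"
proof (cases "norm z <= r")
 case True
 let ?N = "norm z"
 have a: "a >= 0" using A(1)[of 0] by auto
 have N: "?N > 0" using z by simp
 have zj: "\<bar>z $ j\<bar> <= ?N" by (rule component_le_norm_cart)
 have m1: "mk (1/2) de z <= 1/?N" using mk_le[OF z, of "1/2" de] N by (simp add: powr_minus_divide)
 have m3: "mk (3/2) de z <= 1/?N^3" using mk_le[OF z, of "3/2" de] N by (simp add: powr_minus_divide powr_numeral)
 have "\<bar>A' (?N^2)*mk (1/2) de z\<bar> <= (a/?N^2)*(1/?N)"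
  unfolding abs_mult using A(3)[of "?N^2"] N m1 by (intro mult_mono) (auto simp: pos_le_divide_eq mult.commute a)
 then have t1: "\<bar>A' (?N^2)*mk (1/2) de z\<bar> <= a/?N^3" by (simp add: power3_eq_cube power2_eq_square)
 have t2: "\<bar>1/2*A (?N^2)*mk (3/2) de z\<bar> <= (1/2*a)*(1/?N^3)"
  unfolding abs_mult using A(1)[of "?N^2"] m3 by (intro mult_mono) auto
 have "\<bar>dKer A A' de j z\<bar> <= (2*?N)*(a/?N^3 + (1/2*a)*(1/?N^3))"
  unfolding dKer_def abs_mult[of "2*z $ j"] using zj t1 t2
  by (intro mult_mono order_trans[OF abs_triangle_ineq4]) (auto simp: abs_mult)
 also have "... = 3*a*?N powr (-2)" using N by (simp add: powr_minus_divide powr_numeral field_simps power3_eq_cube power2_eq_square)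
 finally show ?thesis using True by (simp add: kb_def)
qed (use A(2,4) normsq_ge[OF _ \<open>r > 0\<close>, of z] in \<open>auto simp: dKer_def kb_def\<close>)

lemma kap_bound:
 assumes "r > 0" and z: "z ~= 0"
 shows "\<bar>kap de r z\<bar> <= 14*BX/r^2*kb 1 r z"
proof (cases "norm z <= r")
 case True
 let ?N = "norm z"
 have N: "?N > 0" using z by simp
 have m1: "mk (1/2) de z <= 1/?N" using mk_le[OF z, of "1/2" de] N by (simp add: powr_minus_divide)
 have m3: "mk (3/2) de z <= 1/?N^3" using mk_le[OF z, of "3/2" de] N by (simp add: powr_minus_divide powr_numeral)
 have s: "?N^2 >= 0" by simp
 note A = A0_bounds[OF \<open>r > 0\<close> s]
 have "\<bar>6*A0' r (?N^2) + 4*?N^2*A0'' r (?N^2)\<bar> <= 6 * \<bar>A0' r (?N^2)\<bar> + 4*(?N^2 * \<bar>A0'' r (?N^2)\<bar>)"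
  by (intro order_trans[OF abs_triangle_ineq]) (simp add: abs_mult)
 also have "... <= 10*(BX/r^2)" using A by linarith
 finally have t1: "\<bar>(6*A0' r (?N^2) + 4*?N^2*A0'' r (?N^2))*mk (1/2) de z\<bar> <= 10*(BX/r^2)*(1/?N)"
  unfolding abs_mult[of _ "mk (1/2) de z"] using m1 by (intro mult_mono) auto
 have "\<bar>4*?N^2*A0' r (?N^2)*mk (3/2) de z\<bar> <= (4*?N^2*(BX/r^2))*(1/?N^3)"
  unfolding abs_mult[of _ "mk (3/2) de z"] abs_mult[of _ "A0' r (?N^2)"] using m3 A(3) BX(1) by (intro mult_mono) auto
 also have "... = 4*(BX/r^2)*(1/?N)" using N by (simp add: power3_eq_cube power2_eq_square)
 finally have "\<bar>kap de r z\<bar> <= 10*(BX/r^2)*(1/?N) + 4*(BX/r^2)*(1/?N)"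
  unfolding kap_def using t1 by (intro order_trans[OF abs_triangle_ineq4] add_mono)
 also have "... = 14*BX/r^2*?N powr (-1)" using N by (simp add: powr_minus_divide field_simps)
 finally show ?thesis using True by (simp add: kb_def)
qed (use normsq_ge[OF _ \<open>r > 0\<close>, of z] A0_zero[OF \<open>r > 0\<close>, of "(norm z)^2"] in \<open>auto simp: kap_def kb_def\<close>)

text \<open>At de = 0 the power with exponent 1/2 is |z|^2 times the one with exponent 3/2, so the
  last term of \<open>kap\<close> lowers the coefficient of \<open>A0'\<close> from 6 to the 2
  occurring in \<open>A1\<close>.\<close>

lemma kap_0: "kap 0 r z = Ker (A1 r) 0 z"
proof (cases "z = 0")
 case False
 then have N: "norm z > 0" by simp
 have "(norm z)\<^sup>2 powr (- (3/2))*(norm z)^2 = (norm z)\<^sup>2 powr (- (3/2) + 1)"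
  using N by (subst powr_add) simp
 then have m: "mk (1/2) 0 z = (norm z)^2*mk (3/2) 0 z"
  by (simp add: mk_def mult.commute)
 show ?thesis unfolding kap_def Ker_def A1_def m by (simp add: algebra_simps)
qed (simp add: kap_def Ker_def mk_def)

lemma powr_deriv_shift:
 assumes "c > 0" "s >= 0"
 shows "((%s. (s + c) powr a) has_real_derivative a*(s + c) powr (a - 1)) (at s)"
 using assms by (auto intro!: derivative_eq_intros)

lemma has_pd_mk:
 assumes "de ~= 0"
 shows "has_pd (%y. mk a de (y - x)) j y (- (2*a)*(y - x) $ j*mk (a + 1) de (y - x))"
proof -
 have d: "((%s. (s + de^2) powr (- a)) has_real_derivative (- a)*((norm (y - x))^2 + de^2) powr (- a - 1)) (at ((norm (y - x))^2))"
  by (rule powr_deriv_shift) (use assms in auto)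
 have "- a - 1 = - (a + 1)" by simp
 then have q: "(- a)*((norm (y - x))^2 + de^2) powr (- a - 1)*(2*(y $ j - x $ j)) = - (2*a)*(y - x) $ j*mk (a + 1) de (y - x)"
  unfolding mk_def by (simp only:) simp
 show ?thesis using has_pd_compose[OF d has_pd_normsq[of x j y]] unfolding q by (simp only: mk_def[of a])
qed

lemma has_pd_A:
 assumes "!!s. (A has_real_derivative A' s) (at s)"
 shows "has_pd (%y. A ((norm (y - x))^2)) j y (2*(y - x) $ j*A' ((norm (y - x))^2))"
 using has_pd_compose[OF assms has_pd_normsq[of x j y]] by (simp add: algebra_simps)

lemma has_pd_Ker:
 assumes "de ~= 0" "!!s. (A has_real_derivative A' s) (at s)"
 shows "has_pd (%y. Ker A de (y - x)) j y (dKer A A' de j (y - x))"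
proof -
 have "2*(y - x) $ j*A' ((norm (y - x))^2)*mk (1/2) de (y - x) + - (2*(1/2))*(y - x) $ j*mk (1/2 + 1) de (y - x)*A ((norm (y - x))^2)
   = dKer A A' de j (y - x)"
  unfolding dKer_def by (simp add: field_simps)
 then show ?thesis
  using has_pd_mult[OF has_pd_A[OF assms(2), of x j y] has_pd_mk[OF assms(1), of "1/2" x j y]]
  by (simp only: Ker_def)
qed

lemma has_pd_zj: "has_pd (%y. 2*(y - x) $ j) j y 2"
 using has_pd_cmult[OF has_pd_diff[OF has_pd_coord[of j j y] has_pd_const[of "x $ j"]], of 2] by simp

text \<open>A function H of s = |z|^2 has the second derivatives 2 H' + 4 z_j^2 H'', with sum 6 H' +
  4 s H''. Here \<open>?h1\<close> and \<open>?h2\<close> are H' and H''.\<close>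

lemma laplacian_Ker:
 assumes d: "de ~= 0"
 shows "laplacian (%y. Ker (A0 r) de (y - x)) y = - pkd de r (y - x) + kap de r (y - x)"
proof -
 define z where "z = y - x"
 define s where "s = (norm z)^2"
 let ?m1 = "mk (1/2) de z" and ?m3 = "mk (3/2) de z" and ?m5 = "mk (5/2) de z"
 let ?h1 = "A0' r s*?m1 - 1/2*A0 r s*?m3"
 let ?h2 = "A0'' r s*?m1 - A0' r s*?m3 + 3/4*A0 r s*?m5"
 have pd1: "pd j (%y. Ker (A0 r) de (y - x)) = (%y. dKer (A0 r) (A0' r) de j (y - x))" for j
  using has_pd_imp_pd[OF has_pd_Ker[OF d A0_derivs(1)]] by blast
 have pd2: "pd j (%y. dKer (A0 r) (A0' r) de j (y - x)) y = 2*?h1 + 4*(z $ j)^2*?h2" for j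
 proof -
  have a: "has_pd (%y. A0' r ((norm (y - x))^2)*mk (1/2) de (y - x)) j y
    (2*z $ j*A0'' r s*?m1 + - z $ j*?m3*A0' r s)"
   using has_pd_mult[OF has_pd_A[OF A0_derivs(2)[of r], of x j y] has_pd_mk[OF d, of "1/2" x j y]]
   by (simp add: z_def s_def)
  have b: "has_pd (%y. (1/2*A0 r ((norm (y - x))^2))*mk (3/2) de (y - x)) j y
    ((1/2*(2*z $ j*A0' r s))*?m3 + - 3*z $ j*?m5*(1/2*A0 r s))"
   using has_pd_mult[OF has_pd_cmult[OF has_pd_A[OF A0_derivs(1)[of r], of x j y], of "1/2"] has_pd_mk[OF d, of "3/2" x j y]]
   by (simp add: z_def s_def)
  have "has_pd (%y. dKer (A0 r) (A0' r) de j (y - x)) j y (2*?h1 + 4*(z $ j)^2*?h2)"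
  proof -
   have "2*(A0' r ((norm (y - x))^2)*mk (1/2) de (y - x) - 1/2*A0 r ((norm (y - x))^2)*mk (3/2) de (y - x))
     + (2*z $ j*A0'' r s*?m1 + - z $ j*?m3*A0' r s - ((1/2*(2*z $ j*A0' r s))*?m3 + - 3*z $ j*?m5*(1/2*A0 r s)))*(2*(y - x) $ j)
     = 2*?h1 + 4*(z $ j)^2*?h2"
    unfolding z_def[symmetric] unfolding s_def[symmetric] by (simp add: field_simps power2_eq_square)
   then show ?thesis using has_pd_mult[OF has_pd_zj[of x j y] has_pd_diff[OF a b]] unfolding dKer_def by (simp only:)
  qed
  then show ?thesis by (rule has_pd_imp_pd)
 qed
 have ss: "(z$1)^2 + (z$2)^2 + (z$3)^2 = s" by (simp add: s_def norm_sq3)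
 have sd: "s + de^2 > 0" using d by (simp add: s_def add_nonneg_pos)
 \<comment> \<open>Writing \<open>?m3\<close> through \<open>?m5\<close> leaves of the terms with
   undifferentiated cutoff only -3 de^2 times \<open>A0\<close> and \<open>?m5\<close>, which is
   \<open>- pkd\<close>.\<close>
 have "(s + de^2) powr (- (5/2))*(s + de^2) = (s + de^2) powr (- (5/2) + 1)"
  using sd by (subst powr_add) simp
 then have m35: "?m3 = ?m5*(s + de^2)" by (simp add: mk_def s_def)
 have "laplacian (%y. Ker (A0 r) de (y - x)) y = 6*?h1 + 4*((z$1)^2 + (z$2)^2 + (z$3)^2)*?h2"
  unfolding laplacian_def pd1 pd2 sum_3 by (simp add: algebra_simps)
 also have "... = 6*?h1 + 4 * s*?h2" unfolding ss ..
 also have "... = - pkd de r z + kap de r z"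
  unfolding pkd_def kap_def s_def[symmetric] by (simp add: algebra_simps m35)
 finally show ?thesis by (simp add: z_def)
qed

text \<open>For de nonzero the kernel is smooth at its centre, and the cutoff makes its support
  compact; this is what allows testing weak equations with it.\<close>

lemma Ker_test_fun:
 assumes d: "de ~= 0" and r: "r > 0" and sub: "cball x r \<subseteq> U"
 shows "test_fun U (%y. Ker (A0 r) de (y - x))"
proof -
 have sm: "smooth3 (%y. Ker (A0 r) de (y - x))"
 proof (rule smooth3I)
  fix n
  have "Cn n (%y. bp 1 (1 + (- 1/r^2)*(norm (y - x))^2))"
   by (rule Cn_compose[OF bp_Dn]) (rule Cn_mult Cn_add Cn_const Cn_normsq subset_UNIV)+
  then have 1: "Cn n (%y. exp 1*bp 1 (1 + (- 1/r^2)*(norm (y - x))^2))"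
   by (intro Cn_mult Cn_const)
  have 2: "Cn n (%y. 1*((norm (y - x))^2 + de^2) powr (- (1/2)))"
   by (rule Cn_compose[OF powr_Dn[of "de^2" n 1 "- (1/2)"] Cn_normsq]) (use d in \<open>auto intro: less_le_trans[of _ 0]\<close>)
  show "Cn n (%y. Ker (A0 r) de (y - x))"
   using Cn_mult[OF 1 2] by (simp add: Ker_def A0_def chik_def mk_def)
 qed
 have "norm (y - x) > r ==> Ker (A0 r) de (y - x) = 0" for y
  using normsq_ge[OF _ r, of "y - x"] A0_zero(1)[OF r] by (simp add: Ker_def)
 then have s: "{y. Ker (A0 r) de (y - x) ~= 0} \<subseteq> cball x r"
  by (auto simp: dist_norm norm_minus_commute not_less[symmetric])
 then have "closure {y. Ker (A0 r) de (y - x) ~= 0} \<subseteq> cball x r" by (intro closure_minimal) auto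
 moreover have "bounded {y. Ker (A0 r) de (y - x) ~= 0}" using s bounded_subset bounded_cball by blast
 ultimately show ?thesis unfolding test_fun_def using sm sub by (auto simp: compact_closure)
qed

section \<open>Representation of weak solutions\<close>

lemma conv_pair_integrable:
 fixes f k :: "real^3 => real"
 assumes f: "integrable lborel f" and k: "integrable lborel k"
 shows "integrable (lborel \<Otimes>\<^sub>M lborel) (%(x, y). f y*k (y - x))"
  "integrable (lborel \<Otimes>\<^sub>M lborel) (%(y, x). f y*k (y - x))"
proof -
 have [measurable]: "f \<in> borel_measurable borel" "k \<in> borel_measurable borel" using f k by auto
 show *: "integrable (lborel \<Otimes>\<^sub>M lborel) (%(y, x). f y*k (y - x))"
 proof (rule lborel_pair.Fubini_integrable)
  have "(%y. \<integral>x. norm (case (y, x) of (y, x) => f y*k (y - x)) \<partial>lborel) = (%y. \<bar>f y\<bar>*(LBINT x. \<bar>k x\<bar>))"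
   using integral_shift3(2)[of "%x. \<bar>k x\<bar>"] by (simp add: abs_mult)
  then show "integrable lborel (%y. \<integral>x. norm (case (y, x) of (y, x) => f y*k (y - x)) \<partial>lborel)"
   using f by simp
  show "AE y in lborel. integrable lborel (%x. case (y, x) of (y, x) => f y*k (y - x))"
   using integrable_shift3(2)[OF k] by simp
 qed measurable
 show "integrable (lborel \<Otimes>\<^sub>M lborel) (%(x, y). f y*k (y - x))"
  using lborel_pair.integrable_product_swap[OF *] by (simp add: case_prod_beta)
qed

lemma integrable_bound_ne0:
 fixes h K :: "real^3 => real"
 assumes "integrable lborel K" "h \<in> borel_measurable borel" "!!z. z ~= 0 ==> \<bar>h z\<bar> <= K z"
 shows "integrable lborel h"
proof (rule Bochner_Integration.integrable_bound[OF assms(1)])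
 show "AE z in lborel. norm (h z) <= norm (K z)"
  using AE_lborel_singleton[of 0]
 proof eventually_elim
  case (elim z)
  show ?case using assms(3)[OF elim] by simp
 qed
qed (use assms in auto)

text \<open>For f merely integrable the limit is taken after integration over x in B: on the product
  space everything is dominated by |f(y)| K(y - x), which is integrable, and the diagonal y = x,
  where the kernels need not converge, is a null set.\<close>

lemma conv_lim:
 fixes f :: "real^3 => real"
 assumes f: "integrable lborel f" and K: "integrable lborel K"
  and k [measurable]: "!!n. kn n \<in> borel_measurable borel" "k \<in> borel_measurable borel"
  and lim: "!!z. z ~= 0 ==> (%n. kn n z) \<longlonglongrightarrow> k z"
  and bd: "!!n z. z ~= 0 ==> \<bar>kn n z\<bar> <= K z" 
  and B [measurable]: "B \<in> sets borel"
 shows "(%n. \<integral>x. indicator B x*(LBINT y. f y*kn n (y - x)) \<partial>lborel) 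
   \<longlonglongrightarrow> (\<integral>x. indicator B x*(LBINT y. f y*k (y - x)) \<partial>lborel)" (is ?lim)
  "integrable lborel (%x. indicator B x*(LBINT y. f y*k (y - x)))"
  "integrable lborel (%x. indicator B x*(LBINT y. f y*kn n (y - x)))"
  "AE x in lborel. integrable lborel (%y. f y*k (y - x))"
proof -
 have [measurable]: "f \<in> borel_measurable borel" "K \<in> borel_measurable borel" using f K by auto
 let ?W = "%(x, y). f y*K (y - x)"
 have W: "integrable (lborel \<Otimes>\<^sub>M lborel) ?W" by (rule conv_pair_integrable[OF f K])
 have bdk: "\<bar>k z\<bar> <= K z" if "z ~= 0" for z
  by (rule LIMSEQ_le_const2[OF tendsto_rabs[OF lim[OF that]]]) (use bd[OF that] in auto)
 have ki: "integrable lborel k"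
  by (rule integrable_bound_ne0[OF K k(2) bdk])
 have kni: "integrable lborel (kn n)" for n
  by (rule integrable_bound_ne0[OF K k(1) bd])
 have ind: "integrable (lborel \<Otimes>\<^sub>M lborel) (%(x, y). indicator B x*(f y*h (y - x)))" if "integrable lborel h" for h
 proof (rule Bochner_Integration.integrable_bound[OF conv_pair_integrable(1)[OF f that]])
  have [measurable]: "h \<in> borel_measurable borel" using that by auto
  show "(%(x, y). indicator B x*(f y*h (y - x))) \<in> borel_measurable (lborel \<Otimes>\<^sub>M lborel)" by measurable
 qed (auto simp: indicator_def)
 have eq: "(\<integral>x. indicator B x*(LBINT y. f y*h (y - x)) \<partial>lborel) 
   = (\<integral>p. (%(x, y). indicator B x*(f y*h (y - x))) p \<partial>(lborel \<Otimes>\<^sub>M lborel))" if "integrable lborel h" for h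
  using lborel_pair.integral_fst'[OF ind[OF that]] by simp
 have I: "integrable lborel (%x. indicator B x*(LBINT y. f y*h (y - x)))" if "integrable lborel h" for h
  using lborel_pair.integrable_fst'[OF ind[OF that]] by simp
 show "integrable lborel (%x. indicator B x*(LBINT y. f y*k (y - x)))" by (rule I[OF ki])
 show "integrable lborel (%x. indicator B x*(LBINT y. f y*kn n (y - x)))" by (rule I[OF kni])
 show "AE x in lborel. integrable lborel (%y. f y*k (y - x))"
  using lborel_pair.AE_integrable_fst'[OF conv_pair_integrable(1)[OF f ki]] by simp
 have ne: "AE p in lborel \<Otimes>\<^sub>M lborel. snd p - fst p ~= (0::real^3)"
 proof (rule lborel_pair.AE_pair_measure)
  show "{p \<in> space (lborel \<Otimes>\<^sub>M lborel). snd p - fst p ~= (0::real^3)} \<in> sets (lborel \<Otimes>\<^sub>M lborel)" by measurable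
  show "AE x in lborel. AE y in lborel. snd (x, y) - fst (x, y) ~= (0::real^3)"
   by (rule AE_I2) (use AE_lborel_singleton in simp)
 qed
 show ?lim
  unfolding eq[OF ki] eq[OF kni]
 proof (rule integral_dominated_convergence[where w="%p. \<bar>?W p\<bar>"])
  show "AE p in lborel \<Otimes>\<^sub>M lborel. (%n. (%(x, y). indicator B x*(f y*kn n (y - x))) p) \<longlonglongrightarrow> (%(x, y). indicator B x*(f y*k (y - x))) p"
   using ne by eventually_elim (auto intro!: tendsto_intros lim)
  show "AE p in lborel \<Otimes>\<^sub>M lborel. norm ((%(x, y). indicator B x*(f y*kn n (y - x))) p) <= \<bar>?W p\<bar>" for n
   using ne
  proof eventually_elim
   fix p :: "(real^3) \<times> (real^3)" assume p: "snd p - fst p ~= 0"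
   obtain x y where [simp]: "p = (x, y)" by (cases p)
   have "\<bar>kn n (y - x)\<bar> <= \<bar>K (y - x)\<bar>" using bd[of "y - x" n] p by simp
   then show "norm ((%(x, y). indicator B x*(f y*kn n (y - x))) p) <= \<bar>?W p\<bar>"
    by (auto simp: indicator_def abs_mult intro: mult_left_mono)
  qed
  show "integrable (lborel \<Otimes>\<^sub>M lborel) (%p. \<bar>?W p\<bar>)" by (rule integrable_abs[OF W])
 qed measurable
qed

lemma pkd_scale:
 assumes "de > 0"
 shows "de^3*pkd de r (de *\<^sub>R w) = chi0 (de^2*(norm w)^2/r^2)*pk w"
proof -
 have "(norm (de *\<^sub>R w))^2 + de^2 = de^2*(1 + (norm w)^2)" by (simp add: power_mult_distrib algebra_simps)
 then have "mk (5/2) de (de *\<^sub>R w) = (de^2*(1 + (norm w)^2)) powr (- (5/2))" unfolding mk_def by presburger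
 also have "... = (de^2) powr (- (5/2))*(1 + (norm w)^2) powr (- (5/2))" by (rule powr_mult)
 also have "(de^2) powr (- (5/2)) = (de powr 2) powr (- (5/2))" using assms by (simp add: powr_numeral)
 also have "... = 1/de^5" using assms unfolding powr_powr by (simp add: powr_minus_divide powr_numeral)
 finally have m: "mk (5/2) de (de *\<^sub>R w) = 1/de^5*(1 + (norm w)^2) powr (-5/2)" by simp
 have d: "de^3*de^2*(1/de^5) = 1" using assms by (simp flip: power_add)
 have "de^3*pkd de r (de *\<^sub>R w) = (de^3*de^2*(1/de^5))*(chi0 (de^2*(norm w)^2/r^2)*pk w)"
  unfolding pkd_def m pk_def A0_def norm_scaleR power_mult_distrib by (simp only: power2_abs mult_ac)
 then show ?thesis unfolding d by simp
qed

text \<open>The substitution x = y - d w turns the integral into one of \<open>pk\<close> against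
  the indicator at y - d w and a cutoff tending to 1. On the frontier of the box the indicator may
  have no limit, so it is excluded here.\<close>

lemma pkd_mollify:
 fixes p q y :: "real^3"
 assumes r: "r > 0" and y: "y \<in> box p q \<or> y \<notin> cbox p q" and dl: "d \<longlonglongrightarrow> 0" "!!n. d n > 0"
 shows "(%n. \<integral>x. indicator (box p q) x*pkd (d n) r (y - x) \<partial>lborel) \<longlonglongrightarrow> cN*indicator (box p q) y"
proof -
 have eq: "(LBINT x. indicator (box p q) x*pkd (d n) r (y - x))
   = (LBINT w. indicator (box p q) (y - d n *\<^sub>R w)*(chi0 ((d n)^2*(norm w)^2/r^2)*pk w))" for n
 proof -
  have "(LBINT x. indicator (box p q) x*pkd (d n) r (y - x))
    = \<bar>- d n\<bar>^3*(LBINT w. indicator (box p q) (y + - d n *\<^sub>R w)*pkd (d n) r (y - (y + - d n *\<^sub>R w)))"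
   using dl(2)[of n] by (intro integral_affine3) auto
  also have "... = (LBINT w. d n^3*(indicator (box p q) (y - d n *\<^sub>R w)*pkd (d n) r (d n *\<^sub>R w)))"
   using dl(2)[of n] by simp
  also have "... = (LBINT w. indicator (box p q) (y - d n *\<^sub>R w)*(chi0 ((d n)^2*(norm w)^2/r^2)*pk w))"
   by (simp add: pkd_scale[OF dl(2), symmetric] mult.left_commute)
  finally show ?thesis .
 qed
 have "(%n. \<integral>w. indicator (box p q) (y - d n *\<^sub>R w)*(chi0 ((d n)^2*(norm w)^2/r^2)*pk w) \<partial>lborel)
   \<longlonglongrightarrow> (LBINT w. indicator (box p q) y*pk w)"
 proof (rule integral_dominated_convergence[where w="%w. BX*pk w"])
  show "AE w in lborel. (%n. indicator (box p q) (y - d n *\<^sub>R w)*(chi0 ((d n)^2*(norm w)^2/r^2)*pk w)) \<longlonglongrightarrow> indicator (box p q) y*pk w"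
  proof (rule AE_I2)
   fix w :: "real^3"
   have "(%n. y - d n *\<^sub>R w) \<longlonglongrightarrow> y - 0 *\<^sub>R w" by (intro tendsto_intros dl)
   then have l: "(%n. y - d n *\<^sub>R w) \<longlonglongrightarrow> y" by simp
   have "(%n. indicator (box p q) (y - d n *\<^sub>R w)) \<longlonglongrightarrow> (indicator (box p q) y :: real)"
    using y
   proof
    assume yb: "y \<in> box p q"
    have "\<forall>\<^sub>F n in sequentially. y - d n *\<^sub>R w \<in> box p q"
     by (rule topological_tendstoD[OF l open_box yb])
    then show ?thesis using yb by (intro tendsto_eventually) (auto elim!: eventually_mono)
   next
    assume yb: "y \<notin> cbox p q"
    have "\<forall>\<^sub>F n in sequentially. y - d n *\<^sub>R w \<in> - cbox p q"
     by (rule topological_tendstoD[OF l]) (use yb in auto)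
    then show ?thesis using yb box_subset_cbox[of p q] by (intro tendsto_eventually) (auto elim!: eventually_mono simp: indicator_def)
   qed
   moreover have "(%n. chi0 ((d n)^2*(norm w)^2/r^2)) \<longlonglongrightarrow> chi0 (0^2*(norm w)^2/r^2)"
    using r by (intro isCont_tendsto_compose[OF DERIV_isCont[OF chik_deriv]] tendsto_intros dl) auto
   ultimately have "(%n. indicator (box p q) (y - d n *\<^sub>R w)*(chi0 ((d n)^2*(norm w)^2/r^2)*pk w)) \<longlonglongrightarrow> indicator (box p q) y*(chi0 (0^2*(norm w)^2/r^2)*pk w)"
    by (intro tendsto_intros)
   then show "(%n. indicator (box p q) (y - d n *\<^sub>R w)*(chi0 ((d n)^2*(norm w)^2/r^2)*pk w)) \<longlonglongrightarrow> indicator (box p q) y*pk w"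
    by (simp add: chi0_0)
  qed
  show "AE w in lborel. norm (indicator (box p q) (y - d n *\<^sub>R w)*(chi0 ((d n)^2*(norm w)^2/r^2)*pk w)) <= BX*pk w" for n
  proof (rule AE_I2)
   fix w :: "real^3"
   have "\<bar>chi0 ((d n)^2*(norm w)^2/r^2)\<bar> <= BX" using r by (intro BX) auto
   then have "\<bar>chi0 ((d n)^2*(norm w)^2/r^2)\<bar>*pk w <= BX*pk w" using pk_pos[of w] by (intro mult_right_mono) auto
   moreover have "0 <= BX*pk w" using BX(1) pk_pos[of w] by simp
   ultimately show "norm (indicator (box p q) (y - d n *\<^sub>R w)*(chi0 ((d n)^2*(norm w)^2/r^2)*pk w)) <= BX*pk w"
    using pk_pos[of w] by (auto simp: indicator_def abs_mult)
  qed
 qed (use pk_integrable in auto)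
 then show ?thesis unfolding eq by (simp add: cN_def mult.commute)
qed

text \<open>After rescaling, the L1 norm of \<open>pkd\<close> is bounded independently of d; this
  dominates the outer integral when d tends to 0 in \<open>representation\<close>.\<close>

lemma pkd_conv_bound:
 assumes r: "r > 0" and d: "d > 0"
 shows "integrable lborel (pkd d r)" "\<bar>\<integral>x. indicator (box p q) x*pkd d r (y - x) \<partial>lborel\<bar> <= BX*cN"
proof -
 have b: "norm (pkd d r (d *\<^sub>R w)) <= norm (BX/d^3*pk w)" for w
 proof -
  have "\<bar>chi0 (d^2*(norm w)^2/r^2)\<bar> <= BX" using r by (intro BX) auto
  then have "\<bar>chi0 (d^2*(norm w)^2/r^2)*pk w\<bar> <= BX*pk w"
   using pk_pos[of w] by (auto simp: abs_mult intro!: mult_right_mono)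
  then have "d^3 * \<bar>pkd d r (d *\<^sub>R w)\<bar> <= BX*pk w"
   using pkd_scale[OF d, of r w] d by (metis abs_mult abs_of_pos zero_less_power)
  then show ?thesis using d BX(1) pk_pos[of w] by (simp add: abs_mult field_simps)
 qed
 have "integrable lborel (%w. pkd d r (0 + d *\<^sub>R w))"
  by (rule Bochner_Integration.integrable_bound[where f="%w. BX/d^3*pk w"])
    (use b pk_integrable in auto)
 from integrable_affine3[OF this, of "1/d" 0] show i: "integrable lborel (pkd d r)" using d by simp
 have "\<bar>\<integral>x. indicator (box p q) x*pkd d r (y - x) \<partial>lborel\<bar> <= (LBINT x. \<bar>pkd d r (y - x)\<bar>)"
 proof (rule integral_abs_bound[THEN order_trans], rule integral_mono_AE')
  show "AE x in lborel. \<bar>indicat_real (box p q) x*pkd d r (y - x)\<bar> <= \<bar>pkd d r (y - x)\<bar>"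
   by (auto simp: indicator_def)
 qed (use integrable_shift3(2)[OF i] in auto)
 also have "... = (LBINT x. \<bar>pkd d r x\<bar>)" by (rule integral_shift3(2)) auto
 also have "... = \<bar>d\<bar>^3*(LBINT w. \<bar>pkd d r (0 + d *\<^sub>R w)\<bar>)" using d by (intro integral_affine3) auto
 also have "... <= \<bar>d\<bar>^3*(LBINT w. BX/d^3*pk w)"
  using b BX(1) d pk_pos pk_integrable
  by (intro mult_left_mono integral_mono_AE') (auto simp: abs_mult less_imp_le intro!: mult_nonneg_nonneg)
 also have "... = BX*cN" using d by (simp add: cN_def)
 finally show "\<bar>\<integral>x. indicator (box p q) x*pkd d r (y - x) \<partial>lborel\<bar> <= BX*cN" .
qed

lemma AE_box_frontier: "AE y in lborel. y \<in> box p q \<or> y \<notin> cbox p (q::real^3)"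
proof -
 have "AE x in lborel. x \<notin> cbox p q - box p q"
  by (rule AE_not_in) (simp add: null_sets_def emeasure_lborel_cbox_eq emeasure_lborel_box_eq emeasure_Diff box_subset_cbox)
 then show ?thesis by (auto elim!: eventually_mono)
qed

lemma integral_diff_sum:
 fixes p q :: "real^3 => real" and g :: "3 => real^3 => real"
 assumes "integrable lborel p" "integrable lborel q" "!!j. integrable lborel (g j)"
 shows "integrable lborel (%x. p x - q x - (\<Sum>j\<in>UNIV. g j x))"
  "(LBINT x. p x - q x - (\<Sum>j\<in>UNIV. g j x)) = (LBINT x. p x) - (LBINT x. q x) - (\<Sum>j\<in>UNIV. \<integral>x. g j x \<partial>lborel)"
 using assms by simp_all

text \<open>The equation is tested with the kernel centred at x, whose support of radius r around a
  point of \<open>ball x0 r\<close> fits into the ball of radius 2*r; the result is integrated over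
  a box in x and de tends to 0. The terms \<open>G\<close> admit a right-hand side in divergence
  form, which is all that is known for a general H1 function.\<close>

lemma representation:
 fixes u F :: "real^3 => real" and G :: "3 => real^3 => real"
 assumes r: "r > 0" and u: "integrable lborel u" and F: "integrable lborel F" and G: "!!j. integrable lborel (G j)"
  and weak: "!!pt. test_fun (ball x0 (2*r)) pt ==> 
   (LBINT y. u y*laplacian pt y) = (LBINT y. F y*pt y) + (\<Sum>j\<in>UNIV. \<integral>y. G j y*pd j pt y \<partial>lborel)"
 shows "AE x in lborel. x \<in> ball x0 r --> cN*u x = (LBINT y. u y*kap 0 r (y - x))
   - (LBINT y. F y*Ker (A0 r) 0 (y - x)) - (\<Sum>j\<in>UNIV. \<integral>y. G j y*dKer (A0 r) (A0' r) 0 j (y - x) \<partial>lborel)"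
proof -
 define d where "d n = 1/(real n + 1)" for n
 have d: "d \<longlonglongrightarrow> 0" "!!n. d n > 0"
  using LIMSEQ_inverse_real_of_nat unfolding d_def by (simp_all add: inverse_eq_divide add.commute)
 have [measurable]: "u \<in> borel_measurable borel" using u by auto
 let ?K = "%de. Ker (A0 r) de" and ?D = "%de j. dKer (A0 r) (A0' r) de j"
 let ?rhs = "%de x. (LBINT y. u y*kap de r (y - x))
   - (LBINT y. F y*?K de (y - x)) - (\<Sum>j\<in>UNIV. \<integral>y. G j y*?D de j (y - x) \<partial>lborel)"
 have K1: "integrable lborel (%z. a*kb 1 r z)" "integrable lborel (%z. a*kb 2 r z)" for a
  using kb_integrable(1)[of 1 r] kb_integrable(1)[of 2 r] r by auto
 have bK: "\<bar>?K de z\<bar> <= BX*kb 1 r z" if "z ~= 0" for de z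
  by (rule Ker_bound) (use A0_bounds[OF r] A0_zero[OF r] r that in auto)
 have bD: "\<bar>?D de j z\<bar> <= 3*BX*kb 2 r z" if "z ~= 0" for de j z
  by (rule dKer_bound) (use A0_bounds[OF r] A0_zero[OF r] r that in auto)
 have lk: "(%n. kap (d n) r z) \<longlonglongrightarrow> kap 0 r z" if "z ~= 0" for z
  unfolding kap_def by (intro tendsto_intros mk_tendsto that d)
 have lK: "(%n. ?K (d n) z) \<longlonglongrightarrow> ?K 0 z" if "z ~= 0" for z
  unfolding Ker_def by (intro tendsto_intros mk_tendsto that d)
 have lD: "(%n. ?D (d n) j z) \<longlonglongrightarrow> ?D 0 j z" if "z ~= 0" for z j
  unfolding dKer_def by (intro tendsto_intros mk_tendsto that d)
 note cu = conv_lim[OF u K1(1), where kn="%n. kap (d n) r" and k="kap 0 r", OF _ _ lk kap_bound[OF r], simplified]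
 note cF = conv_lim[OF F K1(1), where kn="%n. ?K (d n)" and k="?K 0", OF _ _ lK bK, simplified]
 note cG = conv_lim[OF G K1(2), where kn="%n. ?D (d n) j" and k="?D 0 j" for j, OF _ _ lD bD, simplified]
 have id: "(LBINT y. u y * - pkd (d n) r (y - x)) = - ?rhs (d n) x" 
  if x: "x \<in> ball x0 r" and iu: "integrable lborel (%y. u y*kap (d n) r (y - x))" 
    "integrable lborel (%y. u y*pkd (d n) r (y - x))" for x n
 proof -
  have dn: "d n ~= 0" using d(2)[of n] by simp
  have "cball x r \<subseteq> ball x0 (2*r)"
  proof
   fix y assume "y \<in> cball x r"
   then show "y \<in> ball x0 (2*r)" using x dist_triangle[of x0 y x] by simp
  qed
  note w = weak[OF Ker_test_fun[OF dn r this]]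
  have pdd: "pd j (%y. ?K (d n) (y - x)) y = ?D (d n) j (y - x)" for j y
   by (rule has_pd_imp_pd[OF has_pd_Ker[OF dn A0_derivs(1)]])
  have "(LBINT y. u y*laplacian (%y. ?K (d n) (y - x)) y) = (LBINT y. u y*kap (d n) r (y - x) - u y*pkd (d n) r (y - x))"
   unfolding laplacian_Ker[OF dn] by (simp add: algebra_simps)
  also have "... = (LBINT y. u y*kap (d n) r (y - x)) - (LBINT y. u y*pkd (d n) r (y - x))"
   using iu by simp
  finally show ?thesis using w unfolding pdd by simp
 qed
 show ?thesis
 proof -
  have "AE x in lborel. x \<in> ball x0 r --> cN*u x - ?rhs 0 x = 0"
  proof (rule zero_on_boxes)
   fix p q :: "real^3" assume sub: "cbox p q \<subseteq> ball x0 r"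
   have iu: "integrable lborel (%x. indicator B x*u x)" if "B \<in> sets borel" for B
    using u that by (intro integrable_mult_indicator[where 'b=real, simplified]) auto
   have dist: "indicator B x*?rhs de x = indicator B x*(LBINT y. u y*kap de r (y - x))
   - indicator B x*(LBINT y. F y*?K de (y - x)) - (\<Sum>j\<in>UNIV. indicator B x*(LBINT y. G j y*?D de j (y - x)))" for B :: "(real^3) set" and x de
    by (simp add: right_diff_distrib sum_distrib_left)
   have irhs: "integrable lborel (%x. indicator B x*?rhs 0 x)" if "B \<in> sets borel" for B
    unfolding dist by (rule integral_diff_sum(1)[OF cu(2)[OF that] cF(2)[OF that] cG(2)[OF that]])
   have irhs_n: "integrable lborel (%x. indicator B x*?rhs (d n) x)" if "B \<in> sets borel" for B n
    unfolding dist by (rule integral_diff_sum(1)[OF cu(3)[OF that] cF(3)[OF that] cG(3)[OF that]])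
   show "integrable lborel (%x. indicator (cbox p q) x*(cN*u x - ?rhs 0 x))"
    using iu[of "cbox p q"] irhs[of "cbox p q"] by (simp add: right_diff_distrib mult.left_commute)
   let ?B = "box p q"
   have L: "(%n. \<integral>x. indicator ?B x*?rhs (d n) x \<partial>lborel) \<longlonglongrightarrow> (LBINT x. indicator ?B x*?rhs 0 x)"
   proof -
    have s: "(LBINT x. indicator ?B x*?rhs de x) = (\<integral>x. indicator ?B x*(LBINT y. u y*kap de r (y - x)) \<partial>lborel)
     - (\<integral>x. indicator ?B x*(LBINT y. F y*?K de (y - x)) \<partial>lborel) - (\<Sum>j\<in>UNIV. \<integral>x. indicator ?B x*(LBINT y. G j y*?D de j (y - x)) \<partial>lborel)"
     if "de = 0 \<or> (\<exists>n. de = d n)" for de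
     unfolding dist by (rule integral_diff_sum(2)) (use that cu(2,3)[of ?B] cF(2,3)[of ?B] cG(2,3)[of ?B] in auto)
    have s1: "!!n. d n = 0 \<or> (\<exists>k. d n = d k)" "0 = 0 \<or> (\<exists>k. 0 = d k)" by blast+
    show ?thesis unfolding s[OF s1(1)] s[OF s1(2)]
     by (intro tendsto_intros cu(1) cF(1) cG(1)) auto
   qed
   have eq: "(LBINT x. indicator ?B x*?rhs (d n) x) = (\<integral>y. u y*(LBINT x. indicator ?B x*pkd (d n) r (y - x)) \<partial>lborel)" for n
   proof -
    have ii: "integrable (lborel \<Otimes>\<^sub>M lborel) (%(x, y). indicator ?B x*(u y*pkd (d n) r (y - x)))"
    proof (rule Bochner_Integration.integrable_bound[OF conv_pair_integrable(1)[OF u pkd_conv_bound(1)[OF r d(2)[of n]]]])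
     show "(%(x, y). indicator ?B x*(u y*pkd (d n) r (y - x))) \<in> borel_measurable (lborel \<Otimes>\<^sub>M lborel)" by measurable
    qed (auto simp: indicator_def)
    have kn: "integrable lborel (kap (d n) r)"
     by (rule integrable_bound_ne0[OF K1(1) kap_measurable kap_bound[OF r]])
    have "AE x in lborel. integrable lborel (%y. u y*kap (d n) r (y - x))"
     using lborel_pair.AE_integrable_fst'[OF conv_pair_integrable(1)[OF u kn]] by simp
    moreover have "AE x in lborel. integrable lborel (%y. u y*pkd (d n) r (y - x))"
     using lborel_pair.AE_integrable_fst'[OF conv_pair_integrable(1)[OF u pkd_conv_bound(1)[OF r d(2)[of n]]]] by simp
    ultimately have ae: "AE x in lborel. indicator ?B x*?rhs (d n) x = (LBINT y. indicator ?B x*(u y*pkd (d n) r (y - x)))"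
    proof eventually_elim
     case (elim x)
     show ?case
     proof (cases "x \<in> ?B")
      case True
      then have "x \<in> ball x0 r" using sub box_subset_cbox by blast
      from id[OF this elim] True show ?thesis by simp
     qed simp
    qed
    have "(LBINT x. indicator ?B x*?rhs (d n) x) = (\<integral>x. (LBINT y. indicator ?B x*(u y*pkd (d n) r (y - x))) \<partial>lborel)"
     using irhs_n[of ?B n] lborel_pair.integrable_fst'[OF ii] by (intro integral_cong_AE ae) auto
    also have "... = (\<integral>y. (LBINT x. indicator ?B x*(u y*pkd (d n) r (y - x))) \<partial>lborel)"
     using lborel_pair.Fubini_integral[OF ii] by simp
    also have "... = (\<integral>y. u y*(LBINT x. indicator ?B x*pkd (d n) r (y - x)) \<partial>lborel)"
     by (simp add: mult.left_commute[of _ "u _"])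
    finally show ?thesis .
   qed
   have "(%n. \<integral>y. u y*(LBINT x. indicator ?B x*pkd (d n) r (y - x)) \<partial>lborel) \<longlonglongrightarrow> (LBINT y. u y*(cN*indicator ?B y))"
   proof (rule integral_dominated_convergence[where w="%y. \<bar>u y\<bar>*(BX*cN)"])
    show "AE y in lborel. (%n. u y*(LBINT x. indicator ?B x*pkd (d n) r (y - x))) \<longlonglongrightarrow> u y*(cN*indicator ?B y)"
     using AE_box_frontier[of p q] by eventually_elim (intro tendsto_intros pkd_mollify[OF r _ d])
    show "AE y in lborel. norm (u y*(LBINT x. indicator ?B x*pkd (d n) r (y - x))) <= \<bar>u y\<bar>*(BX*cN)" for n
     using pkd_conv_bound(2)[OF r d(2)] by (auto simp: abs_mult intro!: mult_left_mono)
   qed (use u in auto)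
   from LIMSEQ_unique[OF this L[unfolded eq]]
   have "(LBINT y. u y*(cN*indicator ?B y)) = (LBINT x. indicator ?B x*?rhs 0 x)" .
   moreover have "(LBINT x. indicator ?B x*(cN*u x - ?rhs 0 x)) = (LBINT y. u y*(cN*indicator ?B y)) - (LBINT x. indicator ?B x*?rhs 0 x)"
    using iu[of ?B] irhs[of ?B] by (simp add: right_diff_distrib mult.left_commute mult.commute[of "indicator _ _"])
   ultimately show "(LBINT x. indicator ?B x*(cN*u x - ?rhs 0 x)) = 0" by simp
  qed simp
  then show ?thesis by eventually_elim auto
 qed
qed

section \<open>Interior gradient estimates\<close>

definition cv :: "(real^3 => real) => (real^3 => real) => real^3 => real" where
 "cv k f x = (LBINT y. f y*k (y - x))"

definition wlap :: "(real^3) set => (real^3 => real) => (real^3 => real) => bool" where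
 "wlap S u F \<longleftrightarrow> (\<forall>pt. test_fun S pt --> (LBINT y. u y*laplacian pt y) = (LBINT y. F y*pt y))"

lemma has_pd_lipschitz:
 assumes "!!s. s \<in> closed_segment 0 t ==> has_pd k j (sh x s j) (k' (sh x s j))"
  and "!!s. s \<in> closed_segment 0 t ==> \<bar>k' (sh x s j)\<bar> <= C"
 shows "\<bar>k (sh x t j) - k x\<bar> <= C * \<bar>t\<bar>"
proof -
 have "norm (k (sh x t j) - k (sh x 0 j)) <= C*norm (t - 0)"
 proof (rule field_differentiable_bound[of "closed_segment 0 t" "%s. k (sh x s j)" "%s. k' (sh x s j)"])
  fix s assume s: "s \<in> closed_segment 0 t"
  show "((%s. k (sh x s j)) has_real_derivative k' (sh x s j)) (at s within closed_segment 0 t)"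
   using assms(1)[OF s] unfolding has_pd_line by (rule has_field_derivative_at_within)
  show "norm (k' (sh x s j)) <= C" using assms(2)[OF s] by simp
 qed auto
 then show ?thesis by simp
qed

lemma integrable_bounded_mult:
 fixes f k :: "real^3 => real"
 assumes "f \<in> borel_measurable borel" "!!y. \<bar>f y\<bar> <= B" "integrable lborel k"
 shows "integrable lborel (%y. f y*k (y - x))"
proof (rule Bochner_Integration.integrable_bound[where f="%y. B*k (y - x)"])
 show "integrable lborel (%y. B*k (y - x))" using integrable_shift3(1)[OF assms(3)] by simp
 have [measurable]: "k \<in> borel_measurable borel" using assms by auto
 show "(%y. f y*k (y - x)) \<in> borel_measurable lborel" using assms(1) by measurable
 have "B >= 0" using assms(2)[of 0] by linarith
 then show "AE y in lborel. norm (f y*k (y - x)) <= norm (B*k (y - x))"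
  using assms(2) by (auto simp: abs_mult intro!: mult_right_mono)
qed

lemma cv_bound:
 assumes f: "f \<in> borel_measurable borel" "!!y. \<bar>f y\<bar> <= B" and k: "integrable lborel k"
 shows "\<bar>cv k f x\<bar> <= B*(LBINT z. \<bar>k z\<bar>)"
proof -
 have [measurable]: "k \<in> borel_measurable borel" using k by auto
 have B: "B >= 0" using f(2)[of 0] by linarith
 have "\<bar>cv k f x\<bar> <= (LBINT y. \<bar>f y*k (y - x)\<bar>)" unfolding cv_def by (rule integral_abs_bound)
 also have "... <= (LBINT y. B * \<bar>k (y - x)\<bar>)"
 proof (rule integral_mono)
  show "integrable lborel (%y. \<bar>f y*k (y - x)\<bar>)" by (rule integrable_abs[OF integrable_bounded_mult[OF f k]])
  show "integrable lborel (%y. B * \<bar>k (y - x)\<bar>)" using integrable_shift3(1)[OF k, of x] by simp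
  show "\<bar>f y*k (y - x)\<bar> <= B * \<bar>k (y - x)\<bar>" for y using f(2)[of y] by (simp add: abs_mult mult_right_mono)
 qed
 also have "... = B*(LBINT z. \<bar>k z\<bar>)" using integral_shift3(1)[of "%z. \<bar>k z\<bar>" x] by simp
 finally show ?thesis .
qed

lemma compact_support_bounded:
 fixes k :: "real^3 => real"
 assumes "continuous_on UNIV k" "!!z. norm z > r ==> k z = 0"
 shows "\<exists>C\<ge>0. \<forall>z. \<bar>k z\<bar> <= C"
proof -
 have "compact (k ` cball 0 r)" using assms by (intro compact_continuous_image continuous_on_subset[OF assms(1)]) auto
 then obtain C where C: "!!y. y \<in> k ` cball 0 r ==> norm y <= C" by (meson compact_imp_bounded bounded_iff)
 have "\<bar>k z\<bar> <= max 0 C" for z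
 proof (cases "norm z <= r")
  case True
  then have "norm (k z) <= C" by (intro C) auto
  then show ?thesis by simp
 qed (simp add: assms)
 then show ?thesis by (intro exI[of _ "max 0 C"]) auto
qed

lemma integrable_cball_indicator: "integrable lborel (%y::real^3. C*indicator (cball x r) y :: real)"
 by (intro integrable_mult_right integrable_real_indicator emeasure_lborel_cball_finite) auto

lemma cv_continuous:
 fixes f k :: "real^3 => real"
 assumes f [measurable]: "f \<in> borel_measurable borel" and fB: "!!y. \<bar>f y\<bar> <= B"
  and k: "continuous_on UNIV k" "!!z. norm z > r ==> k z = 0"
 shows "continuous_on UNIV (cv k f)"
proof -
 obtain C where C: "C >= 0" "!!z. \<bar>k z\<bar> <= C" using compact_support_bounded[OF k] by blast
 have [measurable]: "k \<in> borel_measurable borel" using k by (intro borel_measurable_continuous_onI)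
 have B: "B >= 0" using fB[of 0] by linarith
 show ?thesis unfolding continuous_on_sequentially
 proof (intro allI ballI impI, elim conjE)
  fix X :: "nat => real^3" and x assume X: "X \<longlonglongrightarrow> x"
  then obtain rh where rh: "!!n. norm (X n - x) <= rh" 
   using convergent_imp_Bseq[of "%n. X n - x"] by (metis Bseq_def convergentI LIM_zero)
  have "(%n. \<integral>y. f y*k (y - X n) \<partial>lborel) \<longlonglongrightarrow> (LBINT y. f y*k (y - x))"
  proof (rule integral_dominated_convergence[where w="%y. (B*C)*indicator (cball x (r + rh)) y"])
   show "AE y in lborel. (%n. f y*k (y - X n)) \<longlonglongrightarrow> f y*k (y - x)"
    using k(1) X by (intro AE_I2 tendsto_intros isCont_tendsto_compose[where g=k]) (auto simp: continuous_on_eq_continuous_at)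
   show "AE y in lborel. norm (f y*k (y - X n)) <= B*C*indicator (cball x (r + rh)) y" for n
   proof (rule AE_I2)
    fix y
    show "norm (f y*k (y - X n)) <= B*C*indicator (cball x (r + rh)) y"
    proof (cases "y \<in> cball x (r + rh)")
     case True
     then show ?thesis using fB[of y] C(2)[of "y - X n"] B C(1) by (simp add: abs_mult mult_mono)
    next
     case False
     have "norm (y - x) <= norm (y - X n) + norm (X n - x)" using norm_triangle_ineq[of "y - X n" "X n - x"] by simp
     then have "norm (y - X n) > r" using False rh[of n] by (simp add: dist_norm norm_minus_commute)
     then show ?thesis using k(2) B C(1) by simp
    qed
   qed
  qed (measurable, rule integrable_cball_indicator)
  then show "(cv k f \<circ> X) \<longlonglongrightarrow> cv k f x" by (simp add: cv_def comp_def)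
 qed
qed

lemma cv_has_pd:
 fixes f k :: "real^3 => real"
 assumes f [measurable]: "f \<in> borel_measurable borel" and fB: "!!y. \<bar>f y\<bar> <= B"
  and k: "continuous_on UNIV k" "!!z. norm z > r ==> k z = 0"
  and k': "continuous_on UNIV k'" "!!z. norm z > r ==> k' z = 0"
  and D: "!!z. has_pd k j z (k' z)"
 shows "has_pd (cv k f) j x (- cv k' f x)"
proof -
 obtain C where C: "C >= 0" "!!z. \<bar>k' z\<bar> <= C" using compact_support_bounded[OF k'] by blast
 have [measurable]: "k \<in> borel_measurable borel" "k' \<in> borel_measurable borel" using k k' by (auto intro: borel_measurable_continuous_onI)
 have B: "B >= 0" using fB[of 0] by linarith
 obtain C0 where C0: "!!z. \<bar>k z\<bar> <= C0" using compact_support_bounded[OF k] by blast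
 have ki: "integrable lborel k"
 proof (rule Bochner_Integration.integrable_bound[OF integrable_cball_indicator[of C0 0 r]])
  show "AE z in lborel. norm (k z) <= norm (C0*indicator (cball 0 r) z)"
  proof (rule AE_I2)
   fix z show "norm (k z) <= norm (C0*indicator (cball 0 r) z)"
    using C0[of z] k(2)[of z] by (cases "norm z <= r") auto
  qed
 qed auto
 have int: "integrable lborel (%y. f y*k (y - x))" for x by (rule integrable_bounded_mult[OF f fB ki])
 have "((%t. (cv k f (sh x t j) - cv k f x)/t) \<longlongrightarrow> - cv k' f x) (at 0)"
  unfolding tendsto_at_iff_sequentially
 proof (intro allI impI)
  fix X :: "nat => real" assume X0: "\<forall>i. X i \<in> UNIV - {0}" and X: "X \<longlonglongrightarrow> 0"
  then obtain rh where rh: "!!n. \<bar>X n\<bar> <= rh" 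
   using convergent_imp_Bseq[of X] by (metis Bseq_def convergentI real_norm_def)
  have eq: "(cv k f (x + X n *\<^sub>R ax j) - cv k f x)/X n = (LBINT y. f y*((k (y - x + (- X n) *\<^sub>R ax j) - k (y - x))/X n))" for n
  proof -
   have "cv k f (x + X n *\<^sub>R ax j) - cv k f x = (LBINT y. f y*k (y - (x + X n *\<^sub>R ax j)) - f y*k (y - x))"
    unfolding cv_def using int by simp
   also have "... = (LBINT y. f y*(k (y - x + (- X n) *\<^sub>R ax j) - k (y - x)))"
    by (simp add: algebra_simps)
   finally show ?thesis by simp
  qed
  have "(%n. \<integral>y. f y*((k (y - x + (- X n) *\<^sub>R ax j) - k (y - x))/X n) \<partial>lborel) \<longlonglongrightarrow> (LBINT y. f y*(- k' (y - x)))"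
  proof (rule integral_dominated_convergence[where w="%y. (B*C)*indicator (cball x (r + rh)) y"])
   show "AE y in lborel. (%n. f y*((k (y - x + (- X n) *\<^sub>R ax j) - k (y - x))/X n)) \<longlonglongrightarrow> f y*(- k' (y - x))"
   proof (rule AE_I2)
    fix y
    have "((%t. (k (y - x + t *\<^sub>R ax j) - k (y - x))/t) \<longlongrightarrow> k' (y - x)) (at 0)"
     using D[of "y - x"] unfolding has_pd_def DERIV_def by simp
    moreover have "filterlim (%n. - X n) (at 0) sequentially"
     using tendsto_minus[OF X] X0 by (auto simp: filterlim_at)
    ultimately have "(%n. (k (y - x + (- X n) *\<^sub>R ax j) - k (y - x))/(- X n)) \<longlonglongrightarrow> k' (y - x)"
     by (rule filterlim_compose)
    from tendsto_mult[OF tendsto_const tendsto_minus[OF this]]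
    show "(%n. f y*((k (y - x + (- X n) *\<^sub>R ax j) - k (y - x))/X n)) \<longlonglongrightarrow> f y*(- k' (y - x))" by simp
   qed
   show "AE y in lborel. norm (f y*((k (y - x + (- X n) *\<^sub>R ax j) - k (y - x))/X n)) <= B*C*indicator (cball x (r + rh)) y" for n
   proof (rule AE_I2)
    fix y
    show "norm (f y*((k (y - x + (- X n) *\<^sub>R ax j) - k (y - x))/X n)) <= B*C*indicator (cball x (r + rh)) y"
    proof (cases "y \<in> cball x (r + rh)")
     case True
     have "\<bar>k (y - x + (- X n) *\<^sub>R ax j) - k (y - x)\<bar> <= C * \<bar>- X n\<bar>"
      by (rule has_pd_lipschitz[where k'=k']) (use D C in auto)
     then have "\<bar>(k (y - x + (- X n) *\<^sub>R ax j) - k (y - x))/X n\<bar> <= C"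
      using X0 by (simp add: abs_divide divide_le_eq)
     then have "\<bar>f y\<bar> * \<bar>(k (y - x + (- X n) *\<^sub>R ax j) - k (y - x))/X n\<bar> <= B*C"
      using fB[of y] B C(1) by (intro mult_mono) auto
     then show ?thesis using True unfolding real_norm_def abs_mult[of "f y"] by simp
    next
     case False
     have n1: "norm (y - x) > r + rh" using False by (simp add: dist_norm norm_minus_commute)
     have "rh >= 0" using rh[of 0] by linarith
     then have z1: "k (y - x) = 0" using n1 by (intro k) linarith
     have "norm (y - x) - norm (X n *\<^sub>R ax j) <= norm (y - x - X n *\<^sub>R ax j)" by (rule norm_triangle_ineq2)
     then have "norm (y - x - X n *\<^sub>R ax j) > r" using n1 rh[of n] by simp
     then have "k (y - x + (- X n) *\<^sub>R ax j) = 0" using k(2) by simp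
     then show ?thesis using z1 B C(1) by simp
    qed
   qed
  qed (measurable, rule integrable_cball_indicator)
  then show "((%t. (cv k f (sh x t j) - cv k f x)/t) \<circ> X) \<longlonglongrightarrow> - cv k' f x"
   unfolding comp_def eq by (simp add: cv_def)
 qed
 then show ?thesis unfolding has_pd_def DERIV_def by simp
qed

lemma mk_continuous: "de ~= 0 ==> continuous_on UNIV (mk a de)"
 unfolding mk_def by (intro continuous_intros) (auto simp: add_nonneg_eq_0_iff)

text \<open>The regularised kernels and their derivatives converge in L1, so their convolutions with
  a bounded f converge uniformly, and a uniform limit of derivatives is the derivative of the limit.
  The constant 648 is 3 times 216, from \<open>dKer_bound\<close> and
  \<open>kb2_integral\<close>.\<close>

lemma cv_C1:
 fixes f :: "real^3 => real"
 assumes f [measurable]: "f \<in> borel_measurable borel" and fB: "!!y. \<bar>f y\<bar> <= B" and r: "r > 0"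
  and A: "!!s. s >= 0 ==> \<bar>A s\<bar> <= a" "!!s. s >= r^2 ==> A s = 0"
  "!!s. s >= 0 ==> s * \<bar>A' s\<bar> <= a" "!!s. s >= r^2 ==> A' s = 0"
  and D: "!!s. (A has_real_derivative A' s) (at s)" "continuous_on UNIV A'"
 shows "has_pd (cv (Ker A 0) f) j x (- cv (dKer A A' 0 j) f x)"
  "continuous_on UNIV (cv (Ker A 0) f)" "continuous_on UNIV (cv (dKer A A' 0 j) f)"
  "\<bar>cv (dKer A A' 0 j) f x\<bar> <= 648*a*B*r"
proof -
 define d where "d n = 1/(real n + 1)" for n
 have d: "d \<longlonglongrightarrow> 0" "!!n. d n ~= 0"
  using LIMSEQ_inverse_real_of_nat unfolding d_def by (simp_all add: inverse_eq_divide add.commute)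
 have Ac: "continuous_on UNIV A" using D(1) by (auto intro!: continuous_at_imp_continuous_on intro: DERIV_isCont)
 have [measurable]: "A \<in> borel_measurable borel" "A' \<in> borel_measurable borel"
  using Ac D(2) by (auto intro: borel_measurable_continuous_onI)
 have B: "B >= 0" using fB[of 0] by linarith
 have a: "a >= 0" using A(1)[of 0] by linarith
 have kc: "continuous_on UNIV (Ker A (d n))" "continuous_on UNIV (dKer A A' (d n) j)" for n
  unfolding Ker_def dKer_def
  by (intro continuous_intros mk_continuous[OF d(2)] continuous_on_compose2[OF Ac] continuous_on_compose2[OF D(2)]; simp)+
 have kz: "Ker A de z = 0" "dKer A A' de j z = 0" if "norm z > r" for z de
  using that A(2,4) normsq_ge[OF that r] by (auto simp: Ker_def dKer_def)
 have bk: "\<bar>Ker A de z\<bar> <= a*kb 1 r z" if "z ~= 0" for de z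
  by (rule Ker_bound) (use A r that in auto)
 have bd: "\<bar>dKer A A' de j z\<bar> <= 3*a*kb 2 r z" if "z ~= 0" for de z
  by (rule dKer_bound) (use A r that in auto)
 have Ki: "integrable lborel (%z. b*kb 1 r z)" "integrable lborel (%z. b*kb 2 r z)" for b
  using kb_integrable(1)[of 1 r] kb_integrable(1)[of 2 r] r by auto
 have ik: "integrable lborel (Ker A de)" for de
  by (rule integrable_bound_ne0[OF Ki(1) _ bk]) auto
 have id: "integrable lborel (dKer A A' de j)" for de
  by (rule integrable_bound_ne0[OF Ki(2) _ bd]) auto
 have lim0: "(%n. \<integral>z. \<bar>k (d n) z - k 0 z\<bar> \<partial>lborel) \<longlonglongrightarrow> 0"
  if [measurable]: "!!de. k de \<in> borel_measurable borel" and K: "integrable lborel K" 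
   and b: "!!de z. z ~= 0 ==> \<bar>k de z\<bar> <= K z" and l: "!!z. z ~= 0 ==> (%n. k (d n) z) \<longlonglongrightarrow> k 0 z" for k :: "real => real^3 => real" and K
 proof -
  have "(%n. \<integral>z. \<bar>k (d n) z - k 0 z\<bar> \<partial>lborel) \<longlonglongrightarrow> (\<integral>(z::real^3). 0 \<partial>lborel)"
  proof (rule integral_dominated_convergence[where w="%z. 2*K z"])
   show "AE z in lborel. (%n. \<bar>k (d n) z - k 0 z\<bar>) \<longlonglongrightarrow> 0"
    using AE_lborel_singleton[of 0]
   proof eventually_elim
    case (elim z)
    have "(%n. \<bar>k (d n) z - k 0 z\<bar>) \<longlonglongrightarrow> \<bar>k 0 z - k 0 z\<bar>" by (intro tendsto_intros l elim)
    then show ?case by simp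
   qed
   show "AE z in lborel. norm \<bar>k (d n) z - k 0 z\<bar> <= 2*K z" for n
    using AE_lborel_singleton[of 0]
   proof eventually_elim
    case (elim z)
    show ?case using b[OF elim, of "d n"] b[OF elim, of 0] by simp
   qed
  qed (use K in auto)
  then show ?thesis by simp
 qed
 have unif: "\<bar>cv (k1) f x - cv k0 f x\<bar> <= B*(LBINT z. \<bar>k1 z - k0 z\<bar>)"
  if "integrable lborel k1" "integrable lborel k0" for k1 k0 x
 proof -
  have "cv k1 f x - cv k0 f x = cv (%z. k1 z - k0 z) f x"
   unfolding cv_def using integrable_bounded_mult[OF f fB that(1), of x] integrable_bounded_mult[OF f fB that(2), of x]
   by (simp add: right_diff_distrib)
  then show ?thesis using cv_bound[OF f fB, of "%z. k1 z - k0 z" x] that by simp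
 qed
 have lk: "(%n. B*(LBINT z. \<bar>Ker A (d n) z - Ker A 0 z\<bar>)) \<longlonglongrightarrow> B*0"
  by (intro tendsto_intros lim0[OF _ Ki(1) bk]) (auto simp: Ker_def intro!: tendsto_intros mk_tendsto d)
 have ld: "(%n. B*(LBINT z. \<bar>dKer A A' (d n) j z - dKer A A' 0 j z\<bar>)) \<longlonglongrightarrow> B*0"
  by (intro tendsto_intros lim0[OF _ Ki(2) bd]) (auto simp: dKer_def intro!: tendsto_intros mk_tendsto d)
 have ul: "uniform_limit UNIV (%n. cv (k (d n)) f) (cv (k 0) f) sequentially"
  if i: "!!de. integrable lborel (k de)" and l: "(%n. B*(LBINT z. \<bar>k (d n) z - k 0 z\<bar>)) \<longlonglongrightarrow> B*0" for k
  unfolding uniform_limit_iff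
 proof (intro allI impI)
  fix e :: real assume "e > 0"
  from order_tendstoD(2)[OF l[simplified] this]
  show "\<forall>\<^sub>F n in sequentially. \<forall>x\<in>UNIV. dist (cv (k (d n)) f x) (cv (k 0) f x) < e"
   by eventually_elim (use unif[OF i i] in \<open>auto simp: dist_real_def intro: le_less_trans\<close>)
 qed
 note ulk = ul[of "Ker A", OF ik lk] and uld = ul[of "%de. dKer A A' de j", OF id ld]
 show "continuous_on UNIV (cv (Ker A 0) f)"
  by (rule uniform_limit_theorem[OF _ ulk]) (auto intro!: always_eventually cv_continuous[OF f fB kc(1)] kz)
 show "continuous_on UNIV (cv (dKer A A' 0 j) f)"
  by (rule uniform_limit_theorem[OF _ uld]) (auto intro!: always_eventually cv_continuous[OF f fB kc(2)] kz)
 have pn: "has_pd (cv (Ker A (d n)) f) j x (- cv (dKer A A' (d n) j) f x)" for n x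
  by (rule cv_has_pd[OF f fB kc(1) _ kc(2)]) (use kz has_pd_Ker[OF d(2)[of n] D(1), of 0] in auto)
 have "\<exists>g. \<forall>t\<in>UNIV. (%n. cv (Ker A (d n)) f (sh x t j)) \<longlonglongrightarrow> g t & (g has_derivative (%h. - cv (dKer A A' 0 j) f (sh x t j)*h)) (at t within UNIV)"
 proof (rule has_derivative_sequence[where f'="%n t h. - cv (dKer A A' (d n) j) f (sh x t j)*h"])
  show "((%t. cv (Ker A (d n)) f (sh x t j)) has_derivative (*) (- cv (dKer A A' (d n) j) f (sh x t j))) (at t within UNIV)" for n t
   using pn[of n "sh x t j"] unfolding has_pd_line has_field_derivative_def by simp
  show "\<forall>\<^sub>F n in sequentially. \<forall>t\<in>UNIV. \<forall>h. norm (- cv (dKer A A' (d n) j) f (sh x t j)*h - - cv (dKer A A' 0 j) f (sh x t j)*h) <= e*norm h"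
   if "e > 0" for e
   using order_tendstoD(2)[OF ld[simplified] that]
  proof eventually_elim
   case (elim n)
   show ?case
   proof (intro ballI allI)
    fix t h :: real
    have "\<bar>cv (dKer A A' (d n) j) f (sh x t j) - cv (dKer A A' 0 j) f (sh x t j)\<bar> <= e"
     using unif[OF id id, of "d n" "sh x t j" 0] elim by simp
    then show "norm (- cv (dKer A A' (d n) j) f (sh x t j)*h - - cv (dKer A A' 0 j) f (sh x t j)*h) <= e*norm h"
     by (simp add: abs_mult[symmetric] left_diff_distrib[symmetric] abs_minus_commute flip: left_diff_distrib)
       (simp add: abs_mult mult_right_mono abs_minus_commute)
   qed
  qed
  show "(%n. cv (Ker A (d n)) f (sh x 0 j)) \<longlonglongrightarrow> cv (Ker A 0) f (sh x 0 j)"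
   by (rule tendsto_uniform_limitI[OF ulk]) simp
 qed auto
 then obtain g where g: "!!t. (%n. cv (Ker A (d n)) f (sh x t j)) \<longlonglongrightarrow> g t" 
  "!!t. (g has_derivative (%h. - cv (dKer A A' 0 j) f (sh x t j)*h)) (at t)" by auto
 have "g t = cv (Ker A 0) f (sh x t j)" for t
  using LIMSEQ_unique[OF g(1) tendsto_uniform_limitI[OF ulk, of "sh x t j"]] by simp
 then have "g = (%t. cv (Ker A 0) f (sh x t j))" by blast
 then show "has_pd (cv (Ker A 0) f) j x (- cv (dKer A A' 0 j) f x)"
  using g(2)[of 0] unfolding has_pd_def has_field_derivative_def by (metis (no_types, lifting) add.right_neutral has_derivative_eq_rhs scaleR_zero_left)
 have "(LBINT z. \<bar>dKer A A' 0 j z\<bar>) <= (LBINT z. 3*a*kb 2 r z)"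
 proof (rule integral_mono_AE)
  show "AE z in lborel. \<bar>dKer A A' 0 j z\<bar> <= 3*a*kb 2 r z"
   using AE_lborel_singleton[of 0] by eventually_elim (rule bd)
 qed (use id Ki in auto)
 also have "... <= 3*a*(216*r)" using mult_left_mono[OF kb2_integral[OF r], of "3*a"] a by simp
 finally have "B*(LBINT z. \<bar>dKer A A' 0 j z\<bar>) <= B*(3*a*(216*r))" using B by (intro mult_left_mono)
 then show "\<bar>cv (dKer A A' 0 j) f x\<bar> <= 648*a*B*r"
  using cv_bound[OF f fB id[of 0], where x = x] by (simp add: mult_ac)
qed

text \<open>6480 is 10 times 648: the 10 is the bound of \<open>A1\<close> and \<open>A1'\<close> in
  \<open>A0_bounds\<close>, and 648 comes from \<open>cv_C1\<close>.\<close>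

definition CG :: real where "CG = 6480*BX/cN"

lemma CG_pos: "CG > 0" unfolding CG_def using BX(1) cN_pos by simp

lemma laplacian_zero_outside:
 assumes "test_fun S pt" "x \<notin> S" shows "laplacian pt x = 0" "pt x = 0" "pd j pt x = 0"
proof -
 have *: "f x = 0" if "test_fun S f" for f
  using that assms(2) closure_subset[of "{x. f x ~= 0}"] unfolding test_fun_def by blast
 show "pt x = 0" "pd j pt x = 0" using*test_fun_pd assms by blast+
 show "laplacian pt x = 0" unfolding laplacian_def using *[OF test_fun_pd[OF test_fun_pd[OF assms(1)]]] by simp
qed

text \<open>With u and F cut off to the ball, the representation formula writes u on the half ball
  through convolutions of bounded functions with the \<open>A1\<close> and \<open>A0\<close>
  kernels. The \<open>A1\<close> kernel carries a factor 1/r^2 and differentiated kernels integrate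
  to O(r), whence Bu/r and BF*r.\<close>

lemma interior_gradient:
 fixes u F :: "real^3 => real"
 assumes r: "r > 0" and u [measurable]: "u \<in> borel_measurable borel" and F [measurable]: "F \<in> borel_measurable borel"
  and Bu: "!!y. y \<in> ball x0 (2*r) ==> \<bar>u y\<bar> <= Bu" and BF: "!!y. y \<in> ball x0 (2*r) ==> \<bar>F y\<bar> <= BF"
  and weak: "wlap (ball x0 (2*r)) u F"
 shows "\<exists>v v'. (\<forall>x j. has_pd v j x (v' j x)) & continuous_on UNIV v & (\<forall>j. continuous_on UNIV (v' j))
   & (\<forall>x j. \<bar>v' j x\<bar> <= CG*(BF*r + Bu/r)) & (AE x in lborel. x \<in> ball x0 r --> u x = v x)"
proof -
 let ?b = "indicator (ball x0 (2*r)) :: real^3 => real"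
 define uu where "uu y = ?b y*u y" for y
 define FF where "FF y = ?b y*F y" for y
 have m [measurable]: "uu \<in> borel_measurable borel" "FF \<in> borel_measurable borel"
  unfolding uu_def FF_def by (intro borel_measurable_times borel_measurable_indicator u F; simp)+
 have x0: "x0 \<in> ball x0 (2*r)" using r by simp
 have B0: "Bu >= 0" "BF >= 0" using Bu[OF x0] BF[OF x0] by linarith+
 have b: "\<bar>uu y\<bar> <= Bu" "\<bar>FF y\<bar> <= BF" for y
  unfolding uu_def FF_def using Bu[of y] BF[of y] B0 by (auto simp: indicator_def)
 have int: "integrable lborel f" if "!!y. \<bar>f y\<bar> <= C" "!!y. y \<notin> ball x0 (2*r) ==> f y = 0" "f \<in> borel_measurable borel" for f and C :: real
 proof (rule Bochner_Integration.integrable_bound[OF integrable_cball_indicator[of C x0 "2*r"]])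
  show "AE z in lborel. norm (f z) <= norm (C*indicator (cball x0 (2*r)) z)"
  proof (rule AE_I2)
   fix z show "norm (f z) <= norm (C*indicator (cball x0 (2*r)) z)"
    using that(1)[of z] that(2)[of z] by (cases "z \<in> ball x0 (2*r)") auto
  qed
 qed (use that in auto)
 have rep: "AE x in lborel. x \<in> ball x0 r --> cN*uu x = (LBINT y. uu y*kap 0 r (y - x))
   - (LBINT y. FF y*Ker (A0 r) 0 (y - x)) - (\<Sum>j\<in>UNIV. \<integral>y. (%_ _. 0) j y*dKer (A0 r) (A0' r) 0 j (y - x) \<partial>lborel)"
 proof (rule representation[OF r])
  show "integrable lborel uu" by (rule int[OF b(1) _ m(1)]) (simp add: uu_def)
  show "integrable lborel FF" by (rule int[OF b(2) _ m(2)]) (simp add: FF_def)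
  fix pt assume t: "test_fun (ball x0 (2*r)) pt"
  have "(%y. uu y*laplacian pt y) = (%y. u y*laplacian pt y)" "(%y. FF y*pt y) = (%y. F y*pt y)"
   using laplacian_zero_outside[OF t] by (auto simp: uu_def FF_def indicator_def fun_eq_iff)
  then show "(LBINT y. uu y*laplacian pt y) = (LBINT y. FF y*pt y) + (\<Sum>j\<in>UNIV. \<integral>y. (%_ _. 0) j y*pd j pt y \<partial>lborel)"
   using weak t by (simp add: wlap_def)
 qed simp
 define v where "v x = 1/cN*(cv (Ker (A1 r) 0) uu x - cv (Ker (A0 r) 0) FF x)" for x
 define v' where "v' j x = 1/cN*(- cv (dKer (A1 r) (A1' r) 0 j) uu x - - cv (dKer (A0 r) (A0' r) 0 j) FF x)" for j x
 have cont: "continuous_on UNIV (A0' r)" "continuous_on UNIV (A0'' r)"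
  using A0_derivs(2,3)[of r] by (auto intro!: continuous_at_imp_continuous_on intro: DERIV_isCont)
 have cont3: "continuous_on UNIV (A0''' r)"
  unfolding A0'''_def chik_def using r
  by (intro continuous_intros continuous_on_compose2[OF bp_continuous[of UNIV]]) auto
 have cont1: "continuous_on UNIV (A1' r)" unfolding A1'_def by (intro continuous_intros cont cont3)
 note c0 = cv_C1[OF m(2) b(2) r, of "A0 r" BX "A0' r", OF A0_bounds(1)[OF r] A0_zero(1)[OF r] A0_bounds(2)[OF r] A0_zero(2)[OF r] A0_derivs(1) cont(1)]
 note c1 = cv_C1[OF m(1) b(1) r, of "A1 r" "10*BX/r^2" "A1' r", OF A0_bounds(5)[OF r] A0_zero(5)[OF r] A0_bounds(6)[OF r] A0_zero(6)[OF r] A0_derivs(4) cont1]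
 have "has_pd v j x (v' j x)" for j x
  unfolding v_def v'_def by (intro has_pd_cmult has_pd_diff c0 c1)
 moreover have "continuous_on UNIV v" unfolding v_def by (intro continuous_intros c0 c1)
 moreover have "continuous_on UNIV (v' j)" for j unfolding v'_def by (intro continuous_intros c0 c1)
 moreover have "\<bar>v' j x\<bar> <= CG*(BF*r + Bu/r)" for j x
 proof -
  have "\<bar>- cv (dKer (A1 r) (A1' r) 0 j) uu x - - cv (dKer (A0 r) (A0' r) 0 j) FF x\<bar>
    <= 648*(10*BX/r^2)*Bu*r + 648*BX*BF*r"
   using c0(4)[of j x] c1(4)[of j x] by linarith
  also have "648*(10*BX/r^2)*Bu*r = 6480*BX*(Bu/r)" using r by (simp add: power2_eq_square)
  also have "6480*BX*(Bu/r) + 648*BX*BF*r <= 6480*BX*(BF*r + Bu/r)"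
   using BX(1) B0 r by (simp add: algebra_simps)
  finally have "1/cN * \<bar>- cv (dKer (A1 r) (A1' r) 0 j) uu x - - cv (dKer (A0 r) (A0' r) 0 j) FF x\<bar> <= 1/cN*(6480*BX*(BF*r + Bu/r))"
   using cN_pos by (intro mult_left_mono) auto
  then show ?thesis using cN_pos unfolding v'_def CG_def by (simp add: abs_mult)
 qed
 moreover have "AE x in lborel. x \<in> ball x0 r --> u x = v x"
  using rep
 proof eventually_elim
  case (elim x)
  show ?case
  proof
   assume x: "x \<in> ball x0 r"
   then have "cN*uu x = cv (Ker (A1 r) 0) uu x - cv (Ker (A0 r) 0) FF x" using elim by (simp add: cv_def kap_0)
   then have "uu x = v x" using cN_pos by (simp add: v_def field_simps)
   then show "u x = v x" using x r by (simp add: uu_def)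
  qed
 qed
 ultimately show ?thesis by blast
qed

section \<open>Integration by parts and symmetry of mixed derivatives\<close>

lemma AE_eq_continuous_on:
 fixes f g :: "real^3 => real"
 assumes S: "open S" and f: "continuous_on S f" and g: "continuous_on S g"
  and ae: "AE x in lborel. x \<in> S --> f x = g x" and x: "x \<in> S"
 shows "f x = g x"
proof (rule ccontr)
 assume ne: "f x ~= g x"
 have "continuous_on S (%y. f y - g y)" using f g by (intro continuous_intros)
 then have op: "open (S \<inter> (%y. f y - g y) -` (- {0}))"
  using S by (subst (asm) continuous_on_open_vimage) (auto simp: Int_commute)
 let ?T = "S \<inter> (%y. f y - g y) -` (- {0})"
 have "AE y in lborel. y \<notin> ?T" using ae by eventually_elim auto
 then have "?T \<in> null_sets lborel" using op by (subst (asm) AE_iff_null_sets[symmetric]) auto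
 then have "negligible ?T" by (simp add: negligible_iff_null_sets null_sets_completionI)
 moreover have "x \<in> ?T" using x ne by simp
 ultimately show False using open_not_negligible[OF op] by blast
qed

lemma test_fun_mono: "test_fun S pt ==> S \<subseteq> T ==> test_fun T pt"
 by (auto simp: test_fun_def)

lemma wlap_mono: "wlap T u F ==> S \<subseteq> T ==> wlap S u F"
 unfolding wlap_def using test_fun_mono by blast

lemma test_fun_continuous: "test_fun S pt ==> continuous_on T pt"
 using smooth3_continuous[of pt T "[]"] by (simp add: test_fun_def)

lemma test_mult_continuous:
 assumes S: "open S" and v: "continuous_on S v" and t: "test_fun S pt"
 shows "continuous_on UNIV (%x. v x*pt x)"
proof -
 let ?K = "closure {x. pt x ~= 0}"
 have K: "?K \<subseteq> S" using t by (simp add: test_fun_def)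
 have "continuous_on (S \<union> - ?K) (%x. v x*pt x)"
 proof (rule continuous_on_open_Un)
  show "continuous_on S (%x. v x*pt x)" by (intro continuous_intros v test_fun_continuous[OF t])
  have "v x*pt x = 0" if "x \<in> - ?K" for x using that closure_subset[of "{x. pt x ~= 0}"] by auto
  then show "continuous_on (- ?K) (%x. v x*pt x)" by (subst continuous_on_cong[OF refl, of _ _ "%x. 0"]) auto
 qed (use S in auto)
 moreover have "S \<union> - ?K = UNIV" using K by auto
 ultimately show ?thesis by simp
qed

lemma test_fun_support:
 assumes "test_fun S pt"
 shows "\<exists>rh. \<forall>x. norm x > rh --> pt x = 0"
proof -
 have "bounded (closure {x. pt x ~= 0})" using assms by (auto simp: test_fun_def intro: compact_imp_bounded)
 then obtain rh where "\<forall>x\<in>closure {x. pt x ~= 0}. norm x <= rh" unfolding bounded_iff by blast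
 then show ?thesis using closure_subset[of "{x. pt x ~= 0}"] by (intro exI[of _ rh]) force
qed

lemma continuous_compact_integrable:
 fixes f :: "real^3 => real"
 assumes "continuous_on UNIV f" "!!z. norm z > r ==> f z = 0"
 shows "integrable lborel f"
proof -
 obtain C where C: "C >= 0" "!!z. \<bar>f z\<bar> <= C" using compact_support_bounded[OF assms] by blast
 show ?thesis
 proof (rule Bochner_Integration.integrable_bound[OF integrable_cball_indicator[of C 0 r]])
  show "AE z in lborel. norm (f z) <= norm (C*indicator (cball 0 r) z)"
  proof (rule AE_I2)
   fix z show "norm (f z) <= norm (C*indicator (cball 0 r) z)"
    using C(2)[of z] assms(2)[of z] by (cases "norm z <= r") auto
  qed
 qed (use assms in \<open>auto intro: borel_measurable_continuous_onI\<close>)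
qed

lemma test_mult_integrable:
 assumes S: "open S" and v: "continuous_on S v" and t: "test_fun S pt"
 shows "integrable lborel (%x. v x*pt x)"
proof -
 obtain rh where "!!x. norm x > rh ==> pt x = 0" using test_fun_support[OF t] by blast
 then show ?thesis by (intro continuous_compact_integrable[OF test_mult_continuous[OF S v t], of rh]) simp
qed

lemma integral_pd_zero:
 assumes f: "continuous_on UNIV f" and g: "continuous_on UNIV g" and z: "!!x. norm x > rh ==> f x = 0" "!!x. norm x > rh ==> g x = 0"
  and D: "!!x. has_pd f j x (g x)"
 shows "(LBINT x. g x) = 0"
proof -
 obtain C where C: "!!x. \<bar>g x\<bar> <= C" using compact_support_bounded[OF g z(2)] by blast
 obtain C' where C': "!!x. \<bar>f x\<bar> <= C'" using compact_support_bounded[OF f z(1)] by blast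
 show ?thesis
 proof (rule integral_rd_zero(2)[of f rh j C C' g])
  show "\<bar>f (sh x t j) - f x\<bar> <= C*t" if "0 < t" "t <= 1" for x t
   using has_pd_lipschitz[of t f j x g C] D C that by simp
 qed (use f z C' D in \<open>auto intro: borel_measurable_continuous_onI has_pd_imp_rd\<close>)
qed

text \<open>v may be arbitrary outside S. The product with the test function is nevertheless
  continuously differentiable on the whole space, because the closed support of the test function
  lies in S.\<close>

lemma ibp:
 assumes S: "open S" and v: "continuous_on S v" and v': "continuous_on S v'"
  and D: "!!x. x \<in> S ==> has_pd v j x (v' x)" and t: "test_fun S pt"
 shows "(LBINT x. v x*pd j pt x) = - (LBINT x. v' x*pt x)"
proof -
 obtain rh1 where rh1: "!!x. norm x > rh1 ==> pt x = 0" using test_fun_support[OF t] by blast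
 obtain rh2 where rh2: "!!x. norm x > rh2 ==> pd j pt x = 0" using test_fun_support[OF test_fun_pd[OF t]] by blast
 have K: "closure {x. pt x ~= 0} \<subseteq> S" using t by (simp add: test_fun_def)
 have sm: "smooth3 pt" using t by (simp add: test_fun_def)
 have "(LBINT x. v' x*pt x + v x*pd j pt x) = 0"
 proof (rule integral_pd_zero[of "%x. v x*pt x" _ "max rh1 rh2"])
  show "continuous_on UNIV (%x. v x*pt x)" by (rule test_mult_continuous[OF S v t])
  show "continuous_on UNIV (%x. v' x*pt x + v x*pd j pt x)"
   by (intro continuous_intros test_mult_continuous[OF S] v v' t test_fun_pd)
  fix x
  show "has_pd (%x. v x*pt x) j x (v' x*pt x + v x*pd j pt x)"
  proof (cases "x \<in> closure {x. pt x ~= 0}")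
   case True
   then have "x \<in> S" using K by blast
   from has_pd_mult[OF D[OF this] smooth3_has_pd1[OF sm]] show ?thesis by (simp add: mult.commute)
  next
   case False
   have "has_pd (%x. v x*pt x) j x 0"
    by (rule zero_outside_pd[of "closure {x. pt x ~= 0}"]) (use False closure_subset[of "{x. pt x ~= 0}"] in auto)
   moreover have "has_pd pt j x 0"
    by (rule zero_outside_pd[of "closure {x. pt x ~= 0}"]) (use False closure_subset[of "{x. pt x ~= 0}"] in auto)
   then have "pd j pt x = 0" by (rule has_pd_imp_pd)
   moreover have "pt x = 0" using False closure_subset[of "{x. pt x ~= 0}"] by auto
   ultimately show ?thesis by simp
  qed
 qed (use rh1 rh2 in auto)
 moreover have "(LBINT x. v' x*pt x + v x*pd j pt x) = (LBINT x. v' x*pt x) + (LBINT x. v x*pd j pt x)"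
  by (intro Bochner_Integration.integral_add test_mult_integrable[OF S] v v' t test_fun_pd)
 ultimately show ?thesis by simp
qed

text \<open>The second difference over a square of side h is symmetric in j and k, and two
  applications of the mean value theorem express it by either mixed derivative.
  \<open>mixed_partials\<close> compares the two at small h.\<close>

lemma mixed_mvt:
 assumes h: "h > 0" "ball x rh \<subseteq> S" "2*h < rh"
  and D1: "!!y. y \<in> S ==> has_pd f j y (f1 y)" and D2: "!!y. y \<in> S ==> has_pd f1 k y (f12 y)"
 shows "\<exists>y. norm (y - x) <= 2*h & f (sh x h j + h *\<^sub>R ax k) - f (sh x h j) - f (sh x h k) + f x = h^2*f12 y"
proof -
 have n: "norm (a *\<^sub>R ax j + b *\<^sub>R ax k) <= 2*h" if "0 <= a" "a <= h" "0 <= b" "b <= h" for a b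
  using norm_triangle_ineq[of "a *\<^sub>R ax j" "b *\<^sub>R ax k"] that by simp
 have inS: "sh x a j + b *\<^sub>R ax k \<in> S" if "0 <= a" "a <= h" "0 <= b" "b <= h" for a b
 proof -
  have "norm (a *\<^sub>R ax j + b *\<^sub>R ax k) < rh" using n[OF that] h by simp
  moreover have "dist x (x + (a *\<^sub>R ax j + b *\<^sub>R ax k)) = norm (a *\<^sub>R ax j + b *\<^sub>R ax k)" unfolding dist_norm by (metis add_diff_cancel_left' norm_minus_commute)
  ultimately have "sh x a j + b *\<^sub>R ax k \<in> ball x rh" by (simp add: add.assoc)
  then show ?thesis using h by blast
 qed
 let ?g = "%s. f (sh x h k + s *\<^sub>R ax j) - f (sh x s j)"
 have "\<exists>z>0. z < h & ?g h - ?g 0 = (h - 0)*(f1 (sh x h k + z *\<^sub>R ax j) - f1 (sh x z j))"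
 proof (rule MVT2[OF h(1)])
  fix s assume s: "0 <= s" "s <= h"
  have "sh x h k + s *\<^sub>R ax j \<in> S" "sh x s j \<in> S"
   using inS[of s h] inS[of s 0] s h by (simp_all add: add_ac)
  then show "(?g has_real_derivative f1 (sh x h k + s *\<^sub>R ax j) - f1 (sh x s j)) (at s)"
   by (intro DERIV_diff) (auto simp: has_pd_line[symmetric] intro: D1)
 qed
 then obtain z where z: "0 < z" "z < h" "?g h - ?g 0 = h*(f1 (sh x h k + z *\<^sub>R ax j) - f1 (sh x z j))" by auto
 have "\<exists>w>0. w < h & f1 (sh x z j + h *\<^sub>R ax k) - f1 (sh x z j + 0 *\<^sub>R ax k) = (h - 0)*f12 (sh x z j + w *\<^sub>R ax k)"
 proof (rule MVT2[OF h(1)])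
  fix s assume s: "0 <= s" "s <= h"
  have "sh x z j + s *\<^sub>R ax k \<in> S" using inS[of z s] s z by simp
  then show "((%s. f1 (sh x z j + s *\<^sub>R ax k)) has_real_derivative f12 (sh x z j + s *\<^sub>R ax k)) (at s)"
   by (auto simp: has_pd_line[symmetric] intro: D2)
 qed
 then obtain w where w: "0 < w" "w < h" "f1 (sh x z j + h *\<^sub>R ax k) - f1 (sh x z j) = h*f12 (sh x z j + w *\<^sub>R ax k)" by auto
 have c: "sh x h k + t *\<^sub>R ax j = sh x t j + h *\<^sub>R ax k" for t by (simp add: add_ac)
 have "norm (sh x z j + w *\<^sub>R ax k - x) <= 2*h" using n[of z w] z w by (simp add: add_ac)
 moreover have "f (sh x h j + h *\<^sub>R ax k) - f (sh x h j) - f (sh x h k) + f x = h*(f1 (sh x z j + h *\<^sub>R ax k) - f1 (sh x z j))"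
  using z(3) unfolding c by simp
 ultimately show ?thesis using w(3) by (intro exI[of _ "sh x z j + w *\<^sub>R ax k"]) (simp add: power2_eq_square)
qed

lemma mixed_partials:
 assumes S: "open S" "x \<in> S"
  and D1: "!!y. y \<in> S ==> has_pd f j y (f1 y)" and D12: "!!y. y \<in> S ==> has_pd f1 k y (f12 y)"
  and D2: "!!y. y \<in> S ==> has_pd f k y (f2 y)" and D21: "!!y. y \<in> S ==> has_pd f2 j y (f21 y)"
  and c: "continuous_on S f12" "continuous_on S f21"
 shows "f12 x = f21 x"
proof (rule ccontr)
 assume "f12 x ~= f21 x"
 then have e: "\<bar>f12 x - f21 x\<bar>/2 > 0" by simp
 let ?e = "\<bar>f12 x - f21 x\<bar>/2"
 obtain rh where rh: "rh > 0" "ball x rh \<subseteq> S" using S by (meson openE)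
 have ic: "isCont f12 x" "isCont f21 x" using c S by (auto simp: continuous_on_eq_continuous_at)
 obtain d1 where d1: "d1 > 0" "!!y. dist y x < d1 ==> dist (f12 y) (f12 x) < ?e"
  using ic(1)[unfolded continuous_at_eps_delta, rule_format, OF e] by blast
 obtain d2 where d2: "d2 > 0" "!!y. dist y x < d2 ==> dist (f21 y) (f21 x) < ?e"
  using ic(2)[unfolded continuous_at_eps_delta, rule_format, OF e] by blast
 note d = d1 d2
 define h where "h = min rh (min d1 d2)/4"
 have h: "h > 0" "2*h < rh" "2*h < d1" "2*h < d2" using rh d unfolding h_def by (auto simp: min_def)
 obtain y where y: "norm (y - x) <= 2*h" "f (sh x h j + h *\<^sub>R ax k) - f (sh x h j) - f (sh x h k) + f x = h^2*f12 y"
  using mixed_mvt[OF h(1) rh(2) h(2) D1 D12] by blast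
 obtain y' where y': "norm (y' - x) <= 2*h" "f (sh x h k + h *\<^sub>R ax j) - f (sh x h k) - f (sh x h j) + f x = h^2*f21 y'"
  using mixed_mvt[OF h(1) rh(2) h(2) D2 D21] by blast
 have c: "sh x h k + h *\<^sub>R ax j = sh x h j + h *\<^sub>R ax k" by (simp add: add_ac)
 have "h^2*f12 y = h^2*f21 y'" using y(2) y'(2) unfolding c by linarith
 then have "f12 y = f21 y'" using h(1) by simp
 moreover have "\<bar>f12 y - f12 x\<bar> < ?e" "\<bar>f21 y' - f21 x\<bar> < ?e"
  using d(2)[of y] d(4)[of y'] y(1) y'(1) h by (auto simp: dist_norm)
 ultimately show False by (auto simp: abs_if split: if_splits)
qed

lemma smooth3_swap: "smooth3 f ==> pd j (pd k f) = pd k (pd j f)"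
proof
 fix x assume f: "smooth3 f"
 show "pd j (pd k f) x = pd k (pd j f) x"
  by (rule mixed_partials[OF open_UNIV UNIV_I, where f=f and j=k and k=j and ?f1.0="pd k f" and ?f2.0="pd j f"])
    (use smooth3_has_pd1[OF f] smooth3_has_pd1[OF smooth3_pd[OF f]] smooth3_continuous[OF f, of UNIV "[_,_]"] in auto)
qed

lemma pd_pd_pd_swap: "smooth3 f ==> pd j (pd k (pd k f)) = pd k (pd k (pd j f))"
 using smooth3_swap[OF smooth3_pd, of f k j k] smooth3_swap[of f j k] by simp

text \<open>The bootstrap: on a small ball the C1 function of \<open>interior_gradient\<close>
  equals v almost everywhere, hence everywhere by continuity, so a continuous weak solution with
  continuous right-hand side is C1 and inherits the derivative bound.\<close>

lemma C1_step:
 assumes S: "open S" and v: "continuous_on S v" and F: "continuous_on S F" and w: "wlap S v F"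
 shows "!!x. x \<in> S ==> has_pd v j x (pd j v x)" "continuous_on S (pd j v)"
  "!!x r Bv BF. r > 0 ==> ball x (2*r) \<subseteq> S ==> (!!y. y \<in> ball x (2*r) ==> \<bar>v y\<bar> <= Bv) 
   ==> (!!y. y \<in> ball x (2*r) ==> \<bar>F y\<bar> <= BF) ==> \<bar>pd j v x\<bar> <= CG*(BF*r + Bv/r)"
proof -
 have main: "(\<forall>y\<in>ball x r. has_pd v j y (pd j v y)) & continuous_on (ball x r) (pd j v) & \<bar>pd j v x\<bar> <= CG*(BF*r + Bv/r)"
  if r: "r > 0" "ball x (2*r) \<subseteq> S" and Bv: "!!y. y \<in> ball x (2*r) ==> \<bar>v y\<bar> <= Bv"
   and BF: "!!y. y \<in> ball x (2*r) ==> \<bar>F y\<bar> <= BF" for x r Bv BF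
 proof -
  let ?v = "%y. if y \<in> S then v y else 0" and ?F = "%y. if y \<in> S then F y else 0"
  have m: "?v \<in> borel_measurable borel" "?F \<in> borel_measurable borel"
   using v F S borel_measurable_continuous_on_if[of S v "%_. 0"] borel_measurable_continuous_on_if[of S F "%_. 0"] by auto
  have w': "wlap (ball x (2*r)) ?v ?F"
  proof (unfold wlap_def, intro allI impI)
   fix pt assume "test_fun (ball x (2*r)) pt"
   then have t: "test_fun S pt" by (rule test_fun_mono) (use r in auto)
   have "(%y. ?v y*laplacian pt y) = (%y. v y*laplacian pt y)" "(%y. ?F y*pt y) = (%y. F y*pt y)"
    using laplacian_zero_outside[OF t] by (auto simp: fun_eq_iff)
   then show "(LBINT y. ?v y*laplacian pt y) = (LBINT y. ?F y*pt y)"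
    using w t by (simp add: wlap_def)
  qed
  obtain V V' where V: "!!x j. has_pd V j x (V' j x)" "continuous_on UNIV V" "!!j. continuous_on UNIV (V' j)"
    "!!x j. \<bar>V' j x\<bar> <= CG*(BF*r + Bv/r)" "AE y in lborel. y \<in> ball x r --> ?v y = V y"
   using interior_gradient[OF r(1) m _ _ w', of Bv BF] Bv BF r(2) by (auto simp: subset_iff)
  have sub: "ball x r \<subseteq> S" using r by (auto simp: subset_iff)
  have eq: "v y = V y" if "y \<in> ball x r" for y
  proof (rule AE_eq_continuous_on[of "ball x r"])
   show "AE y in lborel. y \<in> ball x r --> v y = V y" using V(5) by eventually_elim (use sub in auto)
  qed (use v V sub that in \<open>auto intro: continuous_on_subset\<close>)
  have D: "has_pd v j y (V' j y)" if "y \<in> ball x r" for y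
   by (rule has_pd_cong_open[of "ball x r" y V]) (use that eq V in auto)
  then have pe: "pd j v y = V' j y" if "y \<in> ball x r" for y using that has_pd_imp_pd by blast
  have "continuous_on (ball x r) (pd j v)"
   using V(3)[of j] pe by (subst continuous_on_cong[OF refl pe]) (auto intro: continuous_on_subset)
  then show ?thesis using D pe V(4) r by auto
 qed
 show "\<bar>pd j v x\<bar> <= CG*(BF*r + Bv/r)" if "r > 0" "ball x (2*r) \<subseteq> S" "!!y. y \<in> ball x (2*r) ==> \<bar>v y\<bar> <= Bv" 
   "!!y. y \<in> ball x (2*r) ==> \<bar>F y\<bar> <= BF" for x r Bv BF
  using main[OF that] by blast
 have loc: "\<exists>r>0. (\<forall>y\<in>ball x r. has_pd v j y (pd j v y)) & continuous_on (ball x r) (pd j v)" if x: "x \<in> S" for x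
 proof -
  obtain e where e: "e > 0" "cball x e \<subseteq> S" using S x by (meson open_contains_cball)
  have "bounded (v ` cball x e)" "bounded (F ` cball x e)"
   using v F e by (auto intro!: compact_imp_bounded compact_continuous_image intro: continuous_on_subset)
  then obtain Bv BF where "!!y. y \<in> cball x e ==> \<bar>v y\<bar> <= Bv" "!!y. y \<in> cball x e ==> \<bar>F y\<bar> <= BF"
   unfolding bounded_iff by (metis imageI real_norm_def)
  then show ?thesis using main[of "e/2" x Bv BF] e by (intro exI[of _ "e/2"]) (auto simp: subset_iff)
 qed
 show "has_pd v j x (pd j v x)" if "x \<in> S" for x using loc[OF that] by (metis centre_in_ball)
 show "continuous_on S (pd j v)"
  unfolding continuous_on_eq_continuous_at[OF S]
 proof
  fix x assume "x \<in> S"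
  then obtain r where "r > 0" "continuous_on (ball x r) (pd j v)" using loc by blast
  then show "isCont (pd j v) x" by (auto simp: continuous_on_eq_continuous_at)
 qed
qed

section \<open>Analytic estimates for quadratic systems\<close>

text \<open>The terms of the Leibniz rule, one pair for each subset of positions of the derivative
  list; keeping repetitions avoids multi-indices and binomial coefficients.\<close>

primrec splits :: "3 list => (3 list \<times> 3 list) list" where
 "splits [] = [([], [])]"
| "splits (j # js) = map (%(a, b). (j # a, b)) (splits js) @ map (%(a, b). (a, j # b)) (splits js)"

lemma splits_length: "(a, b) \<in> set (splits js) ==> length a + length b = length js"
 by (induction js arbitrary: a b) auto

text \<open>Grouped by the length k of the first part this is the sum of C(p,k) k! (p-k)! = p! over
  k = 0, ..., p. The Leibniz rule thus costs a factor p + 1 and not 2^p, which is what lets the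
  factorial bounds close in \<open>analytic\<close>.\<close>

lemma splits_fact: "(\<Sum>(a, b)\<leftarrow>splits js. fact (length a)*fact (length b)) = (fact (Suc (length js)) :: real)"
proof (induction js)
 case (Cons j js)
 have "(\<Sum>(a, b)\<leftarrow>splits (j # js). fact (length a)*fact (length b)) =
  (\<Sum>p\<leftarrow>splits js. fact (Suc (length (fst p)))*fact (length (snd p)) + fact (length (fst p))*fact (Suc (length (snd p))) :: real)"
  by (simp add: comp_def case_prod_unfold sum_list_addf)
 also have "... = (\<Sum>p\<leftarrow>splits js. real (length js + 2)*(fact (length (fst p))*fact (length (snd p))))"
 proof (rule arg_cong[of _ _ sum_list], rule map_cong[OF refl])
  fix p assume "p \<in> set (splits js)"
  then have "length (fst p) + length (snd p) = length js" using splits_length[of "fst p" "snd p"] by simp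
  then have l: "real (length js) = real (length (fst p)) + real (length (snd p))" by (metis of_nat_add)
  show "fact (Suc (length (fst p)))*fact (length (snd p)) + fact (length (fst p))*fact (Suc (length (snd p)))
    = real (length js + 2)*(fact (length (fst p))*fact (length (snd p)))"
   by (simp add: l algebra_simps)
 qed
 also have "... = real (length js + 2)*(\<Sum>(a, b)\<leftarrow>splits js. fact (length a)*fact (length b))"
  by (simp add: sum_list_const_mult case_prod_unfold)
 finally show ?case unfolding Cons by (simp add: algebra_simps)
qed simp

lemma has_pd_sum_list:
 "(!!p. p \<in> set ps ==> has_pd (f p) j x (g p)) ==> has_pd (%x. \<Sum>p\<leftarrow>ps. f p x) j x (\<Sum>p\<leftarrow>ps. g p)"
 by (induction ps) (auto intro: has_pd_const has_pd_add)

lemma continuous_on_sum_list: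
 fixes f :: "'b => real^3 => real"
 shows "(!!p. p \<in> set ps ==> continuous_on S (f p)) ==> continuous_on S (%x. \<Sum>p\<leftarrow>ps. f p x)"
 by (induction ps) (auto intro: continuous_intros)

lemma sum_list_abs_le:
 fixes f g :: "'b => real"
 assumes "!!p. p \<in> set ps ==> \<bar>f p\<bar> <= g p"
 shows "\<bar>\<Sum>p\<leftarrow>ps. f p\<bar> <= (\<Sum>p\<leftarrow>ps. g p)"
 using assms by (induction ps) (auto intro: order_trans[OF abs_triangle_ineq] add_mono)

definition Fd :: "('q => real^3 => real) => (real \<times> 'q \<times> 'q) list => 3 list => real^3 => real" where
 "Fd u ts js x = (\<Sum>(c, a, b)\<leftarrow>ts. c*(\<Sum>(p, q)\<leftarrow>splits js. pds p (u a) x*pds q (u b) x))"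

lemma splits_sum_Cons:
 "(\<Sum>(p, q)\<leftarrow>splits (j # js). g p q) = (\<Sum>(p, q)\<leftarrow>splits js. g (j # p) q + g p (j # q) :: real)"
 by (simp add: comp_def case_prod_unfold sum_list_addf)

lemma Fd_has_pd:
 assumes "!!c a b p. (c, a, b) \<in> set ts ==> length p <= length js ==> has_pd (pds p (u a)) j x (pds (j # p) (u a) x)"
  and "!!c a b p. (c, a, b) \<in> set ts ==> length p <= length js ==> has_pd (pds p (u b)) j x (pds (j # p) (u b) x)"
 shows "has_pd (Fd u ts js) j x (Fd u ts (j # js) x)"
proof -
 have "has_pd (%x. \<Sum>t\<leftarrow>ts. fst t*(\<Sum>s\<leftarrow>splits js. pds (fst s) (u (fst (snd t))) x*pds (snd s) (u (snd (snd t))) x)) j x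
   (\<Sum>t\<leftarrow>ts. fst t*(\<Sum>s\<leftarrow>splits js. pds (j # fst s) (u (fst (snd t))) x*pds (snd s) (u (snd (snd t))) x + pds (j # snd s) (u (snd (snd t))) x*pds (fst s) (u (fst (snd t))) x))"
 proof (intro has_pd_sum_list has_pd_cmult has_pd_mult)
  fix t s assume t: "t \<in> set ts" and s: "s \<in> set (splits js)"
  have l: "length (fst s) + length (snd s) = length js" using splits_length[of "fst s" "snd s"] s by simp
  obtain c a b where [simp]: "t = (c, a, b)" by (cases t)
  show "has_pd (pds (fst s) (u (fst (snd t)))) j x (pds (j # fst s) (u (fst (snd t))) x)"
   using assms(1)[of c a b "fst s"] t l by simp
  show "has_pd (pds (snd s) (u (snd (snd t)))) j x (pds (j # snd s) (u (snd (snd t))) x)"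
   using assms(2)[of c a b "snd s"] t l by simp
 qed
 moreover have "Fd u ts js = (%x. \<Sum>t\<leftarrow>ts. fst t*(\<Sum>s\<leftarrow>splits js. pds (fst s) (u (fst (snd t))) x*pds (snd s) (u (snd (snd t))) x))"
  by (simp add: Fd_def fun_eq_iff case_prod_unfold)
 moreover have "Fd u ts (j # js) x = (\<Sum>t\<leftarrow>ts. fst t*(\<Sum>s\<leftarrow>splits js. pds (j # fst s) (u (fst (snd t))) x*pds (snd s) (u (snd (snd t))) x + pds (j # snd s) (u (snd (snd t))) x*pds (fst s) (u (fst (snd t))) x))"
  unfolding Fd_def splits_sum_Cons by (simp add: case_prod_unfold mult.commute)
 ultimately show ?thesis by simp
qed

lemma Fd_continuous:
 assumes "!!c a b p. (c, a, b) \<in> set ts ==> length p <= length js ==> continuous_on S (pds p (u a))"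
  and "!!c a b p. (c, a, b) \<in> set ts ==> length p <= length js ==> continuous_on S (pds p (u b))"
 shows "continuous_on S (Fd u ts js)"
proof -
 have "continuous_on S (%x. \<Sum>t\<leftarrow>ts. fst t*(\<Sum>s\<leftarrow>splits js. pds (fst s) (u (fst (snd t))) x*pds (snd s) (u (snd (snd t))) x))"
 proof (intro continuous_on_sum_list continuous_intros)
  fix t s assume t: "t \<in> set ts" and s: "s \<in> set (splits js)"
  have l: "length (fst s) + length (snd s) = length js" using splits_length[of "fst s" "snd s"] s by simp
  obtain c a b where [simp]: "t = (c, a, b)" by (cases t)
  show "continuous_on S (pds (fst s) (u (fst (snd t))))"
   using assms(1)[of c a b "fst s"] t l by simp
  show "continuous_on S (pds (snd s) (u (snd (snd t))))"
   using assms(2)[of c a b "snd s"] t l by simp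
 qed
 then show ?thesis by (simp add: Fd_def[abs_def] case_prod_unfold)
qed

text \<open>Two integrations by parts: the derivative moves from v to the test function, where it
  commutes with the Laplacian, and after use of the equation it moves back onto F.\<close>

lemma wlap_pd:
 assumes S: "open S" and v: "continuous_on S v" "continuous_on S (pd j v)" "!!x. x \<in> S ==> has_pd v j x (pd j v x)"
  and F: "continuous_on S F" "continuous_on S F'" "!!x. x \<in> S ==> has_pd F j x (F' x)" and w: "wlap S v F"
 shows "wlap S (pd j v) F'"
 unfolding wlap_def
proof (intro allI impI)
 fix pt assume t: "test_fun S pt"
 have sm: "smooth3 pt" using t by (simp add: test_fun_def)
 have tk: "test_fun S (pd k (pd k pt))" for k by (intro test_fun_pd t)
 have "(LBINT y. pd j v y*laplacian pt y) = (\<Sum>k\<in>UNIV. \<integral>y. pd j v y*pd k (pd k pt) y \<partial>lborel)"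
  unfolding laplacian_def sum_distrib_left
  by (intro Bochner_Integration.integral_sum test_mult_integrable[OF S v(2) tk])
 also have "... = (\<Sum>k\<in>UNIV. - (LBINT y. v y*pd k (pd k (pd j pt)) y))"
  using ibp[OF S v(1,2,3) tk] by (simp add: pd_pd_pd_swap[OF sm])
 also have "... = - (\<Sum>k\<in>UNIV. \<integral>y. v y*pd k (pd k (pd j pt)) y \<partial>lborel)" by (simp add: sum_negf)
 also have "(\<Sum>k\<in>UNIV. \<integral>y. v y*pd k (pd k (pd j pt)) y \<partial>lborel) = (LBINT y. v y*laplacian (pd j pt) y)"
  unfolding laplacian_def sum_distrib_left
  by (intro Bochner_Integration.integral_sum[symmetric] test_mult_integrable[OF S v(1)] test_fun_pd t)
 also have "... = (LBINT y. F y*pd j pt y)" using w test_fun_pd[OF t] by (simp add: wlap_def)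
 also have "... = - (LBINT y. F' y*pt y)" by (rule ibp[OF S F t])
 finally show "(LBINT y. pd j v y*laplacian pt y) = (LBINT y. F' y*pt y)" by simp
qed

text \<open>d plays the distance to the singularities, capped at 1, and \<open>m q\<close> is the
  order of the pole of the unknown q. A right-hand side may have a pole two orders higher: the
  gradient estimate multiplies it by a radius proportional to d, which leaves order
  \<open>m q + 1\<close>, that of a first derivative.\<close>

locale qsys =
 fixes S :: "(real^3) set" and d :: "real^3 => real" and Q :: "'q set" and u :: "'q => real^3 => real"
  and rhs :: "'q => (real \<times> 'q \<times> 'q) list" and m :: "'q => nat" and M C :: real
 assumes S: "open S"
  and d: "x \<in> S ==> d x > 0" "x \<in> S ==> d x <= 1" "x \<in> S ==> ball x (d x) \<subseteq> S"
   "x \<in> S ==> y \<in> S ==> d y >= d x - dist x y"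
  and cont: "q \<in> Q ==> continuous_on S (u q)"
  and eqn: "q \<in> Q ==> wlap S (u q) (%x. \<Sum>(c, a, b)\<leftarrow>rhs q. c*(u a x*u b x))"
  and rhs: "q \<in> Q ==> (c, a, b) \<in> set (rhs q) ==> a \<in> Q & b \<in> Q & m a + m b <= m q + 2"
  and m: "q \<in> Q ==> m q <= 1" and M: "M > 0" and bd: "q \<in> Q ==> x \<in> S ==> \<bar>u q x\<bar> <= M*(1/d x)^m q"
  and C: "C >= 0" "q \<in> Q ==> (\<Sum>(c, a, b)\<leftarrow>rhs q. \<bar>c\<bar>) <= C"
begin

text \<open>All unknowns are treated at once: continuity of their derivatives up to order n makes
  the differentiated right-hand sides continuous, and \<open>C1_step\<close> then yields one more
  order for each of them.\<close>

lemma smooth: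
 "length js <= n ==> q \<in> Q ==> continuous_on S (pds js (u q)) & wlap S (pds js (u q)) (Fd u (rhs q) js)"
proof (induction n arbitrary: js q)
 case 0
 have "Fd u (rhs q) [] = (%x. \<Sum>(c, a, b)\<leftarrow>rhs q. c*(u a x*u b x))"
  by (simp add: Fd_def fun_eq_iff)
 then show ?case using 0 cont eqn by simp
next
 case (Suc n)
 show ?case
 proof (cases js)
  case Nil
  then show ?thesis using Suc.IH[of "[]" q] Suc.prems by simp
 next
  case (Cons j ks)
  have c0: "continuous_on S (pds p (u q))" if "length p <= n" "q \<in> Q" for p q using Suc.IH[OF that] by blast
  have Fc: "continuous_on S (Fd u (rhs q) ks)" if ks: "length ks <= n" "q \<in> Q" for ks q
  proof (rule Fd_continuous)
   fix c a b and p :: "3 list" assume "(c, a, b) \<in> set (rhs q)" "length p <= length ks"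
   then show "continuous_on S (pds p (u a))" "continuous_on S (pds p (u b))"
    using c0[of p a] c0[of p b] rhs[OF ks(2), of c a b] ks(1) by simp_all
  qed
  have D: "has_pd (pds p (u q)) k x (pds (k # p) (u q) x)" "continuous_on S (pds (k # p) (u q))" if "length p <= n" "q \<in> Q" "x \<in> S" for p q k x
   using C1_step(1,2)[OF S c0[OF that(1,2)] Fc[OF that(1,2)], where j=k] Suc.IH[OF that(1,2)] that(3) by simp_all
  have l: "length ks <= n" using Suc.prems Cons by simp
  have c1: "continuous_on S (pds (k # p) (u q))" if "length p <= n" "q \<in> Q" for p q k
   using C1_step(2)[OF S c0[OF that] Fc[OF that], where j=k] Suc.IH[OF that] by simp
  have c2: "continuous_on S (pds p (u q))" if "length p <= Suc n" "q \<in> Q" for p q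
   using c1[of "tl p" q "hd p"] c0[of "[]" q] that by (cases p) simp_all
  have "wlap S (pd j (pds ks (u q))) (Fd u (rhs q) (j # ks))"
  proof (rule wlap_pd[OF S, where F = "Fd u (rhs q) ks"])
   show "continuous_on S (Fd u (rhs q) (j # ks))"
   proof (rule Fd_continuous)
    fix c a b and p :: "3 list" assume "(c, a, b) \<in> set (rhs q)" "length p <= length (j # ks)"
    then show "continuous_on S (pds p (u a))" "continuous_on S (pds p (u b))"
     using c2[of p a] c2[of p b] rhs[OF Suc.prems(2), of c a b] l by simp_all
   qed
   show "has_pd (Fd u (rhs q) ks) j x (Fd u (rhs q) (j # ks) x)" if x: "x \<in> S" for x
   proof (rule Fd_has_pd)
    fix c a b and p :: "3 list" assume "(c, a, b) \<in> set (rhs q)" "length p <= length ks"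
    then show "has_pd (pds p (u a)) j x (pds (j # p) (u a) x)" "has_pd (pds p (u b)) j x (pds (j # p) (u b) x)"
     using D(1)[of p a x j] D(1)[of p b x j] rhs[OF Suc.prems(2), of c a b] l x by simp_all
   qed
   show "continuous_on S (pd j (pds ks (u q)))" using c1[OF l Suc.prems(2), of j] by simp
   show "has_pd (pds ks (u q)) j x (pd j (pds ks (u q)) x)" if "x \<in> S" for x
    using D(1)[OF l Suc.prems(2) that, of j] by simp
   show "wlap S (pds ks (u q)) (Fd u (rhs q) ks)" using Suc.IH[OF l Suc.prems(2)] by blast
  qed (use c0[OF l Suc.prems(2)] Fc[OF l Suc.prems(2)] in simp_all)
  then show ?thesis using c2[of "j # ks" q] l Suc.prems Cons by simp
 qed
qed

lemma pds_continuous: "q \<in> Q ==> continuous_on S (pds js (u q))"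
 using smooth by blast

lemma Fd_cont: "q \<in> Q ==> continuous_on S (Fd u (rhs q) js)"
 by (rule Fd_continuous; rule pds_continuous; use rhs in blast)

lemma pds_has_pd: "q \<in> Q ==> x \<in> S ==> has_pd (pds js (u q)) j x (pds (j # js) (u q) x)"
 using C1_step(1)[OF S pds_continuous Fd_cont] smooth[of js "length js" q] by auto

lemma pds_swap: "q \<in> Q ==> x \<in> S ==> pds (js @ j # k # ks) (u q) x = pds (js @ k # j # ks) (u q) x"
proof (induction js arbitrary: x)
 case Nil
 have "pds (j # k # ks) (u q) x = pds (k # j # ks) (u q) x"
  by (rule mixed_partials[OF S Nil(2) pds_has_pd[OF Nil(1)] pds_has_pd[OF Nil(1)] pds_has_pd[OF Nil(1)] pds_has_pd[OF Nil(1)] pds_continuous[OF Nil(1)] pds_continuous[OF Nil(1)]])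
 then show ?case by simp
next
 case (Cons i js)
 have "has_pd (pds (js @ j # k # ks) (u q)) i x (pds (i # js @ j # k # ks) (u q) x)" using pds_has_pd Cons by blast
 then have "has_pd (pds (js @ k # j # ks) (u q)) i x (pds (i # js @ j # k # ks) (u q) x)"
  by (rule has_pd_cong_open[OF S Cons.prems(2), rotated]) (use Cons in blast)
 from has_pd_imp_pd[OF this] show ?case by simp
qed

lemma pow_ratio: "((real n + 2)/(real n + 1))^n <= 3"
proof -
 have "((real n + 2)/(real n + 1))^n <= exp (1/(real n + 1))^n"
  using exp_ge_add_one_self[of "1/(real n + 1)"] by (intro power_mono) (auto simp: field_simps)
 also have "... = exp (real n*(1/(real n + 1)))" by (rule exp_of_nat_mult[symmetric])
 also have "... <= exp 1" by (simp add: field_simps)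
 also have "... <= 3" using exp_le by simp
 finally show ?thesis .
qed

text \<open>24 = 3 * 2^3 is the loss caused by the shrinking distance, 3 from
  \<open>pow_ratio\<close> and 2^3 from at most three further powers; \<open>C*M\<close> stems from
  the quadratic right-hand side and 4 from the term Bv/r.\<close>

definition K where "K = CG*24*(C*M + 4) + 1"

lemma K_pos: "K >= 1" unfolding K_def using CG_pos C M by simp

text \<open>On a ball of radius d/(n + 2) the distance drops at most by the factor (n + 1)/(n + 2),
  whose n-th power stays bounded below, while 1/r brings a multiple of the factor n + 1 that turns
  n! into (n + 1)!. For the right-hand side \<open>splits_fact\<close> gives (n + 1)! directly, so
  both terms of the gradient estimate grow alike.\<close>

theorem analytic:
 "q \<in> Q ==> x \<in> S ==> \<bar>pds js (u q) x\<bar> <= M*K^length js*fact (length js)*(1/d x)^(length js + m q)"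
proof (induction "length js" arbitrary: js q x rule: less_induct)
 case less
 show ?case
 proof (cases js)
  case Nil
  then show ?thesis using bd[OF less.prems] by simp
 next
  case (Cons j ks)
  define n where "n = length ks"
  define de where "de = 1/d x"
  have dx: "d x > 0" "d x <= 1" using d less.prems by auto
  have de: "de >= 1" "de > 0" "d x = 1/de" using dx by (auto simp: de_def)
  define r where "r = d x/(2*(real n + 2))"
  have r: "r > 0" "2*r = d x/(real n + 2)" using dx unfolding r_def by (auto simp del: mult_divide_mult_cancel_left_if) (simp add: field_simps)
  have "d x/(real n + 2) <= d x" using dx by (simp add: field_simps)
  then have sub: "ball x (2*r) \<subseteq> S" using d(3)[OF less.prems(2)] r by (auto simp: subset_iff)
  have IH: "\<bar>pds p (u q) y\<bar> <= M*K^length p*fact (length p)*(1/d y)^(length p + m q)" if "length p <= n" "q \<in> Q" "y \<in> S" for p q y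
   using less.hyps[of p q y] that Cons by (simp add: n_def)
  have dy: "1/d y <= de*((real n + 2)/(real n + 1))" "1/d y > 0" "1/d y >= 1" if "y \<in> ball x (2*r)" for y
  proof -
   have yS: "y \<in> S" using that sub by blast
   have "d y >= d x - d x/(real n + 2)" using d(4)[OF less.prems(2) yS] that r by simp
   also have "d x - d x/(real n + 2) = d x*((real n + 1)/(real n + 2))" by (simp add: field_simps)
   finally have *: "d y >= d x*((real n + 1)/(real n + 2))" .
   have "1/d y <= 1/(d x*((real n + 1)/(real n + 2)))" using*dx d(1)[OF yS] by (intro divide_left_mono mult_pos_pos divide_pos_pos) auto
   then show "1/d y <= de*((real n + 2)/(real n + 1))" by (simp add: de_def)
   show "1/d y > 0" "1/d y >= 1" using d[OF yS] by auto
  qed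
  have dpow: "(1/d y)^(n + l) <= 24*de^(n + l)" if "y \<in> ball x (2*r)" "l <= 3" for y l
  proof -
   have "(1/d y)^(n + l) <= (de*((real n + 2)/(real n + 1)))^(n + l)"
    using dy[OF that(1)] by (intro power_mono) auto
   also have "... = de^(n + l)*(((real n + 2)/(real n + 1))^n*((real n + 2)/(real n + 1))^l)"
    by (simp only: power_mult_distrib power_add mult_ac)
   also have "... <= de^(n + l)*(3*2^l)"
    using pow_ratio[of n] de by (intro mult_left_mono mult_mono power_mono) (auto simp: field_simps)
   also have "(2::real)^l <= 2^3" using that by (intro power_increasing) auto
   finally show ?thesis using de by (simp add: mult.commute)
  qed
  define Bv where "Bv = M*K^n*fact n*(24*de^(n + m q))"
  define BF where "BF = C*(M^2*K^n*fact (Suc n)*(24*de^(n + (m q + 2))))"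
  have K0: "K > 0" using K_pos by simp
  have mq: "m q <= 1" using m less.prems by blast
  have "\<bar>pd j (pds ks (u q)) x\<bar> <= CG*(BF*r + Bv/r)"
  proof (rule C1_step(3)[OF S pds_continuous[OF less.prems(1)] Fd_cont[OF less.prems(1)] _ r(1) sub])
   show "wlap S (pds ks (u q)) (Fd u (rhs q) ks)" using smooth less.prems by blast
   fix y assume y: "y \<in> ball x (2*r)"
   have yS: "y \<in> S" using y sub by blast
   have "\<bar>pds ks (u q) y\<bar> <= M*K^n*fact n*(1/d y)^(n + m q)" using IH[of ks q y] yS less.prems by (simp add: n_def)
   also have "... <= Bv" unfolding Bv_def using dpow[OF y, of "m q"] mq M K0 by (intro mult_left_mono) auto
   finally show "\<bar>pds ks (u q) y\<bar> <= Bv" .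
   have "\<bar>Fd u (rhs q) ks y\<bar> <= (\<Sum>(c, a, b)\<leftarrow>rhs q. \<bar>c\<bar>*(M^2*K^n*fact (Suc n)*(24*de^(n + (m q + 2)))))"
    unfolding Fd_def
   proof (rule sum_list_abs_le, clarify)
    fix c a b assume t: "(c, a, b) \<in> set (rhs q)"
    have ab: "a \<in> Q" "b \<in> Q" "m a + m b <= m q + 2" using rhs[OF less.prems(1) t] by auto
    have "\<bar>\<Sum>(p, q)\<leftarrow>splits ks. pds p (u a) y*pds q (u b) y\<bar> <= (\<Sum>(p, q')\<leftarrow>splits ks. (M^2*K^n*(24*de^(n + (m q + 2))))*(fact (length p)*fact (length q')))"
    proof (rule sum_list_abs_le, clarify)
     fix p q' assume pq: "(p, q') \<in> set (splits ks)"
     have l: "length p + length q' = n" using splits_length[OF pq] by (simp add: n_def)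
     have "\<bar>pds p (u a) y*pds q' (u b) y\<bar> <= (M*K^length p*fact (length p)*(1/d y)^(length p + m a))*(M*K^length q'*fact (length q')*(1/d y)^(length q' + m b))"
      unfolding abs_mult using l ab yS M K0 dy(2)[OF y] by (intro mult_mono IH) auto
     also have "... = (M^2*K^(length p + length q')*(1/d y)^((length p + length q') + (m a + m b)))*(fact (length p)*fact (length q'))"
      by (simp add: power_add power2_eq_square mult_ac)
     also have "... = (M^2*K^n*(1/d y)^(n + (m a + m b)))*(fact (length p)*fact (length q'))" unfolding l ..
     also have "... <= (M^2*K^n*(24*de^(n + (m q + 2))))*(fact (length p)*fact (length q'))"
     proof (intro mult_right_mono mult_left_mono)
      have "(1/d y)^(n + (m a + m b)) <= (1/d y)^(n + (m q + 2))" using ab dy(3)[OF y] by (intro power_increasing) auto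
      also have "... <= 24*de^(n + (m q + 2))" by (rule dpow[OF y]) (use mq in simp)
      finally show "(1/d y)^(n + (m a + m b)) <= 24*de^(n + (m q + 2))" .
     qed (use K0 in auto)
     finally show "\<bar>pds p (u a) y*pds q' (u b) y\<bar> <= (M^2*K^n*(24*de^(n + (m q + 2))))*(fact (length p)*fact (length q'))" .
    qed
    also have "... = (M^2*K^n*(24*de^(n + (m q + 2))))*(\<Sum>(p, q')\<leftarrow>splits ks. fact (length p)*fact (length q'))"
     by (simp add: sum_list_const_mult case_prod_unfold)
    also have "... = M^2*K^n*fact (Suc n)*(24*de^(n + (m q + 2)))" unfolding splits_fact n_def by simp
    finally show "\<bar>c*(\<Sum>(p, q)\<leftarrow>splits ks. pds p (u a) y*pds q (u b) y)\<bar> <= \<bar>c\<bar>*(M^2*K^n*fact (Suc n)*(24*de^(n + (m q + 2))))"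
     unfolding abs_mult by (intro mult_left_mono) auto
   qed
   also have "... = (\<Sum>(c, a, b)\<leftarrow>rhs q. \<bar>c\<bar>)*(M^2*K^n*fact (Suc n)*(24*de^(n + (m q + 2))))"
    by (simp add: sum_list_mult_const case_prod_unfold)
   also have "... <= BF" unfolding BF_def using C(2)[OF less.prems(1)] K0 de by (intro mult_right_mono) auto
   finally show "\<bar>Fd u (rhs q) ks y\<bar> <= BF" .
  qed
  also have "... <= CG*((C*M + 4)*(24*(M*K^n*fact (Suc n)*de^(Suc n + m q))))"
  proof (intro mult_left_mono)
   let ?P = "24*(M*K^n*fact (Suc n)*de^(Suc n + m q))"
   have P0: "?P >= 0" using M K0 de by simp
   have rr: "de*r = 1/(2*(real n + 2))" using de unfolding r_def by simp
   have "BF*r = C*M*?P*(de*r)" unfolding BF_def by (simp add: power_add power2_eq_square mult_ac)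
   also have "... <= C*M*?P*1" unfolding rr using C M P0 by (intro mult_left_mono) auto
   finally have 1: "BF*r <= C*M*?P" by simp
   have "Bv/r = 24*(M*K^n*fact n*de^(Suc n + m q))*(2*(real n + 2))"
   proof -
    have "1/r = de*(2*(real n + 2))" unfolding r_def de_def by simp
    then have "Bv/r = Bv * (de*(2*(real n + 2)))" by (metis times_divide_eq_right mult.right_neutral)
    then show ?thesis unfolding Bv_def by (simp add: mult_ac)
   qed
   also have "... <= 24*(M*K^n*fact n*de^(Suc n + m q))*(4*(real n + 1))"
    using M K0 de by (intro mult_left_mono) auto
   also have "... = 4*?P" by (simp add: algebra_simps)
   finally show "BF*r + Bv/r <= (C*M + 4)*?P" using 1 by (simp add: algebra_simps)
  qed (use CG_pos in auto)
  also have "... = (CG*24*(C*M + 4))*(M*K^n*fact (Suc n)*de^(Suc n + m q))" by (simp add: mult_ac)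
  also have "... <= K*(M*K^n*fact (Suc n)*de^(Suc n + m q))"
   using M K0 de by (intro mult_right_mono) (auto simp: K_def)
  finally show ?thesis unfolding Cons by (simp add: n_def de_def mult_ac)
 qed
qed

end

section \<open>Local integrability of H1 functions against singular kernels\<close>

lemma AE_cover:
 fixes S :: "(real^3) set"
 assumes "!!x. x \<in> S ==> \<exists>r>0. AE y in lborel. y \<in> ball x r --> P y"
 shows "AE y in lborel. y \<in> S --> P y"
proof -
 obtain r where r: "!!x. x \<in> S ==> r x > 0 & (AE y in lborel. y \<in> ball x (r x) --> P y)"
  using bchoice[of S "%x r. r > 0 & (AE y in lborel. y \<in> ball x r --> P y)"] assms by blast
 obtain F where F: "F \<subseteq> (%x. ball x (r x)) ` S" "countable F" "\<Union>F = \<Union>((%x. ball x (r x)) ` S)"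
  by (rule Lindelof[of "(%x. ball x (r x)) ` S"]) auto
 have "AE y in lborel. \<forall>X\<in>F. y \<in> X --> P y"
  using F r by (subst AE_ball_countable) auto
 then show ?thesis
 proof eventually_elim
  case (elim y)
  show ?case
  proof
   assume "y \<in> S"
   then have "y \<in> \<Union>F" using F(3) r[of y] by (auto intro!: bexI[of _ y])
   then show "P y" using elim by blast
  qed
 qed
qed

lemma kb_mult: "kb p r z*kb q r z = kb (p + q) r z"
 by (simp add: kb_def powr_add[symmetric])

lemma kb_sq: "(kb p r z)^2 = kb (2*p) r z"
 by (simp add: power2_eq_square kb_mult)

text \<open>The nearer pole dominates: whichever of a and b is shorter, the product is at most its
  power with the summed exponent. Two singularities can thus be integrated uniformly in their
  position as long as p + q < 3.\<close>

lemma kb_mult_le: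
 assumes "0 <= p" "0 <= q"
 shows "kb p 1 a*kb q 1 b <= kb (p + q) 1 a + kb (p + q) 1 b"
proof (cases "a = 0 \<or> b = 0 \<or> norm a > 1 \<or> norm b > 1")
 case True
 then have "kb p 1 a*kb q 1 b = 0" by (auto simp: kb_def)
 then show ?thesis by (simp only:) simp
next
 case False
 then have pos: "norm a > 0" "norm b > 0" "norm a <= 1" "norm b <= 1" by auto
 show ?thesis
 proof (cases "norm a <= norm b")
  case True
  have "norm b powr (- q) <= norm a powr (- q)" using True pos assms by (intro powr_mono2') auto
  then have "kb p 1 a*kb q 1 b <= kb p 1 a*kb q 1 a" using pos by (intro mult_left_mono) (auto simp: kb_def)
  then show ?thesis unfolding kb_mult by (simp add: add_increasing2)
 next
  case False
  have "norm a powr (- p) <= norm b powr (- p)" using False pos assms by (intro powr_mono2') auto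
  then have "kb p 1 a*kb q 1 b <= kb p 1 b*kb q 1 b" using pos by (intro mult_right_mono) (auto simp: kb_def)
  then show ?thesis unfolding kb_mult by (simp add: add_increasing)
 qed
qed

lemma kb_le_kb: "0 <= p ==> p <= q ==> kb p 1 z <= kb q 1 z"
 by (cases "z = 0") (auto simp: kb_def intro!: powr_mono_both' powr_mono')

definition Kc :: "real => real" where "Kc s = (LBINT z. kb s 1 z)"

lemma kb_nn: "0 <= s ==> s < 3 ==> (\<integral>\<^sup>+y. ennreal (kb s 1 (y - x)) \<partial>lborel) = ennreal (Kc s)"
 using nn_integral_shift3(1)[of "%z. ennreal (kb s 1 z)" x] nn_integral_eq_integral[OF kb_integrable(1)[of s 1]]
 by (simp add: Kc_def)

lemma Kc_nonneg [simp]: "Kc s >= 0" by (simp add: Kc_def)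

lemma test_mult_loc_integrable:
 assumes v: "loc_integrable S v" and t: "test_fun S pt"
 shows "integrable lborel (%x. v x*pt x)"
proof -
 let ?K = "closure {x. pt x ~= 0}"
 have K: "compact ?K" "?K \<subseteq> S" using t by (auto simp: test_fun_def)
 obtain rh where rh: "!!x. norm x > rh ==> pt x = 0" using test_fun_support[OF t] by blast
 obtain C where C: "C >= 0" "!!x. \<bar>pt x\<bar> <= C" using compact_support_bounded[OF test_fun_continuous[OF t] rh] by blast
 have i: "integrable lborel (%x. indicator ?K x * v x)" using v K by (auto simp: loc_integrable_def set_integrable_def)
 have "(%x. (indicator ?K x * v x)*pt x) = (%x. v x*pt x)"
  using closure_subset[of "{x. pt x ~= 0}"] by (auto simp: fun_eq_iff indicator_def)
 moreover have "integrable lborel (%x. (indicator ?K x * v x)*pt x)"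
 proof (rule Bochner_Integration.integrable_bound[where f="%x. C*(indicator ?K x * v x)"])
  have "pt \<in> borel_measurable borel" using test_fun_continuous[OF t] by (intro borel_measurable_continuous_onI)
  then show "(%x. (indicator ?K x * v x)*pt x) \<in> borel_measurable lborel" using borel_measurable_times[OF borel_measurable_integrable[OF i], of pt] by simp
  show "AE x in lborel. norm (indicator ?K x * v x*pt x) <= norm (C*(indicator ?K x * v x))"
   using C by (intro AE_I2) (auto simp: abs_mult indicator_def mult.commute intro: mult_right_mono)
 qed (use i in auto)
 ultimately show ?thesis by simp
qed

lemma weak_local:
 assumes "loc_integrable UNIV f"
 shows "integrable lborel (%y. indicator (ball x r) y*f y)"
proof -
 have i: "integrable lborel (%y. indicator (cball x r) y*f y)" using assms by (auto simp: loc_integrable_def set_integrable_def)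
 have "(%y. indicator (ball x r) y*(indicator (cball x r) y*f y)) = (%y. indicator (ball x r) y*f y)"
  by (auto simp: indicator_def fun_eq_iff)
 moreover have "integrable lborel (%y. indicator (ball x r) y*(indicator (cball x r) y*f y))"
  using integrable_mult_indicator[OF _ i, of "ball x r"] by simp
 ultimately show ?thesis by simp
qed

lemma ennreal_integral_le:
 assumes "f \<in> borel_measurable borel" "k \<in> borel_measurable borel" "!!z. z ~= 0 ==> \<bar>k z\<bar> <= C*K z" "C >= 0" 
  "!!z. K z >= 0" "K \<in> borel_measurable borel" and fg: "!!y. \<bar>f y\<bar> <= g y" "g \<in> borel_measurable borel"
 shows "ennreal \<bar>\<integral>y. f y*k (y - x) \<partial>lborel\<bar> <= ennreal C*(\<integral>\<^sup>+y. ennreal (g y*K (y - x)) \<partial>lborel)"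
proof -
 note [measurable] = assms(1,2,6,8)
 have "ennreal \<bar>\<integral>y. f y*k (y - x) \<partial>lborel\<bar> <= (\<integral>\<^sup>+y. ennreal \<bar>f y*k (y - x)\<bar> \<partial>lborel)"
 proof (cases "integrable lborel (%y. f y*k (y - x))")
  case True
  then show ?thesis using integral_norm_bound_ennreal[OF True] by simp
 qed (simp add: not_integrable_integral_eq)
 also have "... <= (\<integral>\<^sup>+y. ennreal C*ennreal (g y*K (y - x)) \<partial>lborel)"
 proof (rule nn_integral_mono_AE)
  show "AE y in lborel. ennreal \<bar>f y*k (y - x)\<bar> <= ennreal C*ennreal (g y*K (y - x))"
   using AE_lborel_singleton[of x]
  proof eventually_elim
   case (elim y)
   have g0: "g y >= 0" using fg(1)[of y] by linarith
   have "\<bar>f y*k (y - x)\<bar> <= g y*(C*K (y - x))"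
    unfolding abs_mult using elim assms(3)[of "y - x"] fg(1)[of y] g0 by (intro mult_mono) auto
   then show ?case using assms(4,5) g0 by (simp add: ennreal_mult[symmetric] mult_ac ennreal_leI)
  qed
 qed
 also have "... = ennreal C*(\<integral>\<^sup>+y. ennreal (g y*K (y - x)) \<partial>lborel)"
  by (intro nn_integral_cmult) measurable
 finally show ?thesis .
qed

text \<open>The bound is stated with nonnegative, possibly infinite integrals, so that it holds
  before any integrability against the singular kernels is known. The kernels have radius 1, and the
  unit balls in which the representation holds cover the space.\<close>

lemma rep_bound:
 fixes u F :: "real^3 => real" and G :: "3 => real^3 => real"
 assumes u: "loc_integrable UNIV u" "u \<in> borel_measurable borel" and F: "loc_integrable UNIV F" "F \<in> borel_measurable borel"
  and G: "!!j. loc_integrable UNIV (G j)" "!!j. G j \<in> borel_measurable borel"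
  and weak: "!!pt. test_fun UNIV pt ==> 
   (LBINT y. u y*laplacian pt y) = (LBINT y. F y*pt y) + (\<Sum>j\<in>UNIV. \<integral>y. G j y*pd j pt y \<partial>lborel)"
 shows "AE x in lborel. ennreal (cN * \<bar>u x\<bar>) <= ennreal (14*BX)*(\<integral>\<^sup>+y. ennreal (\<bar>u y\<bar>*kb 1 1 (y - x)) \<partial>lborel)
   + ennreal BX*(\<integral>\<^sup>+y. ennreal (\<bar>F y\<bar>*kb 1 1 (y - x)) \<partial>lborel) 
   + (\<Sum>j\<in>UNIV. ennreal (3*BX)*(\<integral>\<^sup>+y. ennreal (\<bar>G j y\<bar>*kb 2 1 (y - x)) \<partial>lborel))" (is "AE x in lborel. ?P x")
proof -
 have "AE x in lborel. x \<in> UNIV --> ?P x"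
 proof (rule AE_cover)
  fix x0 :: "real^3"
  let ?I = "indicator (ball x0 (2*1)) :: real^3 => real"
  have "AE x in lborel. x \<in> ball x0 1 --> cN*(?I x*u x) = (LBINT y. (?I y*u y)*kap 0 1 (y - x))
   - (LBINT y. (?I y*F y)*Ker (A0 1) 0 (y - x)) - (\<Sum>j\<in>UNIV. \<integral>y. (?I y*G j y)*dKer (A0 1) (A0' 1) 0 j (y - x) \<partial>lborel)"
  proof (rule representation)
   fix pt assume t: "test_fun (ball x0 (2*1)) pt"
   have "(%y. (?I y*u y)*laplacian pt y) = (%y. u y*laplacian pt y)" "(%y. (?I y*F y)*pt y) = (%y. F y*pt y)"
    "!!j. (%y. (?I y*G j y)*pd j pt y) = (%y. G j y*pd j pt y)"
    using laplacian_zero_outside[OF t] by (auto simp: indicator_def fun_eq_iff)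
   then show "(LBINT y. (?I y*u y)*laplacian pt y) = (LBINT y. (?I y*F y)*pt y) + (\<Sum>j\<in>UNIV. \<integral>y. (?I y*G j y)*pd j pt y \<partial>lborel)"
    using weak[OF test_fun_mono[OF t]] by simp
  qed (use u F G weak_local in auto)
  then have "AE x in lborel. x \<in> ball x0 1 --> ?P x"
  proof eventually_elim
   case (elim x)
   show ?case
   proof
    assume x: "x \<in> ball x0 1"
    have e: "cN*u x = (LBINT y. (?I y*u y)*kap 0 1 (y - x))
   - (LBINT y. (?I y*F y)*Ker (A0 1) 0 (y - x)) - (\<Sum>j\<in>UNIV. \<integral>y. (?I y*G j y)*dKer (A0 1) (A0' 1) 0 j (y - x) \<partial>lborel)" (is "_ = ?a - ?b - (\<Sum>j\<in>UNIV. ?c j)")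
     using elim x by auto
    have B: "BX >= 0" using BX(1) by simp
    have im: "(%y. ?I y*f y) \<in> borel_measurable borel" if "f \<in> borel_measurable borel" for f
     using that by (intro borel_measurable_times borel_measurable_indicator) auto
    have ib: "\<bar>?I y*f y\<bar> <= \<bar>f y\<bar>" for y and f :: "real^3 => real" by (auto simp: indicator_def)
    have a: "ennreal \<bar>?a\<bar> <= ennreal (14*BX)*(\<integral>\<^sup>+y. ennreal (\<bar>u y\<bar>*kb 1 1 (y - x)) \<partial>lborel)"
     by (rule ennreal_integral_le) (use kap_bound[of 1] B u im ib in auto)
    have b: "ennreal \<bar>?b\<bar> <= ennreal BX*(\<integral>\<^sup>+y. ennreal (\<bar>F y\<bar>*kb 1 1 (y - x)) \<partial>lborel)"
     by (rule ennreal_integral_le) (use Ker_bound[of "A0 1" BX 1] A0_bounds[of 1] A0_zero[of 1] B F im ib in auto)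
    have c: "ennreal \<bar>?c j\<bar> <= ennreal (3*BX)*(\<integral>\<^sup>+y. ennreal (\<bar>G j y\<bar>*kb 2 1 (y - x)) \<partial>lborel)" for j
     by (rule ennreal_integral_le) (use dKer_bound[of "A0 1" BX 1 "A0' 1"] A0_bounds[of 1] A0_zero[of 1] B G im ib in auto)
    have "cN * \<bar>u x\<bar> = \<bar>?a - ?b - (\<Sum>j\<in>UNIV. ?c j)\<bar>" using e cN_pos by (metis abs_mult abs_of_pos)
    also have "... <= \<bar>?a\<bar> + \<bar>?b\<bar> + (\<Sum>j\<in>UNIV. \<bar>?c j\<bar>)" using sum_abs[of ?c UNIV] by linarith
    finally have "ennreal (cN * \<bar>u x\<bar>) <= ennreal (\<bar>?a\<bar> + \<bar>?b\<bar> + (\<Sum>j\<in>UNIV. \<bar>?c j\<bar>))" by (rule ennreal_leI)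
    also have "... = ennreal \<bar>?a\<bar> + ennreal \<bar>?b\<bar> + (\<Sum>j\<in>UNIV. ennreal \<bar>?c j\<bar>)"
     by (simp add: ennreal_plus sum_nonneg sum_ennreal)
    also have "... <= ennreal (14*BX)*(\<integral>\<^sup>+y. ennreal (\<bar>u y\<bar>*kb 1 1 (y - x)) \<partial>lborel)
   + ennreal BX*(\<integral>\<^sup>+y. ennreal (\<bar>F y\<bar>*kb 1 1 (y - x)) \<partial>lborel) 
   + (\<Sum>j\<in>UNIV. ennreal (3*BX)*(\<integral>\<^sup>+y. ennreal (\<bar>G j y\<bar>*kb 2 1 (y - x)) \<partial>lborel))"
     by (intro add_mono sum_mono a b c)
    finally show "?P x" .
   qed
  qed
  then show "\<exists>r>0. AE y in lborel. y \<in> ball x0 r --> ?P y" by (intro exI[of _ 1]) auto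
 qed
 then show ?thesis by simp
qed

text \<open>A local variant of Hardy's inequality with an exponent above 1. The divergence-form
  representation bounds |ph| by the convolution of G with |z|^(-2). Splitting 2 = 5/4 + 3/4 in the
  Cauchy-Schwarz inequality bounds ph^2 by the convolution of G^2 with |z|^(-3/2), because
  |z|^(-5/2) is locally integrable. Integration against |y - x|^(-5/4) then meets the total exponent
  11/4 < 3.\<close>

lemma H1_kernel_bound:
 fixes ph :: "real^3 => real"
 assumes H: "H1_on UNIV ph"
 shows "\<exists>C\<ge>0. \<forall>x. (\<integral>\<^sup>+y. ennreal ((ph y)^2*kb (5/4) 1 (y - x)) \<partial>lborel) <= ennreal C"
proof -
 obtain g where g: "g \<in> borel_measurable borel" "weak_grad_on UNIV ph g" "integrable lborel (%x. (norm (g x))^2)"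
  and p: "ph \<in> borel_measurable borel" "integrable lborel (%x. (ph x)^2)"
  using H by (auto simp: H1_on_def set_integrable_def)
 have gm [measurable]: "(%x. g x $ j) \<in> borel_measurable borel" for j
  using measurable_compose[OF g(1) vec_nth_measurable] by simp
 note [measurable] = p(1) g(1)
 define G where "G y = \<bar>ph y\<bar> + (\<Sum>j\<in>UNIV. \<bar>g y $ j\<bar>)" for y
 have Gm [measurable]: "G \<in> borel_measurable borel" unfolding G_def by measurable
 have G0: "G y >= 0" for y unfolding G_def by (simp add: sum_nonneg)
 have Gb: "(G y)^2 <= 2*(ph y)^2 + 18*(norm (g y))^2" for y
 proof -
  have "(\<Sum>j\<in>UNIV. \<bar>g y $ j\<bar>) <= (\<Sum>j\<in>(UNIV::3 set). norm (g y))" by (intro sum_mono component_le_norm_cart)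
  then have "G y <= \<bar>ph y\<bar> + 3*norm (g y)" unfolding G_def by simp
  then have "(G y)^2 <= (\<bar>ph y\<bar> + 3*norm (g y))^2" using G0 by (intro power_mono)
  also have "... <= 2 * \<bar>ph y\<bar>^2 + 2*(3*norm (g y))^2"
   using sum_squares_bound[of "\<bar>ph y\<bar>" "3*norm (g y)"] by (simp add: power2_sum)
  finally show ?thesis by (simp add: power_mult_distrib)
 qed
 have "integrable lborel (%y. (G y)^2)"
  by (rule Bochner_Integration.integrable_bound[where f="%y. 2*(ph y)^2 + 18*(norm (g y))^2"])
    (use p g Gb in \<open>auto intro: order_trans[OF Gb]\<close>)
 then have GI: "(\<integral>\<^sup>+y. ennreal ((G y)^2) \<partial>lborel) = ennreal (LBINT y. (G y)^2)"
  by (intro nn_integral_eq_integral) auto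
 have "AE x in lborel. ennreal (cN * \<bar>ph x\<bar>) <= ennreal (14*BX)*(\<integral>\<^sup>+y. ennreal (\<bar>ph y\<bar>*kb 1 1 (y - x)) \<partial>lborel)
   + ennreal BX*(\<integral>\<^sup>+y. ennreal (\<bar>(%_. 0) y\<bar>*kb 1 1 (y - x)) \<partial>lborel) 
   + (\<Sum>j\<in>UNIV. ennreal (3*BX)*(\<integral>\<^sup>+y. ennreal (\<bar>- g y $ j\<bar>*kb 2 1 (y - x)) \<partial>lborel))"
 proof (rule rep_bound)
  show "loc_integrable UNIV ph" using g(2) by (simp add: weak_grad_on_def)
  show "loc_integrable UNIV (%x. - g x $ j)" for j using g(2) by (auto simp: weak_grad_on_def loc_integrable_def set_integrable_def)
  show "loc_integrable UNIV (%x. 0)" by (simp add: loc_integrable_def set_integrable_def)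
  fix pt assume t: "test_fun UNIV pt"
  have "(LBINT y. ph y*laplacian pt y) = (\<Sum>j\<in>UNIV. \<integral>y. ph y*pd j (pd j pt) y \<partial>lborel)"
   unfolding laplacian_def sum_distrib_left using g(2)
   by (intro Bochner_Integration.integral_sum test_mult_loc_integrable[where S=UNIV] test_fun_pd t) (simp add: weak_grad_on_def)
  also have "... = (\<Sum>j\<in>UNIV. \<integral>y. - g y $ j*pd j pt y \<partial>lborel)"
   using g(2) test_fun_pd[OF t] by (intro sum.cong) (auto simp: weak_grad_on_def set_lebesgue_integral_def)
  finally show "(LBINT y. ph y*laplacian pt y) = (LBINT y. (%_. 0) y*pt y) + (\<Sum>j\<in>UNIV. \<integral>y. - g y $ j*pd j pt y \<partial>lborel)" by simp
 qed auto
 then have ae: "AE x in lborel. ennreal (cN * \<bar>ph x\<bar>) <= ennreal (23*BX)*(\<integral>\<^sup>+y. ennreal (G y*kb 2 1 (y - x)) \<partial>lborel)"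
 proof eventually_elim
  case (elim x)
  let ?J = "\<integral>\<^sup>+y. ennreal (G y*kb 2 1 (y - x)) \<partial>lborel"
  have 1: "(\<integral>\<^sup>+y. ennreal (\<bar>ph y\<bar>*kb 1 1 (y - x)) \<partial>lborel) <= ?J"
   by (intro nn_integral_mono ennreal_leI mult_mono kb_le_kb) (auto simp: G_def sum_nonneg)
  have 2: "(\<integral>\<^sup>+y. ennreal (\<bar>- g y $ j\<bar>*kb 2 1 (y - x)) \<partial>lborel) <= ?J" for j
  proof (intro nn_integral_mono ennreal_leI mult_mono)
   fix y have "\<bar>g y $ j\<bar> <= (\<Sum>j\<in>UNIV. \<bar>g y $ j\<bar>)" by (rule member_le_sum) auto
   then show "\<bar>- g y $ j\<bar> <= G y" unfolding G_def by simp
  qed (use G0 in auto)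
  have "ennreal (cN * \<bar>ph x\<bar>) <= ennreal (14*BX)*?J + ennreal BX*0 + (\<Sum>j\<in>(UNIV::3 set). ennreal (3*BX)*?J)"
   by (rule order_trans[OF elim]) (intro add_mono sum_mono mult_left_mono 1 2; simp)
  also have "... = (ennreal (14*BX) + ennreal (3*BX) + ennreal (3*BX) + ennreal (3*BX))*?J"
   unfolding sum_3 distrib_right by (simp add: add_ac)
  also have "ennreal (14*BX) + ennreal (3*BX) + ennreal (3*BX) + ennreal (3*BX) = ennreal (23*BX)"
   using BX(1) by (simp flip: ennreal_plus)
  finally show ?case .
 qed
 define D where "D = (23*BX/cN)^2*Kc (5/2)"
 have D0: "D >= 0" unfolding D_def by simp
 have ae2: "AE y in lborel. ennreal ((ph y)^2) <= ennreal D*(\<integral>\<^sup>+z. ennreal ((G z)^2*kb (3/2) 1 (z - y)) \<partial>lborel)"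
  using ae
 proof eventually_elim
  case (elim y)
  let ?J = "\<integral>\<^sup>+z. ennreal (G z*kb 2 1 (z - y)) \<partial>lborel"
  have J: "?J = (\<integral>\<^sup>+z. ennreal (kb (5/4) 1 (z - y))*ennreal (G z*kb (3/4) 1 (z - y)) \<partial>lborel)"
   by (intro nn_integral_cong) (simp add: ennreal_mult[symmetric] G0 mult.left_commute[of "kb _ _ _" "G _"] kb_mult)
  have "?J^2 <= (\<integral>\<^sup>+z. (ennreal (kb (5/4) 1 (z - y)))^2 \<partial>lborel)*(\<integral>\<^sup>+z. (ennreal (G z*kb (3/4) 1 (z - y)))^2 \<partial>lborel)"
   unfolding J by (rule Cauchy_Schwarz_nn_integral) measurable
  also have "... = ennreal (Kc (5/2))*(\<integral>\<^sup>+z. ennreal ((G z)^2*kb (3/2) 1 (z - y)) \<partial>lborel)"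
   by (simp add: ennreal_power kb_sq power_mult_distrib G0 kb_nn)
  finally have J2: "?J^2 <= ennreal (Kc (5/2))*(\<integral>\<^sup>+z. ennreal ((G z)^2*kb (3/2) 1 (z - y)) \<partial>lborel)" .
  have "ennreal ((ph y)^2) = (ennreal (1/cN)*ennreal (cN * \<bar>ph y\<bar>))^2"
   using cN_pos by (simp add: ennreal_mult[symmetric] ennreal_power)
  also have "... <= (ennreal (1/cN)*(ennreal (23*BX)*?J))^2"
   by (intro power_mono mult_left_mono elim) auto
  also have "... = ennreal ((23*BX/cN)^2)*?J^2"
   using cN_pos BX(1) by (simp add: power_mult_distrib ennreal_power ennreal_mult[symmetric] mult.assoc[symmetric] power_divide)
  also have "... <= ennreal ((23*BX/cN)^2)*(ennreal (Kc (5/2))*(\<integral>\<^sup>+z. ennreal ((G z)^2*kb (3/2) 1 (z - y)) \<partial>lborel))"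
   by (intro mult_left_mono J2) auto
  also have "... = ennreal D*(\<integral>\<^sup>+z. ennreal ((G z)^2*kb (3/2) 1 (z - y)) \<partial>lborel)"
   unfolding D_def by (simp add: ennreal_mult mult.assoc)
  finally show ?case .
 qed
 have "(\<integral>\<^sup>+y. ennreal ((ph y)^2*kb (5/4) 1 (y - x)) \<partial>lborel) <= ennreal (D*((LBINT y. (G y)^2)*(2*Kc (11/4))))" for x
 proof -
  have "(\<integral>\<^sup>+y. ennreal ((ph y)^2*kb (5/4) 1 (y - x)) \<partial>lborel) 
    <= (\<integral>\<^sup>+y. ennreal D*(\<integral>\<^sup>+z. ennreal ((G z)^2*(kb (3/2) 1 (z - y)*kb (5/4) 1 (y - x))) \<partial>lborel) \<partial>lborel)"
  proof (rule nn_integral_mono_AE)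
   show "AE y in lborel. ennreal ((ph y)^2*kb (5/4) 1 (y - x)) <= ennreal D*(\<integral>\<^sup>+z. ennreal ((G z)^2*(kb (3/2) 1 (z - y)*kb (5/4) 1 (y - x))) \<partial>lborel)"
    using ae2
   proof eventually_elim
    case (elim y)
    have "ennreal ((ph y)^2*kb (5/4) 1 (y - x)) = ennreal ((ph y)^2)*ennreal (kb (5/4) 1 (y - x))"
     by (simp add: ennreal_mult)
    also have "... <= (ennreal D*(\<integral>\<^sup>+z. ennreal ((G z)^2*kb (3/2) 1 (z - y)) \<partial>lborel))*ennreal (kb (5/4) 1 (y - x))"
     by (intro mult_right_mono elim) auto
    also have "... = ennreal D*(\<integral>\<^sup>+z. ennreal ((G z)^2*(kb (3/2) 1 (z - y)*kb (5/4) 1 (y - x))) \<partial>lborel)"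
     by (simp add: mult.assoc ennreal_mult nn_integral_multc[symmetric])
    finally show ?case .
   qed
  qed
  also have "... = ennreal D*(\<integral>\<^sup>+y. \<integral>\<^sup>+z. ennreal ((G z)^2*(kb (3/2) 1 (z - y)*kb (5/4) 1 (y - x))) \<partial>lborel \<partial>lborel)"
   by (intro nn_integral_cmult) measurable
  also have "(\<integral>\<^sup>+y. \<integral>\<^sup>+z. ennreal ((G z)^2*(kb (3/2) 1 (z - y)*kb (5/4) 1 (y - x))) \<partial>lborel \<partial>lborel)
    = (\<integral>\<^sup>+z. \<integral>\<^sup>+y. ennreal ((G z)^2*(kb (3/2) 1 (z - y)*kb (5/4) 1 (y - x))) \<partial>lborel \<partial>lborel)"
   by (rule lborel_pair.Fubini') measurable
  also have "... <= (\<integral>\<^sup>+z. ennreal ((G z)^2)*ennreal (2*Kc (11/4)) \<partial>lborel)"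
  proof (rule nn_integral_mono)
   fix z
   have "(\<integral>\<^sup>+y. ennreal ((G z)^2*(kb (3/2) 1 (z - y)*kb (5/4) 1 (y - x))) \<partial>lborel)
    = ennreal ((G z)^2)*(\<integral>\<^sup>+y. ennreal (kb (3/2) 1 (z - y)*kb (5/4) 1 (y - x)) \<partial>lborel)"
    by (simp add: ennreal_mult nn_integral_cmult)
   also have "(\<integral>\<^sup>+y. ennreal (kb (3/2) 1 (z - y)*kb (5/4) 1 (y - x)) \<partial>lborel) <= (\<integral>\<^sup>+y. ennreal (kb (11/4) 1 (y - z)) + ennreal (kb (11/4) 1 (y - x)) \<partial>lborel)"
   proof (intro nn_integral_mono)
    fix y
    have "kb (3/2) 1 (z - y)*kb (5/4) 1 (y - x) <= kb (3/2 + 5/4) 1 (z - y) + kb (3/2 + 5/4) 1 (y - x)" by (rule kb_mult_le) auto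
    then show "ennreal (kb (3/2) 1 (z - y)*kb (5/4) 1 (y - x)) <= ennreal (kb (11/4) 1 (y - z)) + ennreal (kb (11/4) 1 (y - x))"
     by (simp add: kb_minus[of _ _ z y] ennreal_plus[symmetric] ennreal_leI del: ennreal_plus)
   qed
   also have "... = ennreal (2*Kc (11/4))"
    by (subst nn_integral_add) (auto simp: kb_nn ennreal_plus[symmetric] simp del: ennreal_plus)
   finally show "(\<integral>\<^sup>+y. ennreal ((G z)^2*(kb (3/2) 1 (z - y)*kb (5/4) 1 (y - x))) \<partial>lborel) <= ennreal ((G z)^2)*ennreal (2*Kc (11/4))"
    by (simp add: mult_left_mono)
  qed
  also have "... = ennreal ((LBINT y. (G y)^2)*(2*Kc (11/4)))"
   by (simp add: nn_integral_multc GI ennreal_mult)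
  finally show ?thesis using D0 by (simp add: ennreal_mult mult_left_mono)
 qed
 then show ?thesis using D0 by (intro exI[of _ "D*((LBINT y. (G y)^2)*(2*Kc (11/4)))"]) auto
qed

lemma test_fun_measurable:
 assumes "test_fun S pt"
 shows "pt \<in> borel_measurable borel" "laplacian pt \<in> borel_measurable borel"
proof -
 show "pt \<in> borel_measurable borel" using test_fun_continuous[OF assms] by (intro borel_measurable_continuous_onI)
 have "continuous_on UNIV (laplacian pt)" unfolding laplacian_def[abs_def]
  by (intro continuous_intros test_fun_continuous[OF test_fun_pd[OF test_fun_pd[OF assms]]])
 then show "laplacian pt \<in> borel_measurable borel" by (intro borel_measurable_continuous_onI)
qed

lemma wlap_cong_AE:
 assumes "wlap S u F" and [measurable]: "u \<in> borel_measurable borel" "F \<in> borel_measurable borel" "u' \<in> borel_measurable borel" "F' \<in> borel_measurable borel"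
  and ae: "AE y in lborel. y \<in> S --> u y = u' y & F y = F' y"
 shows "wlap S u' F'"
 unfolding wlap_def
proof (intro allI impI)
 fix pt assume t: "test_fun S pt"
 note [measurable] = test_fun_measurable[OF t]
 note z = laplacian_zero_outside[OF t]
 have "(LBINT y. u y*laplacian pt y) = (LBINT y. u' y*laplacian pt y)"
  using ae by (intro integral_cong_AE) (auto elim!: eventually_mono simp: z(1))
 moreover have "(LBINT y. F y*pt y) = (LBINT y. F' y*pt y)"
  using ae by (intro integral_cong_AE) (auto elim!: eventually_mono simp: z(2))
 ultimately show "(LBINT y. u' y*laplacian pt y) = (LBINT y. F' y*pt y)"
  using assms(1) t by (simp add: wlap_def)
qed

text \<open>Local continuous representatives come from \<open>interior_gradient\<close>. Two of them
  agree on overlapping balls, since they agree there almost everywhere, so taking at each point the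
  value of the one chosen for that point gives a continuous function.\<close>

lemma cont_rep:
 fixes u F :: "real^3 => real"
 assumes S: "open S" and m: "u \<in> borel_measurable borel" "F \<in> borel_measurable borel" and w: "wlap S u F"
  and loc: "!!x. x \<in> S ==> \<exists>r>0. \<exists>B. ball x r \<subseteq> S & (AE y in lborel. y \<in> ball x r --> \<bar>u y\<bar> <= B & \<bar>F y\<bar> <= B)"
 shows "\<exists>v. continuous_on S v & v \<in> borel_measurable borel & (AE y in lborel. y \<in> S --> u y = v y)"
proof -
 have "\<exists>r v. r > 0 & ball x r \<subseteq> S & continuous_on UNIV v & (AE y in lborel. y \<in> ball x r --> u y = v y)" if x: "x \<in> S" for x
 proof -
  obtain r B where r: "r > 0" "ball x r \<subseteq> S" and B: "AE y in lborel. y \<in> ball x r --> \<bar>u y\<bar> <= B & \<bar>F y\<bar> <= B"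
   using loc[OF x] by blast
  define B' where "B' = \<bar>B\<bar>"
  have B': "B' >= 0" by (simp add: B'_def)
  \<comment> \<open>The bounds hold only almost everywhere, whereas \<open>interior_gradient\<close>
    asks for them at every point; clamping changes u and F only on a null set of the ball.\<close>
  let ?c = "%t. max (- B') (min B' t)"
  have cb: "\<bar>?c t\<bar> <= B'" for t using B' by (auto simp: max_def min_def)
  have ae: "AE y in lborel. y \<in> ball x r --> u y = ?c (u y) & F y = ?c (F y)"
   using B by eventually_elim (auto simp: B'_def max_def min_def)
  have mc: "(%y. ?c (u y)) \<in> borel_measurable borel" "(%y. ?c (F y)) \<in> borel_measurable borel"
   using m by measurable
  have "wlap (ball x (2*(r/2))) (%y. ?c (u y)) (%y. ?c (F y))"
   by (rule wlap_cong_AE[OF wlap_mono[OF w] m mc]) (use ae r in auto)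
  from interior_gradient[OF _ mc cb cb this] r
  obtain v where v: "continuous_on UNIV v" "AE y in lborel. y \<in> ball x (r/2) --> ?c (u y) = v y" by (auto simp del: max_less_iff_conj)
  have "AE y in lborel. y \<in> ball x (r/2) --> u y = v y"
   using ae v(2) by eventually_elim (use r in auto)
  moreover have "ball x (r/2) \<subseteq> S" using r by (auto simp: subset_iff)
  ultimately show ?thesis using v(1) r(1) by (intro exI[of _ "r/2"] exI[of _ v]) simp
 qed
 then have "\<forall>x\<in>S. \<exists>rv. fst rv > 0 & ball x (fst rv) \<subseteq> S & continuous_on UNIV (snd rv) & (AE y in lborel. y \<in> ball x (fst rv) --> u y = snd rv y)"
  by fastforce
 from bchoice[OF this] obtain f where f: "\<forall>x\<in>S. fst (f x) > 0 & ball x (fst (f x)) \<subseteq> S & continuous_on UNIV (snd (f x)) & (AE y in lborel. y \<in> ball x (fst (f x)) --> u y = snd (f x) y)" by blast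
 define r where "r x = fst (f x)" for x
 define v where "v x = snd (f x)" for x
 have rv: "r x > 0 & ball x (r x) \<subseteq> S & continuous_on UNIV (v x) & (AE y in lborel. y \<in> ball x (r x) --> u y = v x y)" if "x \<in> S" for x
  using f that unfolding r_def v_def by blast
 define V where "V x = (if x \<in> S then v x x else 0)" for x
 have eq: "V y = v x y" if x: "x \<in> S" and y: "y \<in> ball x (r x)" for x y
 proof -
  have yS: "y \<in> S" using rv[OF x] y by blast
  have "v y y = v x y"
  proof (rule AE_eq_continuous_on[where S="ball x (r x) \<inter> ball y (r y)" and f="v y" and g="v x" and x=y])
   show "AE z in lborel. z \<in> ball x (r x) \<inter> ball y (r y) --> v y z = v x z"
    using rv[OF x, THEN conjunct2, THEN conjunct2, THEN conjunct2] rv[OF yS, THEN conjunct2, THEN conjunct2, THEN conjunct2]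
    by eventually_elim auto
  qed (use rv[OF x] rv[OF yS] y in \<open>auto intro: continuous_on_subset\<close>)
  then show ?thesis using yS by (simp add: V_def)
 qed
 have c: "continuous_on S V"
  unfolding continuous_on_eq_continuous_at[OF S]
 proof
  fix x assume x: "x \<in> S"
  have "continuous_on (ball x (r x)) V"
   by (subst continuous_on_cong[OF refl eq[OF x]]) (use rv[OF x] in \<open>auto intro: continuous_on_subset\<close>)
  then show "isCont V x" using rv[OF x] by (auto simp: continuous_on_eq_continuous_at)
 qed
 moreover have "V \<in> borel_measurable borel"
 proof -
  have "V = (%y. if y \<in> S then V y else 0)" by (auto simp: V_def)
  then show ?thesis using borel_measurable_continuous_on_if[of S V "%_. 0"] c S by auto
 qed
 moreover have "AE y in lborel. y \<in> S --> u y = V y"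
 proof (rule AE_cover)
  fix x assume x: "x \<in> S"
  have "AE y in lborel. y \<in> ball x (r x) --> u y = v x y" using rv[OF x] by blast
  then have "AE y in lborel. y \<in> ball x (r x) --> u y = V y" by eventually_elim (use eq[OF x] in auto)
  then show "\<exists>r>0. AE y in lborel. y \<in> ball x r --> u y = V y" using rv[OF x] by blast
 qed
 ultimately show ?thesis by blast
qed

lemma AE_le_continuous_on:
 fixes f :: "real^3 => real"
 assumes "open S" "continuous_on S f" "AE x in lborel. x \<in> S --> \<bar>f x\<bar> <= B" "x \<in> S"
 shows "\<bar>f x\<bar> <= B"
proof -
 have "max \<bar>f x\<bar> B = (%_. B) x"
 proof (rule AE_eq_continuous_on[OF assms(1), where f="%x. max \<bar>f x\<bar> B" and g="%_. B" and x=x])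
  show "AE x in lborel. x \<in> S --> max \<bar>f x\<bar> B = B" using assms(3) by eventually_elim auto
 qed (use assms in \<open>auto intro!: continuous_intros\<close>)
 then show ?thesis by linarith
qed

lemma mk_half_0: "mk (1/2) 0 z = 1/norm z"
proof (cases "z = 0")
 case False
 then have "mk (1/2) 0 z = (norm z powr 2) powr (- (1/2))" by (simp add: mk_def powr_numeral)
 also have "... = norm z powr (- 1)" unfolding powr_powr by simp
 finally show ?thesis using False by (simp add: powr_minus_divide)
qed (simp add: mk_def)

text \<open>With 1/sqrt(|x - y|^2 + de^2) in place of 1/|x - y| both derivatives move over by
  classical integration by parts. The Laplacian of this kernel is -3 de^2 times the power with
  exponent -5/2, which rescales to \<open>pk\<close>. The test function supplies the compact
  support, so no cutoff is inserted.\<close>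

lemma newton_potential:
 assumes t: "test_fun UNIV pt"
 shows "(LBINT x. laplacian pt x/norm (x - y)) = - cN*pt y"
  "integrable lborel (%x. laplacian pt x/norm (x - y))"
proof -
 define d where "d n = 1/(real n + 1)" for n
 have d: "d \<longlonglongrightarrow> 0" "!!n. d n > 0"
  using LIMSEQ_inverse_real_of_nat unfolding d_def by (simp_all add: inverse_eq_divide add.commute)
 note m [measurable] = test_fun_measurable[OF t]
 have cL: "continuous_on UNIV (laplacian pt)" unfolding laplacian_def[abs_def]
  by (intro continuous_intros test_fun_continuous[OF test_fun_pd[OF test_fun_pd[OF t]]])
 obtain rh1 where rh1: "!!x. norm x > rh1 ==> pt x = 0" using test_fun_support[OF t] by blast
 have "\<forall>j. \<exists>rh. \<forall>x. norm x > rh --> pd j (pd j pt) x = 0" using test_fun_support[OF test_fun_pd[OF test_fun_pd[OF t]]] by blast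
 then obtain rh where rh: "!!j x. norm x > rh j ==> pd j (pd j pt) x = 0" by metis
 define rh2 where "rh2 = max (rh 1) (max (rh 2) (rh 3))"
 have L0: "laplacian pt x = 0" if "norm x > rh2" for x
  using that rh[of 1 x] rh[of 2 x] rh[of 3 x] unfolding laplacian_def sum_3 rh2_def by simp
 obtain C where C: "C >= 0" "!!x. \<bar>laplacian pt x\<bar> <= C" using compact_support_bounded[OF cL L0] by blast
 obtain C' where C': "C' >= 0" "!!x. \<bar>pt x\<bar> <= C'" using compact_support_bounded[OF test_fun_continuous[OF t] rh1] by blast
 define r where "r = max 1 (rh2 + norm y)"
 have bd: "\<bar>laplacian pt x*mk (1/2) de (x - y)\<bar> <= C*kb 1 r (x - y)" if "x ~= y" for x de
 proof (cases "norm (x - y) <= r")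
  case True
  have "\<bar>laplacian pt x*mk (1/2) de (x - y)\<bar> <= C*norm (x - y) powr (- (2*(1/2)))"
   unfolding abs_mult using C(2)[of x] mk_le[of "x - y" "1/2" de] that C(1) by (intro mult_mono) auto
  then show ?thesis using True by (simp add: kb_def)
 next
  case False
  have "norm x > rh2" using False norm_triangle_ineq4[of x y] unfolding r_def by simp
  then show ?thesis using L0 False by (simp add: kb_def)
 qed
 have kI: "integrable lborel (%x. C*kb 1 r (x - y))"
  using integrable_shift3(1)[OF kb_integrable(1)[of 1 r], of y] by (simp add: r_def)
 have "(%n. \<integral>x. laplacian pt x*mk (1/2) (d n) (x - y) \<partial>lborel) \<longlonglongrightarrow> (LBINT x. laplacian pt x*mk (1/2) 0 (x - y))"
 proof (rule integral_dominated_convergence[where w="%x. C*kb 1 r (x - y)"])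
  show "AE x in lborel. (%n. laplacian pt x*mk (1/2) (d n) (x - y)) \<longlonglongrightarrow> laplacian pt x*mk (1/2) 0 (x - y)"
   using AE_lborel_singleton[of y] by eventually_elim (intro tendsto_intros mk_tendsto d; simp)
  show "AE x in lborel. norm (laplacian pt x*mk (1/2) (d n) (x - y)) <= C*kb 1 r (x - y)" for n
   using AE_lborel_singleton[of y] by eventually_elim (use bd in simp)
 qed (use kI in auto)
 moreover have "(%n. \<integral>x. laplacian pt x*mk (1/2) (d n) (x - y) \<partial>lborel) \<longlonglongrightarrow> - cN*pt y"
 proof -
  have "(LBINT x. laplacian pt x*mk (1/2) (d n) (x - y)) = - (LBINT w. pk w*pt (y + d n *\<^sub>R w))" for n
  proof -
   have dn: "d n ~= 0" using d(2)[of n] by simp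
   let ?v = "%x. mk (1/2) (d n) (x - y)"
   let ?v1 = "%j x. - (2*(1/2))*(x - y) $ j*mk (1/2 + 1) (d n) (x - y)"
   let ?v2 = "%j x. - mk (3/2) (d n) (x - y) + 3*((x - y) $ j)^2*mk (5/2) (d n) (x - y)"
   have c: "continuous_on UNIV (%x. mk a (d n) (x - y))" for a
    by (rule continuous_on_compose2[OF mk_continuous[OF dn, of a]]) (auto intro!: continuous_intros)
   have v1: "has_pd ?v j x (?v1 j x)" for j x by (rule has_pd_mk[OF dn])
   have v2: "has_pd (?v1 j) j x (?v2 j x)" for j x
   proof -
    have "has_pd (%x. - 1/2*(2*(x - y) $ j)) j x (- 1/2*2)" by (intro has_pd_cmult has_pd_zj)
    from has_pd_mult[OF this has_pd_mk[OF dn, of "3/2" y j x]]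
    show ?thesis by (simp add: power2_eq_square algebra_simps)
   qed
   have "(LBINT x. laplacian pt x*mk (1/2) (d n) (x - y)) = (\<Sum>j\<in>UNIV. \<integral>x. ?v x*pd j (pd j pt) x \<partial>lborel)"
   proof -
    have "(%x. laplacian pt x*?v x) = (%x. \<Sum>j\<in>UNIV. ?v x*pd j (pd j pt) x)"
     by (intro ext) (simp only: laplacian_def sum_distrib_right, intro sum.cong refl mult.commute)
    then show ?thesis
     by (simp only:) (intro Bochner_Integration.integral_sum test_mult_integrable[OF open_UNIV c] test_fun_pd t)
   qed
   also have "... = (\<Sum>j\<in>UNIV. \<integral>x. ?v2 j x*pt x \<partial>lborel)"
   proof (intro sum.cong refl)
    fix j :: 3
    have "(LBINT x. ?v x*pd j (pd j pt) x) = - (LBINT x. ?v1 j x*pd j pt x)"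
     by (rule ibp[OF open_UNIV]) (use c v1 test_fun_pd[OF t] in \<open>auto intro!: continuous_intros\<close>)
    also have "(LBINT x. ?v1 j x*pd j pt x) = - (LBINT x. ?v2 j x*pt x)"
     by (rule ibp[OF open_UNIV]) (use c v2 t in \<open>auto intro!: continuous_intros\<close>)
    finally show "(LBINT x. ?v x*pd j (pd j pt) x) = (LBINT x. ?v2 j x*pt x)" by simp
   qed
   also have "... = (LBINT x. (\<Sum>j\<in>UNIV. ?v2 j x*pt x))"
    by (intro Bochner_Integration.integral_sum[symmetric] test_mult_integrable[OF open_UNIV _ t] continuous_intros c)
   also have "... = (LBINT x. - (3*(d n)^2*mk (5/2) (d n) (x - y))*pt x)"
   proof (rule Bochner_Integration.integral_cong[OF refl])
    fix x
    define z where "z = x - y"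
    have "(norm z)^2 + (d n)^2 > 0" using dn by (simp add: add_nonneg_pos)
    then have "mk (5/2) (d n) z*((norm z)^2 + (d n)^2) = ((norm z)^2 + (d n)^2) powr (- (5/2) + 1)"
     unfolding mk_def by (subst powr_add) simp
    then have m35: "mk (3/2) (d n) z = mk (5/2) (d n) z*((z$1)^2 + (z$2)^2 + (z$3)^2 + (d n)^2)"
     unfolding norm_sq3[symmetric] by (simp add: mk_def)
    have "(\<Sum>j\<in>UNIV. (- mk (3/2) (d n) z + 3*(z $ j)^2*mk (5/2) (d n) z)*pt x) = - (3*(d n)^2*mk (5/2) (d n) z)*pt x"
     unfolding sum_3 m35 by (simp add: algebra_simps)
    then show "(\<Sum>j\<in>UNIV. ?v2 j x*pt x) = - (3*(d n)^2*mk (5/2) (d n) (x - y))*pt x" by (simp only: z_def)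
   qed
   also have "... = \<bar>d n\<bar>^3*(LBINT w. - (3*(d n)^2*mk (5/2) (d n) (y + d n *\<^sub>R w - y))*pt (y + d n *\<^sub>R w))"
    by (rule integral_affine3) (use dn in auto)
   also have "... = (LBINT w. - (pk w*pt (y + d n *\<^sub>R w)))"
   proof -
    have "(d n)^3*(3*(d n)^2*mk (5/2) (d n) (d n *\<^sub>R w)) = pk w" for w
    proof -
     have "(norm (d n *\<^sub>R w))^2 + (d n)^2 = (d n)^2*(1 + (norm w)^2)" by (simp add: power_mult_distrib algebra_simps)
     then have "mk (5/2) (d n) (d n *\<^sub>R w) = ((d n)^2*(1 + (norm w)^2)) powr (- (5/2))" unfolding mk_def by presburger
     also have "... = ((d n)^2) powr (- (5/2))*(1 + (norm w)^2) powr (- (5/2))" by (rule powr_mult)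
     also have "((d n)^2) powr (- (5/2)) = (d n powr 2) powr (- (5/2))" using d(2)[of n] by (simp add: powr_numeral)
     also have "... = 1/(d n)^5" using d(2)[of n] unfolding powr_powr by (simp add: powr_minus_divide powr_numeral)
     finally have mm: "mk (5/2) (d n) (d n *\<^sub>R w) = 1/(d n)^5*(1 + (norm w)^2) powr (-5/2)" by simp
     have dd: "(d n)^3*(d n)^2*(1/(d n)^5) = 1" using dn by (simp flip: power_add)
     have "(d n)^3*(3*(d n)^2*mk (5/2) (d n) (d n *\<^sub>R w)) = ((d n)^3*(d n)^2*(1/(d n)^5))*pk w"
      unfolding mm pk_def by (simp only: mult_ac)
     then show ?thesis unfolding dd by simp
    qed
    then have e: "\<bar>d n\<bar>^3*(- (3*(d n)^2*mk (5/2) (d n) (y + d n *\<^sub>R w - y))*pt (y + d n *\<^sub>R w)) = - (pk w*pt (y + d n *\<^sub>R w))" for w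
     using d(2)[of n] by (simp add: abs_of_pos) (metis (no_types, lifting) mult.assoc mult.left_commute)
    show ?thesis by (subst integral_mult_right_zero[symmetric]) (simp only: e)
   qed
   finally show ?thesis by simp
  qed
  moreover have "(%n. \<integral>w. pk w*pt (y + d n *\<^sub>R w) \<partial>lborel) \<longlonglongrightarrow> (LBINT w. pk w*pt y)"
  proof (rule integral_dominated_convergence[where w="%w. C'*pk w"])
   show "AE w in lborel. (%n. pk w*pt (y + d n *\<^sub>R w)) \<longlonglongrightarrow> pk w*pt y"
   proof (intro AE_I2 tendsto_intros)
    fix w :: "real^3"
    have "(%n. y + d n *\<^sub>R w) \<longlonglongrightarrow> y + 0 *\<^sub>R w" by (intro tendsto_intros d)
    then show "(%n. pt (y + d n *\<^sub>R w)) \<longlonglongrightarrow> pt y"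
     using test_fun_continuous[OF t, of UNIV] by (intro isCont_tendsto_compose[of _ pt]) (auto simp: continuous_on_eq_continuous_at)
   qed
   show "AE w in lborel. norm (pk w*pt (y + d n *\<^sub>R w)) <= C'*pk w" for n
    using C'(2) pk_pos by (intro AE_I2) (simp add: abs_mult mult.commute less_imp_le mult_right_mono abs_of_pos)
  qed (use pk_integrable in auto)
  ultimately show ?thesis using tendsto_minus by (fastforce simp: cN_def)
 qed
 ultimately show "(LBINT x. laplacian pt x/norm (x - y)) = - cN*pt y"
  using LIMSEQ_unique by (fastforce simp: mk_half_0)
 have "integrable lborel (%x. laplacian pt x*mk (1/2) 0 (x - y))"
 proof (rule Bochner_Integration.integrable_bound[OF kI])
  show "AE x in lborel. norm (laplacian pt x*mk (1/2) 0 (x - y)) <= norm (C*kb 1 r (x - y))"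
   using AE_lborel_singleton[of y] by eventually_elim (use bd C in simp)
 qed auto
 then show "integrable lborel (%x. laplacian pt x/norm (x - y))" by (simp add: mk_half_0)
qed

section \<open>Regularity of Hartree-Fock orbitals\<close>

text \<open>Names of the unknowns of the quadratic system: the constant 1, the Coulomb potential,
  the orbitals and the potentials of products of two orbitals. The constant makes the eigenvalue
  term quadratic as well.\<close>

datatype hfidx = One | Pot | Ph nat | Wf nat nat

lemma abs_mult_le_squares: "\<bar>a\<bar> * \<bar>b\<bar> <= a^2 + (b::real)^2"
 using sum_squares_bound[of "\<bar>a\<bar>" "\<bar>b\<bar>"] mult_nonneg_nonneg[OF abs_ge_zero[of a] abs_ge_zero[of b]]
 unfolding mult.assoc power2_abs by linarith

locale hf =
 fixes M N :: nat and Z :: "nat => real" and R :: "nat => real^3" and ph :: "nat => real^3 => real" and lam :: "nat => real"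
 assumes HF: "HF_solution M Z R N ph lam"
begin

lemma H1: "i < N ==> H1_on UNIV (ph i)"
 using HF by (simp add: HF_solution_def)

lemma phi_measurable: "i < N ==> ph i \<in> borel_measurable borel"
 using H1 by (simp add: H1_on_def)

lemma phi_sq: "i < N ==> integrable lborel (%x. (ph i x)^2)"
 using H1 by (simp add: H1_on_def set_integrable_def)

lemma phi_loc: "i < N ==> loc_integrable UNIV (ph i)"
 using H1 by (auto simp: H1_on_def weak_grad_on_def)

lemma rho_eq: "hf_rho N ph y = (\<Sum>i<N. (ph i y)^2)"
 by (simp add: hf_rho_def hf_tau_def power2_eq_square)

definition w :: "nat => nat => real^3 => real" where
 "w i j x = (LBINT y. ph i y*ph j y/norm (x - y))"

lemma prod_le_rho: "i < N ==> j < N ==> \<bar>ph i y*ph j y\<bar> <= hf_rho N ph y"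
proof -
 assume ij: "i < N" "j < N"
 have 1: "(ph i y)^2 <= hf_rho N ph y" "(ph j y)^2 <= hf_rho N ph y"
  unfolding rho_eq using ij by (auto intro!: member_le_sum)
 have "2 * \<bar>ph i y\<bar> * \<bar>ph j y\<bar> <= \<bar>ph i y\<bar>^2 + \<bar>ph j y\<bar>^2" by (rule sum_squares_bound)
 then show ?thesis using 1 by (simp add: abs_mult)
qed

lemma w_integrable: "i < N ==> j < N ==> integrable lborel (%y. ph i y*ph j y/norm (x - y))"
proof -
 assume ij: "i < N" "j < N"
 have "integrable lborel (%y. hf_rho N ph y/norm (x - y))" using HF by (simp add: HF_solution_def)
 then show ?thesis
 proof (rule Bochner_Integration.integrable_bound)
  show "(%y. ph i y*ph j y/norm (x - y)) \<in> borel_measurable lborel"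
   using phi_measurable[OF ij(1)] phi_measurable[OF ij(2)] by measurable
  show "AE y in lborel. norm (ph i y*ph j y/norm (x - y)) <= norm (hf_rho N ph y/norm (x - y))"
  proof (rule AE_I2)
   fix y
   have "\<bar>ph i y*ph j y\<bar> <= \<bar>hf_rho N ph y\<bar>" using prod_le_rho[OF ij, of y] by linarith
   then show "norm (ph i y*ph j y/norm (x - y)) <= norm (hf_rho N ph y/norm (x - y))"
    by (simp add: abs_divide divide_right_mono)
  qed
 qed
qed

lemma hartree_eq: "hartree N ph x = (\<Sum>j<N. w j j x)"
 unfolding hartree_def rho_eq w_def sum_divide_distrib
 using w_integrable by (subst Bochner_Integration.integral_sum) (auto simp: power2_eq_square)

lemma exchange_eq: "i < N ==> exchange N ph i x = (\<Sum>j<N. w j i x*ph j x)"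
proof -
 assume i: "i < N"
 have "exchange N ph i x = (LBINT y. (\<Sum>j<N. ph j x*(ph j y*ph i y/norm (x - y))))"
  unfolding exchange_def hf_tau_def sum_divide_distrib sum_distrib_right
  by (intro Bochner_Integration.integral_cong refl sum.cong) simp
 also have "... = (\<Sum>j<N. ph j x*w j i x)"
 proof -
  have "(LBINT y. (\<Sum>j<N. ph j x*(ph j y*ph i y/norm (x - y)))) = (\<Sum>j<N. \<integral>y. ph j x*(ph j y*ph i y/norm (x - y)) \<partial>lborel)"
   by (intro Bochner_Integration.integral_sum integrable_mult_right w_integrable i) simp
  then show ?thesis unfolding w_def integral_mult_right_zero .
 qed
 finally show ?thesis by (simp add: mult.commute)
qed

lemma w_measurable: "i < N ==> j < N ==> w i j \<in> borel_measurable borel"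
proof -
 assume ij: "i < N" "j < N"
 note [measurable] = phi_measurable[OF ij(1)] phi_measurable[OF ij(2)]
 have "(%x. \<integral>y. ph i y*ph j y/norm (x - y) \<partial>lborel) \<in> borel_measurable lborel"
  by (rule lborel.borel_measurable_lebesgue_integral) measurable
 then show ?thesis by (simp add: w_def[abs_def])
qed

lemma CS_ex: "\<exists>C\<ge>0. \<forall>i<N. \<forall>x. integrable lborel (%y. (ph i y)^2*kb (5/4) 1 (y - x)) & (LBINT y. (ph i y)^2*kb (5/4) 1 (y - x)) <= C"
proof -
 have "\<forall>i. \<exists>C\<ge>0. i < N --> (\<forall>x. (\<integral>\<^sup>+y. ennreal ((ph i y)^2*kb (5/4) 1 (y - x)) \<partial>lborel) <= ennreal C)"
 proof
  fix i show "\<exists>C\<ge>0. i < N --> (\<forall>x. (\<integral>\<^sup>+y. ennreal ((ph i y)^2*kb (5/4) 1 (y - x)) \<partial>lborel) <= ennreal C)"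
   by (cases "i < N") (use H1_kernel_bound[OF H1, of i] in blast, auto)
 qed
 from choice[OF this] obtain C where "\<forall>i. C i >= 0 & (i < N --> (\<forall>x. (\<integral>\<^sup>+y. ennreal ((ph i y)^2*kb (5/4) 1 (y - x)) \<partial>lborel) <= ennreal (C i)))" ..
 then have C: "!!i. C i >= 0" "!!i x. i < N ==> (\<integral>\<^sup>+y. ennreal ((ph i y)^2*kb (5/4) 1 (y - x)) \<partial>lborel) <= ennreal (C i)"
  by auto
 have "integrable lborel (%y. (ph i y)^2*kb (5/4) 1 (y - x)) & (LBINT y. (ph i y)^2*kb (5/4) 1 (y - x)) <= (\<Sum>i<N. C i)" if i: "i < N" for i x
 proof
  note [measurable] = phi_measurable[OF i]
  show I: "integrable lborel (%y. (ph i y)^2*kb (5/4) 1 (y - x))"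
   using C(2)[OF i, of x] by (intro integrableI_nonneg) (auto simp: less_top[symmetric] top_unique)
  have "ennreal (LBINT y. (ph i y)^2*kb (5/4) 1 (y - x)) <= ennreal (C i)"
   using C(2)[OF i, of x] nn_integral_eq_integral[OF I] by simp
  then have "(LBINT y. (ph i y)^2*kb (5/4) 1 (y - x)) <= C i" using C(1) by (simp add: ennreal_le_iff)
  also have "... <= (\<Sum>i<N. C i)" using i C(1) by (intro member_le_sum) auto
  finally show "(LBINT y. (ph i y)^2*kb (5/4) 1 (y - x)) <= (\<Sum>i<N. C i)" .
 qed
 then show ?thesis using C(1) by (intro exI[of _ "\<Sum>i<N. C i"]) (auto intro: sum_nonneg)
qed

lemma phi_norm: "i < N ==> (LBINT y. (ph i y)^2) = 1"
 using HF by (auto simp: HF_solution_def power2_eq_square)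

lemma inv_norm_le: "1/norm z <= kb (5/4) 1 z + (1::real)"
proof (cases "z = 0 \<or> norm z > 1")
 case True
 then show ?thesis by (auto simp: kb_def divide_le_eq)
next
 case False
 then have "norm z powr (-1) <= norm z powr (- (5/4))" by (intro powr_mono') auto
 then show ?thesis using False by (simp add: kb_def powr_minus_divide)
qed

text \<open>The pole is dominated by 1/|q| <= |q|^(-5/4) + 1 with the power truncated at radius 1:
  the first part is controlled by \<open>H1_kernel_bound\<close>, the second by the normalisation of
  the orbitals.\<close>

lemma w_bounded: "\<exists>C\<ge>0. \<forall>i<N. \<forall>j<N. \<forall>x. \<bar>w i j x\<bar> <= C"
proof -
 obtain C where C: "C >= 0" "!!i x. i < N ==> integrable lborel (%y. (ph i y)^2*kb (5/4) 1 (y - x))"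
   "!!i x. i < N ==> (LBINT y. (ph i y)^2*kb (5/4) 1 (y - x)) <= C"
  using CS_ex by blast
 have "\<bar>w i j x\<bar> <= 2*(C + 1)" if ij: "i < N" "j < N" for i j x
 proof -
  let ?g = "%y. ((ph i y)^2*kb (5/4) 1 (y - x) + (ph i y)^2) + ((ph j y)^2*kb (5/4) 1 (y - x) + (ph j y)^2)"
  have gi: "integrable lborel ?g" using C(2) phi_sq ij by simp
  have "\<bar>w i j x\<bar> <= (LBINT y. \<bar>ph i y*ph j y/norm (x - y)\<bar>)" unfolding w_def by (rule integral_abs_bound)
  also have "... <= (LBINT y. ?g y)"
  proof (rule integral_mono)
   fix y
   have "\<bar>ph i y*ph j y\<bar> <= (ph i y)^2 + (ph j y)^2" unfolding abs_mult by (rule abs_mult_le_squares)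
   then have "\<bar>ph i y*ph j y\<bar>*(1/norm (y - x)) <= ((ph i y)^2 + (ph j y)^2)*(kb (5/4) 1 (y - x) + 1)"
    using inv_norm_le[of "y - x"] by (intro mult_mono) auto
   then show "\<bar>ph i y*ph j y/norm (x - y)\<bar> <= ?g y"
    by (simp add: abs_divide norm_minus_commute algebra_simps)
   show "integrable lborel (%y. \<bar>ph i y*ph j y/norm (x - y)\<bar>)" by (rule integrable_abs[OF w_integrable[OF ij]])
  qed (rule gi)
  also have "... <= 2*(C + 1)" using C(2) phi_sq phi_norm ij C(3)[OF ij(1), of x] C(3)[OF ij(2), of x] by simp
  finally show ?thesis .
 qed
 then show ?thesis using C(1) by (intro exI[of _ "2*(C + 1)"]) auto
qed

definition F :: "nat => real^3 => real" where
 "F i x = coulomb_pot M Z R x*ph i x + (\<Sum>j<N. w j j x*ph i x) - (\<Sum>j<N. w j i x*ph j x) - lam i*ph i x"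

lemma pot_measurable [measurable]: "coulomb_pot M Z R \<in> borel_measurable borel"
 unfolding coulomb_pot_def[abs_def] by measurable

lemma F_measurable: "i < N ==> F i \<in> borel_measurable borel"
 unfolding F_def[abs_def] using phi_measurable w_measurable
 by (intro borel_measurable_diff borel_measurable_add borel_measurable_times borel_measurable_sum) auto

lemma weak_eq:
 assumes i: "i < N" shows "wlap UNIV (ph i) (F i)"
 unfolding wlap_def
proof (intro allI impI)
 fix pt assume t: "test_fun UNIV pt"
 let ?L = "%x. ph i x*laplacian pt x" and ?V = "%x. coulomb_pot M Z R x*ph i x*pt x" and ?H = "%x. hartree N ph x*ph i x*pt x"
  and ?E = "%x. exchange N ph i x*pt x" and ?P = "%x. ph i x*pt x"
 have I: "integrable lborel ?L" "integrable lborel ?V" "integrable lborel ?H" "integrable lborel ?E"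
  and e: "(LBINT x. ph i x*(- laplacian pt x)) + (LBINT x. ?V x) + (LBINT x. ?H x) - (LBINT x. ?E x) = lam i*(LBINT x. ?P x)"
  using HF i t unfolding HF_solution_def by blast+
 have P: "integrable lborel ?P" by (rule test_mult_loc_integrable[OF phi_loc[OF i] t])
 have "(LBINT y. F i y*pt y) = (LBINT y. ?V y + ?H y - ?E y - lam i*?P y)"
  unfolding F_def hartree_eq exchange_eq[OF i] sum_distrib_right[symmetric]
  by (intro Bochner_Integration.integral_cong refl) (simp add: algebra_simps)
 also have "... = (LBINT y. ?V y) + (LBINT y. ?H y) - (LBINT y. ?E y) - lam i*(LBINT y. ?P y)"
  using I P by simp
 also have "... = (LBINT y. ?L y)" using e by simp
 finally show "(LBINT y. ?L y) = (LBINT y. F i y*pt y)" by simp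
qed

text \<open>A common majorant, up to a constant, of all right-hand sides \<open>F i\<close>; it is
  linear in the orbitals because the pair potentials are already known to be bounded.\<close>

definition Hh :: "real^3 => real" where
 "Hh y = (\<Sum>j<N. \<bar>ph j y\<bar>)*(1 + (\<Sum>l<M. 1/norm (y - R l)))"

lemma F_bound: "\<exists>C\<ge>0. \<forall>i<N. \<forall>y. \<bar>F i y\<bar> <= C*Hh y"
proof -
 obtain W where W: "W >= 0" "!!i j x. i < N ==> j < N ==> \<bar>w i j x\<bar> <= W" using w_bounded by blast
 define z where "z = (\<Sum>l<M. \<bar>Z l\<bar>)"
 define L where "L = (\<Sum>i<N. \<bar>lam i\<bar>)"
 have z0: "z >= 0" "L >= 0" unfolding z_def L_def by (auto intro: sum_nonneg)
 have "\<bar>F i y\<bar> <= (z + (real N*W + W + L))*Hh y" if i: "i < N" for i y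
 proof -
  let ?S = "\<Sum>j<N. \<bar>ph j y\<bar>" and ?T = "\<Sum>l<M. 1/norm (y - R l)"
  have S: "\<bar>ph i y\<bar> <= ?S" using i by (intro member_le_sum) auto
  have S0: "?S >= 0" "?T >= 0" by (auto intro: sum_nonneg)
  have "\<bar>coulomb_pot M Z R y\<bar> <= (\<Sum>l<M. \<bar>Z l/norm (y - R l)\<bar>)" unfolding coulomb_pot_def by (simp only: abs_minus_cancel sum_abs)
  also have "... <= (\<Sum>l<M. z*(1/norm (y - R l)))"
  proof (rule sum_mono)
   fix l assume l: "l \<in> {..<M}"
   have "\<bar>Z l\<bar> <= z" unfolding z_def using l by (intro member_le_sum) auto
   then have "\<bar>Z l\<bar>/norm (y - R l) <= z/norm (y - R l)" by (intro divide_right_mono) auto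
   then show "\<bar>Z l/norm (y - R l)\<bar> <= z*(1/norm (y - R l))" by (simp add: abs_divide)
  qed
  finally have V: "\<bar>coulomb_pot M Z R y\<bar> <= z*?T" by (simp add: sum_distrib_left)
  have a: "\<bar>coulomb_pot M Z R y*ph i y\<bar> <= (z*?T)*?S" unfolding abs_mult using V S S0 z0 by (intro mult_mono) auto
  have b: "\<bar>\<Sum>j<N. w j j y*ph i y\<bar> <= real N*(W*?S)"
  proof -
   have "\<bar>\<Sum>j<N. w j j y*ph i y\<bar> <= (\<Sum>j<N. \<bar>w j j y*ph i y\<bar>)" by (rule sum_abs)
   also have "... <= (\<Sum>j<N. W*?S)" using W S S0 by (intro sum_mono) (auto simp: abs_mult intro!: mult_mono)
   finally show ?thesis by simp
  qed
  have c: "\<bar>\<Sum>j<N. w j i y*ph j y\<bar> <= W*?S"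
  proof -
   have "\<bar>\<Sum>j<N. w j i y*ph j y\<bar> <= (\<Sum>j<N. \<bar>w j i y*ph j y\<bar>)" by (rule sum_abs)
   also have "... <= (\<Sum>j<N. W * \<bar>ph j y\<bar>)" using W i by (intro sum_mono) (auto simp: abs_mult intro!: mult_right_mono)
   finally show ?thesis by (simp add: sum_distrib_left)
  qed
  have "\<bar>lam i\<bar> <= L" unfolding L_def using i by (intro member_le_sum) auto
  then have d: "\<bar>lam i*ph i y\<bar> <= L*?S" unfolding abs_mult using S S0 z0 by (intro mult_mono) auto
  have "\<bar>F i y\<bar> <= (z*?T)*?S + real N*(W*?S) + W*?S + L*?S"
   unfolding F_def using a b c d by linarith
  also have "... = z*(?S*?T) + (real N*W + W + L)*?S" by (simp add: algebra_simps)
  also have "... <= z*Hh y + (real N*W + W + L)*Hh y"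
  proof (intro add_mono mult_left_mono)
   have e: "Hh y = ?S + ?S*?T" unfolding Hh_def by (simp add: distrib_left)
   show "?S*?T <= Hh y" "?S <= Hh y" unfolding e using S0 by auto
  qed (use z0 W in auto)
  finally show ?thesis by (simp add: distrib_right)
 qed
 moreover have "z + (real N*W + W + L) >= 0" using z0 W by simp
 ultimately show ?thesis by blast
qed

text \<open>The pole 1/|q| is split unevenly as |q|^(-5/8) |q|^(-3/8) before xy <= x^2 + y^2 is
  applied: the orbital receives the exponent 5/4 that \<open>H1_kernel_bound\<close> controls, and
  |q|^(-3/4) is left for k^2. For k the Newton kernel the exponents add up to 3/4 + 2 < 3, while an
  even split would give 3.\<close>

lemma amgm_kernel:
 fixes p :: real
 shows "\<bar>p\<bar>*(1/norm q)*k <= (p^2*kb (5/4) 1 q + kb (3/4) 1 q*k^2) + (p^2 + k^2)"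
proof (cases "q = 0 \<or> norm q > 1")
 case True
 have *: "\<bar>p\<bar> * \<bar>k\<bar> <= p^2 + k^2" 
  by (rule abs_mult_le_squares)
 have "\<bar>p\<bar>*(1/norm q)*k <= \<bar>p\<bar>*1 * \<bar>k\<bar>"
  proof -
  have "1/norm q <= 1" using True by (cases "q = 0") (auto simp: divide_le_eq)
  then have "\<bar>p\<bar>*(1/norm q) <= \<bar>p\<bar>*1" by (intro mult_left_mono) auto
  then show ?thesis
   by (intro order_trans[OF mult_left_mono[OF abs_ge_self] mult_right_mono]) auto
 qed
 then show ?thesis using True*by (auto simp: kb_def intro: order_trans)
next
 case False
 then have n: "norm q > 0" "norm q <= 1" by auto
 define \<alpha> where "\<alpha> = norm q powr (- (5/8))"
 define \<beta> where "\<beta> = norm q powr (- (3/8))"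
 have ab: "\<alpha> * \<beta> = 1/norm q" using n unfolding \<alpha>_def \<beta>_def by (simp add: powr_add[symmetric] powr_minus_divide)
 have a2: "\<alpha>^2 = kb (5/4) 1 q" using n unfolding \<alpha>_def kb_def by (simp add: powr_power)
 have b2: "\<beta>^2 = kb (3/4) 1 q" using n unfolding \<beta>_def kb_def by (simp add: powr_power)
 have "\<bar>p\<bar>*(1/norm q)*k = (\<bar>p\<bar> * \<alpha>)*(\<beta>*k)" unfolding ab[symmetric] by simp
 also have "... <= (\<bar>p\<bar> * \<alpha>)^2 + (\<beta>*k)^2"
  using sum_squares_bound[of "\<bar>p\<bar> * \<alpha>" "\<beta>*k"] zero_le_power2[of "\<bar>p\<bar> * \<alpha>"] zero_le_power2[of "\<beta>*k"] by linarith
 also have "... = p^2*kb (5/4) 1 q + kb (3/4) 1 q*k^2" by (simp add: power_mult_distrib a2 b2)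
 finally show ?thesis by (rule order_trans) simp
qed

lemma Hh_measurable [measurable]: "Hh \<in> borel_measurable borel"
 unfolding Hh_def[abs_def] using phi_measurable
 by (intro borel_measurable_times borel_measurable_sum borel_measurable_add) auto

lemma Hh_loc: "loc_integrable UNIV Hh"
 unfolding loc_integrable_def
proof (intro allI impI)
 fix K :: "(real^3) set" assume K: "compact K & K \<subseteq> UNIV"
 have C: "!!i x. i < N ==> integrable lborel (%y. (ph i y)^2*kb (5/4) 1 (y - x))"
  using CS_ex by blast
 have Km: "K \<in> sets borel" using K by (auto intro: borel_compact)
 have Ki: "integrable lborel (indicator K :: real^3 => real)"
  using K emeasure_compact_finite[of K] Km by (intro integrable_real_indicator) auto
 let ?A = "%j y. (ph j y)^2 + indicator K y :: real"
 let ?B = "%j l y. ((ph j y)^2*kb (5/4) 1 (y - R l) + kb (3/4) 1 (y - R l)) + ((ph j y)^2 + indicator K y)"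
 have "integrable lborel (%y. indicator K y*Hh y)"
 proof (rule Bochner_Integration.integrable_bound[where f="%y. (\<Sum>j<N. ?A j y) + (\<Sum>j<N. \<Sum>l<M. ?B j l y)"])
  show "integrable lborel (%y. (\<Sum>j<N. ?A j y) + (\<Sum>j<N. \<Sum>l<M. ?B j l y))"
   using integrable_shift3(1)[OF kb_integrable(1)[of "3/4" 1]]
   by (intro Bochner_Integration.integrable_add Bochner_Integration.integrable_sum C phi_sq Ki) simp_all
  show "AE y in lborel. norm (indicator K y*Hh y) <= norm ((\<Sum>j<N. ?A j y) + (\<Sum>j<N. \<Sum>l<M. ?B j l y))"
  proof (rule AE_I2)
   fix y
   have nn: "0 <= (\<Sum>j<N. ?A j y) + (\<Sum>j<N. \<Sum>l<M. ?B j l y)" by (intro add_nonneg_nonneg sum_nonneg) auto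
   show "norm (indicator K y*Hh y) <= norm ((\<Sum>j<N. ?A j y) + (\<Sum>j<N. \<Sum>l<M. ?B j l y))"
   proof (cases "y \<in> K")
    case True
    have "Hh y = (\<Sum>j<N. \<bar>ph j y\<bar>) + (\<Sum>j<N. \<Sum>l<M. \<bar>ph j y\<bar>*(1/norm (y - R l)))"
     unfolding Hh_def distrib_left sum_product by simp
    also have "... <= (\<Sum>j<N. ?A j y) + (\<Sum>j<N. \<Sum>l<M. ?B j l y)"
    proof (intro add_mono sum_mono)
     fix j show "\<bar>ph j y\<bar> <= ?A j y" using True sum_squares_bound[of "\<bar>ph j y\<bar>" 1] by (simp add: power2_eq_square) 
     fix l show "\<bar>ph j y\<bar>*(1/norm (y - R l)) <= ?B j l y" using amgm_kernel[of "ph j y" "y - R l" 1] True by simp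
    qed
    finally have "Hh y <= (\<Sum>j<N. ?A j y) + (\<Sum>j<N. \<Sum>l<M. ?B j l y)" .
    moreover have "Hh y >= 0" unfolding Hh_def by (intro mult_nonneg_nonneg add_nonneg_nonneg sum_nonneg) auto
    ultimately show ?thesis using True by simp
   qed (use nn in simp)
  qed
 qed (use Km in measurable)
 then show "set_integrable lborel K Hh" by (simp add: set_integrable_def)
qed

lemma F_loc: "i < N ==> loc_integrable UNIV (F i)"
 unfolding loc_integrable_def set_integrable_def
proof (intro allI impI)
 fix K :: "(real^3) set" assume i: "i < N" and K: "compact K & K \<subseteq> UNIV"
 obtain C where C: "C >= 0" "!!y. \<bar>F i y\<bar> <= C*Hh y" using F_bound i by blast
 have H: "integrable lborel (%y. indicator K y*Hh y)" using Hh_loc K by (auto simp: loc_integrable_def set_integrable_def)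
 have Km: "K \<in> sets borel" using K by (auto intro: borel_compact)
 show "integrable lborel (%y. indicator K y *\<^sub>R F i y)"
 proof (rule Bochner_Integration.integrable_bound[where f="%y. C*(indicator K y*Hh y)"])
  show "AE y in lborel. norm (indicator K y *\<^sub>R F i y) <= norm (C*(indicator K y*Hh y))"
  proof (rule AE_I2)
   fix y show "norm (indicator K y *\<^sub>R F i y) <= norm (C*(indicator K y*Hh y))"
    using C(2)[of y] by (cases "y \<in> K") auto
  qed
  show "(%y. indicator K y *\<^sub>R F i y) \<in> borel_measurable lborel"
   using F_measurable[OF i] Km by measurable
 qed (use H in simp)
qed

text \<open>The representation with kernels of radius 1 bounds |phi_i(x)| by the integral of
  \<open>Hh\<close> against 1/|y - x|. The critical terms have one pole at a nucleus and one at x;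
  \<open>amgm_kernel\<close> followed by \<open>kb_mult_le\<close> bounds them uniformly in
  x.\<close>

lemma phi_bounded: "\<exists>B>0. \<forall>i<N. AE x in lborel. \<bar>ph i x\<bar> <= B"
proof -
 obtain C where C: "C >= 0" "!!i x. i < N ==> integrable lborel (%y. (ph i y)^2*kb (5/4) 1 (y - x))"
   "!!i x. i < N ==> (LBINT y. (ph i y)^2*kb (5/4) 1 (y - x)) <= C"
  using CS_ex by blast
 obtain D where D: "D >= 0" "!!i y. i < N ==> \<bar>F i y\<bar> <= D*Hh y" using F_bound by blast
 have kI: "integrable lborel (%y. kb s 1 (y - x))" "(LBINT y. kb s 1 (y - x)) = Kc s" if "0 <= s" "s < 3" for s x
  using integrable_shift3(1)[OF kb_integrable(1)[of s 1]] integral_shift3(1)[of "kb s 1" x] that by (auto simp: Kc_def)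
 define E where "E = real N*(1 + Kc 2) + real N*(real M*((C + 2*Kc (11/4)) + (1 + Kc 2)))"
 have E0: "E >= 0" unfolding E_def using C(1) by simp
 have HK: "(\<integral>\<^sup>+y. ennreal (Hh y*kb 1 1 (y - x)) \<partial>lborel) <= ennreal E" for x
 proof -
  let ?k = "%y. kb 1 1 (y - x)"
  let ?A = "%j y. (ph j y)^2 + kb 2 1 (y - x)"
  let ?B = "%j l y. ((ph j y)^2*kb (5/4) 1 (y - R l) + (kb (11/4) 1 (y - R l) + kb (11/4) 1 (y - x))) + ((ph j y)^2 + kb 2 1 (y - x))"
  let ?g = "%y. (\<Sum>j<N. ?A j y) + (\<Sum>j<N. \<Sum>l<M. ?B j l y)"
  have k2: "(?k y)^2 = kb 2 1 (y - x)" for y by (simp add: kb_sq)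
  have le: "Hh y*?k y <= ?g y" for y
  proof -
   have "Hh y*?k y = (\<Sum>j<N. \<bar>ph j y\<bar>*?k y) + (\<Sum>j<N. \<Sum>l<M. \<bar>ph j y\<bar>*(1/norm (y - R l))*?k y)"
   proof -
    have e: "Hh y = (\<Sum>j<N. \<bar>ph j y\<bar>) + (\<Sum>j<N. \<Sum>l<M. \<bar>ph j y\<bar>*(1/norm (y - R l)))"
     unfolding Hh_def distrib_left sum_product by simp
    show ?thesis unfolding e distrib_right sum_distrib_right ..
   qed
   also have "... <= ?g y"
   proof (intro add_mono sum_mono)
    fix j
    show "\<bar>ph j y\<bar>*?k y <= ?A j y"
     using abs_mult_le_squares[of "ph j y" "?k y"] unfolding k2 by simp
    fix l
    have "kb (3/4) 1 (y - R l)*kb 2 1 (y - x) <= kb (3/4 + 2) 1 (y - R l) + kb (3/4 + 2) 1 (y - x)" by (rule kb_mult_le) auto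
    then show "\<bar>ph j y\<bar>*(1/norm (y - R l))*?k y <= ?B j l y"
     using amgm_kernel[of "ph j y" "y - R l" "?k y"] unfolding k2 by simp
   qed
   finally show ?thesis .
  qed
  have Ai: "integrable lborel (?A j)" "(LBINT y. ?A j y) = 1 + Kc 2" if "j < N" for j
   using phi_sq[OF that] phi_norm[OF that] kI[of 2 x] by auto
  have Bi: "integrable lborel (?B j l)" "(LBINT y. ?B j l y) <= (C + 2*Kc (11/4)) + (1 + Kc 2)" if "j < N" for j l
   using phi_sq[OF that] phi_norm[OF that] kI[of 2 x] kI[of "11/4" x] kI[of "11/4" "R l"] C(2,3)[OF that, of "R l"] by auto
  have gA: "integrable lborel (%y. \<Sum>j<N. ?A j y)" by (intro Bochner_Integration.integrable_sum Ai) simp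
  have gB: "integrable lborel (%y. \<Sum>j<N. \<Sum>l<M. ?B j l y)" by (intro Bochner_Integration.integrable_sum Bi) simp
  have gi: "integrable lborel ?g" by (rule Bochner_Integration.integrable_add[OF gA gB])
  have "(LBINT y. ?g y) = (LBINT y. (\<Sum>j<N. ?A j y)) + (LBINT y. (\<Sum>j<N. \<Sum>l<M. ?B j l y))"
   by (rule Bochner_Integration.integral_add[OF gA gB])
  also have "(LBINT y. (\<Sum>j<N. ?A j y)) = (\<Sum>j<N. \<integral>y. ?A j y \<partial>lborel)"
   by (intro Bochner_Integration.integral_sum Ai) simp
  also have "(LBINT y. (\<Sum>j<N. \<Sum>l<M. ?B j l y)) = (\<Sum>j<N. \<integral>y. (\<Sum>l<M. ?B j l y) \<partial>lborel)"
   by (intro Bochner_Integration.integral_sum Bochner_Integration.integrable_sum Bi) simp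
  also have "... = (\<Sum>j<N. \<Sum>l<M. \<integral>y. ?B j l y \<partial>lborel)"
   by (intro sum.cong refl Bochner_Integration.integral_sum Bi) simp
  also have "(\<Sum>j<N. \<integral>y. ?A j y \<partial>lborel) + (\<Sum>j<N. \<Sum>l<M. \<integral>y. ?B j l y \<partial>lborel) <= (\<Sum>j<N. 1 + Kc 2) + (\<Sum>j<N. \<Sum>l<M. (C + 2*Kc (11/4)) + (1 + Kc 2))"
   using Ai(2) Bi(2) by (intro add_mono sum_mono) auto
  also have "... = E" unfolding E_def by simp
  finally have gE: "ennreal (LBINT y. ?g y) <= ennreal E" by (rule ennreal_leI)
  have "(\<integral>\<^sup>+y. ennreal (Hh y*?k y) \<partial>lborel) <= (\<integral>\<^sup>+y. ennreal (?g y) \<partial>lborel)"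
   by (intro nn_integral_mono ennreal_leI le)
  also have "(\<integral>\<^sup>+y. ennreal (?g y) \<partial>lborel) = ennreal (LBINT y. ?g y)"
   by (intro nn_integral_eq_integral[OF gi] AE_I2 add_nonneg_nonneg sum_nonneg) auto
  also note gE
  finally show ?thesis .
 qed
 define B where "B = ((14*BX + BX*D)*E + 1)/cN"
 have "AE x in lborel. \<bar>ph i x\<bar> <= B" if i: "i < N" for i
 proof -
  have "AE x in lborel. ennreal (cN * \<bar>ph i x\<bar>) <= ennreal (14*BX)*(\<integral>\<^sup>+y. ennreal (\<bar>ph i y\<bar>*kb 1 1 (y - x)) \<partial>lborel)
   + ennreal BX*(\<integral>\<^sup>+y. ennreal (\<bar>F i y\<bar>*kb 1 1 (y - x)) \<partial>lborel) 
   + (\<Sum>j\<in>(UNIV :: 3 set). ennreal (3*BX)*(\<integral>\<^sup>+y. ennreal (\<bar>(%j y. 0) j y\<bar>*kb 2 1 (y - x)) \<partial>lborel))"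
  proof (rule rep_bound[where G="%j y. 0", OF phi_loc[OF i] phi_measurable[OF i] F_loc[OF i] F_measurable[OF i]])
   show "(LBINT y. ph i y*laplacian pt y) = (LBINT y. F i y*pt y) + (\<Sum>j\<in>UNIV. \<integral>y. (%j y. 0) j y*pd j pt y \<partial>lborel)"
    if "test_fun UNIV pt" for pt using weak_eq[OF i] that by (simp add: wlap_def)
  qed (auto simp: loc_integrable_def set_integrable_def)
  then show ?thesis
  proof eventually_elim
   case (elim x)
   have 1: "(\<integral>\<^sup>+y. ennreal (\<bar>ph i y\<bar>*kb 1 1 (y - x)) \<partial>lborel) <= ennreal E"
   proof (rule order_trans[OF nn_integral_mono HK[of x]], rule ennreal_leI, rule mult_right_mono)
    fix y
    have "\<bar>ph i y\<bar>*1 <= Hh y" unfolding Hh_def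
     using i by (intro mult_mono member_le_sum) (auto intro!: sum_nonneg)
    then show "\<bar>ph i y\<bar> <= Hh y" by simp
   qed simp
   have 2: "(\<integral>\<^sup>+y. ennreal (\<bar>F i y\<bar>*kb 1 1 (y - x)) \<partial>lborel) <= ennreal D*ennreal E"
   proof -
    have "(\<integral>\<^sup>+y. ennreal (\<bar>F i y\<bar>*kb 1 1 (y - x)) \<partial>lborel) <= (\<integral>\<^sup>+y. ennreal D*ennreal (Hh y*kb 1 1 (y - x)) \<partial>lborel)"
    proof (rule nn_integral_mono)
     fix y
     have "\<bar>F i y\<bar>*kb 1 1 (y - x) <= D*(Hh y*kb 1 1 (y - x))"
      using mult_right_mono[OF D(2)[OF i, of y], of "kb 1 1 (y - x)"] by (simp add: mult.assoc)
     moreover have "Hh y >= 0" unfolding Hh_def by (intro mult_nonneg_nonneg add_nonneg_nonneg sum_nonneg) auto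
     ultimately show "ennreal (\<bar>F i y\<bar>*kb 1 1 (y - x)) <= ennreal D*ennreal (Hh y*kb 1 1 (y - x))"
      using D(1) by (simp add: ennreal_mult[symmetric] ennreal_leI)
    qed
    also have "... = ennreal D*(\<integral>\<^sup>+y. ennreal (Hh y*kb 1 1 (y - x)) \<partial>lborel)" by (intro nn_integral_cmult) measurable
    also have "... <= ennreal D*ennreal E" by (intro mult_left_mono HK) auto
    finally show ?thesis .
   qed
   have "ennreal (cN * \<bar>ph i x\<bar>) <= ennreal (14*BX)*ennreal E + ennreal BX*(ennreal D*ennreal E) + 0"
    by (rule order_trans[OF elim]) (intro add_mono mult_left_mono 1 2; simp)
   also have "... = ennreal ((14*BX + BX*D)*E)"
    using BX(1) D(1) E0 by (simp add: ennreal_mult[symmetric] ennreal_plus[symmetric] algebra_simps del: ennreal_plus)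
   finally have "cN * \<bar>ph i x\<bar> <= (14*BX + BX*D)*E"
    using BX(1) D(1) E0 by (subst (asm) ennreal_le_iff) auto
   then show ?case unfolding B_def using cN_pos by (simp add: pos_le_divide_eq mult.commute)
  qed
 qed
 moreover have "B > 0" unfolding B_def using BX(1) D(1) E0 cN_pos by (intro divide_pos_pos add_nonneg_pos mult_nonneg_nonneg) auto
 ultimately show ?thesis by blast
qed

end

lemma wlap_const: "wlap S (%x. c) (%x. 0)"
 unfolding wlap_def
proof (intro allI impI)
 fix pt assume t: "test_fun S pt"
 then have t: "test_fun UNIV pt" by (rule test_fun_mono) simp
 have z: "(LBINT x. c*pd j (pd j pt) x) = 0" for j
  using ibp[OF open_UNIV, of "%x. c" "%x. 0" j "pd j pt"] test_fun_pd[OF t] by (simp add: has_pd_const)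
 have "(LBINT y. c*laplacian pt y) = (\<Sum>j\<in>UNIV. \<integral>y. c*pd j (pd j pt) y \<partial>lborel)"
  unfolding laplacian_def sum_distrib_left
  by (intro Bochner_Integration.integral_sum test_mult_integrable[OF open_UNIV] test_fun_pd t) auto
 then show "(LBINT y. c*laplacian pt y) = (LBINT y. 0*pt y)" unfolding z by simp
qed

lemma (in -) laplacian_bound:
 assumes t: "test_fun UNIV pt"
 shows "\<exists>C\<ge>0. \<exists>rh. \<forall>x. \<bar>laplacian pt x\<bar> <= C*indicator (cball 0 rh) x"
proof -
 have cL: "continuous_on UNIV (laplacian pt)" unfolding laplacian_def[abs_def]
  by (intro continuous_intros test_fun_continuous[OF test_fun_pd[OF test_fun_pd[OF t]]])
 have "\<forall>j. \<exists>rh. \<forall>x. norm x > rh --> pd j (pd j pt) x = 0" using test_fun_support[OF test_fun_pd[OF test_fun_pd[OF t]]] by blast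
 from choice[OF this] obtain rh where rh: "\<forall>j x. norm x > rh j --> pd j (pd j pt) x = 0" ..
 define rh2 where "rh2 = max (rh 1) (max (rh 2) (rh 3))"
 have L0: "laplacian pt x = 0" if "norm x > rh2" for x
  using that rh[rule_format, of 1 x] rh[rule_format, of 2 x] rh[rule_format, of 3 x] unfolding laplacian_def sum_3 rh2_def by simp
 obtain C where C: "C >= 0" "!!x. \<bar>laplacian pt x\<bar> <= C" using compact_support_bounded[OF cL L0] by blast
 have "\<bar>laplacian pt x\<bar> <= C*indicator (cball 0 rh2) x" for x
  using C(2)[of x] L0[of x] by (cases "norm x <= rh2") auto
 then show ?thesis using C(1) by blast
qed

context hf
begin

section \<open>The quadratic system solved by orbitals and potentials away from the nuclei\<close>

definition Om :: "(real^3) set" where "Om = - (R ` {..<M})"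

text \<open>Inserting 1 provides the cap required by \<open>qsys\<close> and makes the minimum run
  over a nonempty set in every case.\<close>

definition dd :: "real^3 => real" where
 "dd x = Min (insert 1 ((%i. norm (x - R i)) ` {..<M}))"

lemma Om_open: "open Om"
 unfolding Om_def by (intro open_Compl finite_imp_closed) auto

lemma dd_le: "dd x <= 1" "i < M ==> dd x <= norm (x - R i)"
 unfolding dd_def by (auto intro!: Min_le)

lemma dd_pos: "x \<in> Om ==> dd x > 0"
 unfolding dd_def by (subst Min_gr_iff) (auto simp: Om_def)

lemma dd_Lip: "dd y >= dd x - dist x y"
proof -
 have "\<forall>a\<in>insert 1 ((%i. norm (y - R i)) ` {..<M}). dd x - dist x y <= a"
 proof
  fix a assume "a \<in> insert 1 ((%i. norm (y - R i)) ` {..<M})"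
  then consider "a = 1" | i where "i < M" "a = norm (y - R i)" by auto
  then show "dd x - dist x y <= a"
  proof cases
   case 1
   then show ?thesis using dd_le(1)[of x] zero_le_dist[of x y] by linarith
  next
   case 2
   have "norm (x - R i) <= dist x y + norm (y - R i)" using norm_triangle_ineq[of "x - y" "y - R i"] by (simp add: dist_norm)
   then show ?thesis using dd_le(2)[OF 2(1), of x] 2(2) by linarith
  qed
 qed
 then show ?thesis unfolding dd_def[of y] by (subst Min_ge_iff) auto
qed

lemma dd_ball: "x \<in> Om ==> ball x (dd x) \<subseteq> Om"
proof
 fix y assume x: "x \<in> Om" and y: "y \<in> ball x (dd x)"
 show "y \<in> Om" unfolding Om_def
 proof (rule ComplI)
  assume "y \<in> R ` {..<M}"
  then obtain i where "i < M" "y = R i" by auto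
  then show False using dd_le(2)[of i x] y by (simp add: dist_norm)
 qed
qed

lemma Om_AE: "AE x in lborel. x \<in> Om"
proof -
 have "R ` {..<M} \<in> null_sets lborel" by (rule finite_imp_null_set_lborel) auto
 then show ?thesis unfolding Om_def by (rule AE_I') (auto simp: Om_def)
qed

text \<open>By Fubini the Laplacian of the test function is integrated against the Newton kernel
  first, and \<open>newton_potential\<close> evaluates this inner integral.\<close>

lemma w_wlap:
 assumes ij: "i < N" "j < N"
 shows "wlap UNIV (w i j) (%x. - cN*(ph i x*ph j x))"
 unfolding wlap_def
proof (intro allI impI)
 fix pt assume t: "test_fun UNIV pt"
 note [measurable] = phi_measurable[OF ij(1)] phi_measurable[OF ij(2)] test_fun_measurable[OF t]
 obtain C rh where C: "C >= 0" "!!x. \<bar>laplacian pt x\<bar> <= C*indicator (cball 0 rh) x" using laplacian_bound[OF t] by blast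
 have I0: "integrable lborel (%x. ph i x*ph j x)" using HF ij by (simp add: HF_solution_def)
 define E where "E = C*(Kc (5/4) + (LBINT x. indicator (cball 0 rh) (x::real^3)))"
 have Lb: "(LBINT x. \<bar>laplacian pt x/norm (x - y)\<bar>) <= E" for y
 proof -
  have Ii: "integrable lborel (%x. C*(kb (5/4) 1 (x - y) + indicator (cball 0 rh) x))"
   using integrable_cball_indicator[of 1 0 rh] integrable_shift3(1)[OF kb_integrable(1)[of "5/4" 1], of y] by simp
  have "(LBINT x. \<bar>laplacian pt x/norm (x - y)\<bar>) <= (LBINT x. C*(kb (5/4) 1 (x - y) + indicator (cball 0 rh) x))"
  proof (rule integral_mono)
   show "integrable lborel (%x. \<bar>laplacian pt x/norm (x - y)\<bar>)" by (rule integrable_abs[OF newton_potential(2)[OF t]])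
   fix x
   have "\<bar>laplacian pt x\<bar>*(1/norm (x - y)) <= (C*indicator (cball 0 rh) x)*(kb (5/4) 1 (x - y) + 1)"
    using C inv_norm_le[of "x - y"] by (intro mult_mono) auto
   also have "... <= C*(kb (5/4) 1 (x - y) + indicator (cball 0 rh) x)"
    using C(1) by (auto simp: indicator_def)
   finally show "\<bar>laplacian pt x/norm (x - y)\<bar> <= C*(kb (5/4) 1 (x - y) + indicator (cball 0 rh) x)" by (simp add: abs_divide)
  qed (rule Ii)
  also have "... = E" unfolding E_def Kc_def
   using integrable_cball_indicator[of 1 0 rh] integrable_shift3(1)[OF kb_integrable(1)[of "5/4" 1], of y] integral_shift3(1)[of "kb (5/4) 1" y] by simp
  finally show ?thesis .
 qed
 have ii: "integrable (lborel \<Otimes>\<^sub>M lborel) (%(y, x). (ph i y*ph j y)*(laplacian pt x/norm (x - y)))"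
 proof (rule lborel_pair.Fubini_integrable)
  have m: "(%(y, x). \<bar>laplacian pt x/norm (x - y)\<bar>) \<in> borel_measurable (lborel \<Otimes>\<^sub>M lborel)" by measurable
  have mi: "(%y. \<integral>x. \<bar>laplacian pt x/norm (x - y)\<bar> \<partial>lborel) \<in> borel_measurable lborel"
   by (rule lborel.borel_measurable_lebesgue_integral[OF m])
  have e: "(%y. \<integral>x. norm (case (y, x) of (y, x) => (ph i y*ph j y)*(laplacian pt x/norm (x - y))) \<partial>lborel)
    = (%y. \<bar>ph i y*ph j y\<bar>*(LBINT x. \<bar>laplacian pt x/norm (x - y)\<bar>))" (is "?lhs = _")
  proof
   fix y
   have "?lhs y = (LBINT x. \<bar>ph i y*ph j y\<bar> * \<bar>laplacian pt x/norm (x - y)\<bar>)"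
    by (intro Bochner_Integration.integral_cong refl) (simp only: prod.case real_norm_def abs_mult)
   then show "?lhs y = \<bar>ph i y*ph j y\<bar>*(LBINT x. \<bar>laplacian pt x/norm (x - y)\<bar>)" by (simp only: integral_mult_right_zero)
  qed
  show "integrable lborel ?lhs"
   unfolding e
  proof (rule Bochner_Integration.integrable_bound[where f="%y. (ph i y*ph j y)*E"])
   show "AE y in lborel. norm (\<bar>ph i y*ph j y\<bar>*(LBINT x. \<bar>laplacian pt x/norm (x - y)\<bar>)) <= norm ((ph i y*ph j y)*E)"
   proof (rule AE_I2)
    fix y
    have "0 <= (LBINT x. \<bar>laplacian pt x/norm (x - y)\<bar>)" by (rule Bochner_Integration.integral_nonneg) simp
    then have "\<bar>\<integral>x. \<bar>laplacian pt x/norm (x - y)\<bar> \<partial>lborel\<bar> <= \<bar>E\<bar>" using Lb[of y] by linarith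
    then show "norm (\<bar>ph i y*ph j y\<bar>*(LBINT x. \<bar>laplacian pt x/norm (x - y)\<bar>)) <= norm ((ph i y*ph j y)*E)"
     unfolding real_norm_def abs_mult[of _ E] abs_mult[of "\<bar>_\<bar>"] abs_abs by (intro mult_left_mono) auto
   qed
  qed (use I0 mi in \<open>auto simp: borel_measurable_times\<close>)
  show "AE y in lborel. integrable lborel (%x. case (y, x) of (y, x) => (ph i y*ph j y)*(laplacian pt x/norm (x - y)))"
   by (intro AE_I2) (simp only: prod.case, intro integrable_mult_right newton_potential(2)[OF t])
 qed measurable
 have "(LBINT x. w i j x*laplacian pt x) = (\<integral>x. (LBINT y. (ph i y*ph j y)*(laplacian pt x/norm (x - y))) \<partial>lborel)"
 proof (intro Bochner_Integration.integral_cong refl)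
  fix x
  have "w i j x*laplacian pt x = (LBINT y. laplacian pt x*(ph i y*ph j y/norm (x - y)))"
   unfolding w_def integral_mult_right_zero by (rule mult.commute)
  then show "w i j x*laplacian pt x = (LBINT y. (ph i y*ph j y)*(laplacian pt x/norm (x - y)))"
   by (simp only: times_divide_eq_right mult.commute)
 qed
 also have "... = (\<integral>y. (LBINT x. (ph i y*ph j y)*(laplacian pt x/norm (x - y))) \<partial>lborel)"
  using lborel_pair.Fubini_integral[OF ii] by simp
 also have "... = (LBINT y. - cN*(ph i y*ph j y)*pt y)"
  unfolding integral_mult_right_zero newton_potential(1)[OF t] by (simp add: mult_ac)
 finally show "(LBINT x. w i j x*laplacian pt x) = (LBINT y. - cN*(ph i y*ph j y)*pt y)" .
qed

text \<open>The Laplacian of the potential consists of point masses at the nuclei, where test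
  functions supported in \<open>Om\<close> vanish.\<close>

lemma pot_wlap: "wlap Om (coulomb_pot M Z R) (%x. 0)"
 unfolding wlap_def
proof (intro allI impI)
 fix pt assume t: "test_fun Om pt"
 have tU: "test_fun UNIV pt" by (rule test_fun_mono[OF t]) simp
 have z: "pt (R l) = 0" if "l < M" for l
  by (rule laplacian_zero_outside(2)[OF t]) (use that in \<open>auto simp: Om_def\<close>)
 have "(LBINT y. coulomb_pot M Z R y*laplacian pt y) = (LBINT y. (\<Sum>l<M. - Z l*(laplacian pt y/norm (y - R l))))"
  unfolding coulomb_pot_def by (intro Bochner_Integration.integral_cong refl) (simp add: sum_distrib_right sum_negf)
 also have "... = (\<Sum>l<M. \<integral>y. - Z l*(laplacian pt y/norm (y - R l)) \<partial>lborel)"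
  by (intro Bochner_Integration.integral_sum integrable_mult_right newton_potential(2)[OF tU])
 also have "... = (\<Sum>l<M. - Z l*(- cN*pt (R l)))"
  unfolding integral_mult_right_zero newton_potential(1)[OF tU] ..
 also have "... = 0" using z by simp
 finally show "(LBINT y. coulomb_pot M Z R y*laplacian pt y) = (LBINT y. 0*pt y)" by simp
qed

lemma pot_bound: "x \<in> Om ==> \<bar>coulomb_pot M Z R x\<bar> <= (\<Sum>l<M. \<bar>Z l\<bar>)*(1/dd x)"
proof -
 assume x: "x \<in> Om"
 have "\<bar>coulomb_pot M Z R x\<bar> <= (\<Sum>l<M. \<bar>Z l/norm (x - R l)\<bar>)" unfolding coulomb_pot_def by (simp only: abs_minus_cancel sum_abs)
 also have "... <= (\<Sum>l<M. \<bar>Z l\<bar>*(1/dd x))"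
 proof (rule sum_mono)
  fix l assume "l \<in> {..<M}"
  then have "dd x <= norm (x - R l)" using dd_le by simp
  then have "\<bar>Z l\<bar>/norm (x - R l) <= \<bar>Z l\<bar>/dd x" using dd_pos[OF x] by (intro divide_left_mono mult_pos_pos) auto
  then show "\<bar>Z l/norm (x - R l)\<bar> <= \<bar>Z l\<bar>*(1/dd x)" by (simp add: abs_divide)
 qed
 finally show ?thesis unfolding sum_distrib_right .
qed

lemma pot_continuous: "continuous_on Om (coulomb_pot M Z R)"
 unfolding coulomb_pot_def[abs_def] by (intro continuous_intros) (auto simp: Om_def)

text \<open>A triple (c, a, b) stands for c times the product of the unknowns a and b. Only
  \<open>Pot\<close> has a pole, of order 1, so its product with an orbital stays within the two
  orders that \<open>qsys\<close> admits.\<close>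

definition rhs :: "hfidx => (real \<times> hfidx \<times> hfidx) list" where
 "rhs q = (case q of One => [] | Pot => [] | Wf i j => [(- cN, Ph i, Ph j)]
   | Ph i => [(1, Pot, Ph i), (- lam i, One, Ph i)] @ map (%j. (1, Wf j j, Ph i)) [0..<N] @ map (%j. (- 1, Wf j i, Ph j)) [0..<N])"

definition Q :: "hfidx set" where
 "Q = {One, Pot} \<union> Ph ` {..<N} \<union> (%(i, j). Wf i j) ` ({..<N} \<times> {..<N})"

definition mq :: "hfidx => nat" where "mq q = (if q = Pot then 1 else 0)"

lemma sum_list_upt: "(\<Sum>j\<leftarrow>[0..<n]. f j) = (\<Sum>j<n. f j :: real)"
 by (induction n) auto

text \<open>\<open>qsys\<close> concerns functions known everywhere, so orbitals and pair potentials
  are first replaced on \<open>Om\<close> by continuous representatives; the almost-everywhere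
  bounds carry over by continuity, and the weak equations are insensitive to the change.\<close>

theorem regularity:
 "\<exists>v B K. B > 0 & K >= 1 & (\<forall>i<N. (AE x in lborel. ph i x = v i x) & (\<forall>js j. \<forall>x\<in>Om.
   has_pd (pds js (v i)) j x (pds (j # js) (v i) x) & \<bar>pds js (v i) x\<bar> <= B*K^length js*fact (length js)*(1/dd x)^length js)
  & (\<forall>js. continuous_on Om (pds js (v i))) & (\<forall>js j k ks. \<forall>x\<in>Om. pds (js @ j # k # ks) (v i) x = pds (js @ k # j # ks) (v i) x))"
proof -
 obtain B where B: "B > 0" "!!i. i < N ==> AE x in lborel. \<bar>ph i x\<bar> <= B" using phi_bounded by blast
 obtain W where W: "W >= 0" "!!i j x. i < N ==> j < N ==> \<bar>w i j x\<bar> <= W" using w_bounded by blast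
 obtain D where D: "D >= 0" "!!i y. i < N ==> \<bar>F i y\<bar> <= D*Hh y" using F_bound by blast
 have "\<exists>v. continuous_on Om v & v \<in> borel_measurable borel & (AE y in lborel. y \<in> Om --> ph i y = v y)" if i: "i < N" for i
 proof (rule cont_rep[OF Om_open phi_measurable[OF i] F_measurable[OF i] wlap_mono[OF weak_eq[OF i]]])
  fix x assume x: "x \<in> Om"
  define r where "r = dd x/2"
  have r: "r > 0" using dd_pos[OF x] by (simp add: r_def)
  define B' where "B' = max B (D*((\<Sum>j<N. B)*(1 + (\<Sum>l<M. 1/r))))"
  have all: "AE y in lborel. \<forall>j\<in>{..<N}. \<bar>ph j y\<bar> <= B" using B(2) by (subst AE_ball_countable) auto
  have "AE y in lborel. y \<in> ball x r --> \<bar>ph i y\<bar> <= B' & \<bar>F i y\<bar> <= B'"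
   using all
  proof eventually_elim
   case (elim y)
   show ?case
   proof
    assume y: "y \<in> ball x r"
    have "Hh y <= (\<Sum>j<N. B)*(1 + (\<Sum>l<M. 1/r))" unfolding Hh_def
    proof (intro mult_mono sum_mono add_mono)
     fix l assume "l \<in> {..<M}"
     then have "norm (x - R l) >= 2*r" using dd_le(2) by (simp add: r_def)
     moreover have "norm (x - R l) <= dist x y + norm (y - R l)" using norm_triangle_ineq[of "x - y" "y - R l"] by (simp add: dist_norm)
     ultimately have "norm (y - R l) >= r" using y by simp
     then show "1/norm (y - R l) <= 1/r" using r by (intro divide_left_mono mult_pos_pos) auto
    qed (use elim B in \<open>auto intro!: sum_nonneg add_nonneg_nonneg\<close>)
    then have "D*Hh y <= D*((\<Sum>j<N. B)*(1 + (\<Sum>l<M. 1/r)))" using D(1) by (rule mult_left_mono)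
    then show "\<bar>ph i y\<bar> <= B' & \<bar>F i y\<bar> <= B'" using D(2)[OF i, of y] bspec[OF elim, of i] i unfolding B'_def
     by (intro conjI) (rule order_trans[OF _ max.cobounded1], simp, rule order_trans[OF _ max.cobounded2], linarith)
   qed
  qed
  moreover have "ball x r \<subseteq> Om" using dd_ball[OF x] r by (auto simp: r_def subset_iff)
  ultimately show "\<exists>r>0. \<exists>B. ball x r \<subseteq> Om & (AE y in lborel. y \<in> ball x r --> \<bar>ph i y\<bar> <= B & \<bar>F i y\<bar> <= B)"
   using r by blast
 qed simp
 then have "\<forall>i. \<exists>v. i < N --> continuous_on Om v & v \<in> borel_measurable borel & (AE y in lborel. y \<in> Om --> ph i y = v y)" by blast
 from choice[OF this] obtain v where v0: "\<forall>i. i < N --> continuous_on Om (v i) & v i \<in> borel_measurable borel & (AE y in lborel. y \<in> Om --> ph i y = v i y)" ..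
 then have v: "!!i. i < N ==> continuous_on Om (v i)" "!!i. i < N ==> v i \<in> borel_measurable borel" "!!i. i < N ==> AE y in lborel. y \<in> Om --> ph i y = v i y" by auto
 have "\<exists>v. continuous_on Om v & v \<in> borel_measurable borel & (AE y in lborel. y \<in> Om --> w i j y = v y)" if ij: "i < N" "j < N" for i j
 proof (rule cont_rep[OF Om_open w_measurable[OF ij] _ wlap_mono[OF w_wlap[OF ij]]])
  show "(%x. - cN*(ph i x*ph j x)) \<in> borel_measurable borel" using phi_measurable[OF ij(1)] phi_measurable[OF ij(2)] by measurable
  fix x assume x: "x \<in> Om"
  have "AE y in lborel. y \<in> ball x (dd x) --> \<bar>w i j y\<bar> <= max W (cN*(B*B)) & \<bar>- cN*(ph i y*ph j y)\<bar> <= max W (cN*(B*B))"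
   using B(2)[OF ij(1)] B(2)[OF ij(2)]
  proof eventually_elim
   case (elim y)
   have "\<bar>- cN*(ph i y*ph j y)\<bar> <= cN*(B*B)" unfolding abs_mult using elim cN_pos B(1) by (intro mult_mono) auto
   then show ?case using W(2)[OF ij, of y] by (auto simp: le_max_iff_disj)
  qed
  then show "\<exists>r>0. \<exists>B. ball x r \<subseteq> Om & (AE y in lborel. y \<in> ball x r --> \<bar>w i j y\<bar> <= B & \<bar>- cN*(ph i y*ph j y)\<bar> <= B)"
   using dd_ball[OF x] dd_pos[OF x] by blast
 qed simp
 then have "\<forall>ij. \<exists>v. fst ij < N --> snd ij < N --> continuous_on Om v & v \<in> borel_measurable borel & (AE y in lborel. y \<in> Om --> w (fst ij) (snd ij) y = v y)" by blast
 from choice[OF this] obtain ww where ww0: "\<forall>ij. fst ij < N --> snd ij < N --> continuous_on Om (ww ij) & ww ij \<in> borel_measurable borel & (AE y in lborel. y \<in> Om --> w (fst ij) (snd ij) y = ww ij y)" ..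
 then have ww: "continuous_on Om (ww (i, j))" "ww (i, j) \<in> borel_measurable borel" "AE y in lborel. y \<in> Om --> w i j y = ww (i, j) y" if "i < N" "j < N" for i j
  using that by fastforce+
 define u where "u q = (case q of One => (%x. 1) | Pot => coulomb_pot M Z R | Ph i => v i | Wf i j => ww (i, j))" for q
 \<comment> \<open>One constant for all unknowns, relative to their poles; the summand 1 accounts
   for \<open>One\<close>.\<close>
 define Mb where "Mb = B + W + (\<Sum>l<M. \<bar>Z l\<bar>) + 1"
 have Zs: "(\<Sum>l<M. \<bar>Z l\<bar>) >= 0" by (rule sum_nonneg) simp
 have Mb: "Mb > 0" "B <= Mb" "W <= Mb" "(\<Sum>l<M. \<bar>Z l\<bar>) <= Mb" "1 <= Mb" using B(1) W(1) Zs unfolding Mb_def by linarith+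
 define Cc where "Cc = cN + 1 + (\<Sum>i<N. \<bar>lam i\<bar>) + 2*real N"
 have Q_cases: "q = One \<or> q = Pot \<or> (\<exists>i<N. q = Ph i) \<or> (\<exists>i<N. \<exists>j<N. q = Wf i j)" if "q \<in> Q" for q using that unfolding Q_def by auto
 have QI: "One \<in> Q" "Pot \<in> Q" "i < N ==> Ph i \<in> Q" "i < N ==> j < N ==> Wf i j \<in> Q" for i j unfolding Q_def by auto
 have vB: "\<bar>v i x\<bar> <= B" if "i < N" "x \<in> Om" for i x
 proof (rule AE_le_continuous_on[OF Om_open v(1)[OF that(1)] _ that(2)])
  show "AE x in lborel. x \<in> Om --> \<bar>v i x\<bar> <= B" using v(3)[OF that(1)] B(2)[OF that(1)] by eventually_elim auto
 qed
 have wB: "\<bar>ww (i, j) x\<bar> <= W" if "i < N" "j < N" "x \<in> Om" for i j x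
 proof (rule AE_le_continuous_on[OF Om_open ww(1)[OF that(1,2)] _ that(3)])
  show "AE x in lborel. x \<in> Om --> \<bar>ww (i, j) x\<bar> <= W" using ww(3)[OF that(1,2)]
  proof eventually_elim
   case (elim x)
   then show ?case using W(2)[OF that(1,2), of x] by auto
  qed
 qed
 interpret sys: qsys Om dd Q u rhs mq Mb Cc
 proof
  show "open Om" by (rule Om_open)
  show "x \<in> Om ==> dd x > 0" "x \<in> Om ==> dd x <= 1" "x \<in> Om ==> ball x (dd x) \<subseteq> Om" for x
   using dd_pos dd_le dd_ball by blast+
  show "dd y >= dd x - dist x y" for x y by (rule dd_Lip)
  show "continuous_on Om (u q)" if "q \<in> Q" for q
   using Q_cases[OF that] v(1) ww(1) pot_continuous unfolding u_def by auto
  show "a \<in> Q & b \<in> Q & mq a + mq b <= mq q + 2" if "q \<in> Q" "(c, a, b) \<in> set (rhs q)" for q c a b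
   using Q_cases[OF that(1)] that(2) QI unfolding rhs_def mq_def by auto
  show "mq q <= 1" for q by (simp add: mq_def)
  show "Mb > 0" by (rule Mb)
  show "\<bar>u q x\<bar> <= Mb*(1/dd x)^mq q" if "q \<in> Q" "x \<in> Om" for q x
  proof -
   have "\<bar>coulomb_pot M Z R x\<bar> <= Mb*(1/dd x)"
    using pot_bound[OF that(2)] mult_right_mono[OF Mb(4), of "1/dd x"] dd_pos[OF that(2)] by simp
   then show ?thesis
    using Q_cases[OF that(1)] order_trans[OF vB[OF _ that(2)] Mb(2)] order_trans[OF wB[OF _ _ that(2)] Mb(3)] Mb(5) unfolding u_def mq_def by auto
  qed
  show "Cc >= 0" unfolding Cc_def using cN_pos by (simp add: sum_nonneg)
  show "(\<Sum>(c, a, b)\<leftarrow>rhs q. \<bar>c\<bar>) <= Cc" if "q \<in> Q" for q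
  proof -
   have l: "\<bar>lam i\<bar> <= (\<Sum>i<N. \<bar>lam i\<bar>)" if "i < N" for i using that by (intro member_le_sum) auto
   have s: "(\<Sum>i<N. \<bar>lam i\<bar>) >= 0" by (rule sum_nonneg) simp
   have l2: "\<bar>lam i\<bar> <= cN + (\<Sum>i<N. \<bar>lam i\<bar>)" if "i < N" for i using l[OF that] cN_pos by linarith
   show ?thesis using Q_cases[OF that] l2 s cN_pos unfolding rhs_def Cc_def
    by (auto simp: comp_def sum_list_triv)
  qed
  show "wlap Om (u q) (%x. \<Sum>(c, a, b)\<leftarrow>rhs q. c*(u a x*u b x))" if q: "q \<in> Q" for q
   using Q_cases[OF q]
  proof (elim disjE exE conjE)
   assume "q = One" then show ?thesis using wlap_const[of Om 1] by (simp add: rhs_def u_def)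
  next
   assume "q = Pot" then show ?thesis using pot_wlap by (simp add: rhs_def u_def)
  next
   fix i j assume ij: "i < N" "j < N" and [simp]: "q = Wf i j"
   have "wlap Om (ww (i, j)) (%x. - cN*(v i x * v j x))"
   proof (rule wlap_cong_AE[OF wlap_mono[OF w_wlap[OF ij]]])
    show "AE y in lborel. y \<in> Om --> w i j y = ww (i, j) y & - cN*(ph i y*ph j y) = - cN*(v i y * v j y)"
     using ww(3)[OF ij] v(3)[OF ij(1)] v(3)[OF ij(2)] by eventually_elim auto
    show "(%x. - cN*(ph i x*ph j x)) \<in> borel_measurable borel" using phi_measurable[OF ij(1)] phi_measurable[OF ij(2)] by measurable
    show "(%x. - cN*(v i x * v j x)) \<in> borel_measurable borel" using v(2)[OF ij(1)] v(2)[OF ij(2)] by measurable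
   qed (use w_measurable[OF ij] ww(2)[OF ij] in auto)
   then show ?thesis by (simp add: rhs_def u_def)
  next
   fix i assume i: "i < N" and [simp]: "q = Ph i"
   let ?G = "%x. coulomb_pot M Z R x * v i x + (\<Sum>j<N. ww (j, j) x * v i x) - (\<Sum>j<N. ww (j, i) x * v j x) - lam i * v i x"
   have "wlap Om (v i) ?G"
   proof (rule wlap_cong_AE[OF wlap_mono[OF weak_eq[OF i]]])
    have a1: "AE y in lborel. \<forall>j\<in>{..<N}. y \<in> Om --> ph j y = v j y" using v(3) by (subst AE_ball_countable) auto
    have a2: "AE y in lborel. \<forall>p\<in>{..<N} \<times> {..<N}. y \<in> Om --> w (fst p) (snd p) y = ww p y" using ww(3) by (subst AE_ball_countable) auto
    show "AE y in lborel. y \<in> Om --> ph i y = v i y & F i y = ?G y"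
     using a1 a2
    proof eventually_elim
     case (elim y)
     show ?case
     proof
      assume y: "y \<in> Om"
      have e1: "ph j y = v j y" if "j < N" for j using elim(1) that y by auto
      have e2: "w j k y = ww (j, k) y" if "j < N" "k < N" for j k using elim(2) that y by force
      show "ph i y = v i y & F i y = ?G y" unfolding F_def using e1 e2 i by simp
     qed
    qed
    show "?G \<in> borel_measurable borel"
     using v(2) ww(2) i by (intro borel_measurable_diff borel_measurable_add borel_measurable_times borel_measurable_sum) auto
   qed (use phi_measurable[OF i] F_measurable[OF i] v(2)[OF i] in auto)
   moreover have "(%x. \<Sum>(c, a, b)\<leftarrow>rhs q. c*(u a x*u b x)) = ?G"
    by (simp add: rhs_def u_def comp_def sum_list_upt fun_eq_iff sum_negf)
   ultimately show ?thesis by (simp add: u_def)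
  qed
 qed
 have "(AE x in lborel. ph i x = v i x) & (\<forall>js j. \<forall>x\<in>Om.
   has_pd (pds js (v i)) j x (pds (j # js) (v i) x) & \<bar>pds js (v i) x\<bar> <= Mb * sys.K^length js*fact (length js)*(1/dd x)^length js)
  & (\<forall>js. continuous_on Om (pds js (v i))) & (\<forall>js j k ks. \<forall>x\<in>Om. pds (js @ j # k # ks) (v i) x = pds (js @ k # j # ks) (v i) x)" if i: "i < N" for i
 proof -
  have ui: "u (Ph i) = v i" "mq (Ph i) = 0" by (auto simp: u_def mq_def)
  have ae: "AE x in lborel. ph i x = v i x" using v(3)[OF i] Om_AE by eventually_elim auto
  show ?thesis
   using ae sys.pds_has_pd[OF QI(3)[OF i], unfolded ui] sys.analytic[OF QI(3)[OF i], unfolded ui] sys.pds_continuous[OF QI(3)[OF i], unfolded ui]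
    sys.pds_swap[OF QI(3)[OF i], unfolded ui] by simp
 qed
 then show ?thesis using Mb(1) sys.K_pos by blast
qed

end

section \<open>Taylor expansion on cubes\<close>

definition tmono :: "nat => real => real" where "tmono a h = h^a/fact a"

text \<open>A tensor-product Taylor polynomial with a separate degree in each variable: a partial
  derivative lowers only one of the three degrees and stays in the class.\<close>

definition Tp :: "(nat => nat => nat => real) => nat => nat => nat => real^3 => real^3 => real" where
 "Tp C n1 n2 n3 x0 y = (\<Sum>a<n1. \<Sum>b<n2. \<Sum>c<n3. C a b c*(tmono a (y$1 - x0$1)*tmono b (y$2 - x0$2)*tmono c (y$3 - x0$3)))"

text \<open>The order of the derivatives is the one in which \<open>taylor_value\<close> expands:
  direction 1 innermost, then 2, then 3.\<close>

definition Cf :: "(real^3 => real) => real^3 => nat => nat => nat => real" where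
 "Cf f x0 a b c = pds (replicate c 3 @ replicate b 2 @ replicate a 1) f x0"

lemma fact_add_le: "fact (a + b) <= (2^(a + b)*(fact a*fact b) :: real)"
proof -
 have "fact a*fact b*((a + b) choose a) = (fact (a + b) :: nat)"
  using binomial_fact_lemma[of a "a + b"] by simp
 then have "fact (a + b) = (fact a*fact b*real ((a + b) choose a) :: real)"
  by (metis of_nat_fact of_nat_mult)
 also have "real ((a + b) choose a) <= 2^(a + b)" using binomial_le_pow2[of "a + b" a] by (metis of_nat_le_iff of_nat_numeral of_nat_power)
 finally show ?thesis by (simp add: mult.commute)
qed

lemma geom_half: "(\<Sum>a<n. (1/2)^a) <= (2::real)"
 by (simp add: geometric_sum)

locale anloc =
 fixes f :: "real^3 => real" and x0 :: "real^3" and rh M ka :: real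
 assumes pd: "y \<in> cube_inf x0 rh ==> has_pd (pds js f) j y (pds (j # js) f y)"
  and bd: "y \<in> cube_inf x0 rh ==> \<bar>pds js f y\<bar> <= M*ka^length js*fact (length js)"
  and M: "M >= 0" and ka: "ka >= 0"
begin

lemma taylor1:
 assumes z: "!!t. \<bar>t\<bar> <= \<bar>h\<bar> ==> sh z t j \<in> cube_inf x0 rh"
 shows "\<bar>pds js f (sh z h j) - (\<Sum>a<n. pds (replicate a j @ js) f z*tmono a h)\<bar> <= M*ka^(n + length js)*fact (n + length js)/fact n * \<bar>h\<bar>^n"
proof -
 let ?d = "%m t. pds (replicate m j @ js) f (sh z t j)"
 have "\<exists>t. \<bar>t\<bar> <= \<bar>h\<bar> & ?d 0 h = (\<Sum>m<n. ?d m 0/fact m*h^m) + ?d n t/fact n*h^n"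
 proof (rule Maclaurin_bi_le)
  show "\<forall>m t. m < n & \<bar>t\<bar> <= \<bar>h\<bar> --> DERIV (?d m) t :> ?d (Suc m) t"
   using pd[OF z] by (auto simp: has_pd_line[symmetric])
 qed simp
 then obtain t where t: "\<bar>t\<bar> <= \<bar>h\<bar>" "pds js f (sh z h j) = (\<Sum>m<n. ?d m 0/fact m*h^m) + ?d n t/fact n*h^n" by auto
 have "(\<Sum>m<n. ?d m 0/fact m*h^m) = (\<Sum>a<n. pds (replicate a j @ js) f z*tmono a h)" by (simp add: tmono_def)
 then have "\<bar>pds js f (sh z h j) - (\<Sum>a<n. pds (replicate a j @ js) f z*tmono a h)\<bar> = \<bar>?d n t\<bar>/fact n * \<bar>h\<bar>^n"
  using t(2) by (simp add: abs_mult power_abs)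
 also have "... <= (M*ka^(n + length js)*fact (n + length js))/fact n * \<bar>h\<bar>^n"
  using bd[OF z[OF t(1)], of "replicate n j @ js"] by (intro mult_right_mono divide_right_mono) auto
 finally show ?thesis .
qed

text \<open>(a + b + c)! is at most 4^(a+b+c) times the product of the factorials, so the
  coefficient in coordinates scaled by l is at most M (4 ka l)^(a+b+c), hence at most M.\<close>

lemma coeff_scaled:
 assumes l: "l >= 0" "8*ka*l <= 1" and r: "rh >= 0"
 shows "\<bar>Cf f x0 a b c\<bar>/(fact a*fact b*fact c)*l^(a + b + c) <= M"
proof -
 have x0: "x0 \<in> cube_inf x0 rh" using r by (simp add: cube_inf_def)
 have "\<bar>Cf f x0 a b c\<bar> <= M*ka^(a + b + c)*fact (a + b + c)"
  using bd[OF x0, of "replicate c 3 @ replicate b 2 @ replicate a 1"] by (simp add: Cf_def add_ac)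
 also have "... <= M*ka^(a + b + c)*(4^(a + b + c)*(fact a*fact b*fact c))"
 proof (intro mult_left_mono)
  have "fact (a + b + c) <= (2^(a + b + c)*(fact (a + b)*fact c) :: real)" by (rule fact_add_le)
  also have "... <= 2^(a + b + c)*((2^(a + b)*(fact a*fact b))*fact c)" by (intro mult_left_mono mult_right_mono fact_add_le) auto
  also have "... <= 2^(a + b + c)*((2^(a + b + c)*(fact a*fact b))*fact c)" by (intro mult_left_mono mult_right_mono power_increasing) auto
  also have "... = (2*2)^(a + b + c)*(fact a*fact b*fact c)" unfolding power_mult_distrib by (simp only: mult_ac)
  finally show "fact (a + b + c) <= (4^(a + b + c)*(fact a*fact b*fact c) :: real)" by simp
 qed (use M ka in auto)
 finally have "\<bar>Cf f x0 a b c\<bar>/(fact a*fact b*fact c) <= M*ka^(a + b + c)*4^(a + b + c)"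
  by (subst pos_divide_le_eq) (auto simp: mult_ac)
 then have "\<bar>Cf f x0 a b c\<bar>/(fact a*fact b*fact c)*l^(a + b + c) <= M*ka^(a + b + c)*4^(a + b + c)*l^(a + b + c)"
  using l by (intro mult_right_mono) auto
 also have "... = M*(4*ka*l)^(a + b + c)" by (simp add: power_mult_distrib mult_ac)
 also have "... <= M*1" using l ka M by (intro mult_left_mono power_le_one mult_nonneg_nonneg) auto
 finally show ?thesis by simp
qed

text \<open>The point y is reached from x0 along the axes and one variable is expanded at a time.
  The remainders are summed over the indices already expanded; geometric series give 1, 2 and 4
  times M (1/2)^n, together 7.\<close>

lemma taylor_value:
 assumes l: "0 <= l" "l <= rh" "8*ka*l <= 1" and y: "y \<in> cube_inf x0 l" and n: "n <= n1" "n <= n2" "n <= n3"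
 shows "\<bar>f y - Tp (Cf f x0) n1 n2 n3 x0 y\<bar> <= 7*M*(1/2)^n"
proof -
 define h where "h j = y $ j - x0 $ j" for j
 have h: "\<bar>h j\<bar> <= l" for j using y by (simp add: h_def cube_inf_def)
 define z1 where "z1 = x0 + h 2 *\<^sub>R ax 2 + h 3 *\<^sub>R ax 3"
 define z2 where "z2 = x0 + h 3 *\<^sub>R ax 3"
 have comp: "(sh z1 t 1) $ j - x0 $ j = (if j = 1 then t else h j)" "(sh z2 t 2) $ j - x0 $ j = (if j = 1 then 0 else if j = 2 then t else h j)"
   "(sh x0 t 3) $ j - x0 $ j = (if j = 3 then t else 0)" for t j
  using exhaust_3[of j] by (auto simp: z1_def z2_def axis_def)
 have in1: "sh z1 t 1 \<in> cube_inf x0 rh" if "\<bar>t\<bar> <= \<bar>h 1\<bar>" for t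
  unfolding cube_inf_def mem_Collect_eq comp using order_trans[OF that order_trans[OF h l(2)]] order_trans[OF h l(2)] order_trans[OF l(1,2)] by simp
 have in2: "sh z2 t 2 \<in> cube_inf x0 rh" if "\<bar>t\<bar> <= \<bar>h 2\<bar>" for t
  unfolding cube_inf_def mem_Collect_eq comp using order_trans[OF that order_trans[OF h l(2)]] order_trans[OF h l(2)] order_trans[OF l(1,2)] by simp
 have in3: "sh x0 t 3 \<in> cube_inf x0 rh" if "\<bar>t\<bar> <= \<bar>h 3\<bar>" for t
  unfolding cube_inf_def mem_Collect_eq comp using order_trans[OF that order_trans[OF h l(2)]] order_trans[OF h l(2)] order_trans[OF l(1,2)] by simp
 have yz: "y = z1 + h 1 *\<^sub>R ax 1" unfolding vec_eq_iff forall_3 by (simp add: z1_def h_def axis_def)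
 have zz: "z1 = z2 + h 2 *\<^sub>R ax 2" by (simp add: z1_def z2_def)
 let ?q = "ka*l"
 have q: "0 <= ?q" "8*?q <= 1" using l ka by (simp_all add: mult.assoc)
 have tmono: "\<bar>tmono a (h j)\<bar> <= l^a/fact a" for a j
  unfolding tmono_def abs_divide power_abs using h by (simp add: divide_right_mono power_mono)
 define P1 where "P1 a = pds (replicate a 1) f z1" for a
 define P2 where "P2 a b = pds (replicate b 2 @ replicate a 1) f z2" for a b
 have hp: "\<bar>h j\<bar>^k <= l^k" for j k using h by (intro power_mono) auto
 have Mk: "0 <= M*ka^k*fact k'/fact k''" for k k' k'' using M ka by simp
 have e1: "\<bar>f y - (\<Sum>a<n1. P1 a*tmono a (h 1))\<bar> <= M*(1/2)^n"
 proof -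
  have "\<bar>f y - (\<Sum>a<n1. P1 a*tmono a (h 1))\<bar> <= M*ka^n1*fact n1/fact n1 * \<bar>h 1\<bar>^n1"
   using taylor1[OF in1, where js="[]" and n=n1] unfolding yz P1_def by simp
  also have "... <= M*ka^n1*fact n1/fact n1*l^n1" by (intro mult_left_mono hp Mk)
  also have "... = M*?q^n1" by (simp add: power_mult_distrib)
  also have "... <= M*(1/2)^n1" using q M by (intro mult_left_mono power_mono) auto
  also have "... <= M*(1/2)^n" using n M by (intro mult_left_mono power_decreasing) auto
  finally show ?thesis .
 qed
 have e2: "\<bar>(P1 a - (\<Sum>b<n2. P2 a b*tmono b (h 2)))*tmono a (h 1)\<bar> <= M*(1/2)^n*(1/2)^a" for a
 proof -
  have "\<bar>P1 a - (\<Sum>b<n2. P2 a b*tmono b (h 2))\<bar> <= M*ka^(n2 + a)*fact (n2 + a)/fact n2 * \<bar>h 2\<bar>^n2"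
   using taylor1[OF in2, where js="replicate a 1" and n=n2] unfolding P1_def P2_def zz by simp
  also have "... <= M*ka^(n2 + a)*fact (n2 + a)/fact n2*l^n2" by (intro mult_left_mono hp Mk)
  finally have "\<bar>(P1 a - (\<Sum>b<n2. P2 a b*tmono b (h 2)))*tmono a (h 1)\<bar> <= (M*ka^(n2 + a)*fact (n2 + a)/fact n2*l^n2)*(l^a/fact a)"
   unfolding abs_mult using tmono l Mk by (intro mult_mono) (auto intro!: mult_nonneg_nonneg)
  also have "... = M*?q^(n2 + a)*(fact (n2 + a)/(fact n2*fact a))" by (simp add: power_mult_distrib power_add)
  also have "... <= M*?q^(n2 + a)*2^(n2 + a)"
   using fact_add_le[of n2 a] M q by (intro mult_left_mono) (auto simp: pos_divide_le_eq)
  also have "... = M*(2*?q)^(n2 + a)" by (simp add: power_mult_distrib)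
  also have "... <= M*(1/2)^(n2 + a)" using q M by (intro mult_left_mono power_mono) auto
  also have "... <= M*(1/2)^(n + a)" using n M by (intro mult_left_mono power_decreasing) auto
  finally show ?thesis by (simp add: power_add)
 qed
 have e3: "\<bar>(P2 a b - (\<Sum>c<n3. Cf f x0 a b c*tmono c (h 3)))*(tmono a (h 1)*tmono b (h 2))\<bar> <= M*(1/2)^n*(1/2)^a*(1/2)^b" for a b
 proof -
  have "\<bar>P2 a b - (\<Sum>c<n3. Cf f x0 a b c*tmono c (h 3))\<bar> <= M*ka^(n3 + (b + a))*fact (n3 + (b + a))/fact n3 * \<bar>h 3\<bar>^n3"
   using taylor1[OF in3, where js="replicate b 2 @ replicate a 1" and n=n3] unfolding P2_def Cf_def z2_def by simp
  also have "... <= M*ka^(n3 + (b + a))*fact (n3 + (b + a))/fact n3*l^n3" by (intro mult_left_mono hp Mk)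
  finally have "\<bar>(P2 a b - (\<Sum>c<n3. Cf f x0 a b c*tmono c (h 3)))*(tmono a (h 1)*tmono b (h 2))\<bar> <= (M*ka^(n3 + (b + a))*fact (n3 + (b + a))/fact n3*l^n3)*((l^a/fact a)*(l^b/fact b))"
   unfolding abs_mult using tmono l Mk by (intro mult_mono) (auto intro!: mult_nonneg_nonneg)
  also have "... = M*?q^(n3 + (b + a))*(fact (n3 + (b + a))/(fact n3*(fact b*fact a)))" by (simp add: power_mult_distrib power_add mult_ac)
  also have "... <= M*?q^(n3 + (b + a))*4^(n3 + (b + a))"
  proof (intro mult_left_mono)
   have "fact (n3 + (b + a)) <= (2^(n3 + (b + a))*(fact n3*fact (b + a)) :: real)" by (rule fact_add_le)
   also have "... <= 2^(n3 + (b + a))*(fact n3*(2^(b + a)*(fact b*fact a)))" by (intro mult_left_mono fact_add_le) auto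
   also have "... <= 2^(n3 + (b + a))*(fact n3*(2^(n3 + (b + a))*(fact b*fact a)))" by (intro mult_left_mono mult_right_mono power_increasing) auto
   also have "... = (2*2)^(n3 + (b + a))*(fact n3*(fact b*fact a))" unfolding power_mult_distrib by (simp only: mult_ac)
   finally show "fact (n3 + (b + a))/(fact n3*(fact b*fact a)) <= (4^(n3 + (b + a)) :: real)" by (subst pos_divide_le_eq) auto
  qed (use M q in auto)
  also have "... = M*(4*?q)^(n3 + (b + a))" by (simp add: power_mult_distrib)
  also have "... <= M*(1/2)^(n3 + (b + a))" using q M by (intro mult_left_mono power_mono) auto
  also have "... <= M*(1/2)^(n + (b + a))" using n M by (intro mult_left_mono power_decreasing) auto
  finally show ?thesis by (simp add: power_add mult_ac)
 qed
 let ?A = "\<Sum>a<n1. P1 a*tmono a (h 1)" and ?B = "\<Sum>a<n1. \<Sum>b<n2. P2 a b*(tmono a (h 1)*tmono b (h 2))"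
 have T: "Tp (Cf f x0) n1 n2 n3 x0 y = (\<Sum>a<n1. \<Sum>b<n2. (\<Sum>c<n3. Cf f x0 a b c*tmono c (h 3))*(tmono a (h 1)*tmono b (h 2)))"
  unfolding Tp_def h_def sum_distrib_right by (intro sum.cong refl) simp
 have "?A - ?B = (\<Sum>a<n1. (P1 a - (\<Sum>b<n2. P2 a b*tmono b (h 2)))*tmono a (h 1))"
  unfolding sum_subtractf[symmetric] left_diff_distrib sum_distrib_right by (simp only: mult_ac)
 then have "\<bar>?A - ?B\<bar> <= (\<Sum>a<n1. M*(1/2)^n*(1/2)^a)" using e2 by (simp only:) (intro order_trans[OF sum_abs] sum_mono)
 also have "... = M*(1/2)^n*(\<Sum>a<n1. (1/2)^a)" by (simp only: sum_distrib_left)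
 also have "... <= M*(1/2)^n*2" using M by (intro mult_left_mono geom_half) auto
 finally have f2: "\<bar>?A - ?B\<bar> <= M*(1/2)^n*2" .
 have "?B - Tp (Cf f x0) n1 n2 n3 x0 y = (\<Sum>a<n1. \<Sum>b<n2. (P2 a b - (\<Sum>c<n3. Cf f x0 a b c*tmono c (h 3)))*(tmono a (h 1)*tmono b (h 2)))"
  unfolding T by (simp only: sum_subtractf[symmetric] left_diff_distrib)
 then have "\<bar>?B - Tp (Cf f x0) n1 n2 n3 x0 y\<bar> <= (\<Sum>a<n1. \<Sum>b<n2. M*(1/2)^n*(1/2)^a*(1/2)^b)" using e3
  by (simp only:) (intro order_trans[OF sum_abs] sum_mono)
 also have "... = M*(1/2)^n*(\<Sum>a<n1. (1/2)^a)*(\<Sum>b<n2. (1/2)^b)" by (simp only: mult.assoc sum_product) (simp only: sum_distrib_left)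
 also have "... <= M*(1/2)^n*2*2" using M by (intro mult_mono geom_half) (auto intro!: sum_nonneg)
 finally have f3: "\<bar>?B - Tp (Cf f x0) n1 n2 n3 x0 y\<bar> <= M*(1/2)^n*4" by simp
 show ?thesis using e1 f2 f3 by linarith
qed

end

lemma mono_Suc_deriv: "((%h. tmono a h) has_real_derivative (if a = 0 then 0 else tmono (a - 1) h)) (at h)"
proof (cases a)
 case (Suc b)
 have "((%h. h^Suc b/fact (Suc b)) has_real_derivative (real (Suc b)*h^b)/fact (Suc b)) (at h)"
  using DERIV_cdivide[OF DERIV_pow[of "Suc b" h UNIV], of "fact (Suc b)"] by simp
 then show ?thesis using Suc by (simp add: tmono_def[abs_def])
qed (simp add: tmono_def[abs_def])

lemma Tp_has_pd:
 shows "has_pd (Tp C (Suc n) (Suc n) (Suc n) x0) 1 y (Tp (%a b c. C (Suc a) b c) n (Suc n) (Suc n) x0 y)"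
  "has_pd (Tp C (Suc n) (Suc n) (Suc n) x0) 2 y (Tp (%a b c. C a (Suc b) c) (Suc n) n (Suc n) x0 y)"
  "has_pd (Tp C (Suc n) (Suc n) (Suc n) x0) 3 y (Tp (%a b c. C a b (Suc c)) (Suc n) (Suc n) n x0 y)"
proof -
 let ?d = "%a h. if a = 0 then 0 else tmono (a - 1) h"
 have m: "has_pd (%y. tmono a (y $ k - x0 $ k)) j y (?d a (y $ k - x0 $ k)*(if k = j then 1 else 0))" for a k j
  by (rule has_pd_compose[OF mono_Suc_deriv]) (use has_pd_diff[OF has_pd_coord[of k j y] has_pd_const[of "x0 $ k"]] in simp)
 have g: "has_pd (Tp C (Suc n) (Suc n) (Suc n) x0) j y (\<Sum>a<Suc n. \<Sum>b<Suc n. \<Sum>c<Suc n. C a b c*(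
   ((?d a (y$1 - x0$1)*(if 1 = j then 1 else 0))*tmono b (y$2 - x0$2) + (?d b (y$2 - x0$2)*(if 2 = j then 1 else 0))*tmono a (y$1 - x0$1))*tmono c (y$3 - x0$3)
   + (?d c (y$3 - x0$3)*(if 3 = j then 1 else 0))*(tmono a (y$1 - x0$1)*tmono b (y$2 - x0$2))))" for j
  unfolding Tp_def by (intro has_pd_sum has_pd_cmult has_pd_mult m)
 show "has_pd (Tp C (Suc n) (Suc n) (Suc n) x0) 1 y (Tp (%a b c. C (Suc a) b c) n (Suc n) (Suc n) x0 y)"
 proof -
  have "(\<Sum>a<Suc n. \<Sum>b<Suc n. \<Sum>c<Suc n. C a b c*(?d a (y$1 - x0$1)*tmono b (y$2 - x0$2)*tmono c (y$3 - x0$3))) = Tp (%a b c. C (Suc a) b c) n (Suc n) (Suc n) x0 y"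
   unfolding Tp_def sum.lessThan_Suc_shift[of _ n] by simp
  then show ?thesis using g[of 1] by simp
 qed
 show "has_pd (Tp C (Suc n) (Suc n) (Suc n) x0) 2 y (Tp (%a b c. C a (Suc b) c) (Suc n) n (Suc n) x0 y)"
 proof -
  have "(\<Sum>a<Suc n. \<Sum>b<Suc n. \<Sum>c<Suc n. C a b c*(?d b (y$2 - x0$2)*tmono a (y$1 - x0$1)*tmono c (y$3 - x0$3))) = Tp (%a b c. C a (Suc b) c) (Suc n) n (Suc n) x0 y"
   unfolding Tp_def by (rule sum.cong[OF refl], subst sum.lessThan_Suc_shift) (simp add: mult_ac)
  then show ?thesis using g[of 2] by simp
 qed
 show "has_pd (Tp C (Suc n) (Suc n) (Suc n) x0) 3 y (Tp (%a b c. C a b (Suc c)) (Suc n) (Suc n) n x0 y)"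
 proof -
  have "(\<Sum>a<Suc n. \<Sum>b<Suc n. \<Sum>c<Suc n. C a b c*(?d c (y$3 - x0$3)*(tmono a (y$1 - x0$1)*tmono b (y$2 - x0$2)))) = Tp (%a b c. C a b (Suc c)) (Suc n) (Suc n) n x0 y"
   unfolding Tp_def by (rule sum.cong[OF refl], rule sum.cong[OF refl], subst sum.lessThan_Suc_shift) (simp add: mult_ac)
  then show ?thesis using g[of 3] by simp
 qed
qed

locale anloc_sym = anloc +
 assumes swap: "pds (js @ j # k # ks) f x0 = pds (js @ k # j # ks) f x0"
begin

lemma move: "pds (as @ bs @ [j]) f x0 = pds (as @ j # bs) f x0"
proof (induction bs arbitrary: as)
 case (Cons b bs)
 have "pds (as @ (b # bs) @ [j]) f x0 = pds ((as @ [b]) @ j # bs) f x0" using Cons[of "as @ [b]"] by simp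
 also have "... = pds (as @ j # b # bs) f x0" using swap[of as b j bs] by simp
 finally show ?case by simp
qed simp

text \<open>The additional derivative enters at the inner end of the list and has to be commuted to
  its place in the fixed order, which is the purpose of \<open>swap\<close>.\<close>

lemma Cf_pd:
 "Cf (pd 1 f) x0 a b c = Cf f x0 (Suc a) b c" "Cf (pd 2 f) x0 a b c = Cf f x0 a (Suc b) c" "Cf (pd 3 f) x0 a b c = Cf f x0 a b (Suc c)"
proof -
 have p: "pds js (pd j f) = pds (js @ [j]) f" for js j using pds_append[of js "[j]" f] by simp
 show "Cf (pd 1 f) x0 a b c = Cf f x0 (Suc a) b c"
  unfolding Cf_def p by (simp add: replicate_append_same)
 have "replicate c 3 @ replicate b 2 @ 2 # replicate a (1::3) = replicate c 3 @ replicate (Suc b) 2 @ replicate a 1"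
  by (simp add: replicate_app_Cons_same)
 then show "Cf (pd 2 f) x0 a b c = Cf f x0 a (Suc b) c"
  unfolding Cf_def p using move[of "replicate c 3 @ replicate b 2" "replicate a 1" 2] by (simp add: replicate_app_Cons_same)
 have "replicate c 3 @ 3 # replicate b 2 @ replicate a (1::3) = replicate (Suc c) 3 @ replicate b 2 @ replicate a 1"
  by (simp add: replicate_app_Cons_same)
 then show "Cf (pd 3 f) x0 a b c = Cf f x0 a b (Suc c)"
  unfolding Cf_def p using move[of "replicate c 3" "replicate b 2 @ replicate a 1" 3] by (simp add: replicate_app_Cons_same)
qed

text \<open>The derivative of the Taylor polynomial is the Taylor polynomial of the derivative, with
  one degree less in direction j. The derivative obeys the same kind of bounds with M*ka and 2*ka,
  because (p + 1)! <= 2^p p!, and this turns the condition with 8 into one with 16.\<close>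

lemma taylor_grad:
 assumes l: "0 <= l" "l <= rh" "16*ka*l <= 1" and y: "y \<in> cube_inf x0 l"
 shows "\<exists>D. has_pd (Tp (Cf f x0) (Suc n) (Suc n) (Suc n) x0) j y D & \<bar>pd j f y - D\<bar> <= 7*(M*ka)*(1/2)^n"
proof -
 interpret d: anloc "pd j f" x0 rh "M*ka" "2*ka"
 proof
  have p: "pds js (pd j f) = pds (js @ [j]) f" for js using pds_append[of js "[j]" f] by simp
  show "has_pd (pds js (pd j f)) k y (pds (k # js) (pd j f) y)" if "y \<in> cube_inf x0 rh" for y js k
   using pd[OF that, of "js @ [j]" k] unfolding p by simp
  show "\<bar>pds js (pd j f) y\<bar> <= M*ka*(2*ka)^length js*fact (length js)" if "y \<in> cube_inf x0 rh" for y js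
  proof -
   have "\<bar>pds js (pd j f) y\<bar> <= M*ka^Suc (length js)*fact (Suc (length js))" using bd[OF that, of "js @ [j]"] unfolding p by simp
   also have "... = M*ka*ka^length js*fact (length js)*real (Suc (length js))" by (simp add: algebra_simps)
   also have "... <= M*ka*ka^length js*fact (length js)*2^length js"
   proof (intro mult_left_mono)
    have "Suc (length js) <= 2^length js" by (simp add: Suc_le_eq)
    then show "real (Suc (length js)) <= 2^length js" by (metis of_nat_le_iff of_nat_numeral of_nat_power)
   qed (use M ka in auto)
   finally show ?thesis by (simp add: power_mult_distrib mult_ac)
  qed
 qed (use M ka in auto)
 note v = d.taylor_value[OF l(1,2) _ y]
 consider "j = 1" | "j = 2" | "j = 3" using exhaust_3 by blast
 then show ?thesis
 proof cases
  case 1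
  show ?thesis using Tp_has_pd(1)[of "Cf f x0" n x0 y] v[of n n "Suc n" "Suc n"] l unfolding 1 Cf_pd[symmetric, abs_def] by (intro exI[of _ "Tp (Cf (pd 1 f) x0) n (Suc n) (Suc n) x0 y"]) (simp add: eta_contract_eq)
 next
  case 2
  show ?thesis using Tp_has_pd(2)[of "Cf f x0" n x0 y] v[of n "Suc n" n "Suc n"] l unfolding 2 Cf_pd[symmetric, abs_def] by (intro exI[of _ "Tp (Cf (pd 2 f) x0) (Suc n) n (Suc n) x0 y"]) (simp add: eta_contract_eq)
 next
  case 3
  show ?thesis using Tp_has_pd(3)[of "Cf f x0" n x0 y] v[of n "Suc n" "Suc n" n] l unfolding 3 Cf_pd[symmetric, abs_def] by (intro exI[of _ "Tp (Cf (pd 3 f) x0) (Suc n) (Suc n) n x0 y"]) (simp add: eta_contract_eq)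
 qed
qed

end

section \<open>Networks of bounded width\<close>

abbreviation nz :: "real list => nat" where "nz r \<equiv> length (filter (%t. t ~= 0) r)"

definition rowv :: "real list => real list => real" where "rowv r v = sum_list (map2 (*) r v)"

lemma affine_eq: "affine A b v = map2 (%r c. rowv r v + c) A b"
 by (simp add: affine_def rowv_def)

lemma rowv_append: "length r = length v ==> rowv (r @ r') (v @ v') = rowv r v + rowv r' v'"
 by (simp add: rowv_def)

lemma rowv_zero: "rowv (replicate n 0) v = 0"
proof -
 have "map2 (*) (replicate n (0::real)) v = replicate (min n (length v)) 0"
  by (induction n arbitrary: v) (auto split: list.split simp: zip_Cons1)
 then show ?thesis by (simp add: rowv_def sum_list_replicate)
qed

lemma nn_wf_snoc: "nn_wf d PH n ==> length A = length b ==> \<forall>r\<in>set A. length r = n ==> nn_wf d (PH @ [(A, b)]) (length b)"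
 by (induction d PH n rule: nn_wf.induct) (auto split: if_splits)

lemma nn_wf_snocD: "nn_wf d (PH @ [(A, b)]) e ==> PH ~= [] ==> \<exists>n. nn_wf d PH n & length A = length b & (\<forall>r\<in>set A. length r = n) & length b = e"
proof (induction PH arbitrary: d)
 case (Cons p PH)
 obtain A' b' where [simp]: "p = (A', b')" by (cases p)
 show ?case
 proof (cases "PH = []")
  case False
  then show ?thesis using Cons by fastforce
 qed (use Cons in auto)
qed simp

lemma realize_snoc: "PH ~= [] ==> realize (PH @ [(A, b)]) x = affine A b (map relu (realize PH x))"
proof (induction PH x rule: realize.induct)
 case (2 A b x)
 then show ?case by simp
next
 case (3 A b v va x)
 then show ?case by simp
qed simp

definition lsz :: "real list list => real list => nat" where "lsz A b = nz (concat A) + nz b"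

lemma nn_size_snoc: "nn_size (PH @ [(A, b)]) = nn_size PH + lsz A b"
 by (simp add: nn_size_def lsz_def)

lemma lsz_append: "lsz (A @ A') (b @ b') = lsz A b + lsz A' b'"
 by (simp add: lsz_def)

lemma nz_concat_map_append:
 "nz (concat (map (%r. r @ replicate n 0) A)) = nz (concat A)" "nz (concat (map (%r. replicate n 0 @ r) A)) = nz (concat A)"
 by (induction A) auto

lemma lsz_pad: "lsz (map (%r. r @ replicate n 0) A) b = lsz A b" "lsz (map (%r. replicate n 0 @ r) A) b = lsz A b"
 by (simp_all add: lsz_def nz_concat_map_append)

lemma lsz_le: "\<forall>r\<in>set A. length r <= n ==> lsz A b <= length A*n + length b"
proof -
 assume a: "\<forall>r\<in>set A. length r <= n"
 have "length (concat A) <= length A*n" using a by (induction A) auto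
 then show ?thesis unfolding lsz_def by (meson add_mono le_trans length_filter_le)
qed

definition ev :: "(real^3 => real) list => real^3 => real list" where "ev fs x = map (%f. f x) fs"

text \<open>Networks are handled through the list of functions they realise, so that constructions
  become statements about functions; s is an upper bound of the size.\<close>

definition NN :: "nat => nat => (real^3 => real) list => bool" where
 "NN L s fs \<longleftrightarrow> (\<exists>PH. PH ~= [] & nn_wf 3 PH (length fs) & length PH = L & nn_size PH <= s
   & (\<forall>x. realize PH [x$1, x$2, x$3] = ev fs x))"

lemma NN_append:
 assumes "NN L s fs" and "length A = length b" "\<forall>r\<in>set A. length r = length fs"
  and "length gs = length b" "!!x. ev gs x = affine A b (map relu (ev fs x))"
 shows "NN (Suc L) (s + lsz A b) gs"
proof -
 obtain PH where p: "PH ~= []" "nn_wf 3 PH (length fs)" "length PH = L" "nn_size PH <= s" "!!x. realize PH [x$1, x$2, x$3] = ev fs x"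
  using assms(1) by (auto simp: NN_def)
 show ?thesis unfolding NN_def
  by (rule exI[of _ "PH @ [(A, b)]"]) (use p assms nn_wf_snoc[OF p(2) assms(2,3)] in \<open>auto simp: realize_snoc nn_size_snoc\<close>)
qed

lemma NN_SucD:
 assumes "NN (Suc L) s gs" "L > 0"
 shows "\<exists>s0 fs A b. NN L s0 fs & length A = length b & (\<forall>r\<in>set A. length r = length fs) & length gs = length b
  & (\<forall>x. ev gs x = affine A b (map relu (ev fs x))) & s0 + lsz A b <= s"
proof -
 obtain PH where p: "PH ~= []" "nn_wf 3 PH (length gs)" "length PH = Suc L" "nn_size PH <= s" "!!x. realize PH [x$1, x$2, x$3] = ev gs x"
  using assms(1) by (auto simp: NN_def)
 obtain Ps A b where PH: "PH = Ps @ [(A, b)]" using p(1) by (metis rev_exhaust surj_pair)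
 have ne: "Ps ~= []" using p(3) assms(2) PH by auto
 obtain n where n: "nn_wf 3 Ps n" "length A = length b" "\<forall>r\<in>set A. length r = n" "length b = length gs"
  using nn_wf_snocD[OF _ ne] p(2) unfolding PH by blast
 have len: "length (realize Ps [x$1, x$2, x$3]) = n" for x :: "real^3"
 proof -
  have "nn_wf d Ps n ==> length v = d ==> length (realize Ps v) = n" for d v
   using ne by (induction Ps v arbitrary: d rule: realize.induct) (auto simp: affine_def)
  then show ?thesis using n(1) by simp
 qed
 define fs where "fs = map (%i (x::real^3). realize Ps [x$1, x$2, x$3] ! i) [0..<n]"
 have ev: "ev fs x = realize Ps [x$1, x$2, x$3]" for x
  unfolding ev_def fs_def by (rule nth_equalityI) (simp_all add: len)
 have "NN L (nn_size Ps) fs" unfolding NN_def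
  by (rule exI[of _ Ps]) (use ne n p(3) PH ev in \<open>auto simp: fs_def\<close>)
 moreover have "\<forall>x. ev gs x = affine A b (map relu (ev fs x))" using p(5) unfolding PH realize_snoc[OF ne] ev by simp
 moreover have "nn_size Ps + lsz A b <= s" using p(4) unfolding PH nn_size_snoc .
 ultimately show ?thesis using n by (intro exI[of _ "nn_size Ps"] exI[of _ fs] exI[of _ A] exI[of _ b]) (auto simp: fs_def)
qed

text \<open>In the first layer the two networks share the input and are stacked; in later layers the
  weights are block diagonal. Padding zeros do not count, so the sizes add. Equal depth is
  essential, and the induction removes last layers with \<open>NN_SucD\<close>.\<close>

lemma NN_parallel: "L > 0 ==> NN L s fs ==> NN L s' fs' ==> NN L (s + s') (fs @ fs')"
proof (induction L arbitrary: s s' fs fs')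
 case (Suc L)
 show ?case
 proof (cases "L = 0")
  case True
  obtain PH where p: "PH ~= []" "nn_wf 3 PH (length fs)" "length PH = 1" "nn_size PH <= s" "!!x. realize PH [x$1, x$2, x$3] = ev fs x"
   using Suc.prems True by (auto simp: NN_def)
  obtain Ps where p': "Ps ~= []" "nn_wf 3 Ps (length fs')" "length Ps = 1" "nn_size Ps <= s'" "!!x. realize Ps [x$1, x$2, x$3] = ev fs' x"
   using Suc.prems True by (auto simp: NN_def)
  obtain A b where [simp]: "PH = [(A, b)]" using p(3) by (cases PH) auto
  obtain A' b' where [simp]: "Ps = [(A', b')]" using p'(3) by (cases Ps) auto
  have "affine (A @ A') (b @ b') v = affine A b v @ affine A' b' v" if "length A = length b" for v
   using that by (simp add: affine_def)
  then show ?thesis unfolding NN_def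
   by (intro exI[of _ "[(A @ A', b @ b')]"]) (use p p' True in \<open>auto simp: nn_size_def ev_def\<close>)
 next
  case False
  obtain s0 gs A b where g: "NN L s0 gs" "length A = length b" "\<forall>r\<in>set A. length r = length gs" "length fs = length b"
    "\<forall>x. ev fs x = affine A b (map relu (ev gs x))" "s0 + lsz A b <= s"
   using NN_SucD[OF Suc.prems(2)] False by auto
  obtain s0' gs' A' b' where g': "NN L s0' gs'" "length A' = length b'" "\<forall>r\<in>set A'. length r = length gs'" "length fs' = length b'"
    "\<forall>x. ev fs' x = affine A' b' (map relu (ev gs' x))" "s0' + lsz A' b' <= s'"
   using NN_SucD[OF Suc.prems(3)] False by auto
  let ?A = "map (%r. r @ replicate (length gs') 0) A @ map (%r. replicate (length gs) 0 @ r) A'"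
  have IH: "NN L (s0 + s0') (gs @ gs')" using Suc.IH[OF _ g(1) g'(1)] False by simp
  have "NN (Suc L) (s0 + s0' + lsz ?A (b @ b')) (fs @ fs')"
  proof (rule NN_append[OF IH])
   fix x
   let ?v = "map relu (ev gs x)" and ?v' = "map relu (ev gs' x)"
   have l: "length ?v = length gs" "length ?v' = length gs'" by (simp_all add: ev_def)
   have "map2 (%r c. rowv r (?v @ ?v') + c) (map (%r. r @ replicate (length gs') 0) A) b = map2 (%r c. rowv r ?v + c) A b"
   proof (rule nth_equalityI)
    fix i assume "i < length (map2 (%r c. rowv r (?v @ ?v') + c) (map (%r. r @ replicate (length gs') 0) A) b)"
    then have i: "i < length A" "i < length b" by auto
    then have "length (A ! i) = length ?v" using g(3) l by auto
    then show "map2 (%r c. rowv r (?v @ ?v') + c) (map (%r. r @ replicate (length gs') 0) A) b ! i = map2 (%r c. rowv r ?v + c) A b ! i"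
     using i by (simp add: rowv_append rowv_zero)
   qed simp
   moreover have "map2 (%r c. rowv r (?v @ ?v') + c) (map (%r. replicate (length gs) 0 @ r) A') b' = map2 (%r c. rowv r ?v' + c) A' b'"
    by (rule nth_equalityI) (auto simp: rowv_append rowv_zero ev_def)
   ultimately show "ev (fs @ fs') x = affine ?A (b @ b') (map relu (ev (gs @ gs') x))"
    using g(2,5) g'(2,5) unfolding affine_eq by (simp add: ev_def)
  qed (use g g' in auto)
  moreover have "s0 + s0' + lsz ?A (b @ b') <= s + s'" using g(6) g'(6) unfolding lsz_append lsz_pad by simp
  ultimately show ?thesis unfolding NN_def by (meson le_trans)
 qed
qed simp

text \<open>Affine combinations, that is, what one layer can compute from F before the activation;
  the constants are the biases.\<close>

inductive_set lin :: "(real^3 => real) set => (real^3 => real) set" for F where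
 lin_base: "f \<in> F ==> f \<in> lin F"
| lin_const: "(%x. c) \<in> lin F"
| lin_add: "f \<in> lin F ==> g \<in> lin F ==> (%x. f x + g x) \<in> lin F"
| lin_cmult: "f \<in> lin F ==> (%x. c*f x) \<in> lin F"

lemma lin_mono: "F \<subseteq> lin G ==> lin F \<subseteq> lin G"
proof
 fix f assume "F \<subseteq> lin G" "f \<in> lin F"
 then show "f \<in> lin G" by (induction rule: lin.induct[OF \<open>f \<in> lin F\<close>]) (auto intro: lin.intros)
qed

lemma lin_uminus: "f \<in> lin F ==> (%x. - f x) \<in> lin F"
 using lin_cmult[of f F "-1"] by simp

lemma lin_diff: "f \<in> lin F ==> g \<in> lin F ==> (%x. f x - g x) \<in> lin F"
 using lin_add[OF _ lin_uminus, of f F g] by simp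

lemma lin_coeffs: "g \<in> lin (set hs) ==> \<exists>c b. \<forall>x. g x = (\<Sum>i<length hs. c i*(hs ! i) x) + b"
proof (induction rule: lin.induct)
 case (lin_base f)
 then obtain i where i: "i < length hs" "f = hs ! i" by (auto simp: in_set_conv_nth)
 have "f x = (\<Sum>k<length hs. (if k = i then 1 else 0)*(hs ! k) x) + 0" for x
  using i by (simp add: if_distrib[of "%c. c*_"] sum.delta cong: if_cong)
 then show ?case by (intro exI[of _ "%k. if k = i then 1 else 0"] exI[of _ 0]) blast
next
 case (lin_const c)
 have "c = (\<Sum>k<length hs. 0*(hs ! k) x) + c" for x by simp
 then show ?case by (intro exI[of _ "%k. 0"] exI[of _ c]) simp
next
 case (lin_add f g)
 then obtain c b c' b' where "\<forall>x. f x = (\<Sum>i<length hs. c i*(hs ! i) x) + b" "\<forall>x. g x = (\<Sum>i<length hs. c' i*(hs ! i) x) + b'" by auto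
 then have "\<forall>x. f x + g x = (\<Sum>i<length hs. (c i + c' i)*(hs ! i) x) + (b + b')" by (simp add: distrib_right sum.distrib)
 then show ?case by (intro exI[of _ "%i. c i + c' i"] exI[of _ "b + b'"])
next
 case (lin_cmult f d)
 then obtain c b where "\<forall>x. f x = (\<Sum>i<length hs. c i*(hs ! i) x) + b" by auto
 then have "\<forall>x. d*f x = (\<Sum>i<length hs. (d*c i)*(hs ! i) x) + (d*b)" by (simp add: distrib_left sum_distrib_left mult.assoc)
 then show ?case by (intro exI[of _ "%i. d*c i"] exI[of _ "d*b"])
qed

lemma rowv_coeffs: "rowv (map c [0..<length v]) v = (\<Sum>i<length v. c i * v ! i)"
 unfolding rowv_def by (simp add: sum_list_sum_nth atLeast0LessThan)

lemma lin_rows: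
 assumes "set gs \<subseteq> lin (set hs)"
 shows "\<exists>A b. length A = length gs & length b = length gs & (\<forall>r\<in>set A. length r = length hs) & (\<forall>x. ev gs x = affine A b (ev hs x))"
proof -
 have "\<forall>g\<in>set gs. \<exists>cb. \<forall>x. g x = (\<Sum>i<length hs. fst cb i*(hs ! i) x) + snd cb"
  using lin_coeffs assms by fastforce
 from bchoice[OF this] obtain q where q: "\<forall>g\<in>set gs. \<forall>x. g x = (\<Sum>i<length hs. fst (q g) i*(hs ! i) x) + snd (q g)" ..
 let ?A = "map (%g. map (fst (q g)) [0..<length hs]) gs" and ?b = "map (%g. snd (q g)) gs"
 have "ev gs x = affine ?A ?b (ev hs x)" for x
 proof (rule nth_equalityI)
  fix i assume "i < length (ev gs x)"
  then have i: "i < length gs" by (simp add: ev_def)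
  then show "ev gs x ! i = affine ?A ?b (ev hs x) ! i"
   using q[rule_format, of "gs ! i" x] rowv_coeffs[of "fst (q (gs ! i))" "ev hs x"] by (simp add: affine_eq ev_def)
 qed (simp add: ev_def affine_eq)
 then show ?thesis by (intro exI[of _ ?A] exI[of _ ?b]) auto
qed

text \<open>The functions available after L activations with at most W neurons per layer. The
  closing affine layer is added in \<open>hidden_NN\<close>, so the depth becomes L + 1.\<close>

primrec hidden :: "nat => nat => (real^3 => real) list => bool" where
 "hidden W 0 hs \<longleftrightarrow> hs = [%x. x$1, %x. x$2, %x. x$3]"
| "hidden W (Suc L) hs \<longleftrightarrow> (\<exists>hs0 fs. hidden W L hs0 & set fs \<subseteq> lin (set hs0) & length fs <= W & hs = map (%f x. relu (f x)) fs)"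

lemma hidden_NN:
 assumes "W >= 3"
 shows "hidden W L hs ==> set gs \<subseteq> lin (set hs) ==> length gs <= W ==> NN (Suc L) (Suc L*(W*W + W)) gs"
proof (induction L arbitrary: hs gs)
 case 0
 obtain A b where A: "length A = length gs" "length b = length gs" "\<forall>r\<in>set A. length r = length hs" "\<forall>x. ev gs x = affine A b (ev hs x)"
  using lin_rows[OF 0(2)] by blast
 have h: "length hs = 3" "!!x. ev hs x = [x$1, x$2, x$3]" using 0 by (simp_all add: ev_def)
 have "lsz A b <= length A*3 + length b" by (rule lsz_le) (use A h in auto)
 also have "... <= W*W + W" using A 0 assms by (intro add_mono mult_mono) auto
 finally show ?case unfolding NN_def
  by (intro exI[of _ "[(A, b)]"]) (use A h in \<open>auto simp: nn_size_def lsz_def\<close>)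
next
 case (Suc L)
 obtain hs0 fs where f: "hidden W L hs0" "set fs \<subseteq> lin (set hs0)" "length fs <= W" "hs = map (%f x. relu (f x)) fs"
  using Suc.prems by auto
 have IH: "NN (Suc L) (Suc L*(W*W + W)) fs" by (rule Suc.IH[OF f(1,2,3)])
 obtain A b where A: "length A = length gs" "length b = length gs" "\<forall>r\<in>set A. length r = length hs" "\<forall>x. ev gs x = affine A b (ev hs x)"
  using lin_rows[OF Suc.prems(2)] by blast
 have "lsz A b <= length A*length hs + length b" by (rule lsz_le) (use A in auto)
 also have "... <= W*W + W" using A Suc.prems f by (intro add_mono mult_mono) auto
 finally have sz: "lsz A b <= W*W + W" .
 have "NN (Suc (Suc L)) (Suc L*(W*W + W) + lsz A b) gs"
  by (rule NN_append[OF IH]) (use A f in \<open>auto simp: ev_def comp_def\<close>)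
 moreover have "Suc L*(W*W + W) + lsz A b <= Suc (Suc L)*(W*W + W)" using sz by simp
 ultimately show ?case unfolding NN_def by (meson le_trans)
qed

text \<open>Members of F are affine read-outs of the hidden state; intermediate results thus need no
  neurons of their own, and a linear recombination costs no layer.\<close>

definition Prog :: "nat => nat => (real^3 => real) set => bool" where
 "Prog W L F \<longleftrightarrow> (\<exists>hs. hidden W L hs & F \<subseteq> lin (set hs))"

lemma Prog_0: "Prog W 0 {%x. x$1, %x. x$2, %x. x$3}"
 unfolding Prog_def by (auto intro!: lin_base)

lemma Prog_lin: "Prog W L F ==> G \<subseteq> lin F ==> Prog W L G"
 unfolding Prog_def using lin_mono by blast

lemma Prog_step:
 assumes "Prog W L F" "finite P" "card P <= W" "P \<subseteq> lin F"
 shows "Prog W (Suc L) ((%f x. relu (f x)) ` P)"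
proof -
 obtain hs where h: "hidden W L hs" "F \<subseteq> lin (set hs)" using assms(1) by (auto simp: Prog_def)
 obtain fs where f: "set fs = P" "distinct fs" using finite_distinct_list[OF assms(2)] by blast
 have "length fs <= W" using f assms(3) distinct_card by metis
 moreover have "set fs \<subseteq> lin (set hs)" using f assms(4) lin_mono[OF h(2)] by blast
 ultimately have "hidden W (Suc L) (map (%f x. relu (f x)) fs)" using h by auto
 moreover have "(%f x. relu (f x)) ` P \<subseteq> lin (set (map (%f x. relu (f x)) fs))" using f by (auto intro: lin_base)
 ultimately show ?thesis unfolding Prog_def by blast
qed

lemma relu_diff: "relu t - relu (- t) = t" by (simp add: relu_def max_def)

text \<open>By t = relu t - relu (- t), carrying a value of unknown sign through a layer costs two
  neurons; this is the 2*n in the width.\<close>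

lemma Prog_keep:
 assumes P: "Prog W L F" and V: "V \<subseteq> lin F" "finite V" "card V <= n" and Q: "finite Q" "card Q <= p" "Q \<subseteq> lin F" and W: "2*n + p <= W"
 shows "Prog W (Suc L) (V \<union> (%f x. relu (f x)) ` Q)"
proof -
 let ?m = "%f x. - f x :: real"
 let ?P = "(V \<union> ?m ` V) \<union> Q"
 have "card ?P <= (card V + card (?m ` V)) + card Q" by (intro order_trans[OF card_Un_le] add_mono card_Un_le order_refl)
 also have "... <= W" using V(3) Q(2) W card_image_le[OF V(2), of ?m] by linarith
 finally have "Prog W (Suc L) ((%f x. relu (f x)) ` ?P)"
  using V Q lin_uminus by (intro Prog_step[OF P]) auto
 then show ?thesis
 proof (rule Prog_lin)
  show "V \<union> (%f x. relu (f x)) ` Q \<subseteq> lin ((%f x. relu (f x)) ` ?P)"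
  proof
   fix g assume "g \<in> V \<union> (%f x. relu (f x)) ` Q"
   then consider "g \<in> V" | f where "f \<in> Q" "g = (%x. relu (f x))" by auto
   then show "g \<in> lin ((%f x. relu (f x)) ` ?P)"
   proof cases
    case 1
    have "(%x. relu (g x) - relu (- g x)) \<in> lin ((%f x. relu (f x)) ` ?P)"
     using 1 by (intro lin_diff lin_base) force+
    then show ?thesis by (simp add: relu_diff)
   next
    case 2
    then show ?thesis by (intro lin_base) auto
   qed
  qed
 qed
qed

section \<open>Approximate squares, products and powers\<close>

definition hat :: "real => real" where "hat t = 2*relu t - 4*relu (t - 1/2)"

text \<open>Yarotsky's square: on [-1, 1] this is the piecewise linear interpolant of t^2 at the
  multiples of 2^(-m), obtained by subtracting scaled iterates of the tent map from |t|.\<close>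

primrec sqm :: "nat => real => real" where
 "sqm 0 t = \<bar>t\<bar>"
| "sqm (Suc m) t = sqm m t - (hat ^^ Suc m) \<bar>t\<bar>/4^Suc m"

text \<open>Polarisation with halved arguments, which stay in [-1, 1] whenever a and b do.\<close>

definition mul :: "nat => real => real => real" where
 "mul m a b = sqm m ((a + b)/2) - sqm m ((a - b)/2)"

lemma card_insert2: "finite V ==> card V <= n ==> card (insert a V) <= Suc n"
 by (simp add: card_insert_if)

text \<open>One layer per refinement. The state consists of the partial sum, the current iterate of
  the tent map and the carried set V; only the iterate is transformed, at the price of two
  neurons.\<close>

lemma Prog_sq:
 assumes P: "Prog W L F" and f: "f \<in> lin F" and V: "V \<subseteq> lin F" "finite V" "card V <= n" and W: "2*n + 4 <= W"
 shows "Prog W (L + Suc m) (insert (%x. sqm m (f x)) V)"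
proof -
 have "Prog W (Suc L + m) (insert (%x. sqm m (f x)) (insert (%x. (hat ^^ m) \<bar>f x\<bar>) V))"
 proof (induction m)
  case 0
  have "Prog W (Suc L) (V \<union> (%f x. relu (f x)) ` {f, %x. - f x})"
  proof (rule Prog_keep[OF P V, where p=2])
   show "card {f, %x. - f x} <= 2" by (rule order_trans[OF card_insert_le_m1[of 2]]) auto
   show "{f, %x. - f x} \<subseteq> lin F" using f lin_uminus by auto
  qed (use W in auto)
  then have "Prog W (Suc L) (insert (%x. \<bar>f x\<bar>) (insert (%x. \<bar>f x\<bar>) V))"
  proof (rule Prog_lin)
   have "(%x. relu (f x) + relu (- f x)) \<in> lin (V \<union> (%f x. relu (f x)) ` {f, %x. - f x})"
    by (intro lin_add lin_base) auto
   moreover have "(%x. relu (f x) + relu (- f x)) = (%x. \<bar>f x\<bar>)" by (auto simp: relu_def max_def)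
   ultimately show "insert (%x. \<bar>f x\<bar>) (insert (%x. \<bar>f x\<bar>) V) \<subseteq> lin (V \<union> (%f x. relu (f x)) ` {f, %x. - f x})"
    by (auto intro: lin_base)
  qed
  then show ?case by simp
 next
  case (Suc m)
  let ?s = "%x. sqm m (f x)" and ?h = "%x. (hat ^^ m) \<bar>f x\<bar>"
  let ?F = "insert ?s (insert ?h V)" and ?Q = "{?h, %x. ?h x - 1/2}"
  let ?G = "insert ?s V \<union> (%f x. relu (f x)) ` ?Q"
  have "Prog W (Suc (Suc L + m)) ?G"
  proof (rule Prog_keep[OF Suc, where n="Suc n" and p=2])
   show "insert ?s V \<subseteq> lin ?F" by (auto intro: lin_base)
   show "card (insert ?s V) <= Suc n" by (rule card_insert2[OF V(2,3)])
   show "card ?Q <= 2" by (rule order_trans[OF card_insert_le_m1[of 2]]) auto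
   show "?Q \<subseteq> lin ?F" by (auto intro: lin_base lin_diff lin_const)
  qed (use W V in auto)
  then have "Prog W (Suc L + Suc m) ?G" by simp
  then show ?case
  proof (rule Prog_lin)
   have h: "(%x. 2*relu (?h x) - 4*relu (?h x - 1/2)) \<in> lin ?G"
    by (intro lin_diff lin_cmult lin_base) auto
   then have h': "(%x. (hat ^^ Suc m) \<bar>f x\<bar>) \<in> lin ?G" by (simp add: hat_def)
   have "(%x. ?s x - (1/4^Suc m)*(hat ^^ Suc m) \<bar>f x\<bar>) \<in> lin ?G"
    by (intro lin_diff lin_cmult h') (auto intro: lin_base)
   then have "(%x. sqm (Suc m) (f x)) \<in> lin ?G" by (simp only: sqm.simps times_divide_eq_left mult_1)
   then show "insert (%x. sqm (Suc m) (f x)) (insert (%x. (hat ^^ Suc m) \<bar>f x\<bar>) V) \<subseteq> lin ?G"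
    using h' by (auto intro: lin_base)
  qed
 qed
 then have "Prog W (L + Suc m) (insert (%x. sqm m (f x)) (insert (%x. (hat ^^ m) \<bar>f x\<bar>) V))" by simp
 then show ?thesis by (rule Prog_lin) (auto intro: lin_base)
qed

lemma Prog_mul:
 assumes P: "Prog W L F" and f: "f \<in> lin F" "g \<in> lin F" and V: "V \<subseteq> lin F" "finite V" "card V <= n" and W: "2*n + 8 <= W"
 shows "Prog W (L + 2*Suc m) (insert (%x. mul m (f x) (g x)) V)"
proof -
 let ?a = "%x. (1/2)*(f x + g x)" and ?b = "%x. (1/2)*(f x - g x)"
 have b: "?b \<in> lin F" and a: "?a \<in> lin F" by (intro lin_cmult lin_add lin_diff f)+
 have "Prog W (L + Suc m) (insert (%x. sqm m (?a x)) (insert ?b V))"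
  by (rule Prog_sq[OF P a _ _ card_insert2[OF V(2,3), of ?b]]) (use V W b in auto)
 then have "Prog W (L + Suc m + Suc m) (insert (%x. sqm m (?b x)) (insert (%x. sqm m (?a x)) V))"
  by (rule Prog_sq[OF _ _ _ _ card_insert2[OF V(2,3)]]) (use V W in \<open>auto intro: lin_base\<close>)
 then have "Prog W (L + 2*Suc m) (insert (%x. sqm m (?b x)) (insert (%x. sqm m (?a x)) V))" by (simp add: add.assoc mult_2)
 then show ?thesis
 proof (rule Prog_lin)
  have "(%x. sqm m (?a x) - sqm m (?b x)) \<in> lin (insert (%x. sqm m (?b x)) (insert (%x. sqm m (?a x)) V))"
   by (intro lin_diff lin_base) auto
  then show "insert (%x. mul m (f x) (g x)) V \<subseteq> lin (insert (%x. sqm m (?b x)) (insert (%x. sqm m (?a x)) V))"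
   by (auto simp: mul_def intro: lin_base)
 qed
qed

primrec zz :: "nat => nat => real => real" where
 "zz m 0 z = z"
| "zz m (Suc i) z = mul m (zz m i z) (zz m i z)"

text \<open>Binary powering: \<open>zz m i\<close> approximates the power 2^i, and the powers
  selected by the binary digits of a are multiplied. A digit 0 multiplies by 1 instead of being
  skipped, so that all exponents lead to the same depth, as \<open>NN_parallel\<close>
  requires.\<close>

primrec rr :: "nat => nat => nat => real => real" where
 "rr m a 0 z = 1"
| "rr m a (Suc i) z = mul m (rr m a i z) (if odd (a div 2^i) then zz m i z else 1)"

lemma Prog_pow:
 assumes P: "Prog W L F" and f: "f \<in> lin F" and V: "V \<subseteq> lin F" "finite V" "card V <= n" and W: "2*n + 12 <= W"
 shows "Prog W (L + k*(4*Suc m)) (insert (%x. rr m a k (f x)) V)"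
proof -
 have "Prog W (L + k*(4*Suc m)) (insert (%x. rr m a k (f x)) (insert (%x. zz m k (f x)) V))"
 proof (induction k)
  case 0
  have "Prog W L (insert (%x. 1) (insert f V))" by (rule Prog_lin[OF P]) (use f V in \<open>auto intro: lin_const\<close>)
  then show ?case by simp
 next
  case (Suc k)
  let ?r = "%x. rr m a k (f x)" and ?z = "%x. zz m k (f x)"
  let ?w = "%x. if odd (a div 2^k) then ?z x else 1"
  let ?F = "insert ?r (insert ?z V)"
  have w: "?w \<in> lin ?F" by (cases "odd (a div 2^k)") (auto intro: lin_base lin_const)
  have 1: "Prog W (L + k*(4*Suc m) + 2*Suc m) (insert (%x. mul m (?r x) (?w x)) (insert ?z V))"
   by (rule Prog_mul[OF Suc _ w _ _ card_insert2[OF V(2,3), of ?z]]) (use V W in \<open>auto intro: lin_base\<close>)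
  have "Prog W (L + k*(4*Suc m) + 2*Suc m + 2*Suc m) (insert (%x. mul m (?z x) (?z x)) (insert (%x. mul m (?r x) (?w x)) V))"
   by (rule Prog_mul[OF 1 _ _ _ _ card_insert2[OF V(2,3)]]) (use V W in \<open>auto intro: lin_base\<close>)
  moreover have "L + k*(4*Suc m) + 2*Suc m + 2*Suc m = L + Suc k*(4*Suc m)" by simp
  ultimately show ?case by (simp only: insert_commute zz.simps rr.simps)
 qed
 then show ?thesis by (rule Prog_lin) (auto intro: lin_base)
qed

section \<open>Errors in value and in Lipschitz constant\<close>

lemma hat_range: "0 <= t ==> t <= 1 ==> 0 <= hat t & hat t <= 1"
 by (auto simp: hat_def relu_def max_def)

lemma hat_Lip: "\<bar>hat s - hat t\<bar> <= 2 * \<bar>s - t\<bar>"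
 unfolding hat_def relu_def max_def by (auto simp: abs_if split: if_splits)

lemma hat_pow_range: "0 <= t ==> t <= 1 ==> 0 <= (hat ^^ m) t & (hat ^^ m) t <= 1"
 by (induction m) (auto simp: hat_range)

lemma hat_pow_Lip: "\<bar>(hat ^^ m) s - (hat ^^ m) t\<bar> <= 2^m * \<bar>s - t\<bar>"
proof (induction m)
 case (Suc m)
 have "\<bar>(hat ^^ Suc m) s - (hat ^^ Suc m) t\<bar> <= 2 * \<bar>(hat ^^ m) s - (hat ^^ m) t\<bar>" using hat_Lip by simp
 then show ?case using Suc by simp
qed simp

text \<open>With u the m-th tent iterate of |t| the error is exactly (u - u^2)/4^m. The formula
  reproduces itself under one more refinement because 4 (u - u^2) - hat u = hat u - (hat
  u)^2.\<close>

lemma sqm_error: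
 assumes "\<bar>t\<bar> <= 1"
 shows "sqm m t - t^2 = ((hat ^^ m) \<bar>t\<bar> - ((hat ^^ m) \<bar>t\<bar>)^2)/4^m"
proof (induction m)
 case (Suc m)
 define u where "u = (hat ^^ m) \<bar>t\<bar>"
 have u: "0 <= u" "u <= 1" using hat_pow_range[of "\<bar>t\<bar>" m] assms by (auto simp: u_def)
 have k: "4*(u - u^2) - hat u = hat u - (hat u)^2"
  using u by (cases "u <= 1/2") (auto simp: hat_def relu_def max_def power2_eq_square algebra_simps)
 have "sqm (Suc m) t - t^2 = (u - u^2)/4^m - hat u/4^Suc m" using Suc by (simp add: u_def)
 also have "... = (4*(u - u^2) - hat u)/4^Suc m" by (simp add: field_simps)
 finally show ?case unfolding k by (simp add: u_def)
qed simp

lemma sqm_bounds: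
 assumes "\<bar>t\<bar> <= 1"
 shows "0 <= sqm m t - t^2" "sqm m t - t^2 <= (1/2)^m" "0 <= sqm m t" "sqm m t <= 1"
proof -
 define u where "u = (hat ^^ m) \<bar>t\<bar>"
 have u: "0 <= u" "u <= 1" using hat_pow_range[of "\<bar>t\<bar>" m] assms by (auto simp: u_def)
 have e: "sqm m t - t^2 = (u - u^2)/4^m" using sqm_error[OF assms] by (simp add: u_def)
 have u2: "u^2 <= u" using u by (simp add: power2_eq_square mult_left_le)
 then show 0: "0 <= sqm m t - t^2" unfolding e by simp
 have "(u - u^2)/4^m <= 1/4^m" using u by (intro divide_right_mono) (auto intro: order_trans[of _ u])
 also have "... <= 1/2^m" by (intro divide_left_mono power_mono) auto
 finally show "sqm m t - t^2 <= (1/2)^m" unfolding e by (simp add: power_one_over)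
 show "0 <= sqm m t" using 0 zero_le_power2[of t] by linarith
 have "sqm m t <= \<bar>t\<bar>"
 proof (induction m)
  case (Suc m)
  have "0 <= (hat ^^ Suc m) \<bar>t\<bar>/4^Suc m" using hat_pow_range[of "\<bar>t\<bar>" "Suc m"] assms by simp
  then show ?case using Suc by (simp only: sqm.simps)
 qed simp
 then show "sqm m t <= 1" using assms by simp
qed

text \<open>The iterate has Lipschitz constant 2^m and u - u^2 has constant 1 on [0, 1]; divided by
  4^m this leaves 2^(-m). The squaring error is therefore small in the gradient as well, which the
  H1 norm demands.\<close>

lemma sqm_error_Lip:
 assumes "\<bar>s\<bar> <= 1" "\<bar>t\<bar> <= 1"
 shows "\<bar>(sqm m s - s^2) - (sqm m t - t^2)\<bar> <= (1/2)^m * \<bar>s - t\<bar>"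
proof -
 define u v where "u = (hat ^^ m) \<bar>s\<bar>" and "v = (hat ^^ m) \<bar>t\<bar>"
 have r: "0 <= u" "u <= 1" "0 <= v" "v <= 1" using hat_pow_range[of "\<bar>s\<bar>" m] hat_pow_range[of "\<bar>t\<bar>" m] assms by (auto simp: u_def v_def)
 have "(u - u^2) - (v - v^2) = (u - v)*(1 - u - v)" by (simp add: power2_eq_square algebra_simps)
 then have "\<bar>(u - u^2) - (v - v^2)\<bar> = \<bar>u - v\<bar> * \<bar>1 - u - v\<bar>" by (simp add: abs_mult)
 also have "... <= \<bar>u - v\<bar>*1" using r by (intro mult_left_mono) auto
 also have "\<bar>u - v\<bar> <= 2^m * \<bar>\<bar>s\<bar> - \<bar>t\<bar>\<bar>" unfolding u_def v_def by (rule hat_pow_Lip)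
 also have "... <= 2^m * \<bar>s - t\<bar>" by (intro mult_left_mono) auto
 finally have "\<bar>(u - u^2) - (v - v^2)\<bar> <= 2^m * \<bar>s - t\<bar>" by simp
 then have "\<bar>(u - u^2) - (v - v^2)\<bar>/4^m <= 2^m * \<bar>s - t\<bar>/4^m" by (intro divide_right_mono) auto
 also have "2^m * \<bar>s - t\<bar>/4^m = (2/4)^m * \<bar>s - t\<bar>" unfolding power_divide by simp
 finally show ?thesis unfolding sqm_error[OF assms(1)] sqm_error[OF assms(2)]
  by (simp add: u_def v_def diff_divide_distrib[symmetric] abs_divide)
qed

lemma mul_bounds:
 assumes "\<bar>a\<bar> <= 1" "\<bar>b\<bar> <= 1"
 shows "\<bar>mul m a b\<bar> <= 1" "\<bar>mul m a b - a*b\<bar> <= (1/2)^m"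
proof -
 have s: "\<bar>(a + b)/2\<bar> <= 1" "\<bar>(a - b)/2\<bar> <= 1" using assms by auto
 show "\<bar>mul m a b\<bar> <= 1" unfolding mul_def using sqm_bounds(3,4)[OF s(1), of m] sqm_bounds(3,4)[OF s(2), of m] by linarith
 have "a*b = ((a + b)/2)^2 - ((a - b)/2)^2" by (simp add: power2_eq_square field_simps)
 then show "\<bar>mul m a b - a*b\<bar> <= (1/2)^m" unfolding mul_def
  using sqm_bounds(1,2)[OF s(1), of m] sqm_bounds(1,2)[OF s(2), of m] by linarith
qed

lemma mul_error_Lip:
 assumes "\<bar>a\<bar> <= 1" "\<bar>b\<bar> <= 1" "\<bar>c\<bar> <= 1" "\<bar>d\<bar> <= 1"
 shows "\<bar>(mul m a b - a*b) - (mul m c d - c*d)\<bar> <= (1/2)^m*(\<bar>a - c\<bar> + \<bar>b - d\<bar>)"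
proof -
 have e: "mul m a b - a*b = (sqm m ((a + b)/2) - ((a + b)/2)^2) - (sqm m ((a - b)/2) - ((a - b)/2)^2)" for a b
  unfolding mul_def by (simp add: power2_eq_square field_simps)
 have s: "\<bar>(a + b)/2\<bar> <= 1" "\<bar>(a - b)/2\<bar> <= 1" "\<bar>(c + d)/2\<bar> <= 1" "\<bar>(c - d)/2\<bar> <= 1" using assms by auto
 have "\<bar>(mul m a b - a*b) - (mul m c d - c*d)\<bar> <= (1/2)^m * \<bar>(a + b)/2 - (c + d)/2\<bar> + (1/2)^m * \<bar>(a - b)/2 - (c - d)/2\<bar>"
  unfolding e using sqm_error_Lip[OF s(1,3), of m] sqm_error_Lip[OF s(2,4), of m] by linarith
 also have "... = (1/2)^m*(\<bar>(a + b)/2 - (c + d)/2\<bar> + \<bar>(a - b)/2 - (c - d)/2\<bar>)" by (simp only: distrib_left)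
 also have "... <= (1/2)^m*(\<bar>a - c\<bar> + \<bar>b - d\<bar>)"
  by (intro mult_left_mono) (auto simp: abs_if field_simps)
 finally show ?thesis .
qed

text \<open>The error et is measured in values and, relative to the Lipschitz constant La of f, in
  difference quotients: a C1-type closeness for functions that need not be differentiable. The
  bounds by 1 keep all factors in the range where \<open>mul\<close> is accurate.\<close>

definition ap :: "real => real => (real^3 => real) => (real^3 => real) => bool" where
 "ap et La g f \<longleftrightarrow> (\<forall>x. \<bar>g x\<bar> <= 1 & \<bar>f x\<bar> <= 1 & \<bar>g x - f x\<bar> <= et)
   & (\<forall>x y. \<bar>f x - f y\<bar> <= La*norm (x - y) & \<bar>(g x - f x) - (g y - f y)\<bar> <= et*La*norm (x - y))"

lemma ap_exact: "(!!x. \<bar>f x\<bar> <= 1) ==> (!!x y. \<bar>f x - f y\<bar> <= La*norm (x - y)) ==> 0 <= et ==> ap et La f f"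
proof -
 assume a: "!!x. \<bar>f x\<bar> <= 1" "!!x y. \<bar>f x - f y\<bar> <= La*norm (x - y)" "0 <= et"
 have "0 <= La*norm (x - y)" for x y :: "real^3" using a(2)[of x y] by linarith
 then show ?thesis using a by (simp add: ap_def mult.assoc)
qed

lemma ap_mono: "ap et La g f ==> et <= et' ==> ap et' La g f"
proof -
 assume a: "ap et La g f" "et <= et'"
 show ?thesis unfolding ap_def
 proof (intro conjI allI)
  fix x y :: "real^3"
  note p = a(1)[unfolded ap_def, THEN conjunct1, rule_format, of x] and q = a(1)[unfolded ap_def, THEN conjunct2, rule_format, of x y]
  show "\<bar>g x\<bar> <= 1" "\<bar>f x\<bar> <= 1" "\<bar>g x - f x\<bar> <= et'" using p a(2) by simp_all
  show "\<bar>f x - f y\<bar> <= La*norm (x - y)" using q by simp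
  then have "0 <= La*norm (x - y)" by linarith
  then have "et*(La*norm (x - y)) <= et'*(La*norm (x - y))" using a(2) by (rule mult_right_mono[rotated])
  then show "\<bar>(g x - f x) - (g y - f y)\<bar> <= et'*La*norm (x - y)" using q by (simp add: mult.assoc)
 qed
qed

lemma abs_tri3: "\<bar>p + q + r\<bar> <= \<bar>p\<bar> + \<bar>q\<bar> + \<bar>r\<bar>" for p q r :: real by linarith

lemma abs_tri3': "\<bar>p - p'\<bar> <= P ==> \<bar>q - q'\<bar> <= Q ==> \<bar>r - r'\<bar> <= S ==> \<bar>(p + q + r) - (p' + q' + r')\<bar> <= P + Q + S"
 for p q r :: real by linarith

text \<open>The error consists of that of \<open>mul\<close> and the propagated errors of the two
  factors. The Lipschitz constants add up to 3 et La1 + 4 et La2, which is at most 5 et (La1 + La2);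
  hence the factor 5 for each multiplication.\<close>

lemma ap_mul:
 assumes g: "ap et La1 g1 f1" "ap et La2 g2 f2" and et: "et <= 1" "2*(1/2)^m <= et" and L: "La1 >= 0" "La2 >= 0"
 shows "ap (5*et) (La1 + La2) (%x. mul m (g1 x) (g2 x)) (%x. f1 x*f2 x)"
proof -
 have b1: "\<bar>g1 x\<bar> <= 1 & \<bar>f1 x\<bar> <= 1 & \<bar>g1 x - f1 x\<bar> <= et" for x using g(1) by (simp add: ap_def)
 have b2: "\<bar>g2 x\<bar> <= 1 & \<bar>f2 x\<bar> <= 1 & \<bar>g2 x - f2 x\<bar> <= et" for x using g(2) by (simp add: ap_def)
 have l1: "\<bar>f1 x - f1 y\<bar> <= La1*norm (x - y)" "\<bar>(g1 x - f1 x) - (g1 y - f1 y)\<bar> <= et*La1*norm (x - y)" for x y using g(1) by (simp_all add: ap_def)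
 have l2: "\<bar>f2 x - f2 y\<bar> <= La2*norm (x - y)" "\<bar>(g2 x - f2 x) - (g2 y - f2 y)\<bar> <= et*La2*norm (x - y)" for x y using g(2) by (simp_all add: ap_def)
 have e0: "0 <= et" using et(2) zero_le_power[of "1/2::real" m] by linarith
 show ?thesis unfolding ap_def
 proof (intro conjI allI)
  fix x y :: "real^3"
  let ?n = "norm (x - y)"
  show "\<bar>mul m (g1 x) (g2 x)\<bar> <= 1" using mul_bounds(1)[of "g1 x" "g2 x" m] b1[of x] b2[of x] by simp
  show "\<bar>f1 x*f2 x\<bar> <= 1" unfolding abs_mult using b1[of x] b2[of x] by (simp add: mult_le_one)
  have dec: "mul m (g1 z) (g2 z) - f1 z*f2 z = (mul m (g1 z) (g2 z) - g1 z*g2 z) + (g1 z - f1 z)*g2 z + f1 z*(g2 z - f2 z)" for z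
   by (simp add: algebra_simps)
  have "\<bar>(g1 x - f1 x)*g2 x\<bar> <= et*1" "\<bar>f1 x*(g2 x - f2 x)\<bar> <= 1*et"
   unfolding abs_mult using b1[of x] b2[of x] e0 by (intro mult_mono; simp)+
  then show "\<bar>mul m (g1 x) (g2 x) - f1 x*f2 x\<bar> <= 5*et" unfolding dec
   using mul_bounds(2)[OF b1[THEN conjunct1] b2[THEN conjunct1], of m x x] et(2) e0 abs_tri3[of "mul m (g1 x) (g2 x) - g1 x*g2 x" "(g1 x - f1 x)*g2 x" "f1 x*(g2 x - f2 x)"] zero_le_power[of "1/2::real" m] by linarith
  have f: "\<bar>f1 x - f1 y\<bar> <= La1*?n" "\<bar>f2 x - f2 y\<bar> <= La2*?n" by (fact l1 l2)+
  have n: "?n >= 0" by simp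
  have prod: "\<bar>a*b - c*d\<bar> <= A*B' + C*D'" if "\<bar>a - c\<bar> <= A" "\<bar>b\<bar> <= B'" "\<bar>c\<bar> <= C" "\<bar>b - d\<bar> <= D'" for a b c d A B' C D' :: real
  proof -
   have "a*b - c*d = (a - c)*b + c*(b - d)" by (simp add: algebra_simps)
   then have "\<bar>a*b - c*d\<bar> <= \<bar>a - c\<bar> * \<bar>b\<bar> + \<bar>c\<bar> * \<bar>b - d\<bar>" by (metis abs_mult abs_triangle_ineq)
   also have "... <= A*B' + C*D'" using that by (intro add_mono mult_mono) auto
   finally show ?thesis .
  qed
  show "\<bar>f1 x*f2 x - f1 y*f2 y\<bar> <= (La1 + La2)*?n"
   using prod[OF f(1) _ _ f(2), of 1 1] b1[of y] b2[of x] by (simp add: algebra_simps)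
  have ge: "\<bar>(g1 x - f1 x) - (g1 y - f1 y)\<bar> <= et*La1*?n" "\<bar>(g2 x - f2 x) - (g2 y - f2 y)\<bar> <= et*La2*?n" by (fact l1 l2)+
  have el: "et*La1*?n <= La1*?n" "et*La2*?n <= La2*?n" using et(1) L e0 by (auto intro!: mult_right_mono mult_left_le_one_le)
  have gl: "\<bar>g1 x - g1 y\<bar> <= 2*La1*?n" "\<bar>g2 x - g2 y\<bar> <= 2*La2*?n" using ge f el by linarith+
  have t1: "\<bar>(mul m (g1 x) (g2 x) - g1 x*g2 x) - (mul m (g1 y) (g2 y) - g1 y*g2 y)\<bar> <= et*(La1 + La2)*?n"
  proof -
   have "\<bar>(mul m (g1 x) (g2 x) - g1 x*g2 x) - (mul m (g1 y) (g2 y) - g1 y*g2 y)\<bar> <= (1/2)^m*(\<bar>g1 x - g1 y\<bar> + \<bar>g2 x - g2 y\<bar>)"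
    using b1 b2 by (intro mul_error_Lip) auto
   also have "... <= (1/2)^m*(2*La1*?n + 2*La2*?n)" using gl by (intro mult_left_mono add_mono) auto
   also have "... = (2*(1/2)^m)*((La1 + La2)*?n)" by (simp add: algebra_simps)
   also have "... <= et*((La1 + La2)*?n)" using et(2) L by (intro mult_right_mono) auto
   finally show ?thesis by (simp add: mult.assoc)
  qed
  have t2: "\<bar>(g1 x - f1 x)*g2 x - (g1 y - f1 y)*g2 y\<bar> <= (et*La1*?n)*1 + et*(2*La2*?n)"
   using prod[OF ge(1) _ _ gl(2), of 1 et] b1[of y] b2[of x] by simp
  have t3: "\<bar>f1 x*(g2 x - f2 x) - f1 y*(g2 y - f2 y)\<bar> <= (La1*?n)*et + 1*(et*La2*?n)"
   using prod[OF f(1) _ _ ge(2), of et 1] b1[of y] b2[of x] by simp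
  have "\<bar>(mul m (g1 x) (g2 x) - f1 x*f2 x) - (mul m (g1 y) (g2 y) - f1 y*f2 y)\<bar>
    <= et*(La1 + La2)*?n + ((et*La1*?n)*1 + et*(2*La2*?n)) + ((La1*?n)*et + 1*(et*La2*?n))"
   unfolding dec by (rule abs_tri3'[OF t1 t2 t3])
  also have "... = 3*(et*La1*?n) + 4*(et*La2*?n)" by (simp add: algebra_simps)
  also have "... <= 5*(et*La1*?n) + 5*(et*La2*?n)" using e0 L n by (intro add_mono mult_right_mono) auto
  also have "... = 5*et*(La1 + La2)*?n" by (simp add: algebra_simps)
  finally show "\<bar>(mul m (g1 x) (g2 x) - f1 x*f2 x) - (mul m (g1 y) (g2 y) - f1 y*f2 y)\<bar> <= 5*et*(La1 + La2)*?n" .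
 qed
qed

lemma ap_zz:
 assumes z: "!!x. \<bar>z x\<bar> <= 1" "!!x y. \<bar>z x - z y\<bar> <= La*norm (x - y)" and L: "La >= 0" and th: "2*(1/2)^m <= th" "5^i*th <= 1"
 shows "ap (5^i*th) (2^i*La) (%x. zz m i (z x)) (%x. z x^2^i)"
 using th(2)
proof (induction i)
 case 0
 have "0 <= th" using th(1) zero_le_power[of "1/2::real" m] by linarith
 then show ?case using ap_exact[OF z] by simp
next
 case (Suc i)
 have t0: "0 <= th" using th(1) zero_le_power[of "1/2::real" m] by linarith
 have i1: "5^i*th <= 1" using Suc.prems t0 mult_right_mono[of "5^i" "5^Suc i" th] by simp
 have "th <= 5^i*th" using t0 mult_right_mono[of 1 "5^i" th] by simp
 then have "2*(1/2)^m <= 5^i*th" using th(1) by linarith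
 from ap_mul[OF Suc.IH[OF i1] Suc.IH[OF i1] i1 this] L
 show ?case by (simp add: power_add[symmetric] mult_2[symmetric] mult.assoc)
qed

lemma ap_rr:
 assumes z: "!!x. \<bar>z x\<bar> <= 1" "!!x y. \<bar>z x - z y\<bar> <= La*norm (x - y)" and L: "La >= 0" and th: "2*(1/2)^m <= th" "5^k*th <= 1"
 shows "ap (5^k*th) (2^k*La) (%x. rr m a k (z x)) (%x. z x^(a mod 2^k))"
 using th(2)
proof (induction k)
 case 0
 have "0 <= th" using th(1) zero_le_power[of "1/2::real" m] by linarith
 then show ?case using L by (simp add: ap_def)
next
 case (Suc k)
 have t0: "0 <= th" using th(1) zero_le_power[of "1/2::real" m] by linarith
 have i1: "5^k*th <= 1" using Suc.prems t0 mult_right_mono[of "5^k" "5^Suc k" th] by simp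
 have "th <= 5^k*th" using t0 mult_right_mono[of 1 "5^k" th] by simp
 then have t1: "2*(1/2)^m <= 5^k*th" using th(1) by linarith
 let ?b = "odd (a div 2^k)"
 have w: "ap (5^k*th) (2^k*La) (%x. if ?b then zz m k (z x) else 1) (%x. if ?b then z x^2^k else 1)"
 proof (cases ?b)
  case True
  then show ?thesis using ap_zz[OF z L th(1) i1] by simp
 next
  case False
  then show ?thesis using L t0 by (simp add: ap_def)
 qed
 have "a mod 2^Suc k = 2^k*(a div 2^k mod 2) + a mod 2^k" using mod_mult2_eq[of a "2^k" 2] by (simp add: mult.commute)
 then have e: "z x^(a mod 2^k)*(if ?b then z x^2^k else 1) = z x^(a mod 2^Suc k)" for x
  by (cases ?b) (auto simp: power_add mult.commute odd_iff_mod_2_eq_one)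
 have "ap (5*(5^k*th)) (2^k*La + 2^k*La) (%x. mul m (rr m a k (z x)) (if ?b then zz m k (z x) else 1)) (%x. z x^(a mod 2^k)*(if ?b then z x^2^k else 1))"
  by (rule ap_mul[OF Suc.IH[OF i1] w i1 t1]) (use L in auto)
 moreover have "5*(5^k*th) = 5^Suc k*th" "2^k*La + 2^k*La = 2^Suc k*La" by simp_all
 ultimately show ?case by (simp only: e rr.simps)
qed

section \<open>Cutoffs and the network for one localised monomial\<close>

definition clip :: "real => real" where "clip z = relu (z + 1) - relu (z - 1) - 1"
definition tent :: "real => real" where "tent z = relu (z + 1) - 2*relu z + relu (z - 1)"
definition step :: "real => real" where "step t = relu (2*t - 1) - relu (2*t - 2)"

lemma clip_tent: "\<bar>clip z\<bar> <= 1" "\<bar>clip z - clip y\<bar> <= \<bar>z - y\<bar>" "\<bar>z\<bar> <= 1 ==> clip z = z" "0 <= tent z" "tent z <= 1" "\<bar>tent z - tent y\<bar> <= \<bar>z - y\<bar>"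
 "\<not> \<bar>z\<bar> < 1 ==> tent z = 0"
 unfolding clip_def tent_def relu_def max_def by (simp_all add: abs_if split: if_splits)

lemma step_props: "0 <= step t" "step t <= 1" "\<bar>step s - step t\<bar> <= 2 * \<bar>s - t\<bar>" "t <= 1/2 ==> step t = 0" "1 <= t ==> step t = 1" "s <= t ==> step s <= step t"
 unfolding step_def relu_def max_def by (simp_all add: abs_if split: if_splits)

text \<open>\<open>tent\<close> is a second difference of \<open>relu\<close>, so the sum over
  integer shifts telescopes to a first difference that equals 1 on the covered interval.\<close>

lemma tent_sum:
 assumes "\<bar>y\<bar> <= real G"
 shows "(\<Sum>p<2*G + 1. tent (y - (real p - real G))) = 1"
proof -
 define g where "g p = relu (y - (real p - real G) + 1) - relu (y - (real p - real G))" for p :: nat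
 have "tent (y - (real p - real G)) = g p - g (Suc p)" for p unfolding tent_def g_def by (simp add: algebra_simps)
 then have "(\<Sum>p<2*G + 1. tent (y - (real p - real G))) = g 0 - g (2*G + 1)" by (simp only: sum_lessThan_telescope')
 moreover have "g 0 = 1" "g (2*G + 1) = 0" using assms by (auto simp: g_def relu_def max_def abs_le_iff)
 ultimately show ?thesis by simp
qed

text \<open>The l1 norm is used because it is exactly a ReLU function. The scaling makes it at most
  1/2 on the cube of half side a, where \<open>step\<close> still vanishes.\<close>

definition taxi :: "real^3 => real => real^3 => real" where
 "taxi c a x = (1/(6*a))*(\<bar>x$1 - c$1\<bar> + \<bar>x$2 - c$2\<bar> + \<bar>x$3 - c$3\<bar>)"
text \<open>Dyadic shells: nonzero only where 2^j \<open>taxi\<close> lies between 1/4 and 1. Being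
  differences of consecutive steps, they telescope when summed over j.\<close>

definition annul :: "real^3 => real => nat => real^3 => real" where
 "annul c a j x = step (2^Suc j*taxi c a x) - step (2^j*taxi c a x)"
definition zc :: "real^3 => real => real => 3 => real^3 => real" where
 "zc c l m i x = (1/l)*(x$i - c$i) - m"

lemma norm_l1: "\<bar>x$1\<bar> + \<bar>x$2\<bar> + \<bar>x$3\<bar> <= 2*norm x" "norm x <= \<bar>x$1\<bar> + \<bar>x$2\<bar> + \<bar>x$3\<bar>" for x :: "real^3"
proof -
 have "(\<bar>x$1\<bar> + \<bar>x$2\<bar> + \<bar>x$3\<bar>)^2 <= 3*(norm x)^2"
  using sum_squares_bound[of "\<bar>x$1\<bar>" "\<bar>x$2\<bar>"] sum_squares_bound[of "\<bar>x$1\<bar>" "\<bar>x$3\<bar>"] sum_squares_bound[of "\<bar>x$2\<bar>" "\<bar>x$3\<bar>"]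
  unfolding norm_sq3 by (simp add: power2_eq_square algebra_simps)
 also have "... <= (2*norm x)^2" by (simp add: power_mult_distrib)
 finally show "\<bar>x$1\<bar> + \<bar>x$2\<bar> + \<bar>x$3\<bar> <= 2*norm x" by (rule power2_le_imp_le) simp
 have "(norm x)^2 <= (\<bar>x$1\<bar> + \<bar>x$2\<bar> + \<bar>x$3\<bar>)^2" unfolding norm_sq3 by (simp add: power2_eq_square algebra_simps)
 then show "norm x <= \<bar>x$1\<bar> + \<bar>x$2\<bar> + \<bar>x$3\<bar>" by (rule power2_le_imp_le) simp
qed

lemma taxi_Lip: assumes "a > 0" shows "\<bar>taxi c a x - taxi c a y\<bar> <= norm (x - y)/(3*a)"
proof -
 have "\<bar>taxi c a x - taxi c a y\<bar> = (1/(6*a)) * \<bar>(\<bar>x$1 - c$1\<bar> + \<bar>x$2 - c$2\<bar> + \<bar>x$3 - c$3\<bar>) - (\<bar>y$1 - c$1\<bar> + \<bar>y$2 - c$2\<bar> + \<bar>y$3 - c$3\<bar>)\<bar>"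
  unfolding taxi_def right_diff_distrib[symmetric] abs_mult using assms by simp
 also have "... <= (1/(6*a))*(\<bar>(x - y)$1\<bar> + \<bar>(x - y)$2\<bar> + \<bar>(x - y)$3\<bar>)"
  using assms by (intro mult_left_mono abs_tri3') (auto simp: abs_if)
 also have "... <= (1/(6*a))*(2*norm (x - y))" using assms by (intro mult_left_mono norm_l1) auto
 finally show ?thesis using assms by simp
qed

lemma step_taxi_Lip: assumes "a > 0" shows "\<bar>step (2^j*taxi c a x) - step (2^j*taxi c a y)\<bar> <= 2^j*norm (x - y)/a"
proof -
 have "\<bar>step (2^j*taxi c a x) - step (2^j*taxi c a y)\<bar> <= 2 * \<bar>2^j*taxi c a x - 2^j*taxi c a y\<bar>" by (rule step_props)
 also have "... = 2*2^j * \<bar>taxi c a x - taxi c a y\<bar>" by (simp add: right_diff_distrib[symmetric] abs_mult)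
 also have "... <= 2*2^j*(norm (x - y)/(3*a))" using taxi_Lip[OF assms] by (intro mult_left_mono) auto
 also have "... = 2/3*(2^j*norm (x - y)/a)" by simp
 also have "... <= 1*(2^j*norm (x - y)/a)" using assms by (intro mult_right_mono) auto
 finally show ?thesis by simp
qed

lemma annul_bounds: assumes "a > 0"
 shows "\<bar>annul c a j x\<bar> <= 1" "\<bar>annul c a j x - annul c a j y\<bar> <= 3*2^j/a*norm (x - y)"
proof -
 show "\<bar>annul c a j x\<bar> <= 1" unfolding annul_def
  using step_props(1,2)[of "2^Suc j*taxi c a x"] step_props(1,2)[of "2^j*taxi c a x"] by linarith
 have "\<bar>annul c a j x - annul c a j y\<bar> <= 2^Suc j*norm (x - y)/a + 2^j*norm (x - y)/a"
  unfolding annul_def using step_taxi_Lip[OF assms, of "Suc j" c x y] step_taxi_Lip[OF assms, of j c x y] by linarith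
 then show "\<bar>annul c a j x - annul c a j y\<bar> <= 3*2^j/a*norm (x - y)" using assms by (simp add: field_simps)
qed

lemma zc_Lip: assumes "l > 0" shows "\<bar>zc c l m i x - zc c l m i y\<bar> <= 1/l*norm (x - y)"
proof -
 have "\<bar>zc c l m i x - zc c l m i y\<bar> = 1/l * \<bar>(x - y) $ i\<bar>" unfolding zc_def using assms by (simp add: abs_divide diff_divide_distrib[symmetric])
 then show ?thesis using assms component_le_norm_cart[of "x - y" i] by (simp add: divide_right_mono)
qed

text \<open>The first layer yields clips, tents and \<open>taxi\<close> as affine read-outs; the
  steps applied to \<open>taxi\<close> need a second layer, through which the six cell functions are
  carried.\<close>

lemma Prog_base:
 "Prog 40 2 (set [%x. clip (zc c l m1 1 x), %x. clip (zc c l m2 2 x), %x. clip (zc c l m3 3 x), annul c a j,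
   %x. tent (zc c l m1 1 x), %x. tent (zc c l m2 2 x), %x. tent (zc c l m3 3 x)])"
proof -
 let ?X = "{%x::real^3. x$1, %x. x$2, %x. x$3}"
 let ?r = "(%f x. relu (f x)) :: (real^3 => real) => _"
 let ?q = "%m i. [%x. zc c l m i x + 1, %x. zc c l m i x, %x. zc c l m i x - 1, %x. x$i - c$i, %x. - (x$i - c$i)]"
 let ?P = "set (?q m1 1 @ ?q m2 2 @ ?q m3 3)"
 have co: "(%x. x$i) \<in> lin ?X" for i using exhaust_3[of i] by (auto intro: lin_base)
 have z: "(%x. zc c l m i x) \<in> lin ?X" for m i unfolding zc_def by (intro lin_diff lin_cmult lin_const co)
 have "set (?q m i) \<subseteq> lin ?X" for m i
  unfolding list.set insert_subset by (intro conjI empty_subsetI lin_add lin_diff lin_uminus lin_const co z)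
 from this[of m1 1] this[of m2 2] this[of m3 3] have "?P \<subseteq> lin ?X" by (simp only: set_append Un_subset_iff simp_thms)
 moreover have "card ?P <= 40" by (rule order_trans[OF card_length]) simp
 ultimately have 1: "Prog 40 (Suc 0) (?r ` ?P)" by (intro Prog_step[OF Prog_0]) auto
 have el: "\<exists>m i. f \<in> set (?q m i) & ((m, i) = (m1, 1) \<or> (m, i) = (m2, 2) \<or> (m, i) = (m3, 3)) ==> ?r f \<in> lin (?r ` ?P)" for f
  by (intro lin_base imageI) auto
 have mi: "?r f \<in> lin (?r ` ?P)" if "f \<in> set (?q m i)" "(m, i) = (m1, 1) \<or> (m, i) = (m2, 2) \<or> (m, i) = (m3, 3)" for f m i
  using that by (intro el) blast
 have ct: "(%x. clip (zc c l m i x)) \<in> lin (?r ` ?P)" "(%x. tent (zc c l m i x)) \<in> lin (?r ` ?P)" "(%x. \<bar>x$i - c$i\<bar>) \<in> lin (?r ` ?P)"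
  if h: "(m, i) = (m1, 1) \<or> (m, i) = (m2, 2) \<or> (m, i) = (m3, 3)" for m i
 proof -
  have p: "(%x. relu (zc c l m i x + 1)) \<in> lin (?r ` ?P)" "(%x. relu (zc c l m i x)) \<in> lin (?r ` ?P)" "(%x. relu (zc c l m i x - 1)) \<in> lin (?r ` ?P)"
   "(%x. relu (x$i - c$i)) \<in> lin (?r ` ?P)" "(%x. relu (- (x$i - c$i))) \<in> lin (?r ` ?P)"
   by (rule mi[OF _ h]; simp)+
  show "(%x. clip (zc c l m i x)) \<in> lin (?r ` ?P)" unfolding clip_def by (intro lin_diff lin_const p)
  show "(%x. tent (zc c l m i x)) \<in> lin (?r ` ?P)" unfolding tent_def by (intro lin_diff lin_add lin_cmult p)
  have "(%x. relu (x$i - c$i) + relu (- (x$i - c$i))) \<in> lin (?r ` ?P)" by (intro lin_add p)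
  moreover have "(%x. relu (x$i - c$i) + relu (- (x$i - c$i))) = (%x::real^3. \<bar>x$i - c$i\<bar>)" by (auto simp: relu_def max_def)
  ultimately show "(%x. \<bar>x$i - c$i\<bar>) \<in> lin (?r ` ?P)" by simp
 qed
 have tx: "taxi c a \<in> lin (?r ` ?P)" unfolding taxi_def[abs_def] by (intro lin_cmult lin_add ct(3)[of m1 1] ct(3)[of m2 2] ct(3)[of m3 3]) simp_all
 let ?V = "set [%x. clip (zc c l m1 1 x), %x. clip (zc c l m2 2 x), %x. clip (zc c l m3 3 x), %x. tent (zc c l m1 1 x), %x. tent (zc c l m2 2 x), %x. tent (zc c l m3 3 x)]"
 let ?t = "%j d x. 2*(2^j*taxi c a x) - d"
 let ?Q = "set [?t (Suc j) 1, ?t (Suc j) 2, ?t j 1, ?t j 2]"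
 have V: "?V \<subseteq> lin (?r ` ?P)" using ct(1,2)[of m1 1] ct(1,2)[of m2 2] ct(1,2)[of m3 3] by (simp only: list.set insert_subset empty_subsetI simp_thms)
 have "?t j d \<in> lin (?r ` ?P)" for j d by (intro lin_diff lin_cmult lin_const tx)
 then have Q: "?Q \<subseteq> lin (?r ` ?P)" by (simp only: list.set insert_subset empty_subsetI simp_thms)
 have "Prog 40 (Suc (Suc 0)) (?V \<union> ?r ` ?Q)"
  by (rule Prog_keep[OF 1 V _ _ _ _ Q, where n=6 and p=4]) (auto intro!: order_trans[OF card_length] simp del: set_simps)
 then have 2: "Prog 40 2 (?V \<union> ?r ` ?Q)" by (simp only: numeral_2_eq_2)
 have "(%x. (?r (?t (Suc j) 1) x - ?r (?t (Suc j) 2) x) - (?r (?t j 1) x - ?r (?t j 2) x)) \<in> lin (?V \<union> ?r ` ?Q)"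
  by (intro lin_diff lin_base UnI2 imageI) simp_all
 then have "annul c a j \<in> lin (?V \<union> ?r ` ?Q)" unfolding annul_def[abs_def] step_def .
 then show ?thesis by (intro Prog_lin[OF 2]) (auto intro: lin_base)
qed

lemma Prog_pow_list: "Prog 40 L (set (f # vs)) ==> length vs <= 6 ==> Prog 40 (L + k*(4*Suc m)) (set (vs @ [%x. rr m e k (f x)]))"
 using Prog_pow[of 40 L "set (f # vs)" f "set vs" 6 k m e] order_trans[OF card_length[of vs], of 6] by (auto intro: lin_base)

lemma Prog_mul_list: "Prog 40 L (set (f # g # vs)) ==> length vs <= 6 ==> Prog 40 (L + 2*Suc m) (set ((%x. mul m (f x) (g x)) # vs))"
 using Prog_mul[of 40 L "set (f # g # vs)" f g "set vs" 6 m] order_trans[OF card_length[of vs], of 6] by (auto intro: lin_base)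

text \<open>Three powers of 4*k*Suc m layers and six products of 2*Suc m layers make 12*Suc k*Suc m.
  At most six other values are carried at any time, so width 40 suffices.\<close>

lemma Prog_term:
 assumes "Prog 40 L (set [f1, f2, f3, q, l1, l2, l3])"
 shows "Prog 40 (L + 12*Suc k*Suc m) {%x. mul m (mul m (mul m (mul m (mul m (mul m (rr m e1 k (f1 x)) (rr m e2 k (f2 x))) (rr m e3 k (f3 x))) (q x)) (l1 x)) (l2 x)) (l3 x)}"
proof -
 let ?r1 = "%x. rr m e1 k (f1 x)" and ?r2 = "%x. rr m e2 k (f2 x)" and ?r3 = "%x. rr m e3 k (f3 x)"
 let ?K = "k*(4*Suc m)" and ?M = "2*Suc m"
 have "Prog 40 (L + ?K) (set [f2, f3, q, l1, l2, l3, ?r1])" using Prog_pow_list[OF assms] by simp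
 then have "Prog 40 (L + ?K + ?K) (set [f3, q, l1, l2, l3, ?r1, ?r2])" by (rule Prog_pow_list[THEN back_subst[of "%vs. Prog 40 _ (set vs)"]]) simp_all
 then have "Prog 40 (L + ?K + ?K + ?K) (set [q, l1, l2, l3, ?r1, ?r2, ?r3])" by (rule Prog_pow_list[THEN back_subst[of "%vs. Prog 40 _ (set vs)"]]) simp_all
 then have "Prog 40 (L + ?K + ?K + ?K) (set [?r1, ?r2, ?r3, q, l1, l2, l3])" by (rule Prog_lin) (auto intro: lin_base)
 then have "Prog 40 (L + ?K + ?K + ?K + ?M) (set [%x. mul m (?r1 x) (?r2 x), ?r3, q, l1, l2, l3])" by (rule Prog_mul_list) simp
 then have "Prog 40 (L + ?K + ?K + ?K + ?M + ?M) (set [%x. mul m (mul m (?r1 x) (?r2 x)) (?r3 x), q, l1, l2, l3])" by (rule Prog_mul_list) simp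
 then have "Prog 40 (L + ?K + ?K + ?K + ?M + ?M + ?M) (set [%x. mul m (mul m (mul m (?r1 x) (?r2 x)) (?r3 x)) (q x), l1, l2, l3])" by (rule Prog_mul_list) simp
 from Prog_mul_list[OF Prog_mul_list[OF Prog_mul_list[OF this]]]
 have "Prog 40 (L + ?K + ?K + ?K + ?M + ?M + ?M + ?M + ?M + ?M) (set [%x. mul m (mul m (mul m (mul m (mul m (mul m (?r1 x) (?r2 x)) (?r3 x)) (q x)) (l1 x)) (l2 x)) (l3 x)])"
  by this simp_all
 moreover have "L + ?K + ?K + ?K + ?M + ?M + ?M + ?M + ?M + ?M = L + 12*Suc k*Suc m" by (simp add: algebra_simps)
 ultimately show ?thesis by (simp only: list.set)
qed

text \<open>Clipping leaves the cell coordinates unchanged wherever the tents are nonzero, and keeps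
  the powers bounded by 1 elsewhere, as the error calculus \<open>ap\<close> requires.\<close>

definition tgt :: "real^3 => real => real => nat => real \<times> real \<times> real => nat \<times> nat \<times> nat => real^3 => real" where
 "tgt c a l j = (%(m1, m2, m3) (e1, e2, e3) x. clip (zc c l m1 1 x)^e1*clip (zc c l m2 2 x)^e2*clip (zc c l m3 3 x)^e3
   * annul c a j x*tent (zc c l m1 1 x)*tent (zc c l m2 2 x)*tent (zc c l m3 3 x))"

lemma ap_mul_exact:
 assumes "ap (5^i*th) La1 g f" "ap (5^k*th) La2 h h'" "k <= i" "5^i*th <= 1" "2*(1/2)^m <= th" "La1 >= 0" "La2 >= 0"
 shows "ap (5^Suc i*th) (La1 + La2) (%x. mul m (g x) (h x)) (%x. f x*h' x)"
proof -
 have t0: "0 <= th" using assms(5) zero_le_power[of "1/2::real" m] by linarith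
 have "1*th <= 5^i*th" by (rule mult_right_mono) (use t0 in auto)
 moreover have "ap (5^i*th) La2 h h'" by (rule ap_mono[OF assms(2)]) (use t0 assms(3) in \<open>auto intro!: mult_right_mono power_increasing\<close>)
 ultimately show ?thesis using ap_mul[OF assms(1) _ assms(4), of La2 h h' m] assms(5-7) by (simp add: mult.assoc)
qed

text \<open>k rounds of powering and six products each cost a factor 5, and a layer has at most
  40*40 + 40 = 1640 entries. The Lipschitz constant collects 2^k/l from each power and 1/l from each
  of the four cutoffs. The output is doubled to f and - f because the summing layer acts after an
  activation.\<close>

lemma term_net:
 assumes a: "a > 0" and l: "l > 0" "3*2^j/a <= 1/l" and th: "5^(k + 6)*(2*(1/2)^m) <= (1::real)"
  and e: "e1 < 2^k" "e2 < 2^k" "e3 < 2^k"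
 shows "\<exists>f. NN (3 + 12*Suc k*Suc m) ((3 + 12*Suc k*Suc m)*1640) [f, %x. - f x]
  & ap (5^(k + 6)*(2*(1/2)^m)) ((3*2^k + 4)/l) f (tgt c a l j (m1, m2, m3) (e1, e2, e3))"
proof -
 let ?th = "2*(1/2)^m :: real" and ?La = "1/l"
 let ?f = "%x. mul m (mul m (mul m (mul m (mul m (mul m (rr m e1 k (clip (zc c l m1 1 x))) (rr m e2 k (clip (zc c l m2 2 x)))) (rr m e3 k (clip (zc c l m3 3 x))))
   (annul c a j x)) (tent (zc c l m1 1 x))) (tent (zc c l m2 2 x))) (tent (zc c l m3 3 x))"
 have "Prog 40 (2 + 12*Suc k*Suc m) {?f}" by (rule Prog_term[OF Prog_base])
 then obtain hs where hs: "hidden 40 (2 + 12*Suc k*Suc m) hs" "?f \<in> lin (set hs)" unfolding Prog_def by blast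
 have "NN (Suc (2 + 12*Suc k*Suc m)) (Suc (2 + 12*Suc k*Suc m)*(40*40 + 40)) [?f, %x. - ?f x]"
  by (rule hidden_NN[OF _ hs(1)]) (use hs(2) lin_uminus[OF hs(2)] in auto)
 moreover have "Suc (2 + 12*Suc k*Suc m) = 3 + 12*Suc k*Suc m" by simp
 ultimately have nn: "NN (3 + 12*Suc k*Suc m) ((3 + 12*Suc k*Suc m)*1640) [?f, %x. - ?f x]" by simp
 have le: "5^i*?th <= 1" if "i <= k + 6" for i
  using th by (rule order_trans[rotated]) (use that in \<open>auto intro!: mult_right_mono power_increasing\<close>)
 have cl: "\<bar>clip (zc c l m i x) - clip (zc c l m i y)\<bar> <= ?La*norm (x - y)" "\<bar>tent (zc c l m i x) - tent (zc c l m i y)\<bar> <= ?La*norm (x - y)" for m i x y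
  using order_trans[OF clip_tent(2) zc_Lip[OF l(1)]] order_trans[OF clip_tent(6) zc_Lip[OF l(1)]] by blast+
 have L0: "?La >= 0" using l by simp
 have r: "ap (5^k*?th) (2^k*?La) (%x. rr m e k (clip (zc c l m' i x))) (%x. clip (zc c l m' i x)^e)" if "e < 2^k" for e m' i
  using ap_rr[OF clip_tent(1) cl(1) L0 order_refl le[of k], of e] that by simp
 have t: "ap (5^k*?th) ?La (%x. tent (zc c l m' i x)) (%x. tent (zc c l m' i x))" for m' i
  by (rule ap_exact[OF _ cl(2)]) (use clip_tent(4,5) in \<open>auto simp: abs_if intro: order_trans[of _ 0]\<close>)
 have q: "ap (5^k*?th) ?La (annul c a j) (annul c a j)"
 proof (rule ap_exact[OF annul_bounds(1)[OF a]])
  show "\<bar>annul c a j x - annul c a j y\<bar> <= ?La*norm (x - y)" for x y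
   by (rule order_trans[OF annul_bounds(2)[OF a] mult_right_mono[OF l(2)]]) simp
 qed simp
 have L1: "2^k*?La >= 0" using l by simp
 note A = ap_mul_exact[OF _ _ _ le order_refl]
 have "ap (5^Suc k*?th) (2^k*?La + 2^k*?La) (%x. mul m (rr m e1 k (clip (zc c l m1 1 x))) (rr m e2 k (clip (zc c l m2 2 x)))) (%x. clip (zc c l m1 1 x)^e1*clip (zc c l m2 2 x)^e2)"
  by (rule A[OF r r]) (use e L1 in auto)
 note F = A[OF A[OF A[OF A[OF A[OF this r[OF e(3)] _ _ _ L1] q _ _ _ L0] t _ _ _ L0] t _ _ _ L0] t _ _ _ L0]
 have "ap (5^Suc (Suc (Suc (Suc (Suc (Suc k)))))*?th) (2^k*?La + 2^k*?La + 2^k*?La + ?La + ?La + ?La + ?La) ?f (tgt c a l j (m1, m2, m3) (e1, e2, e3))"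
  unfolding tgt_def case_prod_conv by (rule F; (intro add_nonneg_nonneg L0 L1 | simp))
 moreover have "Suc (Suc (Suc (Suc (Suc (Suc k))))) = k + 6" "2^k*?La + 2^k*?La + 2^k*?La + ?La + ?La + ?La + ?La = (3*2^k + 4)/l"
  using l by (simp_all add: field_simps)
 ultimately have "ap (5^(k + 6)*?th) ((3*2^k + 4)/l) ?f (tgt c a l j (m1, m2, m3) (e1, e2, e3))" by (simp only:)
 then show ?thesis using nn by (intro exI[of _ ?f]) blast
qed

text \<open>All outputs read the same terms and differ only in the last affine layer. Therefore N
  enters the size only through 2*card T + 1 entries per output.\<close>

lemma NN_sum:
 assumes T: "finite T" "T ~= {}" and L: "L > 0" and f: "!!ta. ta \<in> T ==> NN L s [f ta, %x. - f ta x]"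
 shows "NN (Suc L) (card T * s + (N*(2*card T) + N)) (map (%i x. \<Sum>ta\<in>T. C i ta*f ta x) [0..<N])"
proof -
 obtain ts where ts: "set ts = T" "distinct ts" using finite_distinct_list[OF T(1)] by blast
 let ?g = "%ts. concat (map (%ta. [f ta, %x. - f ta x]) ts)"
 have "us ~= [] ==> set us \<subseteq> T ==> NN L (length us * s) (?g us)" for us
 proof (induction us)
  case (Cons u us)
  show ?case
  proof (cases "us = []")
   case True
   then show ?thesis using f[of u] Cons.prems by simp
  next
   case False
   then show ?thesis using NN_parallel[OF L f[of u] Cons.IH] Cons.prems by simp
  qed
 qed simp
 then have n: "NN L (card T * s) (?g ts)" using ts T distinct_card[of ts] by auto
 define hs where "hs = map (%f x. relu (f x)) (?g ts)"
 let ?gs = "map (%i x. \<Sum>ta\<in>T. C i ta*f ta x) [0..<N]"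
 have len: "length hs = length (?g ts)" "length (?g ts) = 2*card T" using ts distinct_card[of ts] by (simp_all add: hs_def length_concat comp_def sum_list_triv mult.commute)
 have b: "f ta \<in> lin (set hs)" if "ta \<in> T" for ta
 proof -
  have "(%x. relu (f ta x) - relu (- f ta x)) \<in> lin (set hs)" using that ts by (intro lin_diff lin_base) (auto simp: hs_def)
  then show ?thesis by (simp add: relu_diff)
 qed
 have "(%x. \<Sum>ta\<in>S. C i ta*f ta x) \<in> lin (set hs)" if "S \<subseteq> T" for i S
  using finite_subset[OF that T(1)] that by (induction S rule: finite_induct) (simp_all add: lin_const lin_add lin_cmult b)
 then have "set ?gs \<subseteq> lin (set hs)" by auto
 from lin_rows[OF this] obtain A b where A: "length A = length ?gs" "length b = length ?gs" "\<forall>r\<in>set A. length r = length hs" "\<forall>x. ev ?gs x = affine A b (ev hs x)" by blast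
 have e: "ev hs x = map relu (ev (?g ts) x)" for x by (simp add: ev_def hs_def)
 have "lsz A b <= length A*(2*card T) + length b" by (rule lsz_le) (use A len in auto)
 then have "card T * s + lsz A b <= card T * s + (N*(2*card T) + N)" using A by simp
 moreover have "NN (Suc L) (card T * s + lsz A b) ?gs" by (rule NN_append[OF n]) (use A e len in auto)
 ultimately show ?thesis unfolding NN_def by (meson le_trans)
qed

section \<open>Graded approximation near a nucleus\<close>

definition cwt :: "real^3 => real => real => nat => real \<times> real \<times> real => real^3 => real" where
 "cwt c a l j = (%(m1, m2, m3) x. annul c a j x*tent (zc c l m1 1 x)*tent (zc c l m2 2 x)*tent (zc c l m3 3 x))"
definition ctr :: "real^3 => real => real \<times> real \<times> real => real^3" where
 "ctr c l = (%(m1, m2, m3). vector [c$1 + l*m1, c$2 + l*m2, c$3 + l*m3])"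

lemma ctr_nth: "ctr c l (m1, m2, m3) $ 1 = c$1 + l*m1" "ctr c l (m1, m2, m3) $ 2 = c$2 + l*m2" "ctr c l (m1, m2, m3) $ 3 = c$3 + l*m3"
 by (simp_all add: ctr_def)

lemma in_cube3: "x \<in> cube_inf c a \<longleftrightarrow> \<bar>x$1 - c$1\<bar> <= a & \<bar>x$2 - c$2\<bar> <= a & \<bar>x$3 - c$3\<bar> <= a"
 unfolding cube_inf_def by (auto simp: forall_3)

lemma zc_ctr: assumes "l > 0" shows "x$1 - ctr c l (m1, m2, m3) $ 1 = l*zc c l m1 1 x" "x$2 - ctr c l (m1, m2, m3) $ 2 = l*zc c l m2 2 x" "x$3 - ctr c l (m1, m2, m3) $ 3 = l*zc c l m3 3 x"
 using assms by (simp_all add: ctr_nth zc_def field_simps)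

lemma cwt_support: assumes "l > 0" "x \<notin> cube_inf (ctr c l m) l" shows "cwt c a l j m x = 0"
proof (rule ccontr)
 assume n: "cwt c a l j m x ~= 0"
 obtain m1 m2 m3 where m: "m = (m1, m2, m3)" by (cases m)
 have "\<bar>zc c l m1 1 x\<bar> < 1" "\<bar>zc c l m2 2 x\<bar> < 1" "\<bar>zc c l m3 3 x\<bar> < 1"
  using n clip_tent(7) unfolding m cwt_def by fastforce+
 then have "\<bar>l*zc c l m1 1 x\<bar> <= l" "\<bar>l*zc c l m2 2 x\<bar> <= l" "\<bar>l*zc c l m3 3 x\<bar> <= l"
  using assms(1) unfolding abs_mult by (simp_all add: mult_left_le)
 then show False using assms(2) unfolding in_cube3 m zc_ctr[OF assms(1)] by blast
qed

lemma taxi_l1: assumes "a > 0" shows "6*a*taxi c a x = \<bar>x$1 - c$1\<bar> + \<bar>x$2 - c$2\<bar> + \<bar>x$3 - c$3\<bar>" "taxi c a x >= 0"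
 using assms by (auto simp: taxi_def)

lemma annul_support: assumes "annul c a j x ~= 0" "a > 0" shows "1/4 < 2^j*taxi c a x" "2^j*taxi c a x < 1"
proof -
 show "1/4 < 2^j*taxi c a x"
 proof (rule ccontr)
  assume n: "\<not> 1/4 < 2^j*taxi c a x"
  then have "2^Suc j*taxi c a x <= 1/2" "2^j*taxi c a x <= 1/2" by auto
  then show False using assms(1) by (simp add: annul_def step_props(4))
 qed
 show "2^j*taxi c a x < 1"
 proof (rule ccontr)
  assume n: "\<not> 2^j*taxi c a x < 1"
  then have "1 <= 2^j*taxi c a x" "1 <= 2^Suc j*taxi c a x" by auto
  then show False using assms(1) by (simp add: annul_def step_props(5))
 qed
qed

lemma annul_sum: assumes "a > 0" "x \<in> cube_inf c a" shows "(\<Sum>j<n. annul c a j x) = step (2^n*taxi c a x)"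
proof -
 have "6*a*taxi c a x <= 6*a*(1/2)" unfolding taxi_l1[OF assms(1)] using assms(2) by (simp add: in_cube3)
 then have "taxi c a x <= 1/2" using assms(1) by (subst (asm) mult_le_cancel_left_pos) auto
 then have "step (taxi c a x) = 0" by (rule step_props)
 moreover have "(\<Sum>j<n. annul c a j x) = step (2^n*taxi c a x) - step (2^0*taxi c a x)"
  unfolding annul_def by (rule sum_lessThan_telescope)
 ultimately show ?thesis by simp
qed

lemma abs_prod_le: "\<bar>p\<bar> <= P ==> \<bar>q\<bar> <= Q ==> \<bar>r\<bar> <= S ==> \<bar>s\<bar> <= T ==> \<bar>p*q + r * s\<bar> <= P*Q + S*T" for p q r s :: real
proof -
 assume h: "\<bar>p\<bar> <= P" "\<bar>q\<bar> <= Q" "\<bar>r\<bar> <= S" "\<bar>s\<bar> <= T"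
 have "\<bar>p*q + r * s\<bar> <= \<bar>p\<bar> * \<bar>q\<bar> + \<bar>r\<bar> * \<bar>s\<bar>" using abs_triangle_ineq[of "p*q" "r * s"] by (simp add: abs_mult)
 also have "... <= P*Q + S*T" using h by (intro add_mono mult_mono) auto
 finally show ?thesis .
qed

lemma abs_prod_diff: "\<bar>p\<bar> <= 1 ==> \<bar>q'\<bar> <= 1 ==> \<bar>p - p'\<bar> <= P ==> \<bar>q - q'\<bar> <= Q ==> \<bar>p*q - p'*q'\<bar> <= P + Q" for p q p' q' :: real
proof -
 assume h: "\<bar>p\<bar> <= 1" "\<bar>q'\<bar> <= 1" "\<bar>p - p'\<bar> <= P" "\<bar>q - q'\<bar> <= Q"
 have "p*q - p'*q' = p*(q - q') + (p - p')*q'" by (simp add: algebra_simps)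
 then show ?thesis using abs_prod_le[OF h(1,4,3,2)] by simp
qed

lemma cwt_bounds: assumes "a > 0" "l > 0" "3*2^j/a <= 1/l"
 shows "\<bar>cwt c a l j m x\<bar> <= 1" "\<bar>cwt c a l j m x - cwt c a l j m y\<bar> <= 4/l*norm (x - y)"
proof -
 obtain m1 m2 m3 where m: "m = (m1, m2, m3)" by (cases m)
 have t: "\<bar>tent (zc c l m i x)\<bar> <= 1" for m i x using clip_tent(4,5)[of "zc c l m i x"] by simp
 have tL: "\<bar>tent (zc c l m i x) - tent (zc c l m i y)\<bar> <= 1/l*norm (x - y)" for m i
  by (rule order_trans[OF clip_tent(6) zc_Lip[OF assms(2)]])
 have aL: "\<bar>annul c a j x - annul c a j y\<bar> <= 1/l*norm (x - y)"
  by (rule order_trans[OF annul_bounds(2)[OF assms(1)] mult_right_mono[OF assms(3)]]) simp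
 have p2: "\<bar>annul c a j x*tent z\<bar> <= 1" if "\<bar>tent z\<bar> <= 1" for z x using annul_bounds(1)[OF assms(1)] that by (simp add: abs_mult mult_le_one)
 have p3: "\<bar>annul c a j x*tent z*tent z'\<bar> <= 1" if "\<bar>tent z\<bar> <= 1" "\<bar>tent z'\<bar> <= 1" for z z' x
  using p2[OF that(1), of x] that(2) unfolding abs_mult[of _ "tent z'"] by (simp add: mult_le_one)
 show "\<bar>cwt c a l j m x\<bar> <= 1" unfolding m cwt_def prod.case abs_mult[of _ "tent (zc c l m3 3 x)"] using p3[OF t t] t by (simp add: mult_le_one)
 have "\<bar>cwt c a l j m x - cwt c a l j m y\<bar> <= 1/l*norm (x - y) + 1/l*norm (x - y) + 1/l*norm (x - y) + 1/l*norm (x - y)"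
  unfolding m cwt_def prod.case by (intro abs_prod_diff t tL aL p2 p3 annul_bounds(1)[OF assms(1)])
 also have "... = 4/l*norm (x - y)" by (simp add: field_simps)
 finally show "\<bar>cwt c a l j m x - cwt c a l j m y\<bar> <= 4/l*norm (x - y)" .
qed

text \<open>The margin 11/10 accommodates cells that meet the cube of half side a and reach beyond
  it.\<close>

locale sing =
 fixes u :: "real^3 => real" and c :: "real^3" and a B ka :: real
 assumes a: "a > 0" and B: "B >= 0" and ka: "ka >= 1"
  and pdu: "x ~= c ==> x \<in> cube_inf c (11/10*a) ==> has_pd (pds js u) j x (pds (j # js) u x)"
  and bdu: "x ~= c ==> x \<in> cube_inf c (11/10*a) ==> \<bar>pds js u x\<bar> <= B*ka^length js*fact (length js)*(1/norm (x - c))^length js"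
  and swu: "x ~= c ==> x \<in> cube_inf c (11/10*a) ==> pds (js @ j # k # ks) u x = pds (js @ k # j # ks) u x"

text \<open>The factor 1/ka brings Taylor expansions of functions with analyticity constant ka/|x -
  c| into their range of convergence. The 40 leaves room both for the condition with 16 in
  \<open>taylor_grad\<close> and for the cells to keep the distance a/2^j/2 from the
  nucleus.\<close>

definition cl :: "real => real => nat => real" where "cl a ka j = a/(40*ka)/2^j"
definition Es :: "nat => (nat \<times> nat \<times> nat) set" where "Es n = {..<Suc n} \<times> {..<Suc n} \<times> {..<Suc n}"
text \<open>On the j-th shell the coordinates relative to c are at most 6*a/2^j, which is 240*ka
  cell sizes; hence one grid size for all shells.\<close>

definition gr :: "real => nat" where "gr ka = nat \<lceil>240*ka\<rceil>"

lemma cl_props: assumes "a > 0" "ka >= 1"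
 shows "cl a ka j > 0" "3*2^j/a <= 1/cl a ka j" "1/cl a ka j = 40*ka/a*2^j" "cl a ka j <= a/40/2^j" "cl a ka j <= a/40"
proof -
 show p: "cl a ka j > 0" "1/cl a ka j = 40*ka/a*2^j" using assms by (simp_all add: cl_def)
 have "3*(2^j/a) <= 40*ka*(2^j/a)" by (rule mult_right_mono) (use assms in auto)
 then show "3*2^j/a <= 1/cl a ka j" unfolding p by (simp add: mult.assoc)
 have "a/(40*ka) <= a/40" using assms by (intro divide_left_mono) auto
 then show q: "cl a ka j <= a/40/2^j" unfolding cl_def by (intro divide_right_mono) auto
 have "a/40/2^j <= a/40/1" using assms by (intro divide_left_mono) auto
 then show "cl a ka j <= a/40" using q by simp
qed

lemma tmono_scale: "C*(tmono e1 (l*z1)*tmono e2 (l*z2)*tmono e3 (l*z3)) = C*l^(e1 + e2 + e3)/(fact e1*fact e2*fact e3)*(z1^e1*z2^e2*z3^e3)"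
 by (simp add: tmono_def power_mult_distrib power_add)

context sing begin

abbreviation "l j \<equiv> cl a ka j"
abbreviation "W j m \<equiv> cwt c a (l j) j m"
text \<open>A cell whose weight vanishes on the cube may be centred where nothing is known about u;
  its coefficients are set to 0 in \<open>Cc\<close>.\<close>

definition act :: "nat => real \<times> real \<times> real => bool" where "act j m \<longleftrightarrow> (\<exists>x\<in>cube_inf c a. W j m x ~= 0)"

lemmas lp = cl_props[OF a ka]

text \<open>A point x of the shell has l1 distance above 6*a/4/2^j from c, hence Euclidean distance
  above (3/4) a/2^j; moving within the cell changes this by at most six cell sizes, that is (6/40)
  a/2^j.\<close>

lemma cell_geometry:
 assumes "act j m" "y \<in> cube_inf (ctr c (l j) m) (l j)"
 shows "y \<in> cube_inf c (11/10*a)" "norm (y - c) >= a/2^j/2" "y ~= c"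
proof -
 obtain x where x: "x \<in> cube_inf c a" "W j m x ~= 0" using assms(1) by (auto simp: act_def)
 have xc: "x \<in> cube_inf (ctr c (l j) m) (l j)" using cwt_support[OF lp(1)] x(2) by blast
 have yx: "\<bar>y$i - x$i\<bar> <= 2*l j" for i
 proof -
  have "\<bar>y$i - ctr c (l j) m $ i\<bar> <= l j" "\<bar>x$i - ctr c (l j) m $ i\<bar> <= l j" using xc assms(2) by (auto simp: cube_inf_def)
  then show ?thesis by linarith
 qed
 show "y \<in> cube_inf c (11/10*a)" unfolding cube_inf_def
 proof (intro CollectI allI)
  fix i show "\<bar>y$i - c$i\<bar> <= 11/10*a" using yx[of i] lp(5)[of j] x(1)[unfolded cube_inf_def, simplified, rule_format, of i] a by linarith
 qed
 have "annul c a j x ~= 0" using x(2) by (cases m) (auto simp: cwt_def)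
 from annul_support(1)[OF this a] have "6*a*(1/4) < 6*a*(2^j*taxi c a x)" using a by (intro mult_strict_left_mono) auto
 also have "... = 2^j*(6*a*taxi c a x)" by simp
 also have "... <= 2^j*(2*norm (x - c))" unfolding taxi_l1[OF a] using norm_l1(1)[of "x - c"] by (intro mult_left_mono) auto
 finally have xn: "norm (x - c) > 3/4*(a/2^j)" by (simp add: field_simps)
 have "norm (y - x) <= \<bar>(y - x)$1\<bar> + \<bar>(y - x)$2\<bar> + \<bar>(y - x)$3\<bar>" by (rule norm_l1)
 also have "... <= 6*l j" using yx[of 1] yx[of 2] yx[of 3] by simp
 also have "... <= 6/40*(a/2^j)" using lp(4)[of j] by simp
 finally have "norm (y - x) <= 6/40*(a/2^j)" .
 moreover have "norm (x - c) <= norm (y - x) + norm (y - c)" using norm_triangle_ineq[of "x - y" "y - c"] by (simp add: norm_minus_commute)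
 moreover define A where "A = a/2^j"
 moreover have "A > 0" using a by (simp add: A_def)
 ultimately show n: "norm (y - c) >= a/2^j/2" using xn unfolding A_def[symmetric] by linarith
 have "a/2^j/2 > 0" using a by simp
 then show "y ~= c" using n by auto
qed

abbreviation "kj j \<equiv> 2*ka/a*2^j"

lemma cell_an: assumes "act j m" shows "anloc_sym u (ctr c (l j) m) (l j) B (kj j)"
proof
 let ?x0 = "ctr c (l j) m"
 show "has_pd (pds js u) i y (pds (i # js) u y)" if "y \<in> cube_inf ?x0 (l j)" for y js i
  using cell_geometry[OF assms that] pdu by blast
 have ce: "?x0 \<in> cube_inf ?x0 (l j)" using lp(1)[of j] by (simp add: cube_inf_def)
 show "pds (js @ i # k # ks) u ?x0 = pds (js @ k # i # ks) u ?x0" for js i k ks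
  using cell_geometry[OF assms ce] swu by blast
 show "B >= 0" "kj j >= 0" using B ka a by auto
 fix y and js :: "3 list" assume y: "y \<in> cube_inf ?x0 (l j)"
 note g = cell_geometry[OF assms y]
 let ?p = "length js"
 have "1/norm (y - c) <= 1/(a/2^j/2)" using g(2,3) a by (intro divide_left_mono mult_pos_pos) auto
 then have "(1/norm (y - c))^?p <= (2/a*2^j)^?p" by (intro power_mono) (auto simp: field_simps)
 then have "B*ka^?p*fact ?p*(1/norm (y - c))^?p <= B*ka^?p*fact ?p*(2/a*2^j)^?p"
  using B ka by (intro mult_left_mono mult_nonneg_nonneg) auto
 also have "... = B*(ka*(2/a*2^j))^?p*fact ?p" by (simp only: power_mult_distrib ac_simps)
 finally have "\<bar>pds js u y\<bar> <= B*(ka*(2/a*2^j))^?p*fact ?p" using bdu[OF g(3,1), of js] by linarith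
 moreover have "ka*(2/a*2^j) = kj j" by simp
 ultimately show "\<bar>pds js u y\<bar> <= B*kj j^?p*fact ?p" by (simp only:)
qed

lemma kl: "16*kj j*l j <= 1" "8*kj j*l j <= 1" "kj j <= 1/l j"
proof -
 have e: "kj j = (1/20)*(1/l j)" unfolding lp(3) by simp
 show "16*kj j*l j <= 1" "8*kj j*l j <= 1" "kj j <= 1/l j" unfolding e using lp(1)[of j] by (auto simp: field_simps)
qed

definition Cc :: "nat => real \<times> real \<times> real => nat \<times> nat \<times> nat => real" where
 "Cc j m = (%(e1, e2, e3). if act j m then Cf u (ctr c (l j) m) e1 e2 e3*l j^(e1 + e2 + e3)/(fact e1*fact e2*fact e3) else 0)"

lemma Cc_bound: "\<bar>Cc j m e\<bar> <= B"
proof (cases "act j m")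
 case True
 then interpret anloc_sym u "ctr c (l j) m" "l j" B "kj j" by (rule cell_an)
 obtain e1 e2 e3 where e: "e = (e1, e2, e3)" by (cases e)
 show ?thesis using coeff_scaled[of "l j" e1 e2 e3] True kl(2)[of j] lp(1)[of j] by (simp add: Cc_def e abs_mult abs_divide)
qed (use B in \<open>simp add: Cc_def split: prod.split\<close>)

definition h :: "nat => nat => real \<times> real \<times> real => real^3 => real" where
 "h n j m x = W j m x*u x - (\<Sum>e\<in>Es n. Cc j m e*tgt c a (l j) j m e x)"

lemma h_eq:
 assumes "act j m"
 shows "h n j m x = W j m x*(u x - Tp (Cf u (ctr c (l j) m)) (Suc n) (Suc n) (Suc n) (ctr c (l j) m) x)"
proof -
 let ?x0 = "ctr c (l j) m"
 obtain m1 m2 m3 where m: "m = (m1, m2, m3)" by (cases m)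
 let ?z1 = "zc c (l j) m1 1 x" and ?z2 = "zc c (l j) m2 2 x" and ?z3 = "zc c (l j) m3 3 x"
 have t: "tgt c a (l j) j m (e1, e2, e3) x = W j m x*(?z1^e1*?z2^e2*?z3^e3)" for e1 e2 e3
 proof (cases "W j m x = 0")
  case True
  then show ?thesis by (auto simp: m tgt_def cwt_def)
 next
  case False
  have "\<bar>?z1\<bar> < 1" "\<bar>?z2\<bar> < 1" "\<bar>?z3\<bar> < 1" using False clip_tent(7) unfolding m cwt_def by fastforce+
  then have "clip ?z1 = ?z1" "clip ?z2 = ?z2" "clip ?z3 = ?z3" by (simp_all add: clip_tent(3))
  then show ?thesis by (simp add: m tgt_def cwt_def)
 qed
 have T: "Tp (Cf u ?x0) (Suc n) (Suc n) (Suc n) ?x0 x = (\<Sum>(e1, e2, e3)\<in>Es n. Cf u ?x0 e1 e2 e3*(tmono e1 (l j*?z1)*tmono e2 (l j*?z2)*tmono e3 (l j*?z3)))"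
  unfolding Tp_def Es_def m zc_ctr[OF lp(1)] by (simp only: sum.cartesian_product case_prod_beta fst_conv snd_conv)
 have "W j m x*Tp (Cf u ?x0) (Suc n) (Suc n) (Suc n) ?x0 x = (\<Sum>e\<in>Es n. Cc j m e*tgt c a (l j) j m e x)"
  unfolding sum_distrib_left T
 proof (rule sum.cong[OF refl], clarify)
  fix e1 e2 e3
  show "W j m x*(Cf u ?x0 e1 e2 e3*(tmono e1 (l j*?z1)*tmono e2 (l j*?z2)*tmono e3 (l j*?z3))) = Cc j m (e1, e2, e3)*tgt c a (l j) j m (e1, e2, e3) x"
   unfolding t Cc_def case_prod_conv if_P[OF assms] tmono_scale by (simp only: ac_simps)
 qed
 then show ?thesis by (simp only: h_def right_diff_distrib)
qed

text \<open>A product rule for differences: increment of the weight times Taylor error plus weight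
  times increment of the Taylor error, giving 4/l + 1/l = 5/l. When an end of the step lies outside
  the cell its weight is 0, and the increment of the weight alone suffices.\<close>

lemma cell_error:
 assumes x: "x \<in> cube_inf c a"
 shows "\<bar>h n j m x\<bar> <= 7*B*(1/2)^n"
  "0 <= t ==> sh x t i \<in> cube_inf c a ==> \<bar>h n j m (sh x t i) - h n j m x\<bar> <= 7*B*(1/2)^n*(5/l j)*t"
proof -
 let ?E = "7*B*(1/2)^n" and ?D = "cube_inf (ctr c (l j) m) (l j)"
 have E0: "?E >= 0" using B by simp
 have l0: "l j > 0" by (rule lp)
 have "\<bar>h n j m x\<bar> <= ?E & (\<forall>t. 0 <= t --> sh x t i \<in> cube_inf c a --> \<bar>h n j m (sh x t i) - h n j m x\<bar> <= ?E*(5/l j)*t)"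
 proof (cases "act j m")
  case False
  then have "h n j m y = 0" if "y \<in> cube_inf c a" for y
  proof -
   have "Cc j m e = 0" for e using False by (simp add: Cc_def split: prod.split)
   then show ?thesis using False that by (auto simp: h_def act_def)
  qed
  then show ?thesis using x E0 l0 by simp
 next
  case True
  then interpret anloc_sym u "ctr c (l j) m" "l j" B "kj j" by (rule cell_an)
  let ?T = "Tp (Cf u (ctr c (l j) m)) (Suc n) (Suc n) (Suc n) (ctr c (l j) m)"
  let ?g = "%y. u y - ?T y"
  have hW: "h n j m y = W j m y*?g y" for y by (rule h_eq[OF True])
  have g: "\<bar>?g y\<bar> <= ?E" if "y \<in> ?D" for y using that l0 kl(2) by (intro taylor_value[where l="l j"]) auto
  have W0: "W j m y = 0" if "y \<notin> ?D" for y using that by (rule cwt_support[OF l0])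
  note W1 = cwt_bounds[OF a l0 lp(2), of c m]
  have hD: "\<bar>h n j m y\<bar> <= \<bar>W j m y\<bar>*?E" for y
   using g[of y] W0[of y] unfolding hW abs_mult by (cases "y \<in> ?D") (auto intro: mult_left_mono)
  have 1: "\<bar>h n j m x\<bar> <= ?E" using hD[of x] mult_right_mono[OF W1(1) E0, of x] by simp
  have "\<bar>h n j m (sh x t i) - h n j m x\<bar> <= ?E*(5/l j)*t" if t: "0 <= t" for t
  proof -
   let ?y = "sh x t i"
   have nt: "norm (?y - x) = t" using t by simp
   have dW: "\<bar>W j m ?y - W j m x\<bar> <= 4/l j*t" using W1(2)[of ?y x] unfolding nt .
   have le: "4/l j*t*?E <= ?E*(5/l j)*t" using E0 l0 t by (simp add: divide_simps mult_nonneg_nonneg)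
   show ?thesis
   proof (cases "x \<in> ?D & ?y \<in> ?D")
    case False
    then have "W j m x = 0 \<or> W j m ?y = 0" using W0 by blast
    then have "\<bar>h n j m ?y - h n j m x\<bar> <= \<bar>W j m ?y - W j m x\<bar>*?E"
     using hD[of x] hD[of ?y] by (auto simp: hW)
    also have "... <= 4/l j*t*?E" using dW E0 by (rule mult_right_mono)
    finally show ?thesis using le by linarith
   next
    case True
    have seg: "sh x s i \<in> ?D" if "s \<in> closed_segment 0 t" for s
    proof -
     have s: "0 <= s" "s <= t" using that t by (auto simp: closed_segment_eq_real_ivl)
     show ?thesis unfolding cube_inf_def
     proof (intro CollectI allI)
      fix k
      have "\<bar>x$k - ctr c (l j) m $ k\<bar> <= l j" "\<bar>?y$k - ctr c (l j) m $ k\<bar> <= l j" using True by (auto simp: cube_inf_def)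
      then show "\<bar>(sh x s i)$k - ctr c (l j) m $ k\<bar> <= l j" using s by (cases "k = i") (simp_all add: axis_def)
     qed
    qed
    have "\<exists>D. has_pd ?T i y D & \<bar>pd i u y - D\<bar> <= 7*(B*kj j)*(1/2)^n" if "y \<in> ?D" for y
     using that l0 kl(1) by (intro taylor_grad[where l="l j"]) auto
    then obtain D where D: "!!y. y \<in> ?D ==> has_pd ?T i y (D y) & \<bar>pd i u y - D y\<bar> <= 7*(B*kj j)*(1/2)^n" by metis
    have pu: "has_pd u i y (pd i u y)" if "y \<in> ?D" for y using pd[OF that, of "[]" i] by simp
    have "\<bar>?g ?y - ?g x\<bar> <= 7*(B*kj j)*(1/2)^n * \<bar>t\<bar>"
     by (rule has_pd_lipschitz[where k'="%y. pd i u y - D y"]; (intro has_pd_diff)?) (use D pu seg in blast)+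
    also have "... = ?E*kj j*t" using t by simp
    also have "... <= ?E*(1/l j)*t" using kl(3) E0 t by (intro mult_right_mono mult_left_mono)
    finally have dg: "\<bar>?g ?y - ?g x\<bar> <= ?E*(1/l j)*t" .
    have "h n j m ?y - h n j m x = (W j m ?y - W j m x)*?g ?y + W j m x*(?g ?y - ?g x)" unfolding hW by (simp only: left_diff_distrib right_diff_distrib)
    then have "\<bar>h n j m ?y - h n j m x\<bar> <= (4/l j*t)*?E + 1*(?E*(1/l j)*t)"
     using abs_prod_le[OF dW g[OF True[THEN conjunct2]] W1(1) dg, of x] by (simp only:)
    also have "... = ?E*(5/l j)*t" by (simp add: algebra_simps add_divide_distrib[symmetric])
    finally show ?thesis .
   qed
  qed
  then show ?thesis using 1 by blast
 qed
 then show "\<bar>h n j m x\<bar> <= ?E" "0 <= t ==> sh x t i \<in> cube_inf c a ==> \<bar>h n j m (sh x t i) - h n j m x\<bar> <= ?E*(5/l j)*t"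
  by blast+
qed

end

definition Qs :: "real => nat => (nat \<times> nat \<times> nat \<times> nat) set" where
 "Qs ka n = {..<n} \<times> {..<2*gr ka + 1} \<times> {..<2*gr ka + 1} \<times> {..<2*gr ka + 1}"
definition mv :: "real => nat \<times> nat \<times> nat => real \<times> real \<times> real" where
 "mv ka = (%(p, q, r). (real p - real (gr ka), real q - real (gr ka), real r - real (gr ka)))"

lemma Qs_Es: "finite (Qs ka n)" "card (Qs ka n) = n*(2*gr ka + 1)^3" "finite (Es n)" "card (Es n) = Suc n^3" "n >= 1 ==> Qs ka n ~= {}" "Es n ~= {}"
 by (simp_all add: Qs_def Es_def card_cartesian_product power3_eq_cube lessThan_empty_iff)

text \<open>Within a shell the tents sum to 1 in each coordinate because the grid covers the shell,
  and the shells telescope. The remaining step is 1 except in a ball of radius O(2^(-n)) around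
  c.\<close>

lemma partition:
 assumes a: "a > 0" and ka: "ka >= 1" and x: "x \<in> cube_inf c a"
 shows "(\<Sum>(j, p)\<in>Qs ka n. cwt c a (cl a ka j) j (mv ka p) x) = step (2^n*taxi c a x)"
proof -
 let ?g = "2*gr ka + 1" and ?t = "%j i p. tent (zc c (cl a ka j) (real p - real (gr ka)) i x)"
 have "(\<Sum>(j, p)\<in>Qs ka n. cwt c a (cl a ka j) j (mv ka p) x) = (\<Sum>j<n. \<Sum>p<?g. \<Sum>q<?g. \<Sum>r<?g. annul c a j x*?t j 1 p*?t j 2 q*?t j 3 r)"
  unfolding Qs_def cwt_def mv_def sum.cartesian_product by (intro sum.cong) auto
 also have "... = (\<Sum>j<n. annul c a j x)"
 proof (rule sum.cong[OF refl])
  fix j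
  have "(\<Sum>p<?g. \<Sum>q<?g. \<Sum>r<?g. annul c a j x*?t j 1 p*?t j 2 q*?t j 3 r) = annul c a j x*(\<Sum>p<?g. ?t j 1 p)*(\<Sum>q<?g. ?t j 2 q)*(\<Sum>r<?g. ?t j 3 r)"
   by (simp only: sum_distrib_left[symmetric] sum_distrib_right[symmetric])
  also have "... = annul c a j x"
  proof (cases "annul c a j x = 0")
   case False
   have "(\<Sum>p<?g. ?t j i p) = 1" for i
   proof -
    have "\<bar>x$i - c$i\<bar> <= 6*a*taxi c a x" unfolding taxi_l1[OF a] using exhaust_3[of i] by auto
    also have "... <= 6*a*(1/2^j)" using annul_support(2)[OF False a] a by (intro mult_left_mono) (auto simp: field_simps)
    finally have "1/cl a ka j * \<bar>x$i - c$i\<bar> <= 1/cl a ka j*(6*a*(1/2^j))" using cl_props(1)[OF a ka] by (intro mult_left_mono) (auto simp: less_imp_le)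
    also have "... = 240*ka" unfolding cl_props(3)[OF a ka] using a by simp
    also have "... <= real (gr ka)" unfolding gr_def by linarith
    finally have "\<bar>1/cl a ka j*(x$i - c$i)\<bar> <= real (gr ka)" using cl_props(1)[OF a ka, of j] by (simp add: abs_mult abs_divide)
    then show ?thesis unfolding zc_def by (rule tent_sum)
   qed
   then show ?thesis by simp
  qed simp
  finally show "(\<Sum>p<?g. \<Sum>q<?g. \<Sum>r<?g. annul c a j x*?t j 1 p*?t j 2 q*?t j 3 r) = annul c a j x" .
 qed
 also have "... = step (2^n*taxi c a x)" by (rule annul_sum[OF a x])
 finally show ?thesis .
qed

text \<open>K counts cells times monomials. In E, 8 = 7 + 1 adds Taylor and network errors of the
  values, and 39 = 7*5 + 4 combines \<open>cell_error\<close> with the four cutoffs in the Lipschitz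
  constant of \<open>term_net\<close>. The degree 8*n makes 2^(-8n) beat the remaining factors,
  which are polynomial in n or a multiple of 2^n.\<close>

lemma net_approx:
 assumes s: "!!i. i < N ==> sing (u i) c a B ka" and a: "a > 0" and ka: "ka >= 1" and n: "n >= 1" and k: "Suc (8*n) <= 2^k"
  and m: "5^(k + 6)*(2*(1/2)^m) <= (1/2::real)^(8*n)"
 defines "K \<equiv> n*(2*gr ka + 1)^3*Suc (8*n)^3"
 defines "E \<equiv> real K*(B*(1/2)^(8*n))*(8 + (3*2^k + 39)*(40*ka/a*2^n))"
 shows "\<exists>fs. NN (4 + 12*Suc k*Suc m) (K*((3 + 12*Suc k*Suc m)*1640) + (N*(2*K) + N)) fs & length fs = N &
  (\<forall>i<N. \<forall>x\<in>cube_inf c a. \<bar>step (2^n*taxi c a x)*u i x - (fs ! i) x\<bar> <= E &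
   (\<forall>t j. 0 <= t --> sh x t j \<in> cube_inf c a -->
    \<bar>(step (2^n*taxi c a (sh x t j))*u i (sh x t j) - (fs ! i) (sh x t j)) - (step (2^n*taxi c a x)*u i x - (fs ! i) x)\<bar> <= E*t))"
proof -
 let ?T = "Qs ka n \<times> Es (8*n)" and ?L = "3 + 12*Suc k*Suc m" and ?de = "(1/2::real)^(8*n)" and ?H = "40*ka/a*2^n"
 let ?l = "cl a ka"
 let ?tg = "%((j, p), e). tgt c a (?l j) j (mv ka p) e"
 note lp = cl_props[OF a ka]
 have de1: "?de <= 1" by (simp add: power_le_one)
 have "\<forall>ta\<in>?T. \<exists>f. NN ?L (?L*1640) [f, %x. - f x] & ap ?de ((3*2^k + 4)/?l (fst (fst ta))) f (?tg ta)"
 proof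
  fix ta assume t: "ta \<in> ?T"
  obtain j p e1 e2 e3 where ta: "ta = ((j, p), (e1, e2, e3))" by (metis surj_pair)
  obtain m1 m2 m3 where mm: "mv ka p = (m1, m2, m3)" by (metis surj_pair)
  have "e1 < 2^k" "e2 < 2^k" "e3 < 2^k" using t k by (auto simp: ta Es_def)
  then have "\<exists>f. NN ?L (?L*1640) [f, %x. - f x] & ap (5^(k + 6)*(2*(1/2)^m)) ((3*2^k + 4)/?l j) f (tgt c a (?l j) j (m1, m2, m3) (e1, e2, e3))"
   by (intro term_net[OF a lp(1,2) order_trans[OF m de1]])
  then show "\<exists>f. NN ?L (?L*1640) [f, %x. - f x] & ap ?de ((3*2^k + 4)/?l (fst (fst ta))) f (?tg ta)"
   using ap_mono[OF _ m] unfolding ta fst_conv prod.case mm by blast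
 qed
 from bchoice[OF this] obtain f where f0: "\<forall>ta\<in>?T. NN ?L (?L*1640) [f ta, %x. - f ta x] & ap ?de ((3*2^k + 4)/?l (fst (fst ta))) (f ta) (?tg ta)" ..
 note f = f0[rule_format, THEN conjunct1] f0[rule_format, THEN conjunct2]
 have T: "finite ?T" "?T ~= {}" "card ?T = K" using Qs_Es n by (auto simp: card_cartesian_product K_def)
 let ?C = "%i ((j, p), e). sing.Cc (u i) c a ka j (mv ka p) e"
 let ?fs = "map (%i x. \<Sum>ta\<in>?T. ?C i ta*f ta x) [0..<N]"
 have "NN (Suc ?L) (card ?T*(?L*1640) + (N*(2*card ?T) + N)) ?fs" by (rule NN_sum[OF T(1,2) _ f(1)]) auto
 then have nn: "NN (4 + 12*Suc k*Suc m) (K*(?L*1640) + (N*(2*K) + N)) ?fs" by (simp add: T(3))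
 have "\<bar>step (2^n*taxi c a x)*u i x - (?fs ! i) x\<bar> <= E &
   (\<forall>t j. 0 <= t --> sh x t j \<in> cube_inf c a -->
    \<bar>(step (2^n*taxi c a (sh x t j))*u i (sh x t j) - (?fs ! i) (sh x t j)) - (step (2^n*taxi c a x)*u i x - (?fs ! i) x)\<bar> <= E*t)"
  if i: "i < N" and x: "x \<in> cube_inf c a" for i x
 proof -
  interpret sing "u i" c a B ka by (rule s[OF i])
  let ?h = "%(j, p). h (8*n) j (mv ka p)"
  \<comment> \<open>The error is the Taylor error of the cells plus the network error of the
    localised monomials; \<open>partition\<close> produces the cutoff in front of u.\<close>
  have eq: "step (2^n*taxi c a y)*u i y - (?fs ! i) y = (\<Sum>q\<in>Qs ka n. ?h q y) + (\<Sum>ta\<in>?T. ?C i ta*(?tg ta y - f ta y))"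
   if y: "y \<in> cube_inf c a" for y
  proof -
   have "(\<Sum>q\<in>Qs ka n. ?h q y) = (\<Sum>(j, p)\<in>Qs ka n. cwt c a (?l j) j (mv ka p) y)*u i y - (\<Sum>ta\<in>?T. ?C i ta*?tg ta y)"
   proof -
    have "(\<Sum>ta\<in>?T. ?C i ta*?tg ta y) = (\<Sum>q\<in>Qs ka n. \<Sum>e\<in>Es (8*n). ?C i (q, e)*?tg (q, e) y)"
     by (subst sum.cartesian_product, rule sum.cong) auto
    then show ?thesis unfolding h_def sum_distrib_right by (simp only: sum_subtractf[symmetric]) (intro sum.cong; auto)
   qed
   then show ?thesis unfolding partition[OF a ka y] using i by (simp add: right_diff_distrib sum_subtractf)
  qed
  have B0: "B*?de >= 0" using B by simp
  have H: "1/?l j <= ?H" if "j < n" for j unfolding lp(3) using a ka that by (intro mult_left_mono power_increasing) auto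
  have H0: "?H >= 0" using a ka by simp
  have cQ: "real (card (Qs ka n)) <= real K" unfolding Qs_Es K_def of_nat_le_iff using mult_le_mono2[of 1 "Suc (8*n)^3" "n*(2*gr ka + 1)^3"] by simp
  have C: "\<bar>?C i ta\<bar> <= B" for ta by (cases ta) (auto simp: Cc_bound)
  have "\<bar>\<Sum>q\<in>Qs ka n. ?h q x\<bar> <= real (card (Qs ka n))*(7*B*?de)"
   by (rule sum_norm_bound[where 'a=real, unfolded real_norm_def]) (simp only: case_prod_beta cell_error(1)[OF x])
  also have "... <= real K*(7*B*?de)" using cQ B0 by (intro mult_right_mono) auto
  finally have v1: "\<bar>\<Sum>q\<in>Qs ka n. ?h q x\<bar> <= real K*(7*B*?de)" .
  have v2: "\<bar>\<Sum>ta\<in>?T. ?C i ta*(?tg ta x - f ta x)\<bar> <= real K*(B*?de)"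
   unfolding T(3)[symmetric]
  proof (rule sum_norm_bound[where 'a=real, unfolded real_norm_def])
   fix ta assume "ta \<in> ?T"
   then have "\<bar>?tg ta x - f ta x\<bar> <= ?de" using f(2) by (simp add: ap_def abs_minus_commute)
   then show "\<bar>?C i ta*(?tg ta x - f ta x)\<bar> <= B*?de" unfolding abs_mult using C B by (intro mult_mono) auto
  qed
  have "\<bar>step (2^n*taxi c a x)*u i x - (?fs ! i) x\<bar> <= real K*(7*B*?de) + real K*(B*?de)"
   unfolding eq[OF x] using v1 v2 by linarith
  also have "... = real K*(B*?de)*8" by (simp add: algebra_simps)
  also have "... <= E" unfolding E_def using B0 mult_nonneg_nonneg[OF _ H0, of "3*2^k + 39"] by (intro mult_left_mono) simp_all
  finally have V: "\<bar>step (2^n*taxi c a x)*u i x - (?fs ! i) x\<bar> <= E" .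
  have "\<bar>(step (2^n*taxi c a y)*u i y - (?fs ! i) y) - (step (2^n*taxi c a x)*u i x - (?fs ! i) x)\<bar> <= E*t"
   if t: "0 <= t" and y: "y \<in> cube_inf c a" "y = sh x t j" for t j y
  proof -
   have ny: "norm (y - x) = t" using t y by simp
   have w1: "\<bar>\<Sum>q\<in>Qs ka n. ?h q y - ?h q x\<bar> <= real (card (Qs ka n))*(7*B*?de*5*?H*t)"
   proof (rule sum_norm_bound[where 'a=real, unfolded real_norm_def])
    fix q assume q: "q \<in> Qs ka n"
    obtain j' p where qq: "q = (j', p)" by (cases q)
    have "\<bar>h (8*n) j' (mv ka p) y - h (8*n) j' (mv ka p) x\<bar> <= 7*B*?de*(5/?l j')*t"
     using cell_error(2)[OF x t, of j] y by simp
    also have "... = (7*B*?de*5)*(1/?l j')*t" by simp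
    also have "... <= (7*B*?de*5)*?H*t" using q B t by (intro mult_right_mono mult_left_mono H) (auto simp: Qs_def qq)
    finally show "\<bar>?h q y - ?h q x\<bar> <= 7*B*?de*5*?H*t" unfolding qq prod.case .
   qed
   also have "... <= real K*(7*B*?de*5*?H*t)" using cQ B a ka t by (intro mult_right_mono mult_nonneg_nonneg) auto
   finally have w1: "\<bar>\<Sum>q\<in>Qs ka n. ?h q y - ?h q x\<bar> <= real K*(7*B*?de*5*?H*t)" .
   have w2: "\<bar>\<Sum>ta\<in>?T. ?C i ta*(?tg ta y - f ta y) - ?C i ta*(?tg ta x - f ta x)\<bar> <= real K*(B*(?de*((3*2^k + 4)*?H)*t))"
    unfolding T(3)[symmetric]
   proof (rule sum_norm_bound[where 'a=real, unfolded real_norm_def])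
    fix ta assume ta: "ta \<in> ?T"
    have "\<bar>(f ta y - ?tg ta y) - (f ta x - ?tg ta x)\<bar> <= ?de*((3*2^k + 4)/?l (fst (fst ta)))*norm (y - x)" using f(2)[OF ta] unfolding ap_def by blast
    then have "\<bar>(?tg ta y - f ta y) - (?tg ta x - f ta x)\<bar> <= ?de*((3*2^k + 4)*(1/?l (fst (fst ta))))*t" unfolding ny by simp
    also have "... <= ?de*((3*2^k + 4)*?H)*t" using ta t by (intro mult_right_mono mult_left_mono H) (auto simp: Qs_def)
    finally have "\<bar>?C i ta\<bar> * \<bar>(?tg ta y - f ta y) - (?tg ta x - f ta x)\<bar> <= B*(?de*((3*2^k + 4)*?H)*t)"
     using C B by (intro mult_mono) auto
    then show "\<bar>?C i ta*(?tg ta y - f ta y) - ?C i ta*(?tg ta x - f ta x)\<bar> <= B*(?de*((3*2^k + 4)*?H)*t)"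
     unfolding abs_mult[symmetric] right_diff_distrib[symmetric] .
   qed
   have "\<bar>(step (2^n*taxi c a y)*u i y - (?fs ! i) y) - (step (2^n*taxi c a x)*u i x - (?fs ! i) x)\<bar>
     <= real K*(7*B*?de*5*?H*t) + real K*(B*(?de*((3*2^k + 4)*?H)*t))"
    unfolding eq[OF x] eq[OF y(1)] using w1 w2 unfolding sum_subtractf by linarith
   also have "... = real K*(B*?de)*((3*2^k + 39)*?H)*t"
   proof -
    have "p*(7*b*d*5*H*t) + p*(b*(d*((3*e + 4)*H)*t)) = p*(b*d)*((3*e + 39)*H)*t" for p b d H e :: real
     by (simp add: algebra_simps)
    then show ?thesis .
   qed
   also have "... <= E*t" unfolding E_def using B0 t by (intro mult_right_mono mult_left_mono) auto
   finally show ?thesis .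
  qed
  then show ?thesis using V by blast
 qed
 then show ?thesis using nn by (intro exI[of _ ?fs]) simp
qed

section \<open>Weak gradients of piecewise linear functions\<close>

lemma has_rd_const: "has_rd (%x. c) j x 0"
 by (simp add: has_rd_def)

lemma has_rd_add: "has_rd f j x a ==> has_rd g j x b ==> has_rd (%x. f x + g x) j x (a + b)"
 unfolding has_rd_def by (rule DERIV_add)

lemma has_rd_diff: "has_rd f j x a ==> has_rd g j x b ==> has_rd (%x. f x - g x) j x (a - b)"
 unfolding has_rd_def by (rule DERIV_diff)

lemma has_rd_mult: "has_rd f j x a ==> has_rd g j x b ==> has_rd (%x. f x*g x) j x (a*g x + b*f x)"
 unfolding has_rd_def by (drule (1) DERIV_mult) simp

lemma has_rd_iff: "has_rd f j x D \<longleftrightarrow> ((%t. (f (sh x t j) - f x)/t) \<longlongrightarrow> D) (at 0 within {0..})"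
 by (simp add: has_rd_def has_field_derivative_iff)

lemma has_rd_bound:
 assumes "has_rd f j x D" "ep > 0" "!!t. 0 < t ==> t < ep ==> \<bar>f (sh x t j) - f x\<bar> <= L*t"
 shows "\<bar>D\<bar> <= L"
proof (rule tendsto_upperbound[OF tendsto_rabs[OF assms(1)[unfolded has_rd_iff]]])
 have "{0..} - {0::real} = {0<..}" by auto
 then show "at (0::real) within {0..} ~= bot" by (simp add: at_within_eq_bot_iff)
 have "\<bar>(f (sh x t j) - f x)/t\<bar> <= L" if "t \<in> {0..}" "t ~= 0" "dist t 0 < ep" for t
  using assms(3)[of t] that by (simp add: abs_divide divide_le_eq)
 then show "\<forall>\<^sub>F t in at 0 within {0..}. \<bar>(f (sh x t j) - f x)/t\<bar> <= L"
  unfolding eventually_at using assms(2) by blast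
qed

text \<open>The critical case is f x = 0: for t > 0 positive homogeneity turns the quotient of
  \<open>relu\<close> into the maximum of 0 and the quotient of f, which converges. A two-sided
  derivative may fail to exist here.\<close>

lemma has_rd_relu: assumes "has_rd f j x D" shows "\<exists>D'. has_rd (%x. relu (f x)) j x D'"
proof -
 let ?F = "at (0::real) within {0..}" and ?p = "%t. f (sh x t j)"
 have q: "((%t. (?p t - f x)/t) \<longlongrightarrow> D) ?F" using assms by (simp add: has_rd_iff)
 have "continuous ?F ?p" using assms unfolding has_rd_def by (rule DERIV_continuous)
 then have p: "(?p \<longlongrightarrow> f x) ?F" by (simp add: continuous_within)
 have pos: "\<forall>\<^sub>F t in ?F. t > 0" unfolding eventually_at by (intro exI[of _ 1]) auto
 consider "f x > 0" | "f x < 0" | "f x = 0" by linarith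
 then show ?thesis
 proof cases
  case 1
  have "\<forall>\<^sub>F t in ?F. (?p t - f x)/t = (relu (?p t) - relu (f x))/t"
   using order_tendstoD(1)[OF p 1] by eventually_elim (use 1 in \<open>simp add: relu_def\<close>)
  from Lim_transform_eventually[OF q this] show ?thesis unfolding has_rd_iff by blast
 next
  case 2
  have "\<forall>\<^sub>F t in ?F. 0 = (relu (?p t) - relu (f x))/t"
   using order_tendstoD(2)[OF p 2] by eventually_elim (use 2 in \<open>simp add: relu_def\<close>)
  from Lim_transform_eventually[OF tendsto_const this] show ?thesis unfolding has_rd_iff by blast
 next
  case 3
  have "((%t. max 0 ((?p t - f x)/t)) \<longlongrightarrow> max 0 D) ?F" by (intro tendsto_max tendsto_const q)
  moreover have "\<forall>\<^sub>F t in ?F. max 0 ((?p t - f x)/t) = (relu (?p t) - relu (f x))/t"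
   using pos by eventually_elim (use 3 in \<open>auto simp: relu_def max_def divide_le_0_iff zero_le_divide_iff\<close>)
  ultimately have "((%t. (relu (?p t) - relu (f x))/t) \<longlongrightarrow> max 0 D) ?F" by (rule Lim_transform_eventually)
  then show ?thesis unfolding has_rd_iff by blast
 qed
qed

text \<open>A class containing the coordinates and stable under affine maps and the activation,
  hence containing all network outputs, whose right derivatives form a weak gradient.\<close>

definition RL :: "(real^3 => real) => bool" where
 "RL f \<longleftrightarrow> (\<exists>L\<ge>0. \<forall>x y. \<bar>f x - f y\<bar> <= L*norm (x - y)) & (\<forall>x j. \<exists>D. has_rd f j x D)"

lemma RL_const: "RL (%x. c)"
 unfolding RL_def using has_rd_const by (auto intro: exI[of _ 0])

lemma RL_coord: "RL (%x. x$i)"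
 unfolding RL_def
proof (intro conjI allI)
 show "\<exists>L\<ge>0. \<forall>x y. \<bar>x$i - y$i\<bar> <= L*norm (x - y)" using component_le_norm_cart[of "_ - _" i] by (intro exI[of _ 1]) auto
qed (use has_pd_imp_rd[OF has_pd_coord] in blast)

lemma RL_add: assumes "RL f" "RL g" shows "RL (%x. f x + g x)"
proof -
 obtain L L' where L: "L >= 0" "L' >= 0" "!!x y. \<bar>f x - f y\<bar> <= L*norm (x - y)" "!!x y. \<bar>g x - g y\<bar> <= L'*norm (x - y)" using assms unfolding RL_def by blast
 have "\<bar>(f x + g x) - (f y + g y)\<bar> <= (L + L')*norm (x - y)" for x y using L(3)[of x y] L(4)[of x y] by (simp add: distrib_right)
 moreover have "\<exists>D. has_rd (%x. f x + g x) j x D" for x j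
 proof -
  obtain p q where "has_rd f j x p" "has_rd g j x q" using assms unfolding RL_def by blast
  then show ?thesis using has_rd_add by blast
 qed
 ultimately show ?thesis using L(1,2) unfolding RL_def by (intro conjI exI[of _ "L + L'"]) auto
qed

lemma RL_cmult: assumes "RL f" shows "RL (%x. c*f x)"
proof -
 obtain L where L: "L >= 0" "!!x y. \<bar>f x - f y\<bar> <= L*norm (x - y)" using assms unfolding RL_def by blast
 have "\<bar>c*f x - c*f y\<bar> <= (\<bar>c\<bar>*L)*norm (x - y)" for x y
  unfolding right_diff_distrib[symmetric] abs_mult mult.assoc using L(2) by (intro mult_left_mono) auto
 moreover have "\<exists>D. has_rd (%x. c*f x) j x D" for x j
  using has_rd_mult[OF has_rd_const[of c j x], of f] assms unfolding RL_def by blast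
 ultimately show ?thesis using L(1) unfolding RL_def by (intro conjI exI[of _ "\<bar>c\<bar>*L"]) auto
qed

lemma RL_relu: assumes "RL f" shows "RL (%x. relu (f x))"
proof -
 have "\<bar>relu s - relu t\<bar> <= \<bar>s - t\<bar>" for s t by (simp add: relu_def max_def abs_if)
 then show ?thesis using assms has_rd_relu unfolding RL_def by (meson order_trans)
qed

lemma RL_row: "\<forall>f\<in>set fs. RL f ==> RL (%x. rowv r (ev fs x))"
proof (induction fs arbitrary: r)
 case (Cons f fs)
 then show ?case by (cases r) (auto simp: rowv_def ev_def intro!: RL_const RL_add RL_cmult)
qed (simp add: rowv_def ev_def RL_const)

lemma RL_affine: assumes "\<forall>f\<in>set fs. RL f"
 shows "\<exists>gs. length gs = min (length A) (length b) & (\<forall>g\<in>set gs. RL g) & (\<forall>x. affine A b (ev fs x) = ev gs x)"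
proof (intro exI conjI allI)
 let ?gs = "map (%(r, c) x. rowv r (ev fs x) + c) (zip A b)"
 show "length ?gs = min (length A) (length b)" by simp
 show "\<forall>g\<in>set ?gs. RL g" by (auto intro!: RL_add RL_row RL_const assms)
 show "affine A b (ev fs x) = ev ?gs x" for x by (auto simp: affine_eq ev_def case_prod_beta)
qed

lemma RL_realize: "nn_wf d PH e ==> \<forall>f\<in>set fs. RL f ==> \<exists>gs. length gs = e & (\<forall>g\<in>set gs. RL g) & (\<forall>x. realize PH (ev fs x) = ev gs x)"
proof (induction d PH e arbitrary: fs rule: nn_wf.induct)
 case (2 d A b L e)
 obtain gs where gs: "length gs = min (length A) (length b)" "\<forall>g\<in>set gs. RL g" "!!x. affine A b (ev fs x) = ev gs x" using RL_affine[OF 2(3)] by blast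
 show ?case
 proof (cases "L = []")
  case True
  then show ?thesis using gs 2(2) by auto
 next
  case False
  have "\<forall>g\<in>set (map (%f x. relu (f x)) gs). RL g" using gs(2) by (auto intro: RL_relu)
  from 2(1)[OF False _ this] False 2(2)
  obtain hs where "length hs = e" "\<forall>g\<in>set hs. RL g" "!!x. realize L (ev (map (%f x. relu (f x)) gs) x) = ev hs x" by auto
  moreover have "realize ((A, b) # L) (ev fs x) = realize L (ev (map (%f x. relu (f x)) gs) x)" for x
   using False gs(3) by (cases L) (auto simp: ev_def comp_def)
  ultimately show ?thesis by auto
 qed
qed simp

lemma NN_RL: assumes "NN L s fs" "f \<in> set fs" shows "RL f"
proof -
 obtain PH where p: "nn_wf 3 PH (length fs)" "!!x::real^3. realize PH [x$1, x$2, x$3] = ev fs x" using assms(1) unfolding NN_def by blast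
 have "\<forall>f\<in>set [%x::real^3. x$1, %x. x$2, %x. x$3]. RL f" by (auto intro: RL_coord)
 from RL_realize[OF p(1) this] obtain gs where "length gs = length fs" "\<forall>g\<in>set gs. RL g" "!!x::real^3. realize PH [x$1, x$2, x$3] = ev gs x" by (auto simp: ev_def)
 moreover from this have "gs = fs" unfolding p(2) by (intro nth_equalityI) (auto simp: ev_def list_eq_iff_nth_eq)
 ultimately show ?thesis using assms(2) by simp
qed

lemma RL_continuous: "RL f ==> continuous_on S f"
proof -
 assume "RL f"
 then obtain L where L: "L >= 0" "!!x y. \<bar>f x - f y\<bar> <= L*norm (x - y)" unfolding RL_def by blast
 have "L-lipschitz_on S f" using L by (intro lipschitz_onI) (auto simp: dist_norm)
 then show ?thesis by (rule lipschitz_on_continuous_on)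
qed

section \<open>Weak gradients: existence for networks, uniqueness, and H1 norms\<close>

lemma set_test_integral:
 assumes "test_fun U pt"
 shows "set_lebesgue_integral lborel U (%x. v x*pt x) = (LBINT x. v x*pt x)"
 unfolding set_lebesgue_integral_def
 by (intro Bochner_Integration.integral_cong refl) (use laplacian_zero_outside(2)[OF assms] in \<open>auto simp: indicator_def\<close>)

lemma loc_integrable_bounded:
 assumes "f \<in> borel_measurable borel" "!!K. compact K ==> K \<subseteq> U ==> \<exists>C. \<forall>x\<in>K. \<bar>f x\<bar> <= C"
 shows "loc_integrable U f"
 unfolding loc_integrable_def set_integrable_def
proof (intro allI impI)
 fix K :: "(real^3) set" assume K: "compact K & K \<subseteq> U"
 then obtain C where "\<forall>x\<in>K. \<bar>f x\<bar> <= C" using assms(2) by blast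
 then show "integrable lborel (%x. indicator K x *\<^sub>R f x)"
  using K assms(1) emeasure_compact_finite[of K] by (intro integrableI_bounded_set_indicator[where B=C]) (auto intro: borel_compact)
qed

text \<open>The product with a test function is Lipschitz with compact support and obeys the
  one-sided product rule, so \<open>integral_rd_zero\<close> becomes integration by parts. The same
  vector of right derivatives works for every U.\<close>

lemma RL_weak_grad:
 assumes f: "RL f"
 shows "\<exists>g. g \<in> borel_measurable borel & (\<forall>x j. has_rd f j x (g x $ j)) & (\<forall>U. weak_grad_on U f g)"
proof -
 obtain L where L: "L >= 0" "!!x y. \<bar>f x - f y\<bar> <= L*norm (x - y)" using f unfolding RL_def by blast
 have "\<forall>x. \<exists>v. \<forall>j. has_rd f j x (v $ j)"
 proof
  fix x
  have "\<forall>j. \<exists>D. has_rd f j x D" using f unfolding RL_def by blast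
  then obtain D where "!!j. has_rd f j x (D j)" by metis
  then show "\<exists>v. \<forall>j. has_rd f j x (v $ j)" by (intro exI[of _ "\<chi> j. D j"]) simp
 qed
 then obtain g where g: "!!x j. has_rd f j x (g x $ j)" by metis
 have fm: "f \<in> borel_measurable borel" using RL_continuous[OF f] by (intro borel_measurable_continuous_onI)
 have gm: "(%x. g x $ j) \<in> borel_measurable borel" for j
 proof (rule borel_measurable_LIMSEQ_real[OF has_rd_seq[OF g]])
  show "(%x. (f (x + (1/(real i + 1)) *\<^sub>R ax j) - f x)/(1/(real i + 1))) \<in> borel_measurable borel" for i
   using fm by measurable
 qed
 have gL: "\<bar>g x $ j\<bar> <= L" for x j
 proof (rule has_rd_bound[OF g zero_less_one])
  show "\<bar>f (sh x t j) - f x\<bar> <= L*t" if "0 < t" for t using L(2)[of "sh x t j" x] that by simp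
 qed
 have "g \<in> borel_measurable borel"
  using gm by (subst borel_measurable_euclidean_space) (auto simp: Basis_vec_def inner_axis)
 moreover have "weak_grad_on U f g" for U unfolding weak_grad_on_def
 proof (intro conjI allI impI)
  show "loc_integrable U f"
  proof (rule loc_integrable_bounded[OF fm])
   fix K :: "(real^3) set" assume "compact K"
   then have "bounded (f ` K)" by (intro compact_imp_bounded compact_continuous_image RL_continuous[OF f])
   then show "\<exists>C. \<forall>x\<in>K. \<bar>f x\<bar> <= C" by (auto simp: bounded_iff)
  qed
  show "loc_integrable U (%x. g x $ j)" for j by (rule loc_integrable_bounded[OF gm]) (use gL in blast)
  fix j pt assume t: "test_fun U pt"
  have t': "test_fun UNIV pt" by (rule test_fun_mono[OF t]) simp
  obtain rh where rh: "!!x. norm x > rh ==> pt x = 0" using test_fun_support[OF t] by blast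
  obtain rh' where rh': "!!x. norm x > rh' ==> pd j pt x = 0" using test_fun_support[OF test_fun_pd[OF t]] by blast
  obtain P where P: "P >= 0" "!!x. \<bar>pt x\<bar> <= P" using compact_support_bounded[OF test_fun_continuous[OF t] rh] by blast
  obtain P' where P': "P' >= 0" "!!x. \<bar>pd j pt x\<bar> <= P'" using compact_support_bounded[OF test_fun_continuous[OF test_fun_pd[OF t]] rh'] by blast
  have pd: "has_pd pt j x (pd j pt x)" for x using t smooth3_has_pd(1)[of pt "[]" j x] by (auto simp: test_fun_def)
  have ptL: "\<bar>pt (sh x s j) - pt x\<bar> <= P' * s" if "s > 0" for x s
   using has_pd_lipschitz[of s pt j x "pd j pt" P'] pd P'(2) that by auto
  define Fb where "Fb = \<bar>f 0\<bar> + L*(\<bar>rh\<bar> + 1)"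
  have Fb: "\<bar>f x\<bar> <= Fb" if "norm x <= \<bar>rh\<bar> + 1" for x
   using L(2)[of x 0] mult_left_mono[OF that L(1)] unfolding Fb_def by simp
  have Fb0: "Fb >= 0" unfolding Fb_def using L(1) by simp
  have rd: "has_rd (%x. f x*pt x) j x (g x $ j*pt x + pd j pt x*f x)" for x
   by (rule has_rd_mult[OF g has_pd_imp_rd[OF pd]])
  have z: "f x*pt x = 0" if "norm x > \<bar>rh\<bar>" for x using rh[of x] that by simp
  have lip: "\<bar>f (sh x s j)*pt (sh x s j) - f x*pt x\<bar> <= (L*P + Fb*P') * s" if s: "0 < s" "s <= 1" for x s
  proof (cases "norm x <= \<bar>rh\<bar> + 1")
   case True
   let ?y = "sh x s j"
   have "f ?y*pt ?y - f x*pt x = (f ?y - f x)*pt ?y + f x*(pt ?y - pt x)" by (simp add: algebra_simps)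
   moreover have "\<bar>f ?y - f x\<bar> <= L * s" using L(2)[of ?y x] s by simp
   ultimately have "\<bar>f ?y*pt ?y - f x*pt x\<bar> <= (L * s)*P + Fb*(P' * s)" using abs_prod_le[OF _ P(2) Fb[OF True] ptL[OF s(1)]] by metis
   then show ?thesis by (simp add: algebra_simps)
  next
   case False
   have "norm x <= norm (sh x s j) + norm (s *\<^sub>R ax j)" using norm_triangle_ineq4[of "sh x s j" "s *\<^sub>R ax j"] by simp
   then have n: "norm (sh x s j) > \<bar>rh\<bar>" "norm x > \<bar>rh\<bar>" using False s by simp_all
   show ?thesis unfolding n[THEN z] using L(1) P(1) Fb0 P'(1) s by simp
  qed
  have bd: "\<bar>f x*pt x\<bar> <= Fb*P" for x
  proof (cases "norm x > \<bar>rh\<bar>")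
   case True
   show ?thesis unfolding z[OF True] using Fb0 P(1) by simp
  next
   case False
   then show ?thesis unfolding abs_mult using Fb[of x] P Fb0 by (intro mult_mono) auto
  qed
  have m: "(%x. f x*pt x) \<in> borel_measurable borel" using fm test_fun_measurable(1)[OF t] by measurable
  note I = integral_rd_zero[OF m z lip bd rd]
  have i2: "integrable lborel (%x. f x*pd j pt x)"
   by (rule test_mult_integrable[OF open_UNIV RL_continuous[OF f] test_fun_pd[OF t']])
  have i1: "integrable lborel (%x. g x $ j*pt x)"
   using Bochner_Integration.integrable_diff[OF I(1) i2] by (simp add: mult.commute)
  have "(LBINT x. g x $ j*pt x + f x*pd j pt x) = 0" using I(2) by (simp add: mult.commute)
  then have "(LBINT x. f x*pd j pt x) = - (LBINT x. g x $ j*pt x)"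
   unfolding Bochner_Integration.integral_add[OF i1 i2] by linarith
  then show "set_lebesgue_integral lborel U (%x. f x*pd j pt x) = - set_lebesgue_integral lborel U (%x. g x $ j*pt x)"
   by (simp add: set_test_integral[OF t] set_test_integral[OF test_fun_pd[OF t]])
 qed
 ultimately show ?thesis using g by blast
qed

lemma loc_integrable_diff: "loc_integrable U f ==> loc_integrable U g ==> loc_integrable U (%x. f x - g x)"
 unfolding loc_integrable_def by (auto intro: set_integral_diff)

lemma loc_integrable_subset: "loc_integrable U f ==> V \<subseteq> U ==> loc_integrable V f"
 unfolding loc_integrable_def by blast

lemma weak_grad_test:
 assumes "weak_grad_on U u g" "test_fun U pt"
 shows "(LBINT x. u x*pd j pt x) = - (LBINT x. g x $ j*pt x)"
  "integrable lborel (%x. u x*pd j pt x)" "integrable lborel (%x. g x $ j*pt x)"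
proof -
 show "(LBINT x. u x*pd j pt x) = - (LBINT x. g x $ j*pt x)"
  using assms(1)[unfolded weak_grad_on_def, THEN conjunct2, THEN conjunct2, rule_format, OF assms(2), of j]
  by (simp only: set_test_integral[OF assms(2)] set_test_integral[OF test_fun_pd[OF assms(2)]])
 show "integrable lborel (%x. u x*pd j pt x)" "integrable lborel (%x. g x $ j*pt x)"
  using assms test_mult_loc_integrable test_fun_pd unfolding weak_grad_on_def by blast+
qed

lemma weak_grad_subset: "weak_grad_on U u g ==> V \<subseteq> U ==> weak_grad_on V u g"
 using weak_grad_test(1) test_fun_mono loc_integrable_subset unfolding weak_grad_on_def
 by (simp add: set_test_integral set_test_integral[OF test_fun_pd]) blast

lemma weak_grad_diff:
 assumes u: "weak_grad_on U u g" and v: "weak_grad_on U v h"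
 shows "weak_grad_on U (%x. u x - v x) (%x. g x - h x)"
 unfolding weak_grad_on_def
proof (intro conjI allI impI)
 show "loc_integrable U (%x. u x - v x)" "loc_integrable U (%x. (g x - h x) $ j)" for j
  using u v by (auto simp: weak_grad_on_def intro: loc_integrable_diff)
 fix j pt assume t: "test_fun U pt"
 note a = weak_grad_test[OF u t, of j] and b = weak_grad_test[OF v t, of j]
 have "(LBINT x. (u x - v x)*pd j pt x) = - (LBINT x. (g x - h x) $ j*pt x)"
  using a(1) b(1) Bochner_Integration.integral_diff[OF a(2) b(2)] Bochner_Integration.integral_diff[OF a(3) b(3)] by (simp add: left_diff_distrib)
 then show "set_lebesgue_integral lborel U (%x. (u x - v x)*pd j pt x) = - set_lebesgue_integral lborel U (%x. (g x - h x) $ j*pt x)"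
  by (simp add: set_test_integral[OF t] set_test_integral[OF test_fun_pd[OF t]])
qed

text \<open>\<open>H1_norm\<close> refers to a gradient picked by \<open>SOME\<close>;
  almost-everywhere uniqueness lets any weak gradient compute the norm. Allowing u and u' to differ
  on a null set covers the passage from an orbital to its smooth representative.\<close>

lemma weak_grad_unique:
 assumes "open U" and g: "weak_grad_on U u g" and h: "weak_grad_on U u' h" and ae: "AE x in lborel. u x = u' x"
 shows "AE x in lborel. x \<in> U --> g x = h x"
proof -
 have "AE x in lborel. x \<in> U --> g x $ j - h x $ j = 0" for j
 proof (rule fundamental_lemma[OF assms(1)])
  show "loc_integrable U (%x. g x $ j - h x $ j)" using g h by (auto simp: weak_grad_on_def intro: loc_integrable_diff)
  fix pt assume t: "test_fun U pt"
  note a = weak_grad_test[OF g t, of j] and b = weak_grad_test[OF h t, of j]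
  have "(LBINT x. u x*pd j pt x) = (LBINT x. u' x*pd j pt x)"
   by (rule integral_cong_AE) (use a(2) b(2) ae in auto)
  then show "(LBINT x. (g x $ j - h x $ j)*pt x) = 0"
   using a(1) b(1) Bochner_Integration.integral_diff[OF a(3) b(3)] by (simp add: left_diff_distrib)
 qed
 then have "AE x in lborel. \<forall>j\<in>UNIV. x \<in> U --> g x $ j - h x $ j = 0" by (intro AE_finite_allI) auto
 then show ?thesis by eventually_elim (auto simp: vec_eq_iff)
qed

lemma norm_sq_le3: "(!!j. \<bar>v $ j\<bar> <= P) ==> (norm v)^2 <= 3*P^2" for v :: "real^3"
 unfolding norm_sq3 using power_mono[of "\<bar>v$1\<bar>" P 2] power_mono[of "\<bar>v$2\<bar>" P 2] power_mono[of "\<bar>v$3\<bar>" P 2] by simp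

text \<open>ph has a weak gradient on the whole space because it is in H1, and on O' it equals the
  classical gradient of v. Since O' has full measure, pointwise bounds there control the norm, and
  the nuclei do not matter. The constant 2 is the square root of 1 + 3, with 3 from
  \<open>norm_sq_le3\<close>.\<close>

lemma H1_estimate:
 assumes ph: "H1_on UNIV ph" and ae: "AE x in lborel. ph x = v x"
  and O: "open O'" "AE x in lborel. x \<in> O'"
  and v: "continuous_on O' v" "!!j. continuous_on O' (v' j)" "!!j x. x \<in> O' ==> has_pd v j x (v' j x)"
  and f: "RL f" and U: "open U"
  and P: "!!x. x \<in> U ==> x \<in> O' ==> \<bar>v x - f x\<bar> <= P x"
   "!!x j D. x \<in> U ==> x \<in> O' ==> has_rd f j x D ==> \<bar>v' j x - D\<bar> <= P x"
  and Q: "integrable lborel Q" "(LBINT x. Q x) <= I" "!!x. x \<in> U ==> (P x)^2 <= Q x" "!!x. 0 <= Q x"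
 shows "H1_on U (%x. ph x - f x)" "H1_norm U (%x. ph x - f x) <= 2 * sqrt I"
proof -
 have [measurable]: "ph \<in> borel_measurable borel" "U \<in> sets borel" using ph U by (auto simp: H1_on_def)
 have [measurable]: "f \<in> borel_measurable borel" using RL_continuous[OF f] by (intro borel_measurable_continuous_onI)
 obtain g where gm [measurable]: "g \<in> borel_measurable borel" and g: "weak_grad_on UNIV ph g" using ph by (auto simp: H1_on_def)
 obtain h where hm [measurable]: "h \<in> borel_measurable borel" and h: "!!x j. has_rd f j x (h x $ j)" "!!U. weak_grad_on U f h"
  using RL_weak_grad[OF f] by blast
 have "weak_grad_on O' v (%x. \<chi> j. v' j x)" unfolding weak_grad_on_def
 proof (intro conjI allI impI)
  have co: "loc_integrable O' w" if "continuous_on O' w" for w :: "real^3 => real"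
   unfolding loc_integrable_def set_integrable_def using that borel_integrable_compact continuous_on_subset by blast
  show "loc_integrable O' v" "loc_integrable O' (%x. (\<chi> j. v' j x) $ j)" for j using co v by auto
  fix j pt assume t: "test_fun O' pt"
  show "set_lebesgue_integral lborel O' (%x. v x*pd j pt x) = - set_lebesgue_integral lborel O' (%x. (\<chi> j. v' j x) $ j*pt x)"
   using ibp[OF O(1) v(1,2,3) t, of j] by (simp add: set_test_integral[OF t] set_test_integral[OF test_fun_pd[OF t]])
 qed
 from weak_grad_unique[OF O(1) weak_grad_subset[OF g subset_UNIV] this ae]
 have gv: "AE x in lborel. \<forall>j. g x $ j = v' j x" using O(2) by eventually_elim auto
 define G where "G = (%x. g x - h x)"
 have Gm [measurable]: "G \<in> borel_measurable borel" unfolding G_def by measurable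
 have G: "weak_grad_on U (%x. ph x - f x) G" unfolding G_def by (rule weak_grad_diff[OF weak_grad_subset[OF g subset_UNIV] h(2)])
 have b1: "AE x in lborel. indicator U x*(ph x - f x)^2 <= Q x"
  using ae O(2)
 proof eventually_elim
  case (elim x)
  have "(v x - f x)^2 <= (P x)^2" if "x \<in> U" using power_mono[OF P(1)[OF that elim(2)], of 2] by simp
  then show ?case using Q(3)[of x] Q(4)[of x] elim(1) by (cases "x \<in> U") auto
 qed
 have b2: "AE x in lborel. indicator U x*(norm (G x))^2 <= 3*Q x"
  using gv O(2)
 proof eventually_elim
  case (elim x)
  have "(norm (G x))^2 <= 3*(P x)^2" if "x \<in> U" by (rule norm_sq_le3) (use P(2)[OF that elim(2) h(1)] elim(1) in \<open>simp add: G_def\<close>)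
  then show ?case using Q(3)[of x] Q(4)[of x] by (cases "x \<in> U") auto
 qed
 have i1: "integrable lborel (%x. indicator U x*(ph x - f x)^2)"
  by (rule Bochner_Integration.integrable_bound[OF Q(1)]) (use b1 in \<open>auto elim!: eventually_mono simp: abs_mult\<close>)
 have i2: "integrable lborel (%x. indicator U x*(norm (G x))^2)"
  by (rule Bochner_Integration.integrable_bound[OF integrable_mult_right[OF Q(1), of 3]]) (use b2 in \<open>auto elim!: eventually_mono simp: abs_mult\<close>)
 let ?S = "%g. g \<in> borel_measurable lborel & weak_grad_on U (%x. ph x - f x) g & set_integrable lborel U (%x. (norm (g x))^2)"
 have GS: "?S G" using G i2 by (simp add: set_integrable_def)
 then show "H1_on U (%x. ph x - f x)" unfolding H1_on_def
  by (intro conjI exI[of _ G]) (use i1 in \<open>simp_all add: set_integrable_def\<close>)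
 define k where "k = (SOME g. ?S g)"
 have k: "?S k" unfolding k_def by (rule someI[of ?S, OF GS])
 have "AE x in lborel. x \<in> U --> k x = G x" by (rule weak_grad_unique[OF U _ G]) (use k in auto)
 then have b3: "AE x in lborel. indicator U x*(norm (k x))^2 <= 3*Q x" using b2
  by eventually_elim (auto simp: indicator_def split: if_splits)
 have "(LBINT x. indicator U x*(ph x - f x)^2) <= (LBINT x. Q x)" by (rule integral_mono_AE[OF i1 Q(1) b1])
 moreover have "(LBINT x. indicator U x*(norm (k x))^2) <= (LBINT x. 3*Q x)"
  by (rule integral_mono_AE[OF _ integrable_mult_right[OF Q(1)] b3]) (use k in \<open>simp add: set_integrable_def\<close>)
 ultimately have "(LBINT x. indicator U x*(ph x - f x)^2) + (LBINT x. indicator U x*(norm (k x))^2) <= 4*I" using Q(2) by simp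
 then have "H1_norm U (%x. ph x - f x) <= sqrt (4*I)"
  unfolding H1_norm_def Let_def k_def[symmetric] by (simp add: set_lebesgue_integral_def)
 then show "H1_norm U (%x. ph x - f x) <= 2 * sqrt I" by (simp add: real_sqrt_mult)
qed

section \<open>Error in the H1 norm\<close>

lemma RL_diff: "RL f ==> RL g ==> RL (%x. f x - g x)"
 using RL_add[OF _ RL_cmult[of g "-1"], of f] by simp

lemma RL_step_taxi: "RL (%x. step (2^n*taxi c a x))"
proof -
 have "RL (%x. relu (x$i - c$i) + relu (- 1*(x$i - c$i)))" for i
  by (intro RL_add RL_relu RL_cmult RL_diff RL_coord RL_const)
 moreover have "(%x::real^3. relu (x$i - c$i) + relu (- 1*(x$i - c$i))) = (%x. \<bar>x$i - c$i\<bar>)" for i by (auto simp: relu_def max_def)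
 ultimately have ab: "RL (%x. \<bar>x$i - c$i\<bar>)" for i by simp
 show ?thesis unfolding step_def taxi_def by (intro RL_diff RL_relu RL_cmult RL_add ab RL_const)
qed

lemma kb2_eq: "norm z <= r ==> z ~= 0 ==> kb 2 r z = (1/norm z)^2"
 by (simp add: kb_def powr_minus power_divide inverse_eq_divide)

lemma cube_norm: "x \<in> cube_inf c s ==> (norm (x - c))^2 <= 3 * s^2"
 by (rule norm_sq_le3) (simp add: cube_inf_def)

text \<open>Besides E there remains (1 - step) u, which lives in the ball of radius 6*a/2^n. Its
  gradient is at most C/|x - c|: that of u by the analytic bound, and that of the step because 2^n/a
  <= 6/|x - c| on this ball. The square of 1/|x - c| integrates to at most 216 times the radius,
  whence 432 = 2*216.\<close>

lemma (in sing) H1_bound: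
 assumes ph: "H1_on UNIV ph" "AE x in lborel. ph x = u x"
  and O: "open O'" "AE x in lborel. x \<in> O'" "c \<notin> O'" "continuous_on O' u" "!!j. continuous_on O' (pd j u)" "!!j x. x \<in> O' ==> has_pd u j x (pd j u x)"
  and f: "RL f" and E: "!!x. x \<in> cube_inf c a ==> \<bar>step (2^n*taxi c a x)*u x - f x\<bar> <= E"
   "!!x t j. x \<in> cube_inf c a ==> 0 <= t ==> sh x t j \<in> cube_inf c a ==>
    \<bar>(step (2^n*taxi c a (sh x t j))*u (sh x t j) - f (sh x t j)) - (step (2^n*taxi c a x)*u x - f x)\<bar> <= E*t"
 defines "C \<equiv> B*(ka + 6 + 6*a)" and "U \<equiv> interior (cube_inf c a)"
 shows "H1_on U (%x. ph x - f x)"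
  "H1_norm U (%x. ph x - f x) <= 2 * sqrt (2*E^2*measure lborel (cball c (2*a)) + 432*C^2*(6*a/2^n))"
proof -
 let ?r = "6*a/2^n" and ?Ps = "%x. step (2^n*taxi c a x)"
 let ?P = "%x. E + (if norm (x - c) <= ?r then C*(1/norm (x - c)) else 0)"
 let ?Q = "%x. 2*E^2*indicator (cball c (2*a)) x + 2*C^2*kb 2 ?r (x - c)"
 have r: "?r > 0" "?r <= 6*a" using a by (auto simp: divide_le_eq mult_le_cancel_left1)
 have C0: "C >= 0" using B ka a by (simp add: C_def)
 have E0: "E >= 0" using E(1)[of c] a by (auto simp: cube_inf_def)
 have UC: "U \<subseteq> cube_inf c a" unfolding U_def by (rule interior_subset)
 have small: "C'*(1/norm (x - c)) <= C*(1/norm (x - c))" if "C' <= C" for C' x using that by (intro mult_right_mono) auto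
 have big: "?Ps x = 1" if "norm (x - c) > ?r" for x
 proof -
  have "6*a < 2^n*norm (x - c)" using that by (simp add: divide_less_eq mult.commute)
  also have "... <= 2^n*(6*a*taxi c a x)" unfolding taxi_l1[OF a] using norm_l1(2)[of "x - c"] by (intro mult_left_mono) auto
  finally have "6*a*1 < 6*a*(2^n*taxi c a x)" by (simp add: ac_simps)
  then show ?thesis using a by (intro step_props(5)) (simp add: mult_less_cancel_left_pos)
 qed
 have Ps01: "\<bar>1 - ?Ps x\<bar> <= 1" for x using step_props(1,2)[of "2^n*taxi c a x"] by simp
 have main: "\<bar>u x - f x\<bar> <= ?P x & (\<forall>j D. has_rd f j x D --> \<bar>pd j u x - D\<bar> <= ?P x)" if x: "x \<in> U" "x \<in> O'" for x
 proof -
  have xc: "x ~= c" "x \<in> cube_inf c a" using x O(3) UC by auto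
  have x11: "x \<in> cube_inf c (11/10*a)"
  proof -
   have "\<bar>x$j - c$j\<bar> <= 11/10*a" for j using xc(2)[unfolded cube_inf_def, simplified, rule_format, of j] a by linarith
   then show ?thesis by (simp add: cube_inf_def)
  qed
  have nx: "norm (x - c) > 0" using xc by simp
  have u0: "\<bar>u x\<bar> <= B" using bdu[OF xc(1) x11, of "[]"] by simp
  have u1: "\<bar>pd j u x\<bar> <= B*ka*(1/norm (x - c))" for j using bdu[OF xc(1) x11, of "[j]"] by simp
  have in0: "\<bar>u x\<bar> <= C*(1/norm (x - c))" if "norm (x - c) <= ?r"
  proof -
   have "B*norm (x - c) <= B*(6*a)" using that r(2) B by (intro mult_left_mono) auto
   then have "B <= B*(6*a)*(1/norm (x - c))" using nx by (simp add: field_simps)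
   also have "... <= C*(1/norm (x - c))" by (rule small) (use B ka in \<open>auto simp: C_def intro!: mult_left_mono\<close>)
   finally show ?thesis using u0 by linarith
  qed
  have "\<bar>(1 - ?Ps x)*u x\<bar> <= (if norm (x - c) <= ?r then C*(1/norm (x - c)) else 0)"
  proof (cases "norm (x - c) <= ?r")
   case True
   have "\<bar>(1 - ?Ps x)*u x\<bar> <= 1 * \<bar>u x\<bar>" unfolding abs_mult using Ps01 by (intro mult_right_mono) auto
   then show ?thesis using in0[OF True] True by simp
  next
   case False
   then show ?thesis using big[of x] by simp
  qed
  moreover have "u x - f x = (1 - ?Ps x)*u x + (?Ps x*u x - f x)" by (simp add: algebra_simps)
  ultimately have 1: "\<bar>u x - f x\<bar> <= ?P x" using E(1)[OF xc(2)] by linarith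
  have "\<bar>pd j u x - D\<bar> <= ?P x" if D: "has_rd f j x D" for j D
  proof -
   obtain e where e: "e > 0" "ball x e \<subseteq> U" using x(1) open_interior unfolding U_def by (meson openE)
   have ue: "sh x t j \<in> cube_inf c a" if "0 < t" "t < e" for t using e(2) UC that by (auto simp: subset_iff dist_norm)
   have ru: "has_rd u j x (pd j u x)" by (rule has_pd_imp_rd[OF O(6)[OF x(2)]])
   obtain d where d: "has_rd ?Ps j x d" using RL_step_taxi[of n c a] unfolding RL_def by blast
   \<comment> \<open>The Lipschitz bound \<open>E(2)\<close> turns into a bound of the right
     derivative, since x is interior and small steps stay in the cube.\<close>
   have "has_rd (%x. ?Ps x*u x - f x) j x ((d*u x + pd j u x*?Ps x) - D)" by (rule has_rd_diff[OF has_rd_mult[OF d ru] D])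
   then have 2: "\<bar>(d*u x + pd j u x*?Ps x) - D\<bar> <= E"
    by (rule has_rd_bound[OF _ e(1)]) (use E(2)[OF xc(2)] ue in auto)
   have dL: "\<bar>d\<bar> <= 2^n/a"
   proof (rule has_rd_bound[OF d zero_less_one])
    show "\<bar>?Ps (sh x t j) - ?Ps x\<bar> <= 2^n/a*t" if "0 < t" for t using step_taxi_Lip[OF a, of n c "sh x t j" x] that by simp
   qed
   have 3: "\<bar>pd j u x*(1 - ?Ps x) + (- d)*u x\<bar> <= (if norm (x - c) <= ?r then C*(1/norm (x - c)) else 0)"
   proof (cases "norm (x - c) <= ?r")
    case True
    have "2^n/a <= 6*(1/norm (x - c))" using True nx a by (simp add: field_simps)
    then have d2: "\<bar>- d\<bar> <= 6*(1/norm (x - c))" using dL by simp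
    have "\<bar>pd j u x*(1 - ?Ps x) + (- d)*u x\<bar> <= B*ka*(1/norm (x - c))*1 + 6*(1/norm (x - c))*B"
     by (rule abs_prod_le[OF u1 Ps01 d2 u0])
    also have "... = (B*ka + 6*B)*(1/norm (x - c))" by (simp add: algebra_simps add_divide_distrib)
    also have "... <= C*(1/norm (x - c))" by (rule small) (use B a in \<open>auto simp: C_def algebra_simps\<close>)
    finally show ?thesis using True by simp
   next
    case False
    have "\<bar>d\<bar> <= 0"
    proof (rule has_rd_bound[OF d])
     show "norm (x - c) - ?r > 0" using False by simp
     fix t assume t: "0 < t" "t < norm (x - c) - ?r"
     have "norm (x - c) <= norm (sh x t j - c) + norm (t *\<^sub>R ax j)" using norm_triangle_ineq4[of "sh x t j - c" "t *\<^sub>R ax j"] by (simp add: algebra_simps)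
     then have "norm (sh x t j - c) > ?r" using t by simp
     then show "\<bar>?Ps (sh x t j) - ?Ps x\<bar> <= 0*t" using big False by simp
    qed
    then show ?thesis using False big[of x] by simp
   qed
   have "pd j u x - D = (pd j u x*(1 - ?Ps x) + (- d)*u x) + ((d*u x + pd j u x*?Ps x) - D)" by (simp add: algebra_simps)
   then show ?thesis using 2 3 by linarith
  qed
  then show ?thesis using 1 by blast
 qed
 have iQ: "integrable lborel ?Q" "(LBINT x. ?Q x) <= 2*E^2*measure lborel (cball c (2*a)) + 432*C^2*?r"
 proof -
  have k: "integrable lborel (%x. kb 2 ?r (x - c))" by (rule integrable_shift3(1)[OF kb_integrable(1)]) (use r in auto)
  have k2: "(LBINT x. kb 2 ?r (x - c)) <= 216*?r" using kb2_integral[OF r(1)] integral_shift3(1)[OF kb_measurable, of 2 ?r c] by simp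
  have b: "integrable lborel (%x. indicator (cball c (2*a)) x :: real)" using integrable_cball_indicator[of 1 c "2*a"] by simp
  show "integrable lborel ?Q" by (intro Bochner_Integration.integrable_add integrable_mult_right k b)
  have "(LBINT x. ?Q x) = 2*E^2*measure lborel (cball c (2*a)) + 2*C^2*(LBINT x. kb 2 ?r (x - c))"
   by (subst Bochner_Integration.integral_add) (auto intro!: integrable_mult_right k b)
  also have "... <= 2*E^2*measure lborel (cball c (2*a)) + 2*C^2*(216*?r)" using k2 by (intro add_left_mono mult_left_mono) auto
  finally show "(LBINT x. ?Q x) <= 2*E^2*measure lborel (cball c (2*a)) + 432*C^2*?r" by simp
 qed
 have PQ: "(?P x)^2 <= ?Q x" if x: "x \<in> U" for x
 proof -
  have "(norm (x - c))^2 <= 3*a^2" using UC x by (intro cube_norm) auto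
  also have "... <= (2*a)^2" by (simp add: power_mult_distrib)
  finally have "norm (x - c) <= 2*a" by (rule power2_le_imp_le) (use a in simp)
  then have i: "indicator (cball c (2*a)) x = (1::real)" by (simp add: dist_norm norm_minus_commute)
  have sq: "(p + q)^2 <= 2*p^2 + 2*q^2" for p q :: real using sum_squares_bound[of p q] by (simp add: power2_sum)
  show ?thesis
  proof (cases "norm (x - c) <= ?r & x ~= c")
   case True
   then have "kb 2 ?r (x - c) = (1/norm (x - c))^2" by (intro kb2_eq) auto
   then show ?thesis using sq[of E "C*(1/norm (x - c))"] True i by (simp add: power_mult_distrib power_divide)
  next
   case False
   then have "?P x = E" by auto
   then show ?thesis using i by simp
  qed
 qed
 have "H1_on U (%x. ph x - f x) & H1_norm U (%x. ph x - f x) <= 2 * sqrt (2*E^2*measure lborel (cball c (2*a)) + 432*C^2*?r)"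
  using H1_estimate[OF ph O(1,2,4,5,6) f, where U=U and P="?P" and Q="?Q"] main iQ PQ by (auto simp: U_def)
 then show "H1_on U (%x. ph x - f x)" "H1_norm U (%x. ph x - f x) <= 2 * sqrt (2*E^2*measure lborel (cball c (2*a)) + 432*C^2*?r)" by auto
qed

lemma (in hf) sing_family:
 assumes k: "k < M" and a: "a > 0" "\<forall>j<M. j ~= k --> norm (R j - R k) > 2*a"
 shows "\<exists>v B ka. B > 0 & ka >= 1 & (\<forall>i<N. sing (v i) (R k) a B ka & (AE x in lborel. ph i x = v i x)
  & continuous_on Om (v i) & (\<forall>j. continuous_on Om (pd j (v i)) & (\<forall>x\<in>Om. has_pd (v i) j x (pd j (v i) x))))"
proof -
 obtain v B K where B: "B > 0" "K >= 1" and r: "\<forall>i<N. (AE x in lborel. ph i x = v i x) & (\<forall>js j. \<forall>x\<in>Om.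
   has_pd (pds js (v i)) j x (pds (j # js) (v i) x) & \<bar>pds js (v i) x\<bar> <= B*K^length js*fact (length js)*(1/dd x)^length js)
  & (\<forall>js. continuous_on Om (pds js (v i))) & (\<forall>js j k ks. \<forall>x\<in>Om. pds (js @ j # k # ks) (v i) x = pds (js @ k # j # ks) (v i) x)"
  using regularity by (elim exE conjE) (rule that)
 have v: "(AE x in lborel. ph i x = v i x)" "!!js j x. x \<in> Om ==> has_pd (pds js (v i)) j x (pds (j # js) (v i) x)"
  "!!js x. x \<in> Om ==> \<bar>pds js (v i) x\<bar> <= B*K^length js*fact (length js)*(1/dd x)^length js"
  "!!js. continuous_on Om (pds js (v i))"
  "!!js j k ks x. x \<in> Om ==> pds (js @ j # k # ks) (v i) x = pds (js @ k # j # ks) (v i) x" if "i < N" for i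
  using r[rule_format, OF that] by simp_all
 \<comment> \<open>On the enlarged cube |x - R k| <= 1.91*a, so any other nucleus has distance at
   least 0.09*a >= 1.91*a/22 from x; the summand 2*a takes care of the cap 1 in
   \<open>dd\<close>.\<close>
 let ?D = "22 + 2*a"
 have geo: "x \<in> Om & dd x >= norm (x - R k)/?D" if x: "x ~= R k" "x \<in> cube_inf (R k) (11/10*a)" for x
 proof -
  let ?n = "norm (x - R k)"
  have "?n^2 <= 3*(11/10*a)^2" by (rule cube_norm[OF x(2)])
  also have "... <= (191/100*a)^2" by (simp add: power_mult_distrib power2_eq_square)
  finally have n: "?n <= 191/100*a" by (rule power2_le_imp_le) (use a in simp)
  have far: "norm (x - R j) >= ?n/?D & x ~= R j" if j: "j < M" for j
  proof (cases "j = k")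
   case True
   have "?n/?D <= ?n/1" using a by (intro divide_left_mono) auto
   then show ?thesis using True x by simp
  next
   case False
   have "norm (R j - R k) <= norm (x - R j) + ?n" using norm_triangle_ineq[of "R j - x" "x - R k"] by (simp add: norm_minus_commute)
   then have g: "norm (x - R j) >= 9/100*a" using a(2)[rule_format, OF j False] n by linarith
   have "?n/?D <= ?n/22" using a by (intro divide_left_mono) auto
   then show ?thesis using g n a(1) by auto
  qed
  have "?n/?D <= ?n/(2*a)" using a by (intro divide_left_mono) auto
  also have "... <= 1" using n a by simp
  finally have "?n/?D <= 1" .
  then have "dd x >= ?n/?D" unfolding dd_def by (subst Min_ge_iff) (use far in auto)
  then show ?thesis using far by (auto simp: Om_def)
 qed
 have "sing (v i) (R k) a B (K*?D)" if i: "i < N" for i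
 proof
  show "a > 0" "B >= 0" using a B by auto
  show "1 <= K*?D" using B(2) a mult_mono[of 1 K 1 ?D] by simp
  fix x :: "real^3" and js :: "3 list" and ks :: "3 list" and j k' :: 3
  assume x: "x ~= R k" "x \<in> cube_inf (R k) (11/10*a)"
  note g = geo[OF x]
  show "has_pd (pds js (v i)) j x (pds (j # js) (v i) x)" "pds (js @ j # k' # ks) (v i) x = pds (js @ k' # j # ks) (v i) x" by (rule v(2)[OF i g[THEN conjunct1]], rule v(5)[OF i g[THEN conjunct1]])
  let ?p = "length js"
  have "1/dd x <= 1/(norm (x - R k)/?D)" using g x a dd_pos by (intro divide_left_mono mult_pos_pos) auto
  then have "(1/dd x)^?p <= (?D*(1/norm (x - R k)))^?p" using dd_pos[of x] g by (intro power_mono) auto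
  then have "B*K^?p*fact ?p*(1/dd x)^?p <= B*K^?p*fact ?p*(?D*(1/norm (x - R k)))^?p" using B by (intro mult_left_mono) auto
  also have "... = B*(K*?D)^?p*fact ?p*(1/norm (x - R k))^?p" unfolding power_mult_distrib by (simp only: ac_simps)
  finally show "\<bar>pds js (v i) x\<bar> <= B*(K*?D)^?p*fact ?p*(1/norm (x - R k))^?p" using v(3)[OF i, of x js] g by linarith
 qed
 moreover have "K*?D >= 1" using B(2) a mult_mono[of 1 K 1 ?D] by simp
 moreover have "continuous_on Om (v i) & (\<forall>j. continuous_on Om (pd j (v i)) & (\<forall>x\<in>Om. has_pd (v i) j x (pd j (v i) x)))" if "i < N" for i
  using v(4)[OF that, of "[]"] v(4)[OF that, of "[_]"] v(2)[OF that, of _ "[]"] by auto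
 ultimately show ?thesis using B(1) v(1) by blast
qed

section \<open>Choice of the parameters\<close>

lemma binary_length: "\<exists>k. n <= 2^k & (2::nat)^k <= 2*n" if "n >= 1" for n :: nat
proof -
 define k where "k = (LEAST k. n <= 2^k)"
 have "\<exists>k. n <= 2^k" using less_exp[of n] by (intro exI[of _ n]) simp
 then have 1: "n <= 2^k" unfolding k_def by (rule LeastI_ex)
 moreover have "2^k <= 2*n"
 proof (cases k)
  case (Suc k')
  then have "\<not> n <= 2^k'" unfolding k_def by (intro not_less_Least) simp
  then show ?thesis using Suc by simp
 qed (use that in simp)
 ultimately show ?thesis by blast
qed

text \<open>With x = 2^n, the count is O(x^4), the last factor O(x^2) and 2^(-8n) = x^(-8); x^(-2)
  remains, of which x^(-1) is kept. The constants 729 = 9^3 and 93 = 54 + 39 come from 8*n + 1 <=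
  9*x.\<close>

lemma error_small:
 fixes g n k :: nat and B H :: real
 assumes n: "n >= 1" and k: "2^k <= 2*Suc (8*n)" and B: "B >= 0" "H >= 0"
 shows "real (n*g*Suc (8*n)^3)*(B*(1/2)^(8*n))*(8 + (3*2^k + 39)*(H*2^n)) <= 729*real g*B*(8 + 93*H)*(1/2)^n"
proof -
 define x :: real where "x = 2^n"
 have "n < 2^n" by (rule less_exp)
 then have nx: "real n <= x" unfolding x_def by (metis less_imp_le of_nat_le_iff of_nat_numeral of_nat_power)
 have x1: "x >= 1" unfolding x_def by simp
 have "real (Suc (8*n)) <= 9*x" using nx x1 by simp
 then have "real (n*g*Suc (8*n)^3) <= x*real g*(9*x)^3" unfolding of_nat_mult of_nat_power using nx x1 by (intro mult_mono power_mono) auto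
 also have "... = 729*real g*x^4" by (simp add: power_mult_distrib power_numeral_reduce)
 finally have K: "real (n*g*Suc (8*n)^3) <= 729*real g*x^4" .
 have "real (2^k) <= real (2*Suc (8*n))" using k by (rule of_nat_mono)
 then have "3*2^k + 39 <= 93*x" using nx x1 by simp
 then have "(3*2^k + 39)*(H*x) <= 93*x*(H*x)" using B x1 by (intro mult_right_mono) auto
 moreover have "8 <= 8*x^2" using x1 by simp
 ultimately have F: "8 + (3*2^k + 39)*(H*x) <= (8 + 93*H)*x^2" by (simp add: algebra_simps power2_eq_square)
 have d: "(1/2::real)^(8*n) = 1/x^8" unfolding x_def by (simp add: power_one_over power_mult[symmetric] mult.commute)
 have "real (n*g*Suc (8*n)^3)*(B*(1/2)^(8*n))*(8 + (3*2^k + 39)*(H*2^n)) <= (729*real g*x^4)*(B*(1/x^8))*((8 + 93*H)*x^2)"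
  unfolding d x_def[symmetric] using K F B x1 by (intro mult_mono mult_nonneg_nonneg add_nonneg_nonneg) auto
 also have "... = 729*real g*B*(8 + 93*H)*(1/x^2)" using x1 by (simp add: field_simps power_numeral_reduce)
 also have "... <= 729*real g*B*(8 + 93*H)*(1/x)" using x1 B by (intro mult_left_mono divide_left_mono) (auto simp: power2_eq_square)
 finally show ?thesis unfolding x_def by (simp add: power_one_over)
qed

text \<open>b is the number of binary digits for exponents up to 8*n, and m the number of
  refinements of each approximate square. The rate is 2^(-n/2) because the neglected ball
  contributes 2^(-n) to the square of the norm.\<close>

lemma (in hf) networks:
 assumes k: "k < M" and a: "a > 0" "\<forall>j<M. j ~= k --> norm (R j - R k) > 2*a"
 shows "\<exists>C\<ge>1. \<forall>n\<ge>1. \<exists>PH b. nn_wf 3 PH N &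
  (\<forall>i<N. H1_on (interior (cube_inf (R k) a)) (%x. ph i x - nn_real3 PH x i) &
   H1_norm (interior (cube_inf (R k) a)) (%x. ph i x - nn_real3 PH x i) <= C * sqrt ((1/2)^n) & (\<forall>x\<in>cube_inf (R k) a. \<bar>nn_real3 PH x i\<bar> <= C)) &
  real (nn_size PH) <= C*real n^6*(1 + real N) & real (nn_depth PH) <= 1000*real n*(real b + 1) & 2^b <= 18*real n"
proof -
 obtain v B ka where B: "B > 0" "ka >= 1" and v: "!!i. i < N ==> sing (v i) (R k) a B ka & (AE x in lborel. ph i x = v i x)
  & continuous_on Om (v i) & (\<forall>j. continuous_on Om (pd j (v i)) & (\<forall>x\<in>Om. has_pd (v i) j x (pd j (v i) x)))"
  using sing_family[OF k a] by blast
 have sg: "!!i. i < N ==> sing (v i) (R k) a B ka" using v by blast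
 define g where "g = (2*gr ka + 1)^3"
 define H where "H = 40*ka/a"
 define CE where "CE = 729*real g*B*(8 + 93*H)"
 define V where "V = measure lborel (cball (R k) (2*a))"
 define C1 where "C1 = B*(ka + 6 + 6*a)"
 define CI where "CI = 2*CE^2*V + 2592*C1^2*a"
 define C where "C = 1 + 2 * sqrt CI + (B + CE) + 729*29520000*real g"
 have H0: "H >= 0" using B a by (simp add: H_def)
 have CE0: "CE >= 0" using B H0 by (simp add: CE_def)
 have CI0: "CI >= 0" using a by (simp add: CI_def V_def)
 have C: "C >= 1" "2 * sqrt CI <= C" "B + CE <= C" "729*29520000*real g <= C" using B CE0 CI0 by (simp_all add: C_def)
 let ?c = "R k" and ?U = "interior (cube_inf (R k) a)"
 show ?thesis
 proof (intro exI[of _ C] conjI allI impI C(1))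
  fix n :: nat assume n: "n >= 1"
  obtain b where b: "Suc (8*n) <= 2^b" "(2::nat)^b <= 2*Suc (8*n)" using binary_length[of "Suc (8*n)"] by auto
  \<comment> \<open>The error amplification 2*5^(b + 6) is at most 2*8^(b + 6) = 2^(3*b + 19), which
    m compensates on top of the required 8*n.\<close>
  define m where "m = 8*n + 3*b + 19"
  have m: "5^(b + 6)*(2*(1/2)^m) <= (1/2::real)^(8*n)"
  proof -
   have "(5::real)^(b + 6)*(2*(1/2)^m) <= (2^3)^(b + 6)*(2*(1/2)^m)" by (intro mult_right_mono power_mono) auto
   also have "... = 2^(3*b + 19)*(1/2)^(3*b + 19)*(1/2)^(8*n)" unfolding m_def power_mult[symmetric] by (simp add: power_add algebra_simps)
   also have "... = (1/2)^(8*n)" unfolding power_mult_distrib[symmetric] by simp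
   finally show ?thesis .
  qed
  define K where "K = n*g*Suc (8*n)^3"
  define E where "E = real K*(B*(1/2)^(8*n))*(8 + (3*2^b + 39)*(H*2^n))"
  have E0: "E >= 0" unfolding E_def using B H0 by simp
  have E1: "E <= CE*(1/2)^n" unfolding E_def K_def CE_def using B H0 by (intro error_small n b(2)) auto
  have E2: "E <= CE" using E1 CE0 mult_left_mono[OF power_le_one[of "1/2::real" n] CE0] by simp
  obtain fs where nn: "NN (4 + 12*Suc b*Suc m) (K*((3 + 12*Suc b*Suc m)*1640) + (N*(2*K) + N)) fs" and len: "length fs = N"
   and fs: "!!i x. i < N ==> x \<in> cube_inf ?c a ==> \<bar>step (2^n*taxi ?c a x) * v i x - (fs ! i) x\<bar> <= E &
   (\<forall>t j. 0 <= t --> sh x t j \<in> cube_inf ?c a -->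
    \<bar>(step (2^n*taxi ?c a (sh x t j)) * v i (sh x t j) - (fs ! i) (sh x t j)) - (step (2^n*taxi ?c a x) * v i x - (fs ! i) x)\<bar> <= E*t)"
   using net_approx[where N=N and u=v, OF sg a(1) B(2) n b(1) m] unfolding E_def K_def H_def g_def by blast
  obtain PH where PH: "nn_wf 3 PH N" "length PH = 4 + 12*Suc b*Suc m" "nn_size PH <= K*((3 + 12*Suc b*Suc m)*1640) + (N*(2*K) + N)"
   "!!x. realize PH [x$1, x$2, x$3] = ev fs x" using nn len unfolding NN_def by blast
  have re: "nn_real3 PH x i = (fs ! i) x" if "i < N" for x i using that len by (simp add: nn_real3_def PH(4) ev_def)
  have "H1_on ?U (%x. ph i x - nn_real3 PH x i) & H1_norm ?U (%x. ph i x - nn_real3 PH x i) <= C * sqrt ((1/2)^n) & (\<forall>x\<in>cube_inf ?c a. \<bar>nn_real3 PH x i\<bar> <= C)"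
   if i: "i < N" for i
  proof (intro conjI ballI)
   interpret S: sing "v i" ?c a B ka using v[OF i] by blast
   have RLf: "RL (fs ! i)" using i len by (intro NN_RL[OF nn]) auto
   have cO: "?c \<notin> Om" using k by (auto simp: Om_def)
   note vi = v[OF i]
   have Hb: "H1_on ?U (%x. ph i x - (fs ! i) x)" "H1_norm ?U (%x. ph i x - (fs ! i) x) <= 2 * sqrt (2*E^2*V + 432*C1^2*(6*a/2^n))"
    unfolding V_def C1_def
    by (rule S.H1_bound[OF H1[OF i] _ Om_open Om_AE cO _ _ _ RLf, where n=n and E=E]; use vi fs[OF i] in blast)+
   show "H1_on ?U (%x. ph i x - nn_real3 PH x i)" using Hb(1) by (simp add: re[OF i])
   have "E^2 <= (CE*(1/2)^n)^2" using E0 E1 by (intro power_mono) auto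
   also have "... = CE^2*((1/2)^n*(1/2)^n)" by (simp add: power2_eq_square)
   also have "... <= CE^2*((1/2)^n*1)" by (intro mult_left_mono power_le_one) auto
   finally have "2*E^2*V <= 2*(CE^2*((1/2)^n*1))*V" by (intro mult_right_mono mult_left_mono) (auto simp: V_def)
   then have "2*E^2*V + 432*C1^2*(6*a/2^n) <= CI*(1/2)^n" unfolding CI_def by (simp add: power_one_over algebra_simps)
   then have "sqrt (2*E^2*V + 432*C1^2*(6*a/2^n)) <= sqrt CI * sqrt ((1/2)^n)" unfolding real_sqrt_mult[symmetric] by (rule real_sqrt_le_mono)
   then have "2 * sqrt (2*E^2*V + 432*C1^2*(6*a/2^n)) <= (2 * sqrt CI) * sqrt ((1/2)^n)" by simp
   also have "... <= C * sqrt ((1/2)^n)" using C(2) by (intro mult_right_mono) auto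
   finally show "H1_norm ?U (%x. ph i x - nn_real3 PH x i) <= C * sqrt ((1/2)^n)" using Hb(2) by (simp add: re[OF i])
   fix x assume x: "x \<in> cube_inf ?c a"
   have "\<bar>step (2^n*taxi ?c a x) * v i x\<bar> <= B"
   proof (cases "x = ?c")
    \<comment> \<open>At the nucleus itself v is not controlled, but the step is 0 there.\<close>
    case True
    then show ?thesis using B step_props(4)[of 0] by (simp add: taxi_def)
   next
    case False
    have "\<bar>x$j - ?c$j\<bar> <= 11/10*a" for j using x[unfolded cube_inf_def, simplified, rule_format, of j] a(1) by linarith
    then have "\<bar>v i x\<bar> <= B" using S.bdu[OF False, of "[]"] by (simp add: cube_inf_def)
    moreover have "\<bar>step (2^n*taxi ?c a x)\<bar> <= 1" using step_props(1,2) by simp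
    ultimately show ?thesis unfolding abs_mult using mult_mono[of _ 1 "\<bar>v i x\<bar>" B] by auto
   qed
   then show "\<bar>nn_real3 PH x i\<bar> <= C" using fs[OF i x] E2 C(3) unfolding re[OF i] by linarith
  qed
  moreover have b18: "2^b <= 18*n" by (rule order_trans[OF b(2)]) (use n in simp)
  have bn: "Suc b <= 18*n" by (rule order_trans[OF Suc_leI[OF less_exp] b18])
  have sm: "Suc m <= 82*n" unfolding m_def using bn n by linarith
  have L: "4 + 12*Suc b*Suc m <= 1000*n*Suc b"
  proof -
   have ar: "4 + 12*p <= 1000*q" if "p <= 82*q" "1 <= q" for p q :: nat using that by linarith
   have "Suc b*Suc m <= Suc b*(82*n)" using sm by (rule mult_le_mono2)
   also have "... = 82*(n*Suc b)" by (simp only: ac_simps)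
   finally show ?thesis using ar[of "Suc b*Suc m" "n*Suc b"] mult_le_mono[OF n, of 1 "Suc b"] by (simp only: mult.assoc mult_1)
  qed
  have "real (nn_depth PH) <= real (1000*n*Suc b)" unfolding nn_depth_def PH(2) using L by (rule of_nat_mono)
  then have "real (nn_depth PH) <= 1000*real n*(real b + 1)" by (simp add: algebra_simps)
  moreover have "real (nn_size PH) <= C*real n^6*(1 + real N)"
  proof -
   \<comment> \<open>In the size the logarithmic factor b is bounded crudely by a multiple of n;
     with K = O(n^4) this leads to n^6. The constant 29520000 is 18000*1640.\<close>
   have "3 + 12*Suc b*Suc m <= 1000*n*(18*n)" using L mult_le_mono2[OF bn, of "1000*n"] by linarith
   then have 1: "(3 + 12*Suc b*Suc m)*1640 <= 29520000*n^2" by (simp add: power2_eq_square)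
   have "Suc (8*n) <= 9*n" using n by simp
   then have "K <= n*g*(9*n)^3" unfolding K_def by (intro mult_le_mono2 power_mono) auto
   also have "... = 729*g*n^4" by (simp add: power_mult_distrib power_numeral_reduce)
   finally have K: "K <= 729*g*n^4" .
   have n4: "n^4 <= n^6" using n by (intro power_increasing) auto
   have "K*((3 + 12*Suc b*Suc m)*1640) <= (729*g*n^4)*(29520000*n^2)" using K 1 by (rule mult_le_mono)
   also have "... = 729*29520000*g*n^6" by (simp add: power_numeral_reduce)
   finally have s1: "K*((3 + 12*Suc b*Suc m)*1640) <= 729*29520000*g*n^6" .
   have g1: "g >= 1" unfolding g_def by simp
   define T where "T = 729*29520000*g*n^6"
   have "1*1 <= g*n^6" using g1 n by (intro mult_le_mono) auto
   moreover have "K <= 729*(g*n^6)" using order_trans[OF K mult_le_mono2[OF n4]] by (simp only: mult.assoc)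
   moreover have "2*K + 1 <= 729*29520000*q" if "1*1 <= q" "K <= 729*q" for q using that by linarith
   ultimately have "2*K + 1 <= T" unfolding T_def mult.assoc by blast
   then have "N*(2*K + 1) <= N*T" by (rule mult_le_mono2)
   then have "nn_size PH <= T + N*T" using PH(3) s1 unfolding T_def[symmetric] by simp
   then have "nn_size PH <= 729*29520000*g*n^6*(1 + N)" unfolding T_def[symmetric] by (simp add: mult.commute)
   then have "real (nn_size PH) <= real (729*29520000*g*n^6*(1 + N))" by (rule of_nat_mono)
   also have "... = 729*29520000*real g*real n^6*(1 + real N)" by (simp add: distrib_left)
   also have "... <= C*real n^6*(1 + real N)" using C(4) by (intro mult_right_mono) auto
   finally show ?thesis .
  qed
  moreover have "2^b <= 18*real n" using of_nat_mono[OF b18, where 'a=real] by simp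
  ultimately show "\<exists>PH b. nn_wf 3 PH N &
  (\<forall>i<N. H1_on ?U (%x. ph i x - nn_real3 PH x i) &
   H1_norm ?U (%x. ph i x - nn_real3 PH x i) <= C * sqrt ((1/2)^n) & (\<forall>x\<in>cube_inf ?c a. \<bar>nn_real3 PH x i\<bar> <= C)) &
  real (nn_size PH) <= C*real n^6*(1 + real N) & real (nn_depth PH) <= 1000*real n*(real b + 1) & 2^b <= 18*real n"
   using PH(1) by (intro exI[of _ PH] exI[of _ b]) blast
 qed
qed

section \<open>Passage from the parameter n to the accuracy\<close>

theorem theorem5p3:
  fixes M N k :: nat and Z :: "nat \<Rightarrow> real" and R :: "nat \<Rightarrow> real^3"
    and \<phi> :: "nat \<Rightarrow> real^3 \<Rightarrow> real" and lam :: "nat \<Rightarrow> real" and a :: real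
  assumes Zpos: "\<forall>i<M. Z i > 0"
    and Rdist: "\<forall>i<M. \<forall>j<M. i \<noteq> j \<longrightarrow> R i \<noteq> R j"
    and HF: "HF_solution M Z R N \<phi> lam"
    and k: "k < M"
    and a: "a > 0" "\<forall>j<M. j \<noteq> k \<longrightarrow> norm (R j - R k) > 2 * a"
  shows "\<exists>\<Phi> :: real \<Rightarrow> nnet.
     (\<forall>\<epsilon>. 0 < \<epsilon> \<and> \<epsilon> < 1 \<longrightarrow>
        nn_wf 3 (\<Phi> \<epsilon>) N \<and>
        (\<forall>i<N. H1_on (interior (cube_inf (R k) a)) (\<lambda>x. \<phi> i x - nn_real3 (\<Phi> \<epsilon>) x i) \<and>
               H1_norm (interior (cube_inf (R k) a)) (\<lambda>x. \<phi> i x - nn_real3 (\<Phi> \<epsilon>) x i) \<le> \<epsilon>)) \<and>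
     (\<forall>i<N. (\<lambda>\<epsilon>. SUP x\<in>cube_inf (R k) a. \<bar>nn_real3 (\<Phi> \<epsilon>) x i\<bar>)
               \<in> O[at_right 0](\<lambda>\<epsilon>. \<bar>ln \<epsilon>\<bar> ^ 6)) \<and>
     (\<lambda>\<epsilon>. real (nn_size (\<Phi> \<epsilon>))) \<in> O[at_right 0](\<lambda>\<epsilon>. \<bar>ln \<epsilon>\<bar> ^ 7 + real N * \<bar>ln \<epsilon>\<bar> ^ 6) \<and>
     (\<lambda>\<epsilon>. real (nn_depth (\<Phi> \<epsilon>))) \<in> O[at_right 0](\<lambda>\<epsilon>. \<bar>ln \<epsilon>\<bar> * ln \<bar>ln \<epsilon>\<bar>)"
proof -
 interpret hf M N Z R \<phi> lam by standard (rule HF)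
 let ?U = "interior (cube_inf (R k) a)" and ?S = "cube_inf (R k) a"
 let ?P = "%C n \<Phi> b. nn_wf 3 \<Phi> N & (\<forall>i<N. H1_on ?U (%x. \<phi> i x - nn_real3 \<Phi> x i) &
   H1_norm ?U (%x. \<phi> i x - nn_real3 \<Phi> x i) <= C * sqrt ((1/2)^n) & (\<forall>x\<in>?S. \<bar>nn_real3 \<Phi> x i\<bar> <= C)) &
  real (nn_size \<Phi>) <= C*real n^6*(1 + real N) & real (nn_depth \<Phi>) <= 1000*real n*(real b + 1) & 2^b <= 18*real n"
 obtain C where C: "C >= 1" and ex: "\<forall>n\<ge>1. \<exists>\<Phi> b. ?P C n \<Phi> b" using networks[OF k a] by (elim exE conjE) (rule that)
 have "\<forall>n. \<exists>\<Phi>b. n >= 1 --> ?P C n (fst \<Phi>b) (snd \<Phi>b)" using ex by simp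
 from choice[OF this] obtain F where F0: "\<forall>n. n >= 1 --> ?P C n (fst (F n)) (snd (F n))" ..
 note F = F0[rule_format]
 \<comment> \<open>The condition C*2^(-n/2) <= eps means n >= log 2 (C^2/eps^2); the added 1 ensures
   n >= 1.\<close>
 define nn where "nn \<epsilon> = nat \<lceil>log 2 (C^2 / \<epsilon>^2)\<rceil> + 1" for \<epsilon> :: real
 define \<Phi> where "\<Phi> \<epsilon> = fst (F (nn \<epsilon>))" for \<epsilon>
 have n1: "nn \<epsilon> >= 1" for \<epsilon> by (simp add: nn_def)
 note P = F[OF n1, folded \<Phi>_def]
 have err: "C * sqrt ((1/2)^nn \<epsilon>) <= \<epsilon>" if e: "0 < \<epsilon>" "\<epsilon> < 1" for \<epsilon>
 proof -
  have pos: "C^2 / \<epsilon>^2 > 0" using C e by simp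
  have "log 2 (C^2 / \<epsilon>^2) <= real (nn \<epsilon>)" unfolding nn_def by linarith
  then have "C^2 / \<epsilon>^2 <= 2^nn \<epsilon>" using pos by (simp add: log_le_iff powr_realpow)
  then have "C^2*(1/2)^nn \<epsilon> <= \<epsilon>^2" using e by (simp add: power_one_over field_simps)
  then have "sqrt (C^2*(1/2)^nn \<epsilon>) <= sqrt (\<epsilon>^2)" by (rule real_sqrt_le_mono)
  then show ?thesis using C e by (simp add: real_sqrt_mult)
 qed
 \<comment> \<open>Here 3 >= 2/ln 2 converts the binary logarithm of C^2/eps^2, and the remaining 2
   covers rounding up and the added 1; all constants are absorbed since |ln eps| >= 1.\<close>
 define D where "D = 3*ln C + 5"
 have D: "D >= 5" using C by (simp add: D_def)
 have ev: "\<forall>\<^sub>F \<epsilon> in at_right 0. 0 < \<epsilon> & \<epsilon> < 1 & \<bar>ln \<epsilon>\<bar> >= 3 & real (nn \<epsilon>) <= D * \<bar>ln \<epsilon>\<bar>"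
  unfolding eventually_at_right_field
 \<comment> \<open>The threshold makes |ln eps| >= 3 >= e, so that ln |ln eps| >= 1 in the depth
   estimate.\<close>
 proof (intro exI[of _ "exp (-3)"] conjI allI impI)
  fix \<epsilon> :: real assume e: "\<epsilon> > 0" "\<epsilon> < exp (- 3)"
  show "\<epsilon> > 0" by fact
  show e1: "\<epsilon> < 1" using e(2) by (rule order_less_trans) simp
  have "ln \<epsilon> < ln (exp (- 3))" using e by (subst ln_less_cancel_iff) auto
  then have l: "ln \<epsilon> < -3" by simp
  then show "\<bar>ln \<epsilon>\<bar> >= 3" by simp
  have X: "\<bar>ln \<epsilon>\<bar> = - ln \<epsilon>" "- ln \<epsilon> >= 3" using l by auto
  have ln2: "ln (2::real) >= 2/3" by (rule ln2_ge_two_thirds)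
  have "log 2 (C^2 / \<epsilon>^2) = (2*ln C + 2*(- ln \<epsilon>))/ln 2" using C e by (simp add: log_def ln_div ln_realpow)
  also have "... <= (2*ln C + 2*(- ln \<epsilon>))/(2/3)" using ln2 ln_ge_zero[OF C] X by (intro divide_left_mono) auto
  finally have u: "log 2 (C^2 / \<epsilon>^2) <= 3*ln C + 3*(- ln \<epsilon>)" by simp
  have "1 <= C^2 / \<epsilon>^2"
  proof -
   have "\<epsilon>^2 <= 1" "1 <= C^2" using e e1 C by (simp_all add: power_le_one)
   then show ?thesis using e by (simp add: le_divide_eq)
  qed
  then have "0 <= log 2 (C^2 / \<epsilon>^2)" by simp
  then have "real (nn \<epsilon>) <= log 2 (C^2 / \<epsilon>^2) + 2" unfolding nn_def by linarith
  also have "... <= 3*ln C*1 + 3*(- ln \<epsilon>) + 2" using u by simp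
  also have "... <= 3*ln C*(- ln \<epsilon>) + 3*(- ln \<epsilon>) + 2*(- ln \<epsilon>)" using X C by (intro add_mono mult_left_mono) auto
  also have "... = D * \<bar>ln \<epsilon>\<bar>" unfolding X D_def by (simp add: algebra_simps)
  finally show "real (nn \<epsilon>) <= D * \<bar>ln \<epsilon>\<bar>" .
 qed simp
 have "(%\<epsilon>. SUP x\<in>?S. \<bar>nn_real3 (\<Phi> \<epsilon>) x i\<bar>) \<in> O[at_right 0](%\<epsilon>. \<bar>ln \<epsilon>\<bar>^6)" if i: "i < N" for i
 \<comment> \<open>The networks are bounded uniformly in eps, so the sixth power of |ln eps| >= 1
   only weakens the estimate.\<close>
 proof (rule bigoI[where c=C])
  show "\<forall>\<^sub>F \<epsilon> in at_right 0. norm (SUP x\<in>?S. \<bar>nn_real3 (\<Phi> \<epsilon>) x i\<bar>) <= C*norm (\<bar>ln \<epsilon>\<bar>^6)"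
   using ev
  proof eventually_elim
   case (elim \<epsilon>)
   have b: "\<bar>nn_real3 (\<Phi> \<epsilon>) x i\<bar> <= C" if "x \<in> ?S" for x using P i that by blast
   have c: "R k \<in> ?S" using a by (simp add: cube_inf_def)
   have "(SUP x\<in>?S. \<bar>nn_real3 (\<Phi> \<epsilon>) x i\<bar>) <= C" using b c by (intro cSUP_least) auto
   moreover have "0 <= (SUP x\<in>?S. \<bar>nn_real3 (\<Phi> \<epsilon>) x i\<bar>)"
    by (rule cSUP_upper2[OF _ c]) (use b in \<open>auto intro!: bdd_aboveI2\<close>)
   moreover have "C*1 <= C * \<bar>ln \<epsilon>\<bar>^6" using C elim by (intro mult_left_mono one_le_power) auto
   ultimately show ?case by simp
  qed
 qed
 moreover have "(%\<epsilon>. real (nn_size (\<Phi> \<epsilon>))) \<in> O[at_right 0](%\<epsilon>. \<bar>ln \<epsilon>\<bar>^7 + real N * \<bar>ln \<epsilon>\<bar>^6)"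
 proof (rule bigoI[where c="C*D^6"])
  show "\<forall>\<^sub>F \<epsilon> in at_right 0. norm (real (nn_size (\<Phi> \<epsilon>))) <= C*D^6*norm (\<bar>ln \<epsilon>\<bar>^7 + real N * \<bar>ln \<epsilon>\<bar>^6)"
   using ev
  proof eventually_elim
   case (elim \<epsilon>)
   let ?X = "\<bar>ln \<epsilon>\<bar>"
   have "real (nn_size (\<Phi> \<epsilon>)) <= C*real (nn \<epsilon>)^6*(1 + real N)" using P by blast
   also have "... <= C*(D*?X)^6*(1 + real N)" using elim C by (intro mult_right_mono mult_left_mono power_mono) auto
   also have "... = C*D^6*(?X^6 + real N*?X^6)" by (simp add: power_mult_distrib algebra_simps)
   also have "... <= C*D^6*(?X^7 + real N*?X^6)" using C D elim by (intro mult_left_mono add_right_mono power_increasing) auto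
   finally show ?case by simp
  qed
 qed
 moreover have "(%\<epsilon>. real (nn_depth (\<Phi> \<epsilon>))) \<in> O[at_right 0](%\<epsilon>. \<bar>ln \<epsilon>\<bar>*ln \<bar>ln \<epsilon>\<bar>)"
 proof (rule bigoI[where c="1000*D*(2*ln (18*D) + 3)"])
  show "\<forall>\<^sub>F \<epsilon> in at_right 0. norm (real (nn_depth (\<Phi> \<epsilon>))) <= 1000*D*(2*ln (18*D) + 3)*norm (\<bar>ln \<epsilon>\<bar>*ln \<bar>ln \<epsilon>\<bar>)"
   using ev
  proof eventually_elim
   case (elim \<epsilon>)
   let ?X = "\<bar>ln \<epsilon>\<bar>" and ?b = "snd (F (nn \<epsilon>))"
   have "3 <= \<bar>ln \<epsilon>\<bar>" using elim by blast
   then have X: "?X >= 3" .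
   have e4: "real (nn \<epsilon>) <= D*?X" using elim by blast
   have "exp 1 <= ?X" using exp_le X by linarith
   then have lX: "ln ?X >= 1" using X by (subst ln_ge_iff) auto
   have l18: "ln (18*D) >= 0" using D by simp
   \<comment> \<open>From 2^b <= 18*n and ln 2 >= 1/2 one gets b = O(ln |ln eps|), the second factor
     of the depth.\<close>
   have b: "real ?b + 1 <= (2*ln (18*D) + 3)*ln ?X"
   proof -
    have "2^?b <= 18*real (nn \<epsilon>)" using P by blast
    also have "... <= 18*(D*?X)" by (rule mult_left_mono[OF e4]) simp
    also have "... = 18*D*?X" by (simp only: mult.assoc)
    finally have "ln ((2::real)^?b) <= ln (18*D*?X)" using D X by (subst ln_le_cancel_iff) auto
    moreover have "ln (18*D*?X) = ln (18*D) + ln ?X" by (rule ln_mult_pos) (use D X in linarith)+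
    moreover have "ln ((2::real)^?b) = real ?b*ln 2" by (simp add: ln_realpow)
    ultimately have "real ?b*ln 2 <= ln (18*D) + ln ?X" by linarith
    moreover have "real ?b*(1/2) <= real ?b*ln 2" using ln2_ge_two_thirds by (intro mult_left_mono) auto
    ultimately have "real ?b + 1 <= 2*ln (18*D)*1 + 2*ln ?X + 1" by simp
    also have "... <= 2*ln (18*D)*ln ?X + 2*ln ?X + ln ?X" using lX l18 by (intro add_mono mult_left_mono) auto
    finally show ?thesis by (simp add: algebra_simps)
   qed
   have "real (nn_depth (\<Phi> \<epsilon>)) <= 1000*real (nn \<epsilon>)*(real ?b + 1)" using P by blast
   also have "... <= 1000*(D*?X)*((2*ln (18*D) + 3)*ln ?X)" using b e4 D by (intro mult_mono) auto
   also have "... = 1000*D*(2*ln (18*D) + 3)*(?X*ln ?X)" by (simp only: ac_simps)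
   finally show ?case using lX by (simp add: abs_mult)
  qed
 qed
 moreover have "nn_wf 3 (\<Phi> \<epsilon>) N & (\<forall>i<N. H1_on ?U (%x. \<phi> i x - nn_real3 (\<Phi> \<epsilon>) x i) & H1_norm ?U (%x. \<phi> i x - nn_real3 (\<Phi> \<epsilon>) x i) <= \<epsilon>)"
  if "0 < \<epsilon>" "\<epsilon> < 1" for \<epsilon>
 proof (intro conjI allI impI)
  show "nn_wf 3 (\<Phi> \<epsilon>) N" using P by blast
  fix i assume "i < N"
  then have "H1_on ?U (%x. \<phi> i x - nn_real3 (\<Phi> \<epsilon>) x i)" "H1_norm ?U (%x. \<phi> i x - nn_real3 (\<Phi> \<epsilon>) x i) <= C * sqrt ((1/2)^nn \<epsilon>)" using P by blast+
  then show "H1_on ?U (%x. \<phi> i x - nn_real3 (\<Phi> \<epsilon>) x i)" "H1_norm ?U (%x. \<phi> i x - nn_real3 (\<Phi> \<epsilon>) x i) <= \<epsilon>" using err[OF that] by auto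
 qed
 ultimately show ?thesis by (intro exI[of _ \<Phi>] conjI allI impI) auto
qed

end
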